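(* Let $(D;A,B;M)_C$ be a double vector bundle with core $C$. Then the set $\mathfrak C(D)=\bigcup_{m\in M}\mathfrak C(D)_m$ is a vector bundle over $M$, and it fits into a short exact sequence of vector bundles over $M$ (a DVB sequence) $$0\longrightarrow C\xrightarrow{\ \mathfrak e\ }\mathfrak C(D)\xrightarrow{\ \mathfrak p\ }A\otimes B\longrightarrow 0,$$ where $\mathfrak p$ is induced by $[d]\mapsto q^D_A(d)\otimes q^D_B(d)$ and $\mathfrak e$ is given by $c\mapsto[\overline c]$.
   Context: All manifolds and vector bundles are smooth, real, of finite dimension/rank. Double vector bundle: a double vector bundle $(D;A,B;M)$ consists of vector bundles $q_A:A\to M$, $q_B:B\to M$ and a manifold $D$ with two vector bundle structures $q^D_A:D\to A$ (operations $+_A,\cdot_A$) and $q^D_B:D\to B$ (operations $+_B,\cdot_B$), with $q_A\circ q^D_A=q_B\circ q^D_B$, such that each of the structure maps (bundle projection, zero section, addition, scalar multiplication) of each vector bundle structure on $D$ is a morphism of vector bundles with respect to the other structures. For $m\in M$ the slice is $D_m=(q^D_A)^{-1}(A_m)=(q^D_B)^{-1}(B_m)$. The core $C=\{c\in D:\exists m\in M,\ q^D_A(c)=0^A_m,\ q^D_B(c)=0^B_m\}$ is a vector bundle over $M$; the two linear structures of $D$ coincide on it. An element $c\in C$ regarded as an element of $D$ is written $\overline c$. Definition of $\mathfrak C(D)_m$: let $\widetilde D_m$ be the free real vector space generated by the set $D_m$, and let $\overline D_m$ be the subspace generated by all elements of the forms $$d_1+d_2-(d_1+_Ad_2),\quad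 d_3+d_4-(d_3+_Bd_4),\quad r\cdot d-(r\cdot_Ad),\quad r\cdot d-(r\cdot_Bd),$$ where $r\in\mathbb R$, $d,d_i\in D_m$, $q^D_A(d_1)=q^D_A(d_2)$, $q^D_B(d_3)=q^D_B(d_4)$. Then $\mathfrak C(D)_m=\widetilde D_m/\overline D_m$, and $[d]$ denotes the class of $d\in D_m$. *)

theory Defs
  imports "HOL-Analysis.Analysis" "HOL-Library.Poly_Mapping"
begin

section \<open>Smooth manifolds\<close>

text \<open>
  \<open>\<real>\<^sup>n\<close> is the library's \<^const>\<open>Euclidean_space\<close>: the functions \<open>nat \<Rightarrow> real\<close> that vanish at all
  indices \<open>\<ge> n\<close>. The dimension is a term, because the dimension of a derived manifold (core,
  tensor product, quotient) has to be computed from other dimensions.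
\<close>

text \<open>
  \<open>C_on k n U f\<close>: the function \<open>f\<close> is of class \<open>C\<^sup>k\<close> on the open set \<open>U \<subseteq> \<real>\<^sup>n\<close>, i.e. all its
  iterated partial derivatives of order at most \<open>k\<close> exist and are continuous on \<open>U\<close>.
\<close>

primrec C_on :: "nat \<Rightarrow> nat \<Rightarrow> (nat \<Rightarrow> real) set \<Rightarrow> ((nat \<Rightarrow> real) \<Rightarrow> real) \<Rightarrow> bool" where
  "C_on 0 n U f \<longleftrightarrow> continuous_map (subtopology (Euclidean_space n) U) euclideanreal f"
| "C_on (Suc k) n U f \<longleftrightarrow>
     continuous_map (subtopology (Euclidean_space n) U) euclideanreal f \<and>
     (\<forall>i<n. \<exists>g. (\<forall>x\<in>U. ((\<lambda>t. f (x(i := t))) has_real_derivative g x) (at (x i))) \<and> C_on k n U g)"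

definition smooth_on :: "nat \<Rightarrow> (nat \<Rightarrow> real) set \<Rightarrow> nat \<Rightarrow> ((nat \<Rightarrow> real) \<Rightarrow> nat \<Rightarrow> real) \<Rightarrow> bool" where
  "smooth_on n U m f \<longleftrightarrow> (\<forall>j<m. \<forall>k. C_on k n U (\<lambda>x. f x j))"

text \<open>
  A chart is a pair of a domain and a coordinate map; values of the coordinate map outside the
  domain are irrelevant. Atlases need not be maximal.
\<close>

type_synonym 'a chart = "'a set \<times> ('a \<Rightarrow> nat \<Rightarrow> real)"

record 'a manifold =
  mtop :: "'a topology"
  mdim :: nat
  atlas :: "'a chart set"

abbreviation mpoints :: "'a manifold \<Rightarrow> 'a set" where
  "mpoints X \<equiv> topspace (mtop X)"

definition is_chart :: "'a topology \<Rightarrow> nat \<Rightarrow> 'a chart \<Rightarrow> bool" where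
  "is_chart T n = (\<lambda>(U, \<phi>). openin T U \<and> openin (Euclidean_space n) (\<phi> ` U) \<and>
     homeomorphic_map (subtopology T U) (subtopology (Euclidean_space n) (\<phi> ` U)) \<phi>)"

definition compatible :: "nat \<Rightarrow> 'a chart \<Rightarrow> 'a chart \<Rightarrow> bool" where
  "compatible n = (\<lambda>(U, \<phi>) (V, \<psi>).
     smooth_on n (\<phi> ` (U \<inter> V)) n (\<lambda>x. \<psi> (inv_into U \<phi> x)) \<and>
     smooth_on n (\<psi> ` (U \<inter> V)) n (\<lambda>x. \<phi> (inv_into V \<psi> x)))"

definition smooth_manifold :: "'a manifold \<Rightarrow> bool" where
  "smooth_manifold X \<longleftrightarrow>
     Hausdorff_space (mtop X) \<and> second_countable (mtop X) \<and>
     (\<forall>c\<in>atlas X. is_chart (mtop X) (mdim X) c) \<and>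
     (\<Union>c\<in>atlas X. fst c) = mpoints X \<and>
     (\<forall>c\<in>atlas X. \<forall>c'\<in>atlas X. compatible (mdim X) c c')"

definition smooth_map :: "'a manifold \<Rightarrow> 'b manifold \<Rightarrow> ('a \<Rightarrow> 'b) \<Rightarrow> bool" where
  "smooth_map X Y f \<longleftrightarrow> continuous_map (mtop X) (mtop Y) f \<and>
     (\<forall>(U, \<phi>)\<in>atlas X. \<forall>(V, \<psi>)\<in>atlas Y.
        smooth_on (mdim X) (\<phi> ` {x\<in>U. f x \<in> V}) (mdim Y) (\<lambda>x. \<psi> (f (inv_into U \<phi> x))))"

definition diffeomorphism :: "'a manifold \<Rightarrow> 'b manifold \<Rightarrow> ('a \<Rightarrow> 'b) \<Rightarrow> bool" where
  "diffeomorphism X Y f \<longleftrightarrow> smooth_map X Y f \<and> bij_betw f (mpoints X) (mpoints Y) \<and>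
     smooth_map Y X (inv_into (mpoints X) f)"

definition euclidean_manifold :: "nat \<Rightarrow> (nat \<Rightarrow> real) manifold" where
  "euclidean_manifold n = \<lparr>mtop = Euclidean_space n, mdim = n,
     atlas = {(topspace (Euclidean_space n), \<lambda>x. x)}\<rparr>"

definition open_submanifold :: "'a manifold \<Rightarrow> 'a set \<Rightarrow> 'a manifold" where
  "open_submanifold X U = \<lparr>mtop = subtopology (mtop X) U, mdim = mdim X,
     atlas = {(V \<inter> U, \<phi>) | V \<phi>. (V, \<phi>) \<in> atlas X}\<rparr>"

text \<open>Coordinates of a point of \<open>\<real>\<^sup>m \<times> \<real>\<^sup>n \<cong> \<real>\<^sup>m\<^sup>+\<^sup>n\<close>.\<close>

definition join_coords :: "nat \<Rightarrow> (nat \<Rightarrow> real) \<Rightarrow> (nat \<Rightarrow> real) \<Rightarrow> nat \<Rightarrow> real" where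
  "join_coords m x y = (\<lambda>i. if i < m then x i else y (i - m))"

definition prod_manifold :: "'a manifold \<Rightarrow> 'b manifold \<Rightarrow> ('a \<times> 'b) manifold" where
  "prod_manifold X Y = \<lparr>mtop = prod_topology (mtop X) (mtop Y), mdim = mdim X + mdim Y,
     atlas = {(U \<times> V, \<lambda>(x, y). join_coords (mdim X) (\<phi> x) (\<psi> y)) | U \<phi> V \<psi>.
                (U, \<phi>) \<in> atlas X \<and> (V, \<psi>) \<in> atlas Y}\<rparr>"

definition maximal_atlas :: "'a manifold \<Rightarrow> 'a chart set" where
  "maximal_atlas X = {c. is_chart (mtop X) (mdim X) c \<and> (\<forall>c'\<in>atlas X. compatible (mdim X) c c')}"

text \<open>
  The structure induced on a \<open>k\<close>-dimensional embedded submanifold \<open>S\<close>, given by slice charts: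
  \<open>\<real>\<^sup>k\<close> is literally the subset of \<open>\<real>\<^sup>n\<close> where the coordinates with index \<open>\<ge> k\<close> vanish. That \<open>S\<close>
  really is an embedded submanifold is not part of the definition; it is expressed by
  \<open>smooth_manifold (submanifold X S k)\<close>, in which the slice charts have to cover \<open>S\<close>.
\<close>

definition submanifold :: "'a manifold \<Rightarrow> 'a set \<Rightarrow> nat \<Rightarrow> 'a manifold" where
  "submanifold X S k = \<lparr>mtop = subtopology (mtop X) S, mdim = k,
     atlas = {(U \<inter> S, \<phi>) | U \<phi>. (U, \<phi>) \<in> maximal_atlas X \<and>
                \<phi> ` (U \<inter> S) = \<phi> ` U \<inter> topspace (Euclidean_space k)}\<rparr>"

text \<open>The fibre product of \<open>f : X \<rightarrow> N\<close> and \<open>g : Y \<rightarrow> N\<close>; only used for submersions.\<close>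

definition fibre_product ::
  "'a manifold \<Rightarrow> ('a \<Rightarrow> 'c) \<Rightarrow> 'b manifold \<Rightarrow> ('b \<Rightarrow> 'c) \<Rightarrow> 'c manifold \<Rightarrow> ('a \<times> 'b) manifold" where
  "fibre_product X f Y g N = submanifold (prod_manifold X Y)
     {(x, y). x \<in> mpoints X \<and> y \<in> mpoints Y \<and> f x = g y} (mdim X + mdim Y - mdim N)"

text \<open>
  The manifold determined by a family of charts into \<open>\<real>\<^sup>n\<close> on a set without topology: it carries
  the topology generated by the preimages of open sets.
\<close>

definition manifold_of_charts :: "nat \<Rightarrow> 'a chart set \<Rightarrow> 'a manifold" where
  "manifold_of_charts n \<A> = \<lparr>
     mtop = topology_generated_by
       {{x\<in>U. \<phi> x \<in> W} | U \<phi> W. (U, \<phi>) \<in> \<A> \<and> openin (Euclidean_space n) W},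
     mdim = n, atlas = \<A>\<rparr>"


section \<open>Smooth vector bundles\<close>

definition vector_space_on ::
  "'e set \<Rightarrow> ('e \<Rightarrow> 'e \<Rightarrow> 'e) \<Rightarrow> (real \<Rightarrow> 'e \<Rightarrow> 'e) \<Rightarrow> 'e \<Rightarrow> bool" where
  "vector_space_on V add scl z \<longleftrightarrow>
     z \<in> V \<and> (\<forall>x\<in>V. \<forall>y\<in>V. add x y \<in> V) \<and> (\<forall>r. \<forall>x\<in>V. scl r x \<in> V) \<and>
     (\<forall>x\<in>V. \<forall>y\<in>V. \<forall>w\<in>V. add (add x y) w = add x (add y w)) \<and>
     (\<forall>x\<in>V. \<forall>y\<in>V. add x y = add y x) \<and>
     (\<forall>x\<in>V. add z x = x) \<and> (\<forall>x\<in>V. \<exists>y\<in>V. add x y = z) \<and>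
     (\<forall>r. \<forall>x\<in>V. \<forall>y\<in>V. scl r (add x y) = add (scl r x) (scl r y)) \<and>
     (\<forall>r s. \<forall>x\<in>V. scl (r + s) x = add (scl r x) (scl s x)) \<and>
     (\<forall>r s. \<forall>x\<in>V. scl r (scl s x) = scl (r * s) x) \<and>
     (\<forall>x\<in>V. scl 1 x = x)"

record ('e, 'm) vbundle =
  total_space :: "'e manifold"
  base :: "'m manifold"
  proj :: "'e \<Rightarrow> 'm"
  vadd :: "'e \<Rightarrow> 'e \<Rightarrow> 'e"
  vscale :: "real \<Rightarrow> 'e \<Rightarrow> 'e"
  vzero :: "'m \<Rightarrow> 'e"

abbreviation vpoints :: "('e, 'm) vbundle \<Rightarrow> 'e set" where
  "vpoints E \<equiv> mpoints (total_space E)"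

definition fibre :: "('e, 'm) vbundle \<Rightarrow> 'm \<Rightarrow> 'e set" where
  "fibre E m = {e \<in> vpoints E. proj E e = m}"

definition rank :: "('e, 'm) vbundle \<Rightarrow> nat" where
  "rank E = mdim (total_space E) - mdim (base E)"

definition local_trivialization ::
  "('e, 'm) vbundle \<Rightarrow> 'm set \<Rightarrow> ('e \<Rightarrow> 'm \<times> (nat \<Rightarrow> real)) \<Rightarrow> bool" where
  "local_trivialization E U \<Phi> \<longleftrightarrow>
     openin (mtop (base E)) U \<and>
     diffeomorphism (open_submanifold (total_space E) {e \<in> vpoints E. proj E e \<in> U})
       (prod_manifold (open_submanifold (base E) U) (euclidean_manifold (rank E))) \<Phi> \<and>
     (\<forall>m\<in>U. \<forall>e\<in>fibre E m. fst (\<Phi> e) = m \<and>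
        (\<forall>e'\<in>fibre E m. snd (\<Phi> (vadd E e e')) = (\<lambda>i. snd (\<Phi> e) i + snd (\<Phi> e') i)) \<and>
        (\<forall>r. snd (\<Phi> (vscale E r e)) = (\<lambda>i. r * snd (\<Phi> e) i)))"

definition vector_bundle :: "('e, 'm) vbundle \<Rightarrow> bool" where
  "vector_bundle E \<longleftrightarrow>
     smooth_manifold (total_space E) \<and> smooth_manifold (base E) \<and>
     mdim (base E) \<le> mdim (total_space E) \<and>
     smooth_map (total_space E) (base E) (proj E) \<and>
     (\<forall>m\<in>mpoints (base E). vector_space_on (fibre E m) (vadd E) (vscale E) (vzero E m)) \<and>
     (\<forall>m\<in>mpoints (base E). \<exists>U \<Phi>. m \<in> U \<and> local_trivialization E U \<Phi>)"

text \<open>\<open>\<phi> : E \<rightarrow> F\<close> is a morphism of vector bundles over \<open>f\<close>.\<close>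

definition vb_morphism ::
  "('e, 'm) vbundle \<Rightarrow> ('f, 'n) vbundle \<Rightarrow> ('e \<Rightarrow> 'f) \<Rightarrow> ('m \<Rightarrow> 'n) \<Rightarrow> bool" where
  "vb_morphism E F \<phi> f \<longleftrightarrow>
     smooth_map (total_space E) (total_space F) \<phi> \<and> smooth_map (base E) (base F) f \<and>
     (\<forall>e\<in>vpoints E. proj F (\<phi> e) = f (proj E e)) \<and>
     (\<forall>m\<in>mpoints (base E). \<forall>e\<in>fibre E m.
        (\<forall>e'\<in>fibre E m. \<phi> (vadd E e e') = vadd F (\<phi> e) (\<phi> e')) \<and>
        (\<forall>r. \<phi> (vscale E r e) = vscale F r (\<phi> e)))"

text \<open>A short exact sequence \<open>0 \<rightarrow> E \<rightarrow> F \<rightarrow> G \<rightarrow> 0\<close> of vector bundles over the same base.\<close>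

definition short_exact_sequence ::
  "('e, 'm) vbundle \<Rightarrow> ('f, 'm) vbundle \<Rightarrow> ('g, 'm) vbundle \<Rightarrow> ('e \<Rightarrow> 'f) \<Rightarrow> ('f \<Rightarrow> 'g) \<Rightarrow> bool" where
  "short_exact_sequence E F G \<phi> \<psi> \<longleftrightarrow>
     vector_bundle E \<and> vector_bundle F \<and> vector_bundle G \<and> base E = base F \<and> base F = base G \<and>
     vb_morphism E F \<phi> (\<lambda>m. m) \<and> vb_morphism F G \<psi> (\<lambda>m. m) \<and>
     inj_on \<phi> (vpoints E) \<and>
     \<phi> ` vpoints E = {x \<in> vpoints F. \<psi> x = vzero G (proj F x)} \<and>
     \<psi> ` vpoints F = vpoints G"


section \<open>Double vector bundles\<close>

text \<open>
  Both vector bundles \<open>DA\<close> (that is \<open>D \<rightarrow> A\<close>) and \<open>DB\<close> (that is \<open>D \<rightarrow> B\<close>) have total space \<open>D\<close>.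
  The fibre product \<open>D \<times>\<^sub>A D\<close> is a vector bundle over \<open>B \<times>\<^sub>M B\<close>, with the componentwise
  operations of \<open>DB\<close>.
\<close>

definition square_bundle ::
  "('d, 'a) vbundle \<Rightarrow> ('d, 'b) vbundle \<Rightarrow> ('b, 'm) vbundle \<Rightarrow> ('d \<times> 'd, 'b \<times> 'b) vbundle" where
  "square_bundle DA DB B = \<lparr>
     total_space = fibre_product (total_space DA) (proj DA) (total_space DA) (proj DA) (base DA),
     base = fibre_product (total_space B) (proj B) (total_space B) (proj B) (base B),
     proj = map_prod (proj DB) (proj DB),
     vadd = (\<lambda>(d\<^sub>1, d\<^sub>2) (e\<^sub>1, e\<^sub>2). (vadd DB d\<^sub>1 e\<^sub>1, vadd DB d\<^sub>2 e\<^sub>2)),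
     vscale = (\<lambda>r. map_prod (vscale DB r) (vscale DB r)),
     vzero = map_prod (vzero DB) (vzero DB)\<rparr>"

text \<open>
  The structure maps of \<open>D \<rightarrow> A\<close> (projection, zero section, addition, multiplication by each
  scalar) are morphisms with respect to \<open>D \<rightarrow> B\<close>, over the structure maps of \<open>B \<rightarrow> M\<close>.
\<close>

definition structure_maps_linear ::
  "('d, 'a) vbundle \<Rightarrow> ('d, 'b) vbundle \<Rightarrow> ('a, 'm) vbundle \<Rightarrow> ('b, 'm) vbundle \<Rightarrow> bool" where
  "structure_maps_linear DA DB A B \<longleftrightarrow>
     vb_morphism DB A (proj DA) (proj B) \<and>
     vb_morphism A DB (vzero DA) (vzero B) \<and>
     vb_morphism (square_bundle DA DB B) DB (\<lambda>(d\<^sub>1, d\<^sub>2). vadd DA d\<^sub>1 d\<^sub>2) (\<lambda>(b\<^sub>1, b\<^sub>2). vadd B b\<^sub>1 b\<^sub>2) \<and>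
     (\<forall>r. vb_morphism DB DB (vscale DA r) (vscale B r))"

definition double_vector_bundle ::
  "('d, 'a) vbundle \<Rightarrow> ('d, 'b) vbundle \<Rightarrow> ('a, 'm) vbundle \<Rightarrow> ('b, 'm) vbundle \<Rightarrow> bool" where
  "double_vector_bundle DA DB A B \<longleftrightarrow>
     vector_bundle DA \<and> vector_bundle DB \<and> vector_bundle A \<and> vector_bundle B \<and>
     total_space DA = total_space DB \<and> base DA = total_space A \<and> base DB = total_space B \<and>
     base A = base B \<and>
     (\<forall>d\<in>vpoints DA. proj A (proj DA d) = proj B (proj DB d)) \<and>
     structure_maps_linear DA DB A B \<and> structure_maps_linear DB DA B A"

definition slice :: "('d, 'a) vbundle \<Rightarrow> ('a, 'm) vbundle \<Rightarrow> 'm \<Rightarrow> 'd set" where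
  "slice DA A m = {d \<in> vpoints DA. proj A (proj DA d) = m}"

definition core_set ::
  "('d, 'a) vbundle \<Rightarrow> ('d, 'b) vbundle \<Rightarrow> ('a, 'm) vbundle \<Rightarrow> ('b, 'm) vbundle \<Rightarrow> 'd set" where
  "core_set DA DB A B = {c \<in> vpoints DA. \<exists>m\<in>mpoints (base A).
     proj DA c = vzero A m \<and> proj DB c = vzero B m}"

text \<open>
  The core, with the structure of an embedded submanifold of \<open>D\<close> and the operations of \<open>D \<rightarrow> A\<close>
  (on the core they agree with those of \<open>D \<rightarrow> B\<close>). Its rank is
  \<open>dim D - dim M - rank A - rank B = dim D + dim M - dim A - dim B\<close>.
\<close>

definition core_bundle ::
  "('d, 'a) vbundle \<Rightarrow> ('d, 'b) vbundle \<Rightarrow> ('a, 'm) vbundle \<Rightarrow> ('b, 'm) vbundle \<Rightarrow> ('d, 'm) vbundle" where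
  "core_bundle DA DB A B = \<lparr>
     total_space = submanifold (total_space DA) (core_set DA DB A B)
       (mdim (base A) + (mdim (total_space DA) + mdim (base A)
          - (mdim (total_space A) + mdim (total_space B)))),
     base = base A,
     proj = (\<lambda>c. proj A (proj DA c)),
     vadd = vadd DA,
     vscale = vscale DA,
     vzero = (\<lambda>m. vzero DA (vzero A m))\<rparr>"


section \<open>Families of quotients of free vector spaces\<close>

text \<open>
  The free real vector space on a set \<open>G\<close> consists of the \<open>p :: 'x \<Rightarrow>\<^sub>0 real\<close> with
  \<open>Poly_Mapping.keys p \<subseteq> G\<close>; the generator given by \<open>x\<close> is \<open>gen x\<close>.
\<close>

abbreviation gen :: "'x \<Rightarrow> 'x \<Rightarrow>\<^sub>0 real" where
  "gen x \<equiv> Poly_Mapping.single x 1"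

definition free_scale :: "real \<Rightarrow> ('x \<Rightarrow>\<^sub>0 real) \<Rightarrow> ('x \<Rightarrow>\<^sub>0 real)" where
  "free_scale r p = Poly_Mapping.map (\<lambda>t. r * t) p"

lemma lookup_free_scale:
  "Poly_Mapping.lookup (free_scale r p) x = r * Poly_Mapping.lookup p x"
  by (simp add: free_scale_def Poly_Mapping.map.rep_eq when_def)

interpretation free: vector_space free_scale
  by unfold_locales
    (auto intro!: poly_mapping_eqI simp: lookup_free_scale lookup_add algebra_simps)

text \<open>
  For a family of sets of generators \<open>G m\<close> and of relations \<open>R m\<close>, the quotient
  \<open>Free (G m) / span (R m)\<close> consists of cosets. A class is tagged with its base point \<open>m\<close>, so that
  the union over all \<open>m\<close> is disjoint.
\<close>

definition quot_class :: "('m \<Rightarrow> ('x \<Rightarrow>\<^sub>0 real) set) \<Rightarrow> 'm \<Rightarrow> ('x \<Rightarrow>\<^sub>0 real) \<Rightarrow> 'm \<times> ('x \<Rightarrow>\<^sub>0 real) set" where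
  "quot_class R m p = (m, (\<lambda>z. p + z) ` free.span (R m))"

definition quot_set ::
  "'m set \<Rightarrow> ('m \<Rightarrow> 'x set) \<Rightarrow> ('m \<Rightarrow> ('x \<Rightarrow>\<^sub>0 real) set) \<Rightarrow> ('m \<times> ('x \<Rightarrow>\<^sub>0 real) set) set" where
  "quot_set M G R = {quot_class R m p | m p. m \<in> M \<and> Poly_Mapping.keys p \<subseteq> G m}"

definition quot_add ::
  "('m \<Rightarrow> ('x \<Rightarrow>\<^sub>0 real) set) \<Rightarrow> 'm \<times> ('x \<Rightarrow>\<^sub>0 real) set \<Rightarrow> 'm \<times> ('x \<Rightarrow>\<^sub>0 real) set
     \<Rightarrow> 'm \<times> ('x \<Rightarrow>\<^sub>0 real) set" where
  "quot_add R u v = (fst u, \<Union>p\<in>snd u. \<Union>q\<in>snd v. snd (quot_class R (fst u) (p + q)))"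

definition quot_scale ::
  "('m \<Rightarrow> ('x \<Rightarrow>\<^sub>0 real) set) \<Rightarrow> real \<Rightarrow> 'm \<times> ('x \<Rightarrow>\<^sub>0 real) set \<Rightarrow> 'm \<times> ('x \<Rightarrow>\<^sub>0 real) set" where
  "quot_scale R r u = (fst u, \<Union>p\<in>snd u. snd (quot_class R (fst u) (free_scale r p)))"

definition quot_bundle ::
  "'m manifold \<Rightarrow> ('m \<Rightarrow> ('x \<Rightarrow>\<^sub>0 real) set) \<Rightarrow> ('m \<times> ('x \<Rightarrow>\<^sub>0 real) set) manifold
     \<Rightarrow> ('m \<times> ('x \<Rightarrow>\<^sub>0 real) set, 'm) vbundle" where
  "quot_bundle M R X = \<lparr>total_space = X, base = M, proj = fst, vadd = quot_add R,
     vscale = quot_scale R, vzero = (\<lambda>m. quot_class R m 0)\<rparr>"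


section \<open>The tensor product of vector bundles\<close>

definition tensor_relations ::
  "('a, 'm) vbundle \<Rightarrow> ('b, 'm) vbundle \<Rightarrow> 'm \<Rightarrow> (('a \<times> 'b) \<Rightarrow>\<^sub>0 real) set" where
  "tensor_relations A B m =
     {gen (a, b) + gen (a', b) - gen (vadd A a a', b) | a a' b.
        a \<in> fibre A m \<and> a' \<in> fibre A m \<and> b \<in> fibre B m} \<union>
     {gen (a, b) + gen (a, b') - gen (a, vadd B b b') | a b b'.
        a \<in> fibre A m \<and> b \<in> fibre B m \<and> b' \<in> fibre B m} \<union>
     {free_scale r (gen (a, b)) - gen (vscale A r a, b) | r a b. a \<in> fibre A m \<and> b \<in> fibre B m} \<union>
     {free_scale r (gen (a, b)) - gen (a, vscale B r b) | r a b. a \<in> fibre A m \<and> b \<in> fibre B m}"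

definition tensor_set ::
  "('a, 'm) vbundle \<Rightarrow> ('b, 'm) vbundle \<Rightarrow> ('m \<times> (('a \<times> 'b) \<Rightarrow>\<^sub>0 real) set) set" where
  "tensor_set A B = quot_set (mpoints (base A)) (\<lambda>m. fibre A m \<times> fibre B m) (tensor_relations A B)"

definition tensor ::
  "('a, 'm) vbundle \<Rightarrow> ('b, 'm) vbundle \<Rightarrow> 'a \<Rightarrow> 'b \<Rightarrow> 'm \<times> (('a \<times> 'b) \<Rightarrow>\<^sub>0 real) set" where
  "tensor A B a b = quot_class (tensor_relations A B) (proj A a) (gen (a, b))"

text \<open>
  Trivializations \<open>\<Phi>\<close> of \<open>A\<close> and \<open>\<Psi>\<close> of \<open>B\<close> induce one of the tensor product: the coordinates of
  \<open>\<Sum>\<^sub>k t\<^sub>k (a\<^sub>k \<otimes> b\<^sub>k)\<close> are \<open>\<Sum>\<^sub>k t\<^sub>k \<Phi>(a\<^sub>k)\<^sub>i \<Psi>(b\<^sub>k)\<^sub>j\<close>, and the pair \<open>(i, j)\<close> is encoded as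
  \<open>i * rank B + j\<close>. The value is the same for all representatives \<open>p\<close> of a class.
\<close>

definition tensor_coords ::
  "('a, 'm) vbundle \<Rightarrow> ('b, 'm) vbundle \<Rightarrow> ('a \<Rightarrow> 'm \<times> (nat \<Rightarrow> real)) \<Rightarrow> ('b \<Rightarrow> 'm \<times> (nat \<Rightarrow> real))
     \<Rightarrow> 'm \<times> (('a \<times> 'b) \<Rightarrow>\<^sub>0 real) set \<Rightarrow> nat \<Rightarrow> real" where
  "tensor_coords A B \<Phi> \<Psi> u = the_elem ((\<lambda>p k. if k < rank A * rank B
     then \<Sum>(a, b)\<in>Poly_Mapping.keys p. Poly_Mapping.lookup p (a, b)
            * snd (\<Phi> a) (k div rank B) * snd (\<Psi> b) (k mod rank B)
     else 0) ` snd u)"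

definition tensor_charts ::
  "('a, 'm) vbundle \<Rightarrow> ('b, 'm) vbundle \<Rightarrow> ('m \<times> (('a \<times> 'b) \<Rightarrow>\<^sub>0 real) set) chart set" where
  "tensor_charts A B =
     {({u \<in> tensor_set A B. fst u \<in> U \<inter> V},
       \<lambda>u. join_coords (mdim (base A)) (\<phi> (fst u)) (tensor_coords A B \<Phi> \<Psi> u)) | U \<phi> V \<Phi> \<Psi>.
      (U, \<phi>) \<in> atlas (base A) \<and> local_trivialization A V \<Phi> \<and> local_trivialization B V \<Psi>}"

definition tensor_bundle ::
  "('a, 'm) vbundle \<Rightarrow> ('b, 'm) vbundle \<Rightarrow> ('m \<times> (('a \<times> 'b) \<Rightarrow>\<^sub>0 real) set, 'm) vbundle" where
  "tensor_bundle A B = quot_bundle (base A) (tensor_relations A B)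
     (manifold_of_charts (mdim (base A) + rank A * rank B) (tensor_charts A B))"


section \<open>The bundle \<open>\<CC>(D)\<close>\<close>

definition dvb_relations ::
  "('d, 'a) vbundle \<Rightarrow> ('d, 'b) vbundle \<Rightarrow> ('a, 'm) vbundle \<Rightarrow> 'm \<Rightarrow> ('d \<Rightarrow>\<^sub>0 real) set" where
  "dvb_relations DA DB A m =
     {gen d\<^sub>1 + gen d\<^sub>2 - gen (vadd DA d\<^sub>1 d\<^sub>2) | d\<^sub>1 d\<^sub>2.
        d\<^sub>1 \<in> slice DA A m \<and> d\<^sub>2 \<in> slice DA A m \<and> proj DA d\<^sub>1 = proj DA d\<^sub>2} \<union>
     {gen d\<^sub>3 + gen d\<^sub>4 - gen (vadd DB d\<^sub>3 d\<^sub>4) | d\<^sub>3 d\<^sub>4.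
        d\<^sub>3 \<in> slice DA A m \<and> d\<^sub>4 \<in> slice DA A m \<and> proj DB d\<^sub>3 = proj DB d\<^sub>4} \<union>
     {free_scale r (gen d) - gen (vscale DA r d) | r d. d \<in> slice DA A m} \<union>
     {free_scale r (gen d) - gen (vscale DB r d) | r d. d \<in> slice DA A m}"

definition frakC_set ::
  "('d, 'a) vbundle \<Rightarrow> ('d, 'b) vbundle \<Rightarrow> ('a, 'm) vbundle \<Rightarrow> ('m \<times> ('d \<Rightarrow>\<^sub>0 real) set) set" where
  "frakC_set DA DB A = quot_set (mpoints (base A)) (slice DA A) (dvb_relations DA DB A)"

definition frakC_class ::
  "('d, 'a) vbundle \<Rightarrow> ('d, 'b) vbundle \<Rightarrow> ('a, 'm) vbundle \<Rightarrow> 'd \<Rightarrow> 'm \<times> ('d \<Rightarrow>\<^sub>0 real) set" where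
  "frakC_class DA DB A d = quot_class (dvb_relations DA DB A) (proj A (proj DA d)) (gen d)"

text \<open>
  \<open>\<CC>(D) \<rightarrow> M\<close> with the quotient vector space structure on its fibres, for a given manifold
  structure \<open>X\<close> on the set \<open>\<CC>(D)\<close>.
\<close>

definition frakC_bundle ::
  "('d, 'a) vbundle \<Rightarrow> ('d, 'b) vbundle \<Rightarrow> ('a, 'm) vbundle \<Rightarrow> ('m \<times> ('d \<Rightarrow>\<^sub>0 real) set) manifold
     \<Rightarrow> ('m \<times> ('d \<Rightarrow>\<^sub>0 real) set, 'm) vbundle" where
  "frakC_bundle DA DB A X = quot_bundle (base A) (dvb_relations DA DB A) X"

end

theory Submission
  imports Defs
begin

text \<open>
  Linear coordinates of \<open>D \<rightarrow> B\<close> near the zero section of \<open>B\<close> can be chosen so that \<open>q\<^sub>A\<close> becomes a coordinate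
  projection. Setting the other coordinates to zero lifts \<open>(a, b)\<close> to \<open>D\<close> for \<open>b\<close> close to zero. A frame \<open>b\<^sub>j\<close> of \<open>B\<close>
  is scaled by \<open>\<epsilon>\<^sub>j\<close> into that neighbourhood, lifted, and combined in the structure of \<open>D\<close> over \<open>A\<close> with
  coefficients \<open>\<beta>\<^sub>j / \<epsilon>\<^sub>j\<close>: this is a bilinear section \<open>\<sigma>\<close> of \<open>D \<rightarrow> A \<oplus> B\<close> over an open subset of \<open>M\<close>. The difference
  of \<open>d\<close> and \<open>\<sigma>(q\<^sub>A d, q\<^sub>B d)\<close> comes from the core, with coordinates \<open>\<gamma>(d)\<close>, so that \<open>D\<close> has
  local coordinates \<open>(m, \<gamma>, \<alpha>, \<beta>)\<close>. Then the core is the slice \<open>\<alpha> = \<beta> = 0\<close>, and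
  \<open>d \<mapsto> (\<alpha>\<^sub>i(d) \<beta>\<^sub>j(d), \<gamma>(d))\<close> extends linearly to coordinates on the fibres of the quotient,
  in which the two maps of the sequence are an inclusion and a projection of coordinates.
\<close>

section \<open>Calculus on open subsets of \<open>\<real>\<^sup>n\<close>\<close>

text \<open>The definition of a double vector bundle provides no splitting, and does not say that
  \<open>D\<close> projects onto the pairs \<open>(a, b)\<close> over a common point by a
  submersion; both have to come from linearity. The zero elements of \<open>D\<close> over
  \<open>A\<close> lie above the zero section of \<open>B\<close> and show that \<open>pA\<close>
  has full rank there. This is why adapted coordinates are available near the zero section of
  \<open>B\<close> only, and why frames of \<open>B\<close> have to be scaled into that region. The
  price is an asymmetry: the coordinates are linear over \<open>B\<close> by construction, whereas
  their linearity over \<open>A\<close> must be proved. Additivity over \<open>A\<close> follows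
  from the interchange law once the coordinates vanish on the zero section of
  \<open>D \<rightarrow> A\<close>; homogeneity then follows from additivity and smoothness. On the
  quotient, spanning is algebra modulo the relations, and independence comes from coordinate
  functionals that kill the relations. Its Hausdorff property and second countability are inherited
  from \<open>M\<close>.\<close>

abbreviation EE :: "nat \<Rightarrow> (nat \<Rightarrow> real) set" where
  "EE n \<equiv> topspace (Euclidean_space n)"

text \<open>Points of \<open>EE n\<close> are sequences that vanish from index \<open>n\<close> on.
  Truncating a tuple computed componentwise puts it there without a condition on its tail, so
  continuity and smoothness can be checked on the components below \<open>n\<close>.\<close>

definition trunc :: "nat \<Rightarrow> (nat \<Rightarrow> real) \<Rightarrow> nat \<Rightarrow> real" where
  "trunc n v = (\<lambda>i. if i < n then v i else 0)"

lemma trunc_lt [simp]: "i < n \<Longrightarrow> trunc n v i = v i"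
  and trunc_ge [simp]: "\<not> i < n \<Longrightarrow> trunc n v i = 0"
  by (auto simp: trunc_def)

lemma trunc_EE [simp]: "trunc n v \<in> EE n"
  by (auto simp: topspace_Euclidean_space)

lemma trunc_id: "v \<in> EE n \<Longrightarrow> trunc n v = v"
  by (auto simp: topspace_Euclidean_space trunc_def fun_eq_iff)

lemma EE_ge: "v \<in> EE n \<Longrightarrow> n \<le> i \<Longrightarrow> v i = 0"
  by (auto simp: topspace_Euclidean_space)

lemma EE_eqI: "v \<in> EE n \<Longrightarrow> w \<in> EE n \<Longrightarrow> (\<And>i. i < n \<Longrightarrow> v i = w i) \<Longrightarrow> v = w"
  by (metis EE_ge ext not_less)

lemma trunc_cong: "(\<And>i. i < n \<Longrightarrow> v i = w i) \<Longrightarrow> trunc n v = trunc n w"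
  by (auto simp: trunc_def)

lemma continuous_map_coord: "continuous_map (Euclidean_space n) euclideanreal (\<lambda>x. x i)"
  unfolding Euclidean_space_def
  by (rule continuous_map_from_subtopology) (metis UNIV_I continuous_map_product_coordinates)

lemma continuous_map_trunc:
  "continuous_map X (Euclidean_space n) (\<lambda>x. trunc n (f x)) \<longleftrightarrow> (\<forall>i<n. continuous_map X euclideanreal (\<lambda>x. f x i))"
  unfolding trunc_def by (rule continuous_map_componentwise_Euclidean_space)

text \<open>A basic open set of the product topology constrains each coordinate separately.
  Coordinates from index \<open>n\<close> on agree automatically, being zero on \<open>EE n\<close>,
  so the least of \<open>n\<close> radii gives a cube.\<close>

lemma openin_Euclidean_box:
  assumes "openin (Euclidean_space n) U" "x \<in> U"
  shows "\<exists>e>0. \<forall>y\<in>EE n. (\<forall>i<n. \<bar>y i - x i\<bar> < e) \<longrightarrow> y \<in> U"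
proof -
  obtain T where T: "openin (powertop_real UNIV) T" "U = T \<inter> {x. \<forall>i\<ge>n. x i = 0}"
    using assms(1) unfolding Euclidean_space_def openin_subtopology by auto
  obtain X where X: "x \<in> Pi\<^sub>E UNIV X" "\<And>i. openin euclideanreal (X i)"
      "finite {i. X i \<noteq> topspace euclideanreal}" "Pi\<^sub>E UNIV X \<subseteq> T"
    using product_topology_open_contains_basis[OF T(1), of x] assms(2) T(2) by auto
  have "\<exists>e. \<forall>i. e i > 0 \<and> ball (x i) (e i) \<subseteq> X i"
  proof (intro choice allI)
    fix i
    have "open (X i)" "x i \<in> X i" using X(1,2) by auto
    then show "\<exists>e. e > 0 \<and> ball (x i) e \<subseteq> X i" by (meson openE)
  qed
  then obtain e where e: "\<And>i. e i > 0" "\<And>i. ball (x i) (e i) \<subseteq> X i" by metis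
  \<comment> \<open>The element 1 keeps the minimum defined and positive when
    \<open>n = 0\<close>.\<close>
  define d where "d = Min (insert 1 (e ` {..<n}))"
  have d: "d > 0" "\<And>i. i < n \<Longrightarrow> d \<le> e i"
    unfolding d_def using e(1) by (auto intro!: Min_le)
  show ?thesis
  proof (intro exI[of _ d] conjI ballI impI d(1))
    fix y assume y: "y \<in> EE n" "\<forall>i<n. \<bar>y i - x i\<bar> < d"
    have "y i \<in> X i" for i
    proof (cases "i < n")
      case True
      then have "y i \<in> ball (x i) (e i)" using y(2) d(2)[OF True]
        by (auto simp: dist_real_def abs_minus_commute)
      then show ?thesis using e(2) by blast
    next
      case False
      then have "y i = x i" using y(1) assms(2) T(2) by (auto simp: topspace_Euclidean_space)
      then show ?thesis using X(1) by auto
    qed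
    then show "y \<in> U" using X(4) y(1) T(2) by (auto simp: topspace_Euclidean_space)
  qed
qed

lemma openin_Euclidean_subset: "openin (Euclidean_space n) U \<Longrightarrow> U \<subseteq> EE n"
  by (rule openin_subset)

lemma EE_upd: "x \<in> EE n \<Longrightarrow> i < n \<Longrightarrow> x(i := t) \<in> EE n"
  by (auto simp: topspace_Euclidean_space)

lemma line_in_open:
  assumes "openin (Euclidean_space n) U" "x \<in> U" "i < n"
  shows "\<exists>e>0. \<forall>t\<in>ball (x i) e. x(i := t) \<in> U"
proof -
  obtain e where e: "e > 0" "\<And>y. y \<in> EE n \<Longrightarrow> (\<forall>i<n. \<bar>y i - x i\<bar> < e) \<Longrightarrow> y \<in> U"
    using openin_Euclidean_box[OF assms(1,2)] by auto
  have "x \<in> EE n" using assms openin_Euclidean_subset by blast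
  then show ?thesis using e assms(3)
    by (intro exI[of _ e]) (auto intro!: e(2) EE_upd simp: dist_real_def abs_minus_commute)
qed

lemma DERIV_line_cong:
  assumes "openin (Euclidean_space n) U" "x \<in> U" "i < n" "\<And>y. y \<in> U \<Longrightarrow> f y = g y"
    and "((\<lambda>t. f (x(i := t))) has_real_derivative l) (at (x i))"
  shows "((\<lambda>t. g (x(i := t))) has_real_derivative l) (at (x i))"
proof -
  obtain e where e: "e > 0" "\<And>t. t \<in> ball (x i) e \<Longrightarrow> x(i := t) \<in> U"
    using line_in_open[OF assms(1-3)] by auto
  show ?thesis
    by (rule has_field_derivative_transform_within_open[OF assms(5), of "ball (x i) e"])
       (use e assms(4) in auto)
qed

text \<open>\<open>C_on\<close> only asserts that some derivative function exists. This canonical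
  one depends on \<open>f\<close> and not on the domain, so derivatives taken on different open sets
  agree without further argument.\<close>

definition pdiff :: "nat \<Rightarrow> ((nat \<Rightarrow> real) \<Rightarrow> real) \<Rightarrow> (nat \<Rightarrow> real) \<Rightarrow> real" where
  "pdiff i f x = deriv (\<lambda>t. f (x(i := t))) (x i)"

lemma pdiff_eq: "((\<lambda>t. f (x(i := t))) has_real_derivative l) (at (x i)) \<Longrightarrow> pdiff i f x = l"
  unfolding pdiff_def by (rule DERIV_imp_deriv)

section \<open>Algebra of functions of class C^k\<close>

lemma C_on_cong:
  assumes "openin (Euclidean_space n) U" "\<And>x. x \<in> U \<Longrightarrow> f x = g x" "C_on k n U f"
  shows "C_on k n U g"
proof -
  have c: "continuous_map (subtopology (Euclidean_space n) U) euclideanreal f \<Longrightarrow>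
    continuous_map (subtopology (Euclidean_space n) U) euclideanreal g"
    by (rule continuous_map_eq[where f=f]) (use assms in auto)
  show ?thesis
  proof (cases k)
    case 0
    then show ?thesis using c assms(3) by auto
  next
    case (Suc k')
    show ?thesis unfolding Suc C_on.simps
    proof (intro conjI allI impI)
      show "continuous_map (subtopology (Euclidean_space n) U) euclideanreal g"
        using c assms(3) Suc by auto
      fix i assume i: "i < n"
      then obtain h where h: "\<And>x. x\<in>U \<Longrightarrow> ((\<lambda>t. f (x(i := t))) has_real_derivative h x) (at (x i))" "C_on k' n U h"
        using assms(3)[unfolded Suc C_on.simps] by blast
      show "\<exists>h. (\<forall>x\<in>U. ((\<lambda>t. g (x(i := t))) has_real_derivative h x) (at (x i))) \<and> C_on k' n U h"
        using DERIV_line_cong[OF assms(1) _ i assms(2) h(1)] h(2) by (intro exI[of _ h]) blast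
    qed
  qed
qed

lemma C_on_continuous: "C_on k n U f \<Longrightarrow> continuous_map (subtopology (Euclidean_space n) U) euclideanreal f"
  by (cases k) auto

text \<open>Derivatives are unique, so any witness in \<open>C_on\<close> agrees on \<open>U\<close>
  with \<open>pdiff i f\<close>; since \<open>U\<close> is open, the class of the witness passes to
  \<open>pdiff i f\<close>.\<close>

lemma C_on_Suc_iff:
  assumes "openin (Euclidean_space n) U"
  shows "C_on (Suc k) n U f \<longleftrightarrow> continuous_map (subtopology (Euclidean_space n) U) euclideanreal f \<and>
     (\<forall>i<n. (\<forall>x\<in>U. ((\<lambda>t. f (x(i := t))) has_real_derivative pdiff i f x) (at (x i))) \<and> C_on k n U (pdiff i f))"
  (is "?L \<longleftrightarrow> ?R")
proof
  assume L: ?L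
  show ?R
  proof (intro conjI allI impI)
    show "continuous_map (subtopology (Euclidean_space n) U) euclideanreal f" using L by auto
    fix i assume "i < n"
    then obtain g where g: "\<And>x. x\<in>U \<Longrightarrow> ((\<lambda>t. f (x(i := t))) has_real_derivative g x) (at (x i))" "C_on k n U g"
      using L[unfolded C_on.simps] by blast
    have eq: "pdiff i f x = g x" if "x \<in> U" for x using pdiff_eq[OF g(1)[OF that]] .
    show "\<forall>x\<in>U. ((\<lambda>t. f (x(i := t))) has_real_derivative pdiff i f x) (at (x i))"
      using g(1) eq by auto
    show "C_on k n U (pdiff i f)" using C_on_cong[OF assms _ g(2)] eq by auto
  qed
qed auto

lemma C_on_SucI:
  assumes "continuous_map (subtopology (Euclidean_space n) U) euclideanreal f"
    "\<And>i x. i < n \<Longrightarrow> x \<in> U \<Longrightarrow> ((\<lambda>t. f (x(i := t))) has_real_derivative g i x) (at (x i))"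
    "\<And>i. i < n \<Longrightarrow> C_on k n U (g i)"
  shows "C_on (Suc k) n U f"
  using assms by (auto intro!: exI)

lemma C_on_SucD: "C_on (Suc k) n U f \<Longrightarrow> C_on k n U f"
proof (induction k arbitrary: f)
  case (Suc k)
  then show ?case by (simp only: C_on.simps(2)[of "Suc k"] C_on.simps(2)[of k]) blast
qed auto

lemma C_on_subset:
  assumes "C_on k n U f" "V \<subseteq> U"
  shows "C_on k n V f"
  using assms(1)
proof (induction k arbitrary: f)
  case 0
  then show ?case using assms(2) by (auto intro: continuous_map_from_subtopology_mono)
next
  case (Suc k)
  then show ?case using assms(2) by (auto intro: continuous_map_from_subtopology_mono) (metis subsetD)
qed

lemma continuous_map_locally:
  assumes "\<And>x. x \<in> U \<Longrightarrow> \<exists>V. x \<in> V \<and> openin X V \<and> continuous_map (subtopology X V) Y f"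
  shows "continuous_map (subtopology X U) Y f"
proof -
  have *: "f x \<in> topspace Y" if x: "x \<in> topspace X" "x \<in> U" for x
  proof -
    obtain V where V: "x \<in> V" "openin X V" "continuous_map (subtopology X V) Y f"
      using assms[OF x(2)] by blast
    then show ?thesis using x continuous_map_image_subset_topspace[OF V(3)] by auto
  qed
  have "openin (subtopology X U) {x \<in> topspace X \<inter> U. f x \<in> W}" if W: "openin Y W" for W
  proof (subst openin_subopen, intro ballI)
    fix x assume x: "x \<in> {x \<in> topspace X \<inter> U. f x \<in> W}"
    obtain V where V: "x \<in> V" "openin X V" "continuous_map (subtopology X V) Y f"
      using assms x by blast
    have "openin (subtopology X V) {y \<in> topspace (subtopology X V). f y \<in> W}"
      by (rule openin_continuous_map_preimage[OF V(3) W])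
    then have o: "openin X {y \<in> V. f y \<in> W}"
      using V(2) openin_subset[OF V(2)] by (auto simp: openin_open_subtopology Int_absorb1)
    show "\<exists>T. openin (subtopology X U) T \<and> x \<in> T \<and> T \<subseteq> {x \<in> topspace X \<inter> U. f x \<in> W}"
      using openin_subtopology_Int[OF o, of U] x V(1) openin_subset[OF V(2)]
      by (intro exI[of _ "{y \<in> V. f y \<in> W} \<inter> U"]) auto
  qed
  then show ?thesis using * by (auto simp: continuous_map)
qed

text \<open>Gluing the derivatives requires no choice: \<open>pdiff i f\<close> is one and the same
  function for all neighbourhoods.\<close>

lemma C_on_locally:
  assumes U: "openin (Euclidean_space n) U"
    and "\<And>x. x \<in> U \<Longrightarrow> \<exists>V. x \<in> V \<and> openin (Euclidean_space n) V \<and> C_on k n V f"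
  shows "C_on k n U f"
  using assms(2)
proof (induction k arbitrary: f)
  case 0
  then show ?case by (auto intro!: continuous_map_locally)
next
  case (Suc k)
  have "continuous_map (subtopology (Euclidean_space n) U) euclideanreal f"
  proof (rule continuous_map_locally)
    fix x assume "x \<in> U"
    from Suc.prems[OF this] obtain V where "x \<in> V" "openin (Euclidean_space n) V" "C_on (Suc k) n V f" by blast
    then show "\<exists>V. x \<in> V \<and> openin (Euclidean_space n) V \<and> continuous_map (subtopology (Euclidean_space n) V) euclideanreal f"
      using C_on_continuous by blast
  qed
  moreover have "((\<lambda>t. f (x(i := t))) has_real_derivative pdiff i f x) (at (x i))" if "i < n" "x \<in> U" for i x
  proof -
    from Suc.prems[OF that(2)] obtain V where V: "x \<in> V" "openin (Euclidean_space n) V" "C_on (Suc k) n V f" by blast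
    then show ?thesis using V(3)[unfolded C_on_Suc_iff[OF V(2)]] that by simp
  qed
  moreover have "C_on k n U (pdiff i f)" if i: "i < n" for i
  proof (rule Suc.IH)
    fix x assume "x \<in> U"
    from Suc.prems[OF this] obtain V where V: "x \<in> V" "openin (Euclidean_space n) V" "C_on (Suc k) n V f" by blast
    then show "\<exists>V. x \<in> V \<and> openin (Euclidean_space n) V \<and> C_on k n V (pdiff i f)"
      using V(3)[unfolded C_on_Suc_iff[OF V(2)]] i by blast
  qed
  ultimately show ?case unfolding C_on_Suc_iff[OF U] by simp
qed

lemma C_on_const: "C_on k n U (\<lambda>x. c)"
  by (induction k arbitrary: c) (auto intro!: exI[of _ "\<lambda>_. 0"])

lemma C_on_coord: "C_on k n U (\<lambda>x. x j)"
proof (cases k)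
  case 0
  then show ?thesis by (auto intro: continuous_map_from_subtopology continuous_map_coord)
next
  case (Suc k')
  have "((\<lambda>t. (x(i := t)) j) has_real_derivative (if i = j then 1 else 0)) (at (x i))" for i and x :: "nat \<Rightarrow> real"
    by auto
  moreover have "C_on k' n U (\<lambda>x. if i = j then 1 else 0)" for i by (rule C_on_const)
  ultimately show ?thesis unfolding Suc
    by (intro C_on_SucI) (auto intro: continuous_map_from_subtopology continuous_map_coord)
qed

lemma C_on_add:
  assumes U: "openin (Euclidean_space n) U" and "C_on k n U f" "C_on k n U g"
  shows "C_on k n U (\<lambda>x. f x + g x)"
  using assms(2,3)
proof (induction k arbitrary: f g)
  case 0
  then show ?case by (auto intro: continuous_intros)
next
  case (Suc k)
  note F = Suc.prems(1)[unfolded C_on_Suc_iff[OF U]] and G = Suc.prems(2)[unfolded C_on_Suc_iff[OF U]]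
  show ?case
  proof (rule C_on_SucI[where g="\<lambda>i x. pdiff i f x + pdiff i g x"])
    show "continuous_map (subtopology (Euclidean_space n) U) euclideanreal (\<lambda>x. f x + g x)"
      using F G by (auto intro: continuous_intros)
    fix i x assume i: "i < n" and x: "x \<in> U"
    show "((\<lambda>t. f (x(i := t)) + g (x(i := t))) has_real_derivative pdiff i f x + pdiff i g x) (at (x i))"
      by (rule DERIV_add) (use F G i x in auto)
  next
    fix i assume i: "i < n"
    show "C_on k n U (\<lambda>x. pdiff i f x + pdiff i g x)"
      using F G i by (intro Suc.IH) auto
  qed
qed

text \<open>The product rule pairs a derivative of one factor with the other factor itself, so the
  induction varies both functions and lowers the order by \<open>C_on_SucD\<close>.\<close>

lemma C_on_mult:
  assumes U: "openin (Euclidean_space n) U" and "C_on k n U f" "C_on k n U g"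
  shows "C_on k n U (\<lambda>x. f x * g x)"
  using assms(2,3)
proof (induction k arbitrary: f g)
  case 0
  then show ?case by (auto intro: continuous_intros)
next
  case (Suc k)
  note F = Suc.prems(1)[unfolded C_on_Suc_iff[OF U]] and G = Suc.prems(2)[unfolded C_on_Suc_iff[OF U]]
  show ?case
  proof (rule C_on_SucI[where g="\<lambda>i x. pdiff i f x * g x + pdiff i g x * f x"])
    show "continuous_map (subtopology (Euclidean_space n) U) euclideanreal (\<lambda>x. f x * g x)"
      using F G by (auto intro: continuous_intros)
    fix i x assume i: "i < n" and x: "x \<in> U"
    show "((\<lambda>t. f (x(i := t)) * g (x(i := t))) has_real_derivative pdiff i f x * g x + pdiff i g x * f x) (at (x i))"
      using DERIV_mult[of "\<lambda>t. f (x(i := t))" "pdiff i f x" "x i" UNIV "\<lambda>t. g (x(i := t))" "pdiff i g x"] F G i x by auto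
  next
    fix i assume i: "i < n"
    show "C_on k n U (\<lambda>x. pdiff i f x * g x + pdiff i g x * f x)"
      using F G i by (intro C_on_add[OF U] Suc.IH) (auto intro: C_on_SucD[OF Suc.prems(1)] C_on_SucD[OF Suc.prems(2)])
  qed
qed

lemma C_on_sum:
  assumes U: "openin (Euclidean_space n) U" and "\<And>j. j \<in> J \<Longrightarrow> C_on k n U (f j)"
  shows "C_on k n U (\<lambda>x. \<Sum>j\<in>J. f j x)"
  using assms(2) by (induction J rule: infinite_finite_induct) (auto intro: C_on_const C_on_add[OF U])

text \<open>The derivative of \<open>1 / f\<close> is built from \<open>1 / f\<close> and the
  derivative of \<open>f\<close>, so the inductive hypothesis for the same \<open>f\<close>, one
  order lower, closes the step.\<close>

lemma C_on_inverse:
  assumes U: "openin (Euclidean_space n) U" and "C_on k n U f" "\<And>x. x \<in> U \<Longrightarrow> f x \<noteq> 0"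
  shows "C_on k n U (\<lambda>x. inverse (f x))"
  using assms(2)
proof (induction k)
  case 0
  then show ?case using assms(3) by (auto intro: continuous_intros)
next
  case (Suc k)
  note F = Suc.prems(1)[unfolded C_on_Suc_iff[OF U]]
  note inv = Suc.IH[OF C_on_SucD[OF Suc.prems]]
  show ?case
  proof (rule C_on_SucI[where g="\<lambda>i x. - 1 * (inverse (f x) * pdiff i f x * inverse (f x))"])
    show "continuous_map (subtopology (Euclidean_space n) U) euclideanreal (\<lambda>x. inverse (f x))"
      using F assms(3) by (auto intro: continuous_intros)
    fix i x assume i: "i < n" and x: "x \<in> U"
    show "((\<lambda>t. inverse (f (x(i := t)))) has_real_derivative - 1 * (inverse (f x) * pdiff i f x * inverse (f x))) (at (x i))"
      using DERIV_inverse'[of "\<lambda>t. f (x(i := t))" "pdiff i f x" "x i" UNIV] F i x assms(3)[OF x] by auto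
  next
    fix i assume i: "i < n"
    show "C_on k n U (\<lambda>x. - 1 * (inverse (f x) * pdiff i f x * inverse (f x)))"
      using F i inv by (intro C_on_mult[OF U] C_on_const) auto
  qed
qed

text \<open>Continuous partial derivatives give total differentiability: change the coordinates one at a
  time and apply the mean value theorem to each step.\<close>

lemma C1_total_differentiable:
  assumes V: "openin (Euclidean_space m) V" "y \<in> V" and g: "C_on (Suc 0) m V g" and e: "e > 0"
  shows "\<exists>d>0. \<forall>u\<in>EE m. (\<forall>j<m. \<bar>u j - y j\<bar> < d) \<longrightarrow> u \<in> V \<and>
     \<bar>g u - g y - (\<Sum>j<m. pdiff j g y * (u j - y j))\<bar> \<le> e * (\<Sum>j<m. \<bar>u j - y j\<bar>)"
proof -
  have yE: "y \<in> EE m" using V openin_Euclidean_subset by blast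
  note G = g[unfolded C_on_Suc_iff[OF V(1)]]
  have op: "openin (Euclidean_space m) {z \<in> V. \<bar>pdiff j g z - pdiff j g y\<bar> < e}" if "j < m" for j
  proof -
    have "continuous_map (subtopology (Euclidean_space m) V) euclideanreal (\<lambda>z. \<bar>pdiff j g z - pdiff j g y\<bar>)"
      using G that by (auto intro!: continuous_intros)
    then have "openin (subtopology (Euclidean_space m) V) {z \<in> topspace (subtopology (Euclidean_space m) V). \<bar>pdiff j g z - pdiff j g y\<bar> \<in> {..<e}}"
      by (rule openin_continuous_map_preimage) auto
    moreover have "topspace (subtopology (Euclidean_space m) V) = V" using V openin_Euclidean_subset by auto
    ultimately show ?thesis using V(1) by (simp only: openin_open_subtopology lessThan_iff)
  qed
  have "\<exists>d. \<forall>j<m. d j > 0 \<and> (\<forall>u\<in>EE m. (\<forall>i<m. \<bar>u i - y i\<bar> < d j) \<longrightarrow> u \<in> V \<and> \<bar>pdiff j g u - pdiff j g y\<bar> < e)"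
  proof (intro choice allI)
    fix j show "\<exists>d. j < m \<longrightarrow> d > 0 \<and> (\<forall>u\<in>EE m. (\<forall>i<m. \<bar>u i - y i\<bar> < d) \<longrightarrow> u \<in> V \<and> \<bar>pdiff j g u - pdiff j g y\<bar> < e)"
      using openin_Euclidean_box[OF op[of j], of y] V(2) e by (cases "j < m") auto
  qed
  then obtain d where d: "\<And>j. j < m \<Longrightarrow> d j > 0"
    "\<And>j u. j < m \<Longrightarrow> u\<in>EE m \<Longrightarrow> (\<forall>i<m. \<bar>u i - y i\<bar> < d j) \<Longrightarrow> u \<in> V \<and> \<bar>pdiff j g u - pdiff j g y\<bar> < e" by metis
  obtain d0 where d0: "d0 > 0" "\<And>u. u \<in> EE m \<Longrightarrow> (\<forall>i<m. \<bar>u i - y i\<bar> < d0) \<Longrightarrow> u \<in> V"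
    using openin_Euclidean_box[OF V] by auto
  \<comment> \<open>\<open>d0\<close> secures membership in \<open>V\<close> also when
    \<open>m = 0\<close>, where there is no \<open>d j\<close>.\<close>
  define D where "D = Min (insert d0 (d ` {..<m}))"
  have D: "D > 0" "\<And>j. j < m \<Longrightarrow> D \<le> d j" "D \<le> d0"
    unfolding D_def using d(1) d0 by (auto intro!: Min_le)
  have main: "u \<in> V \<and> \<bar>g u - g y - (\<Sum>j<m. pdiff j g y * (u j - y j))\<bar> \<le> e * (\<Sum>j<m. \<bar>u j - y j\<bar>)"
    if u: "u \<in> EE m" "\<forall>j<m. \<bar>u j - y j\<bar> < D" for u
  proof -
    \<comment> \<open>The increment of \<open>g\<close> telescopes along the path
      \<open>z 0 = y\<close>, ..., \<open>z m = u\<close>.\<close>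
    define z where "z = (\<lambda>j i. if i < j then u i else y i)"
    have z0: "z 0 = y" by (auto simp: z_def)
    have zm: "z m = u" using EE_ge[OF yE] EE_ge[OF u(1)] by (auto simp: z_def fun_eq_iff not_less)
    have step: "\<bar>g (z (Suc j)) - g (z j) - pdiff j g y * (u j - y j)\<bar> \<le> e * \<bar>u j - y j\<bar>" if j: "j < m" for j
    proof -
      have upd: "(z j)(j := t) \<in> EE m" for t
        using j u(1) yE by (auto simp: z_def topspace_Euclidean_space)
      have near: "(z j)(j := t) \<in> V \<and> \<bar>pdiff j g ((z j)(j := t)) - pdiff j g y\<bar> < e"
        if t: "t \<in> closed_segment (y j) (u j)" for t
      proof (rule d(2)[OF j upd], intro allI impI)
        fix i assume "i < m"
        have "\<bar>t - y j\<bar> \<le> \<bar>u j - y j\<bar>" using t by (auto simp: closed_segment_eq_real_ivl split: if_splits)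
        then have "\<bar>t - y j\<bar> < D" using u(2) j by force
        then show "\<bar>((z j)(j := t)) i - y i\<bar> < d j" using u(2) \<open>i < m\<close> D(1) D(2)[OF j]
          by (auto simp: z_def)
      qed
      \<comment> \<open>Subtracting the linear part leaves a function of one variable whose
        derivative is the variation of \<open>pdiff j g\<close>, bounded by \<open>e\<close> along
        the segment.\<close>
      define h where "h = (\<lambda>t. g ((z j)(j := t)) - pdiff j g y * t)"
      have "norm (h (u j) - h (y j)) \<le> e * norm (u j - y j)"
      proof (rule field_differentiable_bound[of "closed_segment (y j) (u j)" _ "\<lambda>t. pdiff j g ((z j)(j := t)) - pdiff j g y"])
        fix t assume t: "t \<in> closed_segment (y j) (u j)"
        have "((\<lambda>s. g (((z j)(j := t))(j := s))) has_real_derivative pdiff j g ((z j)(j := t))) (at (((z j)(j := t)) j))"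
          using G j near[OF t] by blast
        then have "((\<lambda>s. g ((z j)(j := s))) has_real_derivative pdiff j g ((z j)(j := t))) (at t)" by simp
        then have "(h has_real_derivative pdiff j g ((z j)(j := t)) - pdiff j g y) (at t)"
          unfolding h_def by (auto intro!: derivative_eq_intros)
        then show "(h has_real_derivative pdiff j g ((z j)(j := t)) - pdiff j g y) (at t within closed_segment (y j) (u j))"
          by (rule has_field_derivative_at_within)
        show "norm (pdiff j g ((z j)(j := t)) - pdiff j g y) \<le> e" using near[OF t] by auto
      qed auto
      moreover have "(z j)(j := u j) = z (Suc j)" "(z j)(j := y j) = z j" by (auto simp: z_def fun_eq_iff less_Suc_eq)
      ultimately show ?thesis unfolding h_def by (auto simp: algebra_simps)
    qed
    have "g u - g y = (\<Sum>j<m. g (z (Suc j)) - g (z j))"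
      using sum_lessThan_telescope[of "\<lambda>j. g (z j)" m] z0 zm by simp
    then have "\<bar>g u - g y - (\<Sum>j<m. pdiff j g y * (u j - y j))\<bar> = \<bar>\<Sum>j<m. g (z (Suc j)) - g (z j) - pdiff j g y * (u j - y j)\<bar>"
      by (simp add: sum_subtractf)
    also have "\<dots> \<le> (\<Sum>j<m. e * \<bar>u j - y j\<bar>)"
      by (rule order_trans[OF sum_abs sum_mono]) (use step in auto)
    also have "\<dots> = e * (\<Sum>j<m. \<bar>u j - y j\<bar>)" by (simp add: sum_distrib_left)
    finally show ?thesis using d0(2)[OF u(1)] u(2) D(3) by fastforce
  qed
  then show ?thesis using D(1) by (intro exI[of _ D]) auto
qed

text \<open>The chain rule along a curve: by total differentiability the error of the linear
  approximation is small compared with the increments of the components, and these are of the order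
  of \<open>t - t0\<close>.\<close>

lemma DERIV_chain_coords:
  assumes V: "openin (Euclidean_space m) V" "y t0 \<in> V" and g: "C_on (Suc 0) m V g"
    and y: "\<And>t. y t \<in> EE m" "\<And>j. j < m \<Longrightarrow> ((\<lambda>t. y t j) has_real_derivative d j) (at t0)"
  shows "((\<lambda>t. g (y t)) has_real_derivative (\<Sum>j<m. pdiff j g (y t0) * d j)) (at t0)"
proof -
  define q where "q = (\<lambda>j t. (y t j - y t0 j) / (t - t0))"
  have q: "(q j \<longlongrightarrow> d j) (at t0)" if "j < m" for j
    using y(2)[OF that] unfolding has_field_derivative_iff q_def .
  \<comment> \<open>\<open>S\<close> exceeds the limit of the sum of the absolute difference
    quotients, hence eventually that sum itself; the summand 1 also makes it positive.\<close>
  define S where "S = (\<Sum>j<m. \<bar>d j\<bar>) + 1"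
  have S: "S > 0" unfolding S_def by (intro add_nonneg_pos sum_nonneg) auto
  have sumq: "eventually (\<lambda>t. (\<Sum>j<m. \<bar>q j t\<bar>) < S) (at t0)"
  proof (rule order_tendstoD(2))
    show "((\<lambda>t. \<Sum>j<m. \<bar>q j t\<bar>) \<longlongrightarrow> (\<Sum>j<m. \<bar>d j\<bar>)) (at t0)" using q by (auto intro!: tendsto_intros)
  qed (simp add: S_def)
  \<comment> \<open>\<open>R\<close> is the difference quotient of \<open>g\<close> along the curve
    minus its prediction from the quotients \<open>q j\<close>. It remains to show that
    \<open>R\<close> tends to 0.\<close>
  define R where "R = (\<lambda>t. (g (y t) - g (y t0)) / (t - t0) - (\<Sum>j<m. pdiff j g (y t0) * q j t))"
  have "(R \<longlongrightarrow> 0) (at t0)"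
  proof (rule tendstoI)
    fix e :: real assume e: "e > 0"
    obtain \<delta> where \<delta>: "\<delta> > 0" "\<And>u. u\<in>EE m \<Longrightarrow> (\<forall>j<m. \<bar>u j - y t0 j\<bar> < \<delta>) \<Longrightarrow>
       \<bar>g u - g (y t0) - (\<Sum>j<m. pdiff j g (y t0) * (u j - y t0 j))\<bar> \<le> (e / S) * (\<Sum>j<m. \<bar>u j - y t0 j\<bar>)"
      using C1_total_differentiable[OF V g, of "e / S"] e S by auto
    have "eventually (\<lambda>t. \<forall>j\<in>{..<m}. \<bar>y t j - y t0 j\<bar> < \<delta>) (at t0)"
    proof (intro eventually_ball_finite ballI)
      fix j assume "j \<in> {..<m}"
      then have "((\<lambda>t. y t j) \<longlongrightarrow> y t0 j) (at t0)" using DERIV_isCont[OF y(2)] by (auto simp: isCont_def)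
      then show "eventually (\<lambda>t. \<bar>y t j - y t0 j\<bar> < \<delta>) (at t0)"
        using tendstoD[OF _ \<delta>(1)] by (fastforce simp: dist_real_def)
    qed auto
    then show "eventually (\<lambda>t. dist (R t) 0 < e) (at t0)"
      using sumq eventually_neq_at_within[of t0 t0 UNIV]
    proof eventually_elim
      case (elim t)
      have 1: "R t * (t - t0) = g (y t) - g (y t0) - (\<Sum>j<m. pdiff j g (y t0) * (y t j - y t0 j))"
      proof -
        have nz: "t - t0 \<noteq> 0" using elim(3) by simp
        have "R t * (t - t0) = (g (y t) - g (y t0)) / (t - t0) * (t - t0) - (\<Sum>j<m. pdiff j g (y t0) * q j t * (t - t0))"
          unfolding R_def by (simp only: left_diff_distrib sum_distrib_right)
        moreover have "(g (y t) - g (y t0)) / (t - t0) * (t - t0) = g (y t) - g (y t0)"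
          using nz by simp
        moreover have "pdiff j g (y t0) * q j t * (t - t0) = pdiff j g (y t0) * (y t j - y t0 j)" for j
          using nz by (simp add: q_def)
        ultimately show ?thesis by simp
      qed
      have 2: "(\<Sum>j<m. \<bar>y t j - y t0 j\<bar>) = (\<Sum>j<m. \<bar>q j t\<bar>) * \<bar>t - t0\<bar>"
        unfolding q_def using elim(3) by (simp add: sum_distrib_right)
      have "\<bar>R t\<bar> * \<bar>t - t0\<bar> \<le> (e / S) * ((\<Sum>j<m. \<bar>q j t\<bar>) * \<bar>t - t0\<bar>)"
        using \<delta>(2)[OF y(1), of t] elim(1) unfolding abs_mult[symmetric] 1 2 by auto
      then have "\<bar>R t\<bar> \<le> (e / S) * (\<Sum>j<m. \<bar>q j t\<bar>)" using elim(3)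
        by (simp add: mult.assoc[symmetric] del: times_divide_eq_left)
      also have "\<dots> < (e / S) * S" using elim(2) e S by (intro mult_strict_left_mono) auto
      finally show ?case using S by simp
    qed
  qed
  moreover have "((\<lambda>t. \<Sum>j<m. pdiff j g (y t0) * q j t) \<longlongrightarrow> (\<Sum>j<m. pdiff j g (y t0) * d j)) (at t0)"
    using q by (auto intro!: tendsto_intros)
  ultimately have "((\<lambda>t. R t + (\<Sum>j<m. pdiff j g (y t0) * q j t)) \<longlongrightarrow> 0 + (\<Sum>j<m. pdiff j g (y t0) * d j)) (at t0)"
    by (rule tendsto_add)
  then show ?thesis unfolding has_field_derivative_iff R_def by simp
qed

text \<open>A partial derivative of the composite is a sum of products of some
  \<open>pdiff j g\<close>, composed with \<open>f\<close>, and derivatives of the components of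
  \<open>f\<close>. Hence induction on the order with \<open>g\<close> arbitrary and
  \<open>f\<close> fixed suffices.\<close>

lemma C_on_compose:
  assumes U: "openin (Euclidean_space n) U" and V: "openin (Euclidean_space m) V"
    and f: "\<And>j. j < m \<Longrightarrow> C_on k n U (\<lambda>x. f x j)" and fV: "\<And>x. x \<in> U \<Longrightarrow> trunc m (f x) \<in> V"
    and g: "C_on k m V g"
  shows "C_on k n U (\<lambda>x. g (trunc m (f x)))"
  using f g
proof (induction k arbitrary: g)
  case 0
  have "continuous_map (subtopology (Euclidean_space n) U) (subtopology (Euclidean_space m) V) (\<lambda>x. trunc m (f x))"
    using 0 fV by (auto simp: continuous_map_in_subtopology continuous_map_trunc)
  then show ?case using continuous_map_compose[of _ _ "\<lambda>x. trunc m (f x)" _ g] 0 by (simp add: o_def)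
next
  case (Suc k)
  note f' = C_on_SucD[OF Suc.prems(1)] and G = Suc.prems(2)[unfolded C_on_Suc_iff[OF V]]
  have IH: "C_on k n U (\<lambda>x. h (trunc m (f x)))" if "C_on k m V h" for h
    using Suc.IH[OF f' that] by simp
  have g1: "C_on (Suc 0) m V g"
    using G by (auto intro!: C_on_SucI C_on_continuous simp: C_on.simps(1))
  show ?case
  proof (rule C_on_SucI[where g="\<lambda>i x. \<Sum>j<m. pdiff j g (trunc m (f x)) * pdiff i (\<lambda>x. f x j) x"])
    have "continuous_map (subtopology (Euclidean_space n) U) (subtopology (Euclidean_space m) V) (\<lambda>x. trunc m (f x))"
      using Suc.prems fV by (auto simp: continuous_map_in_subtopology continuous_map_trunc intro: C_on_continuous)
    then show "continuous_map (subtopology (Euclidean_space n) U) euclideanreal (\<lambda>x. g (trunc m (f x)))"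
      using continuous_map_compose[of _ _ "\<lambda>x. trunc m (f x)" _ g] G by (simp add: o_def)
    fix i x assume i: "i < n" and x: "x \<in> U"
    have "((\<lambda>t. g (trunc m (f (x(i := t))))) has_real_derivative
       (\<Sum>j<m. pdiff j g (trunc m (f (x(i := x i)))) * pdiff i (\<lambda>x. f x j) x)) (at (x i))"
    proof (rule DERIV_chain_coords[OF V _ g1])
      fix j assume j: "j < m"
      have "((\<lambda>t. f (x(i := t)) j) has_real_derivative pdiff i (\<lambda>x. f x j) x) (at (x i))"
        using Suc.prems(1)[OF j] i x unfolding C_on_Suc_iff[OF U] by blast
      then show "((\<lambda>t. trunc m (f (x(i := t))) j) has_real_derivative pdiff i (\<lambda>x. f x j) x) (at (x i))"
        using j by simp
    qed (use fV x in auto)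
    then show "((\<lambda>t. g (trunc m (f (x(i := t))))) has_real_derivative
       (\<Sum>j<m. pdiff j g (trunc m (f x)) * pdiff i (\<lambda>x. f x j) x)) (at (x i))" by simp
  next
    fix i assume i: "i < n"
    show "C_on k n U (\<lambda>x. \<Sum>j<m. pdiff j g (trunc m (f x)) * pdiff i (\<lambda>x. f x j) x)"
      using G Suc.prems(1)[unfolded C_on_Suc_iff[OF U]] i
      by (intro C_on_sum[OF U] C_on_mult[OF U] IH) auto
  qed
qed

section \<open>Smooth functions and smooth maps\<close>

definition charted :: "'a manifold \<Rightarrow> bool" where
  "charted X \<longleftrightarrow> (\<forall>c\<in>atlas X. is_chart (mtop X) (mdim X) c) \<and> (\<Union>c\<in>atlas X. fst c) = mpoints X"

definition sfun :: "'a manifold \<Rightarrow> 'a set \<Rightarrow> ('a \<Rightarrow> real) \<Rightarrow> bool" where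
  "sfun X P g \<longleftrightarrow> openin (mtop X) P \<and>
     (\<forall>(U, \<phi>)\<in>atlas X. \<forall>k. C_on k (mdim X) (\<phi> ` (P \<inter> U)) (\<lambda>x. g (inv_into U \<phi> x)))"

text \<open>Smoothness by pulling back local smooth functions. In this form composition and locality
  involve no coordinates; the link to charts is made by \<open>smo_chartI\<close>,
  \<open>smooth_map_smo\<close> and \<open>smo_smooth_map\<close>. The open domain \<open>P\<close>
  covers maps that are defined only locally.\<close>

definition smo :: "'a manifold \<Rightarrow> 'a set \<Rightarrow> 'b manifold \<Rightarrow> ('a \<Rightarrow> 'b) \<Rightarrow> bool" where
  "smo X P Y F \<longleftrightarrow> openin (mtop X) P \<and> F ` P \<subseteq> mpoints Y \<and>
     (\<forall>W g. sfun Y W g \<longrightarrow> sfun X {x\<in>P. F x \<in> W} (\<lambda>x. g (F x)))"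

text \<open>Compatibility of charts, phrased as smoothness of the coordinate functions. The
  Hausdorff and countability conditions are kept apart, because constructions inherit them by
  separate arguments.\<close>

definition mfd :: "'a manifold \<Rightarrow> bool" where
  "mfd X \<longleftrightarrow> charted X \<and> (\<forall>(V, \<psi>)\<in>atlas X. \<forall>j<mdim X. sfun X V (\<lambda>x. \<psi> x j))"

lemma mfd_charted: "mfd X \<Longrightarrow> charted X" by (simp add: mfd_def)

lemma open_vimage_subtopology:
  assumes "openin T P" "continuous_map (subtopology T P) Y f" "openin Y W"
  shows "openin T {x\<in>P. f x \<in> W}"
proof -
  have "topspace (subtopology T P) = P" using openin_subset[OF assms(1)] by auto
  then have "openin (subtopology T P) {x\<in>P. f x \<in> W}"
    using openin_continuous_map_preimage[OF assms(2,3)] by simp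
  then show ?thesis using assms(1) openin_open_subtopology by blast
qed

lemma is_chartD:
  assumes "is_chart T n (U, \<phi>)"
  shows "openin T U" "openin (Euclidean_space n) (\<phi> ` U)" "inj_on \<phi> U"
    "continuous_map (subtopology T U) (Euclidean_space n) \<phi>"
    "x \<in> U \<Longrightarrow> \<phi> x \<in> EE n"
    "x \<in> U \<Longrightarrow> inv_into U \<phi> (\<phi> x) = x"
    "U \<subseteq> topspace T"
    "W \<subseteq> U \<Longrightarrow> openin T W \<Longrightarrow> openin (Euclidean_space n) (\<phi> ` W)"
    "openin (Euclidean_space n) Q \<Longrightarrow> openin T {x\<in>U. \<phi> x \<in> Q}"
proof -
  show U: "openin T U" and o: "openin (Euclidean_space n) (\<phi> ` U)" using assms by (auto simp: is_chart_def)
  then show UT: "U \<subseteq> topspace T" by (auto dest: openin_subset)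
  have h: "homeomorphic_map (subtopology T U) (subtopology (Euclidean_space n) (\<phi> ` U)) \<phi>"
    using assms by (auto simp: is_chart_def)
  then have e: "continuous_map (subtopology T U) (subtopology (Euclidean_space n) (\<phi> ` U)) \<phi>"
    "open_map (subtopology T U) (subtopology (Euclidean_space n) (\<phi> ` U)) \<phi>"
    "inj_on \<phi> (topspace (subtopology T U))"
    by (auto simp: homeomorphic_eq_everything_map)
  have ts: "topspace (subtopology T U) = U" using UT by auto
  show inj: "inj_on \<phi> U" using e(3) ts by simp
  show c: "continuous_map (subtopology T U) (Euclidean_space n) \<phi>"
    using e(1) by (simp add: continuous_map_in_subtopology)
  show "x \<in> U \<Longrightarrow> \<phi> x \<in> EE n" using openin_subset[OF o] by auto
  show "x \<in> U \<Longrightarrow> inv_into U \<phi> (\<phi> x) = x" using inj by simp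
  show "openin (Euclidean_space n) (\<phi> ` W)" if "W \<subseteq> U" "openin T W"
  proof -
    have "openin (subtopology T U) W" using that U by (auto simp: openin_open_subtopology)
    then show ?thesis using e(2) o by (auto simp: open_map_def openin_open_subtopology)
  qed
  show "openin T {x\<in>U. \<phi> x \<in> Q}" if Q: "openin (Euclidean_space n) Q"
  proof -
    have "openin (subtopology T U) {x \<in> topspace (subtopology T U). \<phi> x \<in> Q}"
      by (rule openin_continuous_map_preimage[OF c Q])
    then show ?thesis unfolding ts using U by (simp add: openin_open_subtopology)
  qed
qed

lemma is_chartI:
  assumes U: "openin T U" and V: "openin (Euclidean_space n) V"
    and c: "continuous_map (subtopology T U) (Euclidean_space n) \<phi>"
    and c': "continuous_map (subtopology (Euclidean_space n) V) T h"
    and inv: "\<And>x. x \<in> U \<Longrightarrow> \<phi> x \<in> V \<and> h (\<phi> x) = x" "\<And>y. y \<in> V \<Longrightarrow> h y \<in> U \<and> \<phi> (h y) = y"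
  shows "is_chart T n (U, \<phi>)" "\<phi> ` U = V" "\<And>y. y \<in> V \<Longrightarrow> inv_into U \<phi> y = h y"
proof -
  show im: "\<phi> ` U = V" using inv by force
  have ts: "topspace (subtopology T U) = U" "topspace (subtopology (Euclidean_space n) V) = V"
    using openin_subset[OF U] openin_subset[OF V] by auto
  have "homeomorphic_maps (subtopology T U) (subtopology (Euclidean_space n) V) \<phi> h"
    unfolding homeomorphic_maps_def continuous_map_in_subtopology using c c' inv ts by auto
  then have "homeomorphic_map (subtopology T U) (subtopology (Euclidean_space n) V) \<phi>"
    using homeomorphic_maps_map by blast
  then show "is_chart T n (U, \<phi>)" using U V im by (auto simp: is_chart_def)
  have "inj_on \<phi> U" using inv by (metis inj_onI)
  then show "inv_into U \<phi> y = h y" if "y \<in> V" for y using inv(2)[OF that] by (metis inv_into_f_f)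
qed

lemma charted_chart: "charted X \<Longrightarrow> (U, \<phi>) \<in> atlas X \<Longrightarrow> is_chart (mtop X) (mdim X) (U, \<phi>)"
  by (auto simp: charted_def)

lemma charted_cover:
  assumes "charted X" "x \<in> mpoints X"
  obtains U \<phi> where "(U, \<phi>) \<in> atlas X" "x \<in> U"
  using assms by (fastforce simp: charted_def)

lemma sfun_openin: "sfun X P g \<Longrightarrow> openin (mtop X) P" by (simp add: sfun_def)

lemma sfun_C_on: "sfun X P g \<Longrightarrow> (U, \<phi>) \<in> atlas X \<Longrightarrow> C_on k (mdim X) (\<phi> ` (P \<inter> U)) (\<lambda>x. g (inv_into U \<phi> x))"
  by (auto simp: sfun_def)

lemma sfunI:
  assumes "openin (mtop X) P"
    "\<And>U \<phi> k. (U, \<phi>) \<in> atlas X \<Longrightarrow> C_on k (mdim X) (\<phi> ` (P \<inter> U)) (\<lambda>x. g (inv_into U \<phi> x))"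
  shows "sfun X P g"
  using assms by (auto simp: sfun_def)

lemma chart_image_open:
  "charted X \<Longrightarrow> (U, \<phi>) \<in> atlas X \<Longrightarrow> openin (mtop X) P \<Longrightarrow> openin (Euclidean_space (mdim X)) (\<phi> ` (P \<inter> U))"
  by (meson charted_chart inf_le2 is_chartD(1,8) openin_Int)

lemma sfun_cong:
  assumes X: "charted X" and g: "sfun X P g" and eq: "\<And>x. x \<in> P \<Longrightarrow> g x = h x"
  shows "sfun X P h"
proof (rule sfunI[OF sfun_openin[OF g]])
  fix U \<phi> k assume U: "(U, \<phi>) \<in> atlas X"
  show "C_on k (mdim X) (\<phi> ` (P \<inter> U)) (\<lambda>x. h (inv_into U \<phi> x))"
    by (rule C_on_cong[OF chart_image_open[OF X U sfun_openin[OF g]] _ sfun_C_on[OF g U]])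
       (use eq is_chartD(6)[OF charted_chart[OF X U]] in auto)
qed

lemma sfun_subset:
  assumes "sfun X P g" "openin (mtop X) Q" "Q \<subseteq> P"
  shows "sfun X Q g"
  using assms(2) by (rule sfunI) (use sfun_C_on[OF assms(1)] assms(3) in \<open>auto intro!: C_on_subset[OF sfun_C_on[OF assms(1)]]\<close>)

lemma sfun_locally:
  assumes X: "charted X" and P: "openin (mtop X) P" and Q: "\<And>x. x \<in> P \<Longrightarrow> \<exists>Q. x \<in> Q \<and> sfun X Q g"
  shows "sfun X P g"
proof (rule sfunI[OF P])
  fix U \<phi> k assume U: "(U, \<phi>) \<in> atlas X"
  show "C_on k (mdim X) (\<phi> ` (P \<inter> U)) (\<lambda>x. g (inv_into U \<phi> x))"
  proof (rule C_on_locally[OF chart_image_open[OF X U P]])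
    fix y assume "y \<in> \<phi> ` (P \<inter> U)"
    then obtain x where x: "x \<in> P" "x \<in> U" "y = \<phi> x" by auto
    then obtain Q where q: "x \<in> Q" "sfun X Q g" using Q by blast
    show "\<exists>V. y \<in> V \<and> openin (Euclidean_space (mdim X)) V \<and> C_on k (mdim X) V (\<lambda>x. g (inv_into U \<phi> x))"
      using x q chart_image_open[OF X U sfun_openin[OF q(2)]] sfun_C_on[OF q(2) U]
      by (intro exI[of _ "\<phi> ` (Q \<inter> U)"]) auto
  qed
qed

lemma sfun_const: "openin (mtop X) P \<Longrightarrow> sfun X P (\<lambda>_. c)"
  by (auto intro!: sfunI C_on_const)

lemma sfun_add: "charted X \<Longrightarrow> sfun X P f \<Longrightarrow> sfun X P g \<Longrightarrow> sfun X P (\<lambda>x. f x + g x)"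
  by (auto intro!: sfunI C_on_add chart_image_open intro: sfun_openin sfun_C_on)

lemma sfun_mult: "charted X \<Longrightarrow> sfun X P f \<Longrightarrow> sfun X P g \<Longrightarrow> sfun X P (\<lambda>x. f x * g x)"
  by (auto intro!: sfunI C_on_mult chart_image_open intro: sfun_openin sfun_C_on)

lemma sfun_minus: "charted X \<Longrightarrow> sfun X P f \<Longrightarrow> sfun X P (\<lambda>x. - f x)"
  using sfun_mult[OF _ sfun_const[OF sfun_openin], of X P f f "-1"] by simp

lemma sfun_diff: "charted X \<Longrightarrow> sfun X P f \<Longrightarrow> sfun X P g \<Longrightarrow> sfun X P (\<lambda>x. f x - g x)"
  using sfun_add[OF _ _ sfun_minus] by fastforce

lemma sfun_sum:
  "charted X \<Longrightarrow> openin (mtop X) P \<Longrightarrow> (\<And>j. j \<in> J \<Longrightarrow> sfun X P (f j)) \<Longrightarrow> sfun X P (\<lambda>x. \<Sum>j\<in>J. f j x)"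
  by (induction J rule: infinite_finite_induct) (auto intro: sfun_const sfun_add)

lemma sfun_inverse:
  assumes X: "charted X" and f: "sfun X P f" and nz: "\<And>x. x \<in> P \<Longrightarrow> f x \<noteq> 0"
  shows "sfun X P (\<lambda>x. inverse (f x))"
proof (rule sfunI[OF sfun_openin[OF f]])
  fix U \<phi> k assume U: "(U, \<phi>) \<in> atlas X"
  show "C_on k (mdim X) (\<phi> ` (P \<inter> U)) (\<lambda>x. inverse (f (inv_into U \<phi> x)))"
    by (rule C_on_inverse[OF chart_image_open[OF X U sfun_openin[OF f]] sfun_C_on[OF f U]])
       (use nz is_chartD(6)[OF charted_chart[OF X U]] in auto)
qed

lemma sfun_compose_C_on:
  assumes X: "charted X" and P: "openin (mtop X) P" and f: "\<And>j. j < m \<Longrightarrow> sfun X P (\<lambda>x. f x j)"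
    and V: "openin (Euclidean_space m) V" and g: "\<And>k. C_on k m V g"
    and fV: "\<And>x. x \<in> P \<Longrightarrow> trunc m (f x) \<in> V"
  shows "sfun X P (\<lambda>x. g (trunc m (f x)))"
proof (rule sfunI[OF P])
  fix U \<phi> k assume U: "(U, \<phi>) \<in> atlas X"
  show "C_on k (mdim X) (\<phi> ` (P \<inter> U)) (\<lambda>x. g (trunc m (f (inv_into U \<phi> x))))"
    by (rule C_on_compose[OF chart_image_open[OF X U P] V _ _ g])
       (use sfun_C_on[OF f U] fV is_chartD(6)[OF charted_chart[OF X U]] in auto)
qed

lemma sfun_vimage_open:
  assumes X: "charted X" and f: "sfun X P f" and W: "open W"
  shows "openin (mtop X) {x\<in>P. f x \<in> W}"
proof (subst openin_subopen, intro ballI)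
  fix x assume x: "x \<in> {x\<in>P. f x \<in> W}"
  note P = sfun_openin[OF f]
  obtain U \<phi> where U: "(U, \<phi>) \<in> atlas X" "x \<in> U"
    using charted_cover[OF X, of x] x openin_subset[OF P] by blast
  note ch = is_chartD[OF charted_chart[OF X U(1)]]
  let ?Q = "\<phi> ` (P \<inter> U)"
  have Q: "openin (Euclidean_space (mdim X)) ?Q" by (rule chart_image_open[OF X U(1) P])
  have "continuous_map (subtopology (Euclidean_space (mdim X)) ?Q) euclideanreal (\<lambda>x. f (inv_into U \<phi> x))"
    by (rule C_on_continuous[OF sfun_C_on[OF f U(1), of 0]])
  then have "openin (Euclidean_space (mdim X)) {y \<in> ?Q. f (inv_into U \<phi> y) \<in> W}"
    by (rule open_vimage_subtopology[OF Q]) (use W in auto)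
  then have "openin (mtop X) {z\<in>U. \<phi> z \<in> {y \<in> ?Q. f (inv_into U \<phi> y) \<in> W}}" by (rule ch(9))
  moreover have "{z\<in>U. \<phi> z \<in> {y \<in> ?Q. f (inv_into U \<phi> y) \<in> W}} = {z\<in>U. z \<in> P \<and> f z \<in> W}"
    using ch(6) inj_on_image_mem_iff[OF ch(3), of _ "P \<inter> U"] by (simp cong: conj_cong)
  ultimately show "\<exists>T. openin (mtop X) T \<and> x \<in> T \<and> T \<subseteq> {x\<in>P. f x \<in> W}"
    using U(2) x by (intro exI[of _ "{z\<in>U. z \<in> P \<and> f z \<in> W}"]) auto
qed

lemma sfun_continuous:
  assumes X: "charted X" and f: "sfun X P f"
  shows "continuous_map (subtopology (mtop X) P) euclideanreal f"
proof -
  have P: "openin (mtop X) P" by (rule sfun_openin[OF f])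
  have ts: "topspace (subtopology (mtop X) P) = P" using openin_subset[OF P] by auto
  show ?thesis unfolding continuous_map ts
    using sfun_vimage_open[OF X f] P by (auto simp: openin_open_subtopology)
qed

lemma smo_openin: "smo X P Y F \<Longrightarrow> openin (mtop X) P" by (simp add: smo_def)

lemma smo_in: "smo X P Y F \<Longrightarrow> x \<in> P \<Longrightarrow> F x \<in> mpoints Y" by (auto simp: smo_def)

lemma smo_sfun: "smo X P Y F \<Longrightarrow> sfun Y W g \<Longrightarrow> sfun X {x\<in>P. F x \<in> W} (\<lambda>x. g (F x))"
  by (auto simp: smo_def)

lemma smo_sfun': "smo X P Y F \<Longrightarrow> sfun Y W g \<Longrightarrow> F ` P \<subseteq> W \<Longrightarrow> sfun X P (\<lambda>x. g (F x))"
  using smo_sfun[of X P Y F W g] by (simp add: image_subset_iff Collect_conj_eq Int_absorb2 subset_iff cong: conj_cong)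

lemma smo_vimage_open: "smo X P Y F \<Longrightarrow> openin (mtop Y) W \<Longrightarrow> openin (mtop X) {x\<in>P. F x \<in> W}"
  using smo_sfun[OF _ sfun_const] sfun_openin by blast

lemma smo_continuous:
  assumes "smo X P Y F"
  shows "continuous_map (subtopology (mtop X) P) (mtop Y) F"
proof -
  have P: "P \<subseteq> mpoints X" using smo_openin[OF assms] openin_subset by blast
  then have ts: "topspace (subtopology (mtop X) P) = P" by auto
  show ?thesis unfolding continuous_map ts
    using smo_in[OF assms] smo_vimage_open[OF assms] smo_openin[OF assms] by (auto simp: openin_open_subtopology)
qed

lemma smo_subset:
  assumes "smo X P Y F" "openin (mtop X) Q" "Q \<subseteq> P"
  shows "smo X Q Y F"
  unfolding smo_def
proof (intro conjI allI impI)
  fix W g assume g: "sfun Y W g"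
  have "sfun X {x\<in>P. F x \<in> W} (\<lambda>x. g (F x))" by (rule smo_sfun[OF assms(1) g])
  moreover have "{x\<in>Q. F x \<in> W} = Q \<inter> {x\<in>P. F x \<in> W}" using assms(3) by auto
  ultimately show "sfun X {x\<in>Q. F x \<in> W} (\<lambda>x. g (F x))"
    using assms(2) by (auto intro: sfun_subset sfun_openin)
qed (use assms smo_in[OF assms(1)] in auto)

lemma smo_cong:
  assumes X: "charted X" and F: "smo X P Y F" and eq: "\<And>x. x \<in> P \<Longrightarrow> F x = G x"
  shows "smo X P Y G"
  unfolding smo_def
proof (intro conjI allI impI)
  fix W g assume g: "sfun Y W g"
  have "{x\<in>P. F x \<in> W} = {x\<in>P. G x \<in> W}" using eq by auto
  then show "sfun X {x\<in>P. G x \<in> W} (\<lambda>x. g (G x))"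
    using sfun_cong[OF X smo_sfun[OF F g], of "\<lambda>x. g (G x)"] eq by auto
qed (use smo_openin[OF F] smo_in[OF F] eq in auto)

lemma smo_compose:
  assumes F: "smo X P Y F" and G: "smo Y Q Z G" and sub: "F ` P \<subseteq> Q"
  shows "smo X P Z (\<lambda>x. G (F x))"
  unfolding smo_def
proof (intro conjI allI impI)
  fix W g assume g: "sfun Z W g"
  have "sfun X {x\<in>P. F x \<in> {y\<in>Q. G y \<in> W}} (\<lambda>x. g (G (F x)))"
    by (rule smo_sfun[OF F smo_sfun[OF G g]])
  moreover have "{x\<in>P. F x \<in> {y\<in>Q. G y \<in> W}} = {x\<in>P. G (F x) \<in> W}" using sub by auto
  ultimately show "sfun X {x\<in>P. G (F x) \<in> W} (\<lambda>x. g (G (F x)))" by simp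
qed (use smo_openin[OF F] smo_in[OF G] sub in auto)

lemma smo_id: "openin (mtop X) P \<Longrightarrow> smo X P X (\<lambda>x. x)"
  unfolding smo_def
proof (intro conjI allI impI)
  fix W and g :: "'a \<Rightarrow> real" assume "openin (mtop X) P" "sfun X W g"
  then show "sfun X {x\<in>P. x \<in> W} g"
    by (auto intro!: sfun_subset[of X W g] intro: sfun_openin simp flip: Int_def)
qed (auto dest: openin_subset)

lemma smo_locally:
  assumes X: "charted X" and P: "openin (mtop X) P" and Q: "\<And>x. x \<in> P \<Longrightarrow> \<exists>Q. x \<in> Q \<and> smo X Q Y F"
  shows "smo X P Y F"
  unfolding smo_def
proof (intro conjI allI impI)
  fix W g assume g: "sfun Y W g"
  have "openin (mtop X) {x\<in>P. F x \<in> W}"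
  proof (subst openin_subopen, intro ballI)
    fix x assume x: "x \<in> {x\<in>P. F x \<in> W}"
    then obtain Q where q: "x \<in> Q" "smo X Q Y F" using Q by blast
    show "\<exists>T. openin (mtop X) T \<and> x \<in> T \<and> T \<subseteq> {x\<in>P. F x \<in> W}"
      using smo_vimage_open[OF q(2) sfun_openin[OF g]] q(1) x P
      by (intro exI[of _ "P \<inter> {x\<in>Q. F x \<in> W}"]) auto
  qed
  then show "sfun X {x\<in>P. F x \<in> W} (\<lambda>x. g (F x))"
  proof (rule sfun_locally[OF X])
    fix x assume x: "x \<in> {x\<in>P. F x \<in> W}"
    then obtain Q where q: "x \<in> Q" "smo X Q Y F" using Q by blast
    then show "\<exists>Q. x \<in> Q \<and> sfun X Q (\<lambda>x. g (F x))" using smo_sfun[OF q(2) g] x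
      by (intro exI[of _ "{x\<in>Q. F x \<in> W}"]) simp
  qed
next
  show "F ` P \<subseteq> mpoints Y"
  proof (intro image_subsetI)
    fix x assume "x \<in> P"
    then obtain Q where "x \<in> Q" "smo X Q Y F" using Q by blast
    then show "F x \<in> mpoints Y" using smo_in by fast
  qed
qed (rule P)

text \<open>On \<open>V\<close> a smooth function \<open>g\<close> is its chart expression applied
  to the coordinates of the point, so the chain rule reduces smoothness of the composite to that of
  the coordinates of \<open>F\<close>. This is how smooth maps are obtained from coordinate
  formulas.\<close>

lemma smo_chartI:
  assumes X: "charted X" and V: "(V, \<psi>) \<in> atlas Y" and Y: "charted Y"
    and P: "openin (mtop X) P" and FV: "\<And>x. x \<in> P \<Longrightarrow> F x \<in> V"
    and sm: "\<And>j. j < mdim Y \<Longrightarrow> sfun X P (\<lambda>x. \<psi> (F x) j)"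
  shows "smo X P Y F"
  unfolding smo_def
proof (intro conjI allI impI)
  note ch = is_chartD[OF charted_chart[OF Y V]]
  show "openin (mtop X) P" by (rule P)
  show "F ` P \<subseteq> mpoints Y" using ch(7) FV by auto
  fix W g assume g: "sfun Y W g"
  let ?Q = "\<psi> ` (W \<inter> V)"
  have Q: "openin (Euclidean_space (mdim Y)) ?Q" by (rule chart_image_open[OF Y V sfun_openin[OF g]])
  have tr: "trunc (mdim Y) (\<psi> (F x)) = \<psi> (F x)" if "x \<in> P" for x using ch(5)[OF FV[OF that]] by (rule trunc_id)
  have "continuous_map (subtopology (mtop X) P) (Euclidean_space (mdim Y)) (\<lambda>x. trunc (mdim Y) (\<psi> (F x)))"
    unfolding continuous_map_trunc using sfun_continuous[OF X sm] by blast
  then have "openin (mtop X) {x\<in>P. trunc (mdim Y) (\<psi> (F x)) \<in> ?Q}"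
    by (rule open_vimage_subtopology[OF P _ Q])
  moreover have eq: "trunc (mdim Y) (\<psi> (F x)) \<in> ?Q \<longleftrightarrow> F x \<in> W" if "x \<in> P" for x
    using tr[OF that] FV[OF that] ch(3) by (auto simp: inj_on_def)
  ultimately have o: "openin (mtop X) {x\<in>P. F x \<in> W}"
    by (simp cong: conj_cong)
  have "sfun X {x\<in>P. F x \<in> W} (\<lambda>x. g (inv_into V \<psi> (trunc (mdim Y) (\<psi> (F x)))))"
    by (rule sfun_compose_C_on[OF X o _ Q sfun_C_on[OF g V]])
       (use eq sfun_subset[OF sm o] in auto)
  then show "sfun X {x\<in>P. F x \<in> W} (\<lambda>x. g (F x))"
    by (rule sfun_cong[OF X]) (use tr ch(6) FV in auto)
qed

lemma mfd_coord: "mfd Y \<Longrightarrow> (V, \<psi>) \<in> atlas Y \<Longrightarrow> j < mdim Y \<Longrightarrow> sfun Y V (\<lambda>y. \<psi> y j)"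
  by (auto simp: mfd_def)

lemma smooth_manifold_mfd:
  assumes "smooth_manifold X"
  shows "mfd X"
proof -
  have ch: "charted X" using assms by (auto simp: smooth_manifold_def charted_def)
  moreover have "sfun X V (\<lambda>x. \<psi> x j)" if V: "(V, \<psi>) \<in> atlas X" and j: "j < mdim X" for V \<psi> j
  proof (rule sfunI[OF is_chartD(1)[OF charted_chart[OF ch V]]])
    fix U \<phi> k assume U: "(U, \<phi>) \<in> atlas X"
    have "compatible (mdim X) (U, \<phi>) (V, \<psi>)" using assms U V by (auto simp: smooth_manifold_def)
    then show "C_on k (mdim X) (\<phi> ` (V \<inter> U)) (\<lambda>x. \<psi> (inv_into U \<phi> x) j)"
      using j by (auto simp: compatible_def smooth_on_def Int_commute)
  qed
  ultimately show ?thesis by (auto simp: mfd_def)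
qed

lemma mfd_smooth_manifold:
  assumes "mfd X" "Hausdorff_space (mtop X)" "second_countable (mtop X)"
  shows "smooth_manifold X"
proof -
  have "compatible (mdim X) (U, \<phi>) (V, \<psi>)" if "(U, \<phi>) \<in> atlas X" "(V, \<psi>) \<in> atlas X" for U \<phi> V \<psi>
    using sfun_C_on[OF mfd_coord[OF assms(1) that(2)] that(1)] sfun_C_on[OF mfd_coord[OF assms(1) that(1)] that(2)]
    by (auto simp: compatible_def smooth_on_def Int_commute)
  then show ?thesis using assms by (auto simp: smooth_manifold_def mfd_def charted_def)
qed

lemma smooth_map_smo:
  assumes X: "charted X" and Y: "charted Y" and F: "smooth_map X Y F"
  shows "smo X (mpoints X) Y F"
proof (rule smo_locally[OF X])
  have c: "continuous_map (mtop X) (mtop Y) F" using F by (simp add: smooth_map_def)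
  fix x assume x: "x \<in> mpoints X"
  then have "F x \<in> mpoints Y" using c by (auto simp: continuous_map_def)
  then obtain V \<psi> where V: "(V, \<psi>) \<in> atlas Y" "F x \<in> V" by (rule charted_cover[OF Y])
  have Vo: "openin (mtop Y) V" using is_chartD(1)[OF charted_chart[OF Y V(1)]] .
  let ?Q = "{x \<in> mpoints X. F x \<in> V}"
  have Q: "openin (mtop X) ?Q" by (rule openin_continuous_map_preimage[OF c Vo])
  have "smo X ?Q Y F"
  proof (rule smo_chartI[OF X V(1) Y Q])
    fix j assume j: "j < mdim Y"
    show "sfun X ?Q (\<lambda>x. \<psi> (F x) j)"
    proof (rule sfunI[OF Q])
      fix U \<phi> k assume U: "(U, \<phi>) \<in> atlas X"
      have "smooth_on (mdim X) (\<phi> ` {x\<in>U. F x \<in> V}) (mdim Y) (\<lambda>x. \<psi> (F (inv_into U \<phi> x)))"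
        using F U V(1) by (fastforce simp: smooth_map_def)
      moreover have "?Q \<inter> U = {x\<in>U. F x \<in> V}" using is_chartD(7)[OF charted_chart[OF X U]] by auto
      ultimately show "C_on k (mdim X) (\<phi> ` (?Q \<inter> U)) (\<lambda>x. \<psi> (F (inv_into U \<phi> x)) j)"
        using j by (auto simp: smooth_on_def)
    qed
  qed auto
  then show "\<exists>Q. x \<in> Q \<and> smo X Q Y F" using x V(2) by (intro exI[of _ ?Q]) auto
qed auto

lemma smo_smooth_map:
  assumes X: "charted X" and Y: "mfd Y" and F: "smo X (mpoints X) Y F"
  shows "smooth_map X Y F"
  unfolding smooth_map_def
proof (intro conjI ballI, safe)
  show "continuous_map (mtop X) (mtop Y) F" using smo_continuous[OF F] by simp
  fix U \<phi> V \<psi> assume U: "(U, \<phi>) \<in> atlas X" and V: "(V, \<psi>) \<in> atlas Y"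
  have eq: "{x \<in> mpoints X. F x \<in> V} \<inter> U = {x\<in>U. F x \<in> V}" using is_chartD(7)[OF charted_chart[OF X U]] by auto
  show "smooth_on (mdim X) (\<phi> ` {x\<in>U. F x \<in> V}) (mdim Y) (\<lambda>x. \<psi> (F (inv_into U \<phi> x)))"
    unfolding smooth_on_def using sfun_C_on[OF smo_sfun[OF F mfd_coord[OF Y V]] U] eq by auto
qed

text \<open>Compatibility of a new chart splits into two halves: its coordinates are smooth
  functions, and its inverse is smooth when read in the given atlas.\<close>

lemma maximal_atlas_iff:
  "(V, \<psi>) \<in> maximal_atlas X \<longleftrightarrow> is_chart (mtop X) (mdim X) (V, \<psi>) \<and> (\<forall>j<mdim X. sfun X V (\<lambda>x. \<psi> x j)) \<and>
     (\<forall>(U, \<phi>)\<in>atlas X. \<forall>j<mdim X. \<forall>k. C_on k (mdim X) (\<psi> ` (U \<inter> V)) (\<lambda>x. \<phi> (inv_into V \<psi> x) j))"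
  (is "?L \<longleftrightarrow> ?R")
proof -
  have "?L \<longleftrightarrow> is_chart (mtop X) (mdim X) (V, \<psi>) \<and> (\<forall>(U, \<phi>)\<in>atlas X. \<forall>j<mdim X. \<forall>k.
      C_on k (mdim X) (\<psi> ` (V \<inter> U)) (\<lambda>x. \<phi> (inv_into V \<psi> x) j) \<and>
      C_on k (mdim X) (\<phi> ` (V \<inter> U)) (\<lambda>x. \<psi> (inv_into U \<phi> x) j))"
    unfolding maximal_atlas_def compatible_def smooth_on_def by auto
  also have "\<dots> \<longleftrightarrow> ?R"
    unfolding sfun_def Int_commute[of V] by (fastforce dest: is_chartD(1))
  finally show ?thesis .
qed

lemma atlas_maximal: "mfd X \<Longrightarrow> (V, \<psi>) \<in> atlas X \<Longrightarrow> (V, \<psi>) \<in> maximal_atlas X"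
  unfolding maximal_atlas_iff
  using sfun_C_on[OF mfd_coord] mfd_coord by (fastforce dest: mfd_charted charted_chart)

text \<open>A chart of the maximal atlas may lie outside the atlas, so the coordinates of
  \<open>F\<close> are carried to an atlas chart around \<open>F x\<close> by the transition
  map.\<close>

lemma smo_maximal_chartI:
  assumes X: "charted X" and Y: "charted Y" and V: "(V, \<psi>) \<in> maximal_atlas Y"
    and P: "openin (mtop X) P" and FV: "\<And>x. x \<in> P \<Longrightarrow> F x \<in> V"
    and sm: "\<And>j. j < mdim Y \<Longrightarrow> sfun X P (\<lambda>x. \<psi> (F x) j)"
  shows "smo X P Y F"
proof (rule smo_locally[OF X P])
  note V' = V[unfolded maximal_atlas_iff]
  note ch = is_chartD[OF conjunct1[OF V']]
  have tr: "trunc (mdim Y) (\<psi> (F x)) = \<psi> (F x)" if "x \<in> P" for x using ch(5)[OF FV[OF that]] by (rule trunc_id)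
  have cm: "continuous_map (subtopology (mtop X) P) (Euclidean_space (mdim Y)) (\<lambda>x. trunc (mdim Y) (\<psi> (F x)))"
    unfolding continuous_map_trunc using sfun_continuous[OF X sm] by blast
  fix x assume x: "x \<in> P"
  obtain U \<phi> where U: "(U, \<phi>) \<in> atlas Y" "F x \<in> U" using charted_cover[OF Y, of "F x"] FV[OF x] ch(7) by blast
  note cU = is_chartD[OF charted_chart[OF Y U(1)]]
  let ?Q = "\<psi> ` (U \<inter> V)"
  have Q: "openin (Euclidean_space (mdim Y)) ?Q" by (rule ch(8)) (use ch(1) cU(1) in auto)
  have "openin (mtop X) {x\<in>P. trunc (mdim Y) (\<psi> (F x)) \<in> ?Q}"
    by (rule open_vimage_subtopology[OF P cm Q])
  moreover have eq: "trunc (mdim Y) (\<psi> (F x)) \<in> ?Q \<longleftrightarrow> F x \<in> U" if "x \<in> P" for x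
    using tr[OF that] FV[OF that] ch(3) by (auto simp: inj_on_def)
  ultimately have o: "openin (mtop X) {x\<in>P. F x \<in> U}"
    by (simp cong: conj_cong)
  have "smo X {x\<in>P. F x \<in> U} Y F"
  proof (rule smo_chartI[OF X U(1) Y o])
    fix j assume j: "j < mdim Y"
    have "sfun X {x\<in>P. F x \<in> U} (\<lambda>x. \<phi> (inv_into V \<psi> (trunc (mdim Y) (\<psi> (F x)))) j)"
      by (rule sfun_compose_C_on[OF X o _ Q, where g="\<lambda>y. \<phi> (inv_into V \<psi> y) j"])
         (use V' U(1) j eq sfun_subset[OF sm o] in auto)
    then show "sfun X {x\<in>P. F x \<in> U} (\<lambda>x. \<phi> (F x) j)"
      by (rule sfun_cong[OF X]) (use tr ch(6) FV in auto)
  qed auto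
  then show "\<exists>Q. x \<in> Q \<and> smo X Q Y F" using x U(2) by (intro exI[of _ "{x\<in>P. F x \<in> U}"]) auto
qed

section \<open>Euclidean spaces and open submanifolds\<close>

lemma euclidean_manifold_simps [simp]:
  "mtop (euclidean_manifold n) = Euclidean_space n" "mdim (euclidean_manifold n) = n"
  "atlas (euclidean_manifold n) = {(EE n, \<lambda>x. x)}"
  by (auto simp: euclidean_manifold_def)

lemma open_submanifold_simps [simp]:
  "mtop (open_submanifold X U) = subtopology (mtop X) U" "mdim (open_submanifold X U) = mdim X"
  by (auto simp: open_submanifold_def)

lemma atlas_open_submanifold: "atlas (open_submanifold X U) = {(V \<inter> U, \<phi>) | V \<phi>. (V, \<phi>) \<in> atlas X}"
  by (auto simp: open_submanifold_def)

lemma prod_manifold_simps [simp]: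
  "mtop (prod_manifold X Y) = prod_topology (mtop X) (mtop Y)" "mdim (prod_manifold X Y) = mdim X + mdim Y"
  by (auto simp: prod_manifold_def)

lemma charted_euclidean: "charted (euclidean_manifold n)"
  using homeomorphic_map_id[of "Euclidean_space n" "Euclidean_space n"]
  by (auto simp: charted_def is_chart_def id_def)

lemma sfun_euclidean_iff: "sfun (euclidean_manifold n) P g \<longleftrightarrow> openin (Euclidean_space n) P \<and> (\<forall>k. C_on k n P g)"
proof -
  have "C_on k n ((\<lambda>x. x) ` (P \<inter> EE n)) (\<lambda>x. g (inv_into (EE n) (\<lambda>x. x) x)) = C_on k n P g"
    if P: "openin (Euclidean_space n) P" for k
  proof -
    have eq: "inv_into (EE n) (\<lambda>x. x) x = x" if "x \<in> P" for x
      using openin_subset[OF P] that inv_into_f_f[of "\<lambda>x. x" "EE n" x] by auto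
    have "P \<inter> EE n = P" using openin_subset[OF P] by auto
    then show ?thesis using C_on_cong[OF P, of "\<lambda>x. g (inv_into (EE n) (\<lambda>x. x) x)" g]
        C_on_cong[OF P, of g "\<lambda>x. g (inv_into (EE n) (\<lambda>x. x) x)"] eq by auto
  qed
  then show ?thesis by (auto simp: sfun_def)
qed

lemma mfd_euclidean: "mfd (euclidean_manifold n)"
  by (auto simp: mfd_def charted_euclidean sfun_euclidean_iff C_on_coord)

lemma smo_to_euclidean:
  assumes "charted X" "openin (mtop X) P" "\<And>j. j < n \<Longrightarrow> sfun X P (\<lambda>x. f x j)"
  shows "smo X P (euclidean_manifold n) (\<lambda>x. trunc n (f x))"
  by (rule smo_chartI[OF assms(1) _ charted_euclidean assms(2), where V="EE n" and \<psi>="\<lambda>x. x"])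
     (use assms(3) in auto)

lemma smo_chart_inverse:
  assumes X: "charted X" and V: "(V, \<psi>) \<in> maximal_atlas X"
  shows "smo (euclidean_manifold (mdim X)) (\<psi> ` V) X (inv_into V \<psi>)"
proof -
  note ch = is_chartD[OF conjunct1[OF V[unfolded maximal_atlas_iff]]]
  show ?thesis
  proof (rule smo_maximal_chartI[OF charted_euclidean X V])
    fix j
    have "sfun (euclidean_manifold (mdim X)) (\<psi> ` V) (\<lambda>y. y j)"
      using ch(2) by (auto simp: sfun_euclidean_iff C_on_coord)
    then show "sfun (euclidean_manifold (mdim X)) (\<psi> ` V) (\<lambda>y. \<psi> (inv_into V \<psi> y) j)"
      by (rule sfun_cong[OF charted_euclidean]) (auto simp: f_inv_into_f)
  next
    show "openin (mtop (euclidean_manifold (mdim X))) (\<psi> ` V)" using ch(2) by simp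
    show "\<And>x. x \<in> \<psi> ` V \<Longrightarrow> inv_into V \<psi> x \<in> V" by (rule inv_into_into)
  qed
qed

text \<open>A smooth map into Euclidean space with a smooth inverse \<open>h\<close> is a chart.
  Transition maps need not be computed: one direction is smoothness of the coordinates of
  \<open>\<phi>\<close>, the other smoothness of \<open>h\<close>.\<close>

lemma maximal_atlasI:
  assumes X: "mfd X" and P: "openin (mtop X) P" and Q: "openin (Euclidean_space (mdim X)) Q"
    and \<phi>: "\<And>j. j < mdim X \<Longrightarrow> sfun X P (\<lambda>x. \<phi> x j)"
    and h: "smo (euclidean_manifold (mdim X)) Q X h"
    and inv: "\<And>x. x \<in> P \<Longrightarrow> \<phi> x \<in> Q \<and> h (\<phi> x) = x" "\<And>y. y \<in> Q \<Longrightarrow> h y \<in> P \<and> \<phi> (h y) = y"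
  shows "(P, \<phi>) \<in> maximal_atlas X" "\<phi> ` P = Q"
proof -
  have tr: "trunc (mdim X) (\<phi> x) = \<phi> x" if "x \<in> P" for x
    using inv(1)[OF that] openin_subset[OF Q] by (auto intro!: trunc_id)
  have "continuous_map (subtopology (mtop X) P) (Euclidean_space (mdim X)) (\<lambda>x. trunc (mdim X) (\<phi> x))"
    unfolding continuous_map_trunc using sfun_continuous[OF mfd_charted[OF X] \<phi>] by blast
  then have c: "continuous_map (subtopology (mtop X) P) (Euclidean_space (mdim X)) \<phi>"
    by (rule continuous_map_eq) (use tr in auto)
  have c': "continuous_map (subtopology (Euclidean_space (mdim X)) Q) (mtop X) h"
    using smo_continuous[OF h] by simp
  note ch = is_chartI[OF P Q c c' inv]
  show im: "\<phi> ` P = Q" by (rule ch(2))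
  have "C_on k (mdim X) (\<phi> ` (U \<inter> P)) (\<lambda>x. \<psi> (inv_into P \<phi> x) j)"
    if U: "(U, \<psi>) \<in> atlas X" and j: "j < mdim X" for U \<psi> j k
  proof -
    have "sfun (euclidean_manifold (mdim X)) {y\<in>Q. h y \<in> U} (\<lambda>y. \<psi> (h y) j)"
      by (rule smo_sfun[OF h mfd_coord[OF X U j]])
    then have s: "openin (Euclidean_space (mdim X)) {y\<in>Q. h y \<in> U}" "C_on k (mdim X) {y\<in>Q. h y \<in> U} (\<lambda>y. \<psi> (h y) j)"
      by (auto simp: sfun_euclidean_iff)
    have eq: "{y\<in>Q. h y \<in> U} = \<phi> ` (U \<inter> P)" using inv by force
    show ?thesis using C_on_cong[OF s(1) _ s(2), of "\<lambda>x. \<psi> (inv_into P \<phi> x) j"] ch(3) unfolding eq[symmetric] by simp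
  qed
  then show "(P, \<phi>) \<in> maximal_atlas X" unfolding maximal_atlas_iff using ch(1) \<phi> by auto
qed

lemma is_chart_restrict:
  assumes "is_chart T n (U, \<phi>)" "openin T Q"
  shows "is_chart T n (U \<inter> Q, \<phi>)" "is_chart (subtopology T Q) n (U \<inter> Q, \<phi>)"
    "y \<in> \<phi> ` (U \<inter> Q) \<Longrightarrow> inv_into (U \<inter> Q) \<phi> y = inv_into U \<phi> y"
proof -
  note ch = is_chartD[OF assms(1)]
  have h: "homeomorphic_map (subtopology T U) (subtopology (Euclidean_space n) (\<phi> ` U)) \<phi>"
    using assms by (auto simp: is_chart_def)
  have "homeomorphic_map (subtopology T (U \<inter> Q)) (subtopology (Euclidean_space n) (\<phi> ` (U \<inter> Q))) \<phi>"
    using homeomorphic_map_subtopologies[OF h, of Q "\<phi> ` (U \<inter> Q)"] ch(7) openin_subset[OF ch(2)]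
    by (auto simp: subtopology_subtopology Int_absorb1 Int_absorb2 image_mono Int_assoc[symmetric])
  moreover have "openin (Euclidean_space n) (\<phi> ` (U \<inter> Q))" by (rule ch(8)) (use ch(1) assms(2) in auto)
  moreover have "subtopology (subtopology T Q) (U \<inter> Q) = subtopology T (U \<inter> Q)"
    by (simp add: subtopology_subtopology Int_commute inf_left_commute)
  ultimately show "is_chart T n (U \<inter> Q, \<phi>)" "is_chart (subtopology T Q) n (U \<inter> Q, \<phi>)"
    using ch(1) assms(2) by (auto simp: is_chart_def openin_open_subtopology)
  show "inv_into (U \<inter> Q) \<phi> y = inv_into U \<phi> y" if "y \<in> \<phi> ` (U \<inter> Q)"
    using that ch(3,6) by (auto intro!: inv_into_f_eq inj_on_subset[OF ch(3)])
qed

lemma charted_open_submanifold: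
  assumes "charted X" "openin (mtop X) Q"
  shows "charted (open_submanifold X Q)"
  unfolding charted_def
proof (intro conjI ballI)
  fix c assume "c \<in> atlas (open_submanifold X Q)"
  then show "is_chart (mtop (open_submanifold X Q)) (mdim (open_submanifold X Q)) c"
    using is_chart_restrict(2)[OF charted_chart[OF assms(1)] assms(2)] by (auto simp: atlas_open_submanifold)
next
  have "(\<Union>c\<in>atlas (open_submanifold X Q). fst c) = (\<Union>c\<in>atlas X. fst c) \<inter> Q"
    by (force simp: atlas_open_submanifold)
  then show "(\<Union>c\<in>atlas (open_submanifold X Q). fst c) = mpoints (open_submanifold X Q)"
    using assms(1) by (simp add: charted_def)
qed

text \<open>Shrinking a chart to \<open>Q\<close> changes neither its coordinates nor its inverse on
  the image of a subset of \<open>Q\<close>.\<close>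

lemma sfun_open_submanifold:
  assumes X: "charted X" and Q: "openin (mtop X) Q"
  shows "sfun (open_submanifold X Q) P g \<longleftrightarrow> sfun X P g \<and> P \<subseteq> Q"
proof (cases "openin (mtop X) P \<and> P \<subseteq> Q")
  case True
  then have P: "openin (mtop X) P" "P \<subseteq> Q" by auto
  have "C_on k (mdim X) (\<phi> ` (P \<inter> (U \<inter> Q))) (\<lambda>x. g (inv_into (U \<inter> Q) \<phi> x)) =
     C_on k (mdim X) (\<phi> ` (P \<inter> U)) (\<lambda>x. g (inv_into U \<phi> x))" if U: "(U, \<phi>) \<in> atlas X" for U \<phi> k
  proof -
    have 1: "P \<inter> (U \<inter> Q) = P \<inter> U" using P by auto
    have 2: "inv_into (U \<inter> Q) \<phi> y = inv_into U \<phi> y" if "y \<in> \<phi> ` (P \<inter> U)" for y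
      using is_chart_restrict(3)[OF charted_chart[OF X U] Q] that P(2) by blast
    show ?thesis unfolding 1
    proof
      assume "C_on k (mdim X) (\<phi> ` (P \<inter> U)) (\<lambda>x. g (inv_into (U \<inter> Q) \<phi> x))"
      then show "C_on k (mdim X) (\<phi> ` (P \<inter> U)) (\<lambda>x. g (inv_into U \<phi> x))"
        by (rule C_on_cong[OF chart_image_open[OF X U P(1)], rotated]) (simp only: 2)
    next
      assume "C_on k (mdim X) (\<phi> ` (P \<inter> U)) (\<lambda>x. g (inv_into U \<phi> x))"
      then show "C_on k (mdim X) (\<phi> ` (P \<inter> U)) (\<lambda>x. g (inv_into (U \<inter> Q) \<phi> x))"
        by (rule C_on_cong[OF chart_image_open[OF X U P(1)], rotated]) (simp only: 2)
    qed
  qed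
  then have eq: "\<And>U \<phi> k. (U, \<phi>) \<in> atlas X \<Longrightarrow>
     C_on k (mdim X) (\<phi> ` (P \<inter> (U \<inter> Q))) (\<lambda>x. g (inv_into (U \<inter> Q) \<phi> x)) =
     C_on k (mdim X) (\<phi> ` (P \<inter> U)) (\<lambda>x. g (inv_into U \<phi> x))" .
  have o: "openin (mtop (open_submanifold X Q)) P" using P Q by (simp add: openin_open_subtopology)
  show ?thesis
  proof (intro iffI conjI P(2); (elim conjE)?)
    assume g: "sfun (open_submanifold X Q) P g"
    show "sfun X P g"
    proof (rule sfunI[OF P(1)])
      fix U \<phi> k assume U: "(U, \<phi>) \<in> atlas X"
      then have "(U \<inter> Q, \<phi>) \<in> atlas (open_submanifold X Q)" unfolding atlas_open_submanifold by blast
      from sfun_C_on[OF g this, of k] show "C_on k (mdim X) (\<phi> ` (P \<inter> U)) (\<lambda>x. g (inv_into U \<phi> x))"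
        using eq[OF U] by simp
    qed
  next
    assume g: "sfun X P g"
    show "sfun (open_submanifold X Q) P g"
    proof (rule sfunI[OF o])
      fix U' \<phi> k assume "(U', \<phi>) \<in> atlas (open_submanifold X Q)"
      then obtain U where U: "U' = U \<inter> Q" "(U, \<phi>) \<in> atlas X" unfolding atlas_open_submanifold by blast
      show "C_on k (mdim (open_submanifold X Q)) (\<phi> ` (P \<inter> U')) (\<lambda>x. g (inv_into U' \<phi> x))"
        using sfun_C_on[OF g U(2), of k] eq[OF U(2)] U(1) by simp
    qed
  qed
next
  case False
  then show ?thesis using Q by (auto simp: sfun_def openin_open_subtopology)
qed

lemma mfd_open_submanifold:
  assumes "mfd X" "openin (mtop X) Q"
  shows "mfd (open_submanifold X Q)"
  unfolding mfd_def
proof (intro conjI ballI, safe)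
  show "charted (open_submanifold X Q)" using assms by (simp add: charted_open_submanifold mfd_charted)
  fix V \<psi> j assume "(V, \<psi>) \<in> atlas (open_submanifold X Q)" "j < mdim (open_submanifold X Q)"
  then obtain U where U: "V = U \<inter> Q" "(U, \<psi>) \<in> atlas X" "j < mdim X" by (auto simp: open_submanifold_def)
  then show "sfun (open_submanifold X Q) V (\<lambda>x. \<psi> x j)"
    unfolding sfun_open_submanifold[OF mfd_charted[OF assms(1)] assms(2)]
    using sfun_subset[OF mfd_coord[OF assms(1) U(2,3)], of V] sfun_openin[OF mfd_coord[OF assms(1) U(2,3)]] assms(2)
    by (simp add: openin_Int)
qed

lemma smo_open_submanifold_dom:
  assumes X: "charted X" and Q: "openin (mtop X) Q"
  shows "smo (open_submanifold X Q) P Y F \<longleftrightarrow> smo X P Y F \<and> P \<subseteq> Q"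
  using Q unfolding smo_def sfun_open_submanifold[OF X Q] by (auto simp: openin_open_subtopology)

lemma smo_open_submanifold_cod:
  assumes Y: "charted Y" and Q: "openin (mtop Y) Q"
  shows "smo X P (open_submanifold Y Q) F \<longleftrightarrow> smo X P Y F \<and> F ` P \<subseteq> Q"
proof
  assume F: "smo X P (open_submanifold Y Q) F"
  have sub: "F ` P \<subseteq> Q" "F ` P \<subseteq> mpoints Y" using smo_in[OF F] by auto
  moreover have "sfun X {x\<in>P. F x \<in> W} (\<lambda>x. g (F x))" if g: "sfun Y W g" for W g
  proof -
    have "sfun (open_submanifold Y Q) (W \<inter> Q) g" unfolding sfun_open_submanifold[OF Y Q]
      using sfun_subset[OF g] sfun_openin[OF g] Q by auto
    moreover have "{x\<in>P. F x \<in> W \<inter> Q} = {x\<in>P. F x \<in> W}" using sub by auto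
    ultimately show ?thesis using smo_sfun[OF F, of "W \<inter> Q" g] by simp
  qed
  ultimately show "smo X P Y F \<and> F ` P \<subseteq> Q" using smo_openin[OF F] by (auto simp: smo_def)
next
  assume "smo X P Y F \<and> F ` P \<subseteq> Q"
  then show "smo X P (open_submanifold Y Q) F" unfolding smo_def sfun_open_submanifold[OF Y Q] by auto
qed

section \<open>Products of manifolds\<close>

definition shift :: "nat \<Rightarrow> (nat \<Rightarrow> real) \<Rightarrow> nat \<Rightarrow> real" where
  "shift m z = (\<lambda>i. z (i + m))"

lemma shift_apply [simp]: "shift m z i = z (i + m)" by (simp add: shift_def)

lemma shift_EE: "z \<in> EE (m + n) \<Longrightarrow> shift m z \<in> EE n"
  by (auto simp: topspace_Euclidean_space)

lemma join_coords_EE: "y \<in> EE n \<Longrightarrow> join_coords m x y \<in> EE (m + n)"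
  by (auto simp: topspace_Euclidean_space join_coords_def)

lemma trunc_join: "x \<in> EE m \<Longrightarrow> trunc m (join_coords m x y) = x"
  by (auto simp: join_coords_def fun_eq_iff trunc_def topspace_Euclidean_space)

lemma shift_join: "shift m (join_coords m x y) = y"
  by (auto simp: join_coords_def fun_eq_iff)

lemma join_split: "join_coords m (trunc m z) (shift m z) = z"
  by (auto simp: join_coords_def fun_eq_iff)

lemma continuous_map_trunc_EE: "continuous_map (Euclidean_space (m + n)) (Euclidean_space m) (trunc m)"
  using continuous_map_trunc[of _ m "\<lambda>x. x"] continuous_map_coord by auto

lemma continuous_map_shift: "continuous_map (Euclidean_space (m + n)) (Euclidean_space n) (shift m)"
proof (rule continuous_map_eq)
  show "continuous_map (Euclidean_space (m + n)) (Euclidean_space n) (\<lambda>z. trunc n (shift m z))"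
    unfolding continuous_map_trunc using continuous_map_coord by auto
qed (auto intro: trunc_id shift_EE)

lemma prod_chart:
  assumes X: "is_chart S m (U, \<phi>)" and Y: "is_chart T n (V, \<psi>)"
  defines "\<xi> \<equiv> \<lambda>(x, y). join_coords m (\<phi> x) (\<psi> y)"
  shows "is_chart (prod_topology S T) (m + n) (U \<times> V, \<xi>)"
    "\<And>z. z \<in> \<xi> ` (U \<times> V) \<Longrightarrow> inv_into (U \<times> V) \<xi> z = (inv_into U \<phi> (trunc m z), inv_into V \<psi> (shift m z))"
    "\<xi> ` (U \<times> V) = {z\<in>EE (m + n). trunc m z \<in> \<phi> ` U \<and> shift m z \<in> \<psi> ` V}"
proof -
  note c1 = is_chartD[OF X] and c2 = is_chartD[OF Y]
  let ?h = "\<lambda>z. (inv_into U \<phi> (trunc m z), inv_into V \<psi> (shift m z))"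
  let ?Q = "{z\<in>EE (m + n). trunc m z \<in> \<phi> ` U \<and> shift m z \<in> \<psi> ` V}"
  have o: "openin (prod_topology S T) (U \<times> V)" using c1(1) c2(1) by (simp add: openin_prod_Times_iff)
  have "openin (Euclidean_space (m+n)) ({z\<in>EE (m + n). trunc m z \<in> \<phi> ` U} \<inter> {z\<in>EE (m + n). shift m z \<in> \<psi> ` V})"
    by (intro openin_Int openin_continuous_map_preimage[OF continuous_map_trunc_EE]
        openin_continuous_map_preimage[OF continuous_map_shift] c1(2) c2(2))
  moreover have "{z\<in>EE (m + n). trunc m z \<in> \<phi> ` U} \<inter> {z\<in>EE (m + n). shift m z \<in> \<psi> ` V} = ?Q" by auto
  ultimately have oQ: "openin (Euclidean_space (m+n)) ?Q" by simp
  have st: "subtopology (prod_topology S T) (U \<times> V) = prod_topology (subtopology S U) (subtopology T V)"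
    by (simp add: subtopology_Times)
  have cf: "continuous_map (subtopology S U) euclideanreal (\<lambda>x. \<phi> x i)" for i
    using continuous_map_compose[OF c1(4) continuous_map_coord] by (simp add: o_def)
  have cg: "continuous_map (subtopology T V) euclideanreal (\<lambda>x. \<psi> x i)" for i
    using continuous_map_compose[OF c2(4) continuous_map_coord] by (simp add: o_def)
  have ci: "continuous_map (subtopology (prod_topology S T) (U \<times> V)) euclideanreal (\<lambda>z. \<xi> z i)" for i
  proof (cases "i < m")
    case True
    then show ?thesis unfolding st \<xi>_def
      using continuous_map_compose[OF continuous_map_fst cf[of i]] by (simp add: o_def join_coords_def case_prod_beta)
  next
    case False
    then show ?thesis unfolding st \<xi>_def
      using continuous_map_compose[OF continuous_map_snd cg[of "i - m"]] by (simp add: o_def join_coords_def case_prod_beta)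
  qed
  have tr: "trunc (m+n) (\<xi> z) = \<xi> z" if "z \<in> U \<times> V" for z
    using that c1(5) c2(5) by (auto simp: \<xi>_def intro!: trunc_id join_coords_EE)
  have c: "continuous_map (subtopology (prod_topology S T) (U \<times> V)) (Euclidean_space (m+n)) \<xi>"
  proof (rule continuous_map_eq)
    show "continuous_map (subtopology (prod_topology S T) (U \<times> V)) (Euclidean_space (m+n)) (\<lambda>z. trunc (m+n) (\<xi> z))"
      unfolding continuous_map_trunc using ci by blast
  qed (use tr in auto)
  have i1: "continuous_map (subtopology (Euclidean_space m) (\<phi> ` U)) S (inv_into U \<phi>)"
    and i2: "continuous_map (subtopology (Euclidean_space n) (\<psi> ` V)) T (inv_into V \<psi>)"
  proof -
    have h: "homeomorphic_map (subtopology S U) (subtopology (Euclidean_space m) (\<phi> ` U)) \<phi>"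
      "homeomorphic_map (subtopology T V) (subtopology (Euclidean_space n) (\<psi> ` V)) \<psi>"
      using X Y by (auto simp: is_chart_def)
    obtain g where g: "homeomorphic_maps (subtopology S U) (subtopology (Euclidean_space m) (\<phi> ` U)) \<phi> g"
      using h(1) homeomorphic_map_maps by blast
    show "continuous_map (subtopology (Euclidean_space m) (\<phi> ` U)) S (inv_into U \<phi>)"
    proof (rule continuous_map_eq)
      show "continuous_map (subtopology (Euclidean_space m) (\<phi> ` U)) S g"
        using g by (simp add: homeomorphic_maps_def continuous_map_in_subtopology)
      fix x assume "x \<in> topspace (subtopology (Euclidean_space m) (\<phi> ` U))"
      then show "g x = inv_into U \<phi> x" using g c1(6,7) by (auto simp: homeomorphic_maps_def)
    qed
    obtain g where g: "homeomorphic_maps (subtopology T V) (subtopology (Euclidean_space n) (\<psi> ` V)) \<psi> g"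
      using h(2) homeomorphic_map_maps by blast
    show "continuous_map (subtopology (Euclidean_space n) (\<psi> ` V)) T (inv_into V \<psi>)"
    proof (rule continuous_map_eq)
      show "continuous_map (subtopology (Euclidean_space n) (\<psi> ` V)) T g"
        using g by (simp add: homeomorphic_maps_def continuous_map_in_subtopology)
      fix x assume "x \<in> topspace (subtopology (Euclidean_space n) (\<psi> ` V))"
      then show "g x = inv_into V \<psi> x" using g c2(6,7) by (auto simp: homeomorphic_maps_def)
    qed
  qed
  have t1: "continuous_map (subtopology (Euclidean_space (m+n)) ?Q) (subtopology (Euclidean_space m) (\<phi> ` U)) (trunc m)"
    unfolding continuous_map_in_subtopology
    using continuous_map_from_subtopology[OF continuous_map_trunc_EE] by auto
  have t2: "continuous_map (subtopology (Euclidean_space (m+n)) ?Q) (subtopology (Euclidean_space n) (\<psi> ` V)) (shift m)"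
    unfolding continuous_map_in_subtopology
    using continuous_map_from_subtopology[OF continuous_map_shift] by auto
  have c': "continuous_map (subtopology (Euclidean_space (m+n)) ?Q) (prod_topology S T) ?h"
    unfolding continuous_map_pairwise
    using continuous_map_compose[OF t1 i1] continuous_map_compose[OF t2 i2] by (simp add: o_def)
  have inv1: "\<xi> z \<in> ?Q \<and> ?h (\<xi> z) = z" if "z \<in> U \<times> V" for z
    using that c1(5,6) c2(5,6) by (auto simp: \<xi>_def join_coords_EE trunc_join shift_join)
  have inv2: "?h z \<in> U \<times> V \<and> \<xi> (?h z) = z" if "z \<in> ?Q" for z
    using that by (auto simp: \<xi>_def f_inv_into_f inv_into_into join_split simp del: shift_apply)
  show "is_chart (prod_topology S T) (m + n) (U \<times> V, \<xi>)" and "\<xi> ` (U \<times> V) = ?Q"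
    using is_chartI[OF o oQ c c' inv1 inv2] by blast+
  then show "\<And>z. z \<in> \<xi> ` (U \<times> V) \<Longrightarrow> inv_into (U \<times> V) \<xi> z = (inv_into U \<phi> (trunc m z), inv_into V \<psi> (shift m z))"
    using is_chartI(3)[OF o oQ c c' inv1 inv2] by blast
qed

lemma charted_prod:
  assumes X: "charted X" and Y: "charted Y"
  shows "charted (prod_manifold X Y)"
  unfolding charted_def
proof (intro conjI ballI)
  fix c assume "c \<in> atlas (prod_manifold X Y)"
  then show "is_chart (mtop (prod_manifold X Y)) (mdim (prod_manifold X Y)) c"
    using prod_chart(1)[OF charted_chart[OF X] charted_chart[OF Y]] by (auto simp: prod_manifold_def)
next
  have "\<exists>c\<in>atlas (prod_manifold X Y). (x, y) \<in> fst c" if xy: "x \<in> mpoints X" "y \<in> mpoints Y" for x y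
  proof -
    obtain U \<phi> where "(U, \<phi>) \<in> atlas X" "x \<in> U" using charted_cover[OF X xy(1)] .
    moreover obtain V \<psi> where "(V, \<psi>) \<in> atlas Y" "y \<in> V" using charted_cover[OF Y xy(2)] .
    ultimately have "(U \<times> V, \<lambda>(x, y). join_coords (mdim X) (\<phi> x) (\<psi> y)) \<in> atlas (prod_manifold X Y)" "(x, y) \<in> U \<times> V"
      by (auto simp: prod_manifold_def)
    then show ?thesis by force
  qed
  moreover have "fst c \<subseteq> mpoints (prod_manifold X Y)" if "c \<in> atlas (prod_manifold X Y)" for c
    using that subsetD[OF is_chartD(7)[OF charted_chart[OF X]]] subsetD[OF is_chartD(7)[OF charted_chart[OF Y]]]
    by (auto simp: prod_manifold_def)
  ultimately show "(\<Union>c\<in>atlas (prod_manifold X Y). fst c) = mpoints (prod_manifold X Y)"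
    by (auto; blast)
qed

text \<open>In a product chart \<open>fst\<close> is the truncation to the first
  \<open>mdim X\<close> coordinates, so the pulled back function is a composite with a coordinate
  projection.\<close>

lemma smo_fst:
  assumes X: "charted X" and Y: "charted Y" and P: "openin (mtop X) P" and Q: "openin (mtop Y) Q"
  shows "smo (prod_manifold X Y) (P \<times> Q) X fst"
  unfolding smo_def
proof (intro conjI allI impI)
  fix W g assume g: "sfun X W g"
  have W: "openin (mtop X) W" by (rule sfun_openin[OF g])
  have eq: "{z \<in> P \<times> Q. fst z \<in> W} = (P \<inter> W) \<times> Q" by auto
  show "sfun (prod_manifold X Y) {z \<in> P \<times> Q. fst z \<in> W} (\<lambda>z. g (fst z))"
    unfolding eq
  proof (rule sfunI)
    show oo: "openin (mtop (prod_manifold X Y)) ((P \<inter> W) \<times> Q)"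
      using P Q W by (simp add: openin_prod_Times_iff openin_Int)
    fix UV \<xi> k assume A: "(UV, \<xi>) \<in> atlas (prod_manifold X Y)"
    then obtain U \<phi> V \<psi> where U: "(U, \<phi>) \<in> atlas X" and V: "(V, \<psi>) \<in> atlas Y"
      and UV: "UV = U \<times> V" "\<xi> = (\<lambda>(x, y). join_coords (mdim X) (\<phi> x) (\<psi> y))"
      by (auto simp: prod_manifold_def)
    note pc = prod_chart[OF charted_chart[OF X U] charted_chart[OF Y V], folded UV(2)]
    let ?I = "\<xi> ` ((P \<inter> W) \<times> Q \<inter> UV)"
    have I: "openin (Euclidean_space (mdim X + mdim Y)) ?I"
      using chart_image_open[OF charted_prod[OF X Y] A oo] by simp
    have "C_on k (mdim X + mdim Y) ?I (\<lambda>z. (\<lambda>x. g (inv_into U \<phi> x)) (trunc (mdim X) z))"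
      by (rule C_on_compose[OF I chart_image_open[OF X U W] C_on_coord _ sfun_C_on[OF g U]])
         (use is_chartD(5)[OF charted_chart[OF X U]] in \<open>auto simp: UV trunc_join\<close>)
    then show "C_on k (mdim (prod_manifold X Y)) ?I (\<lambda>z. g (fst (inv_into UV \<xi> z)))"
      using C_on_cong[OF I] pc(2) unfolding UV(1) by (smt (verit) IntE fst_conv imageE image_eqI prod_manifold_simps(2))
  qed
qed (use P Q openin_subset[OF P] in \<open>auto simp: openin_prod_Times_iff\<close>)

lemma smo_snd:
  assumes X: "charted X" and Y: "charted Y" and P: "openin (mtop X) P" and Q: "openin (mtop Y) Q"
  shows "smo (prod_manifold X Y) (P \<times> Q) Y snd"
  unfolding smo_def
proof (intro conjI allI impI)
  fix W g assume g: "sfun Y W g"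
  have W: "openin (mtop Y) W" by (rule sfun_openin[OF g])
  have eq: "{z \<in> P \<times> Q. snd z \<in> W} = P \<times> (Q \<inter> W)" by auto
  show "sfun (prod_manifold X Y) {z \<in> P \<times> Q. snd z \<in> W} (\<lambda>z. g (snd z))"
    unfolding eq
  proof (rule sfunI)
    show oo: "openin (mtop (prod_manifold X Y)) (P \<times> (Q \<inter> W))"
      using P Q W by (simp add: openin_prod_Times_iff openin_Int)
    fix UV \<xi> k assume A: "(UV, \<xi>) \<in> atlas (prod_manifold X Y)"
    then obtain U \<phi> V \<psi> where U: "(U, \<phi>) \<in> atlas X" and V: "(V, \<psi>) \<in> atlas Y"
      and UV: "UV = U \<times> V" "\<xi> = (\<lambda>(x, y). join_coords (mdim X) (\<phi> x) (\<psi> y))"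
      by (auto simp: prod_manifold_def)
    note pc = prod_chart[OF charted_chart[OF X U] charted_chart[OF Y V], folded UV(2)]
    let ?I = "\<xi> ` (P \<times> (Q \<inter> W) \<inter> UV)"
    have I: "openin (Euclidean_space (mdim X + mdim Y)) ?I"
      using chart_image_open[OF charted_prod[OF X Y] A oo] by simp
    have sh: "trunc (mdim Y) (shift (mdim X) z) = shift (mdim X) z" if "z \<in> ?I" for z
      using openin_subset[OF I] that by (intro trunc_id shift_EE) auto
    have "C_on k (mdim X + mdim Y) ?I (\<lambda>z. (\<lambda>x. g (inv_into V \<psi> x)) (trunc (mdim Y) (shift (mdim X) z)))"
    proof (rule C_on_compose[OF I chart_image_open[OF Y V W] _ _ sfun_C_on[OF g V]])
      show "C_on k (mdim X + mdim Y) ?I (\<lambda>z. shift (mdim X) z j)" for j by (simp add: C_on_coord)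
      fix z assume z: "z \<in> ?I"
      then show "trunc (mdim Y) (shift (mdim X) z) \<in> \<psi> ` (W \<inter> V)"
        unfolding sh[OF z] by (auto simp: UV shift_join)
    qed
    then show "C_on k (mdim (prod_manifold X Y)) ?I (\<lambda>z. g (snd (inv_into UV \<xi> z)))"
      using C_on_cong[OF I] pc(2) sh unfolding UV(1) by (smt (verit) IntE snd_conv imageE image_eqI prod_manifold_simps(2))
  qed
qed (use P Q openin_subset[OF Q] in \<open>auto simp: openin_prod_Times_iff\<close>)

lemma mfd_prod:
  assumes X: "mfd X" and Y: "mfd Y"
  shows "mfd (prod_manifold X Y)"
  unfolding mfd_def
proof (intro conjI ballI, safe)
  note X' = mfd_charted[OF X] and Y' = mfd_charted[OF Y]
  show "charted (prod_manifold X Y)" by (rule charted_prod[OF X' Y'])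
  fix UV \<xi> j assume A: "(UV, \<xi>) \<in> atlas (prod_manifold X Y)" and j: "j < mdim (prod_manifold X Y)"
  then obtain U \<phi> V \<psi> where U: "(U, \<phi>) \<in> atlas X" and V: "(V, \<psi>) \<in> atlas Y"
      and UV: "UV = U \<times> V" "\<xi> = (\<lambda>(x, y). join_coords (mdim X) (\<phi> x) (\<psi> y))"
      by (auto simp: prod_manifold_def)
  have o: "openin (mtop X) U" "openin (mtop Y) V"
    using is_chartD(1)[OF charted_chart[OF X' U]] is_chartD(1)[OF charted_chart[OF Y' V]] .
  show "sfun (prod_manifold X Y) UV (\<lambda>z. \<xi> z j)"
  proof (cases "j < mdim X")
    case True
    have "sfun (prod_manifold X Y) (U \<times> V) (\<lambda>z. \<phi> (fst z) j)"
      by (rule smo_sfun'[OF smo_fst[OF X' Y' o] mfd_coord[OF X U True]]) auto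
    then show ?thesis unfolding UV
      by (rule sfun_cong[OF charted_prod[OF X' Y']]) (auto simp: join_coords_def True)
  next
    case False
    then have "j - mdim X < mdim Y" using j by auto
    then have "sfun (prod_manifold X Y) (U \<times> V) (\<lambda>z. \<psi> (snd z) (j - mdim X))"
      by (intro smo_sfun'[OF smo_snd[OF X' Y' o] mfd_coord[OF Y V]]) auto
    then show ?thesis unfolding UV
      by (rule sfun_cong[OF charted_prod[OF X' Y']]) (auto simp: join_coords_def False)
  qed
qed

lemma smo_pair:
  assumes X: "charted X" and Y: "mfd Y" and Z: "mfd Z" and f: "smo X P Y f" and g: "smo X P Z g"
  shows "smo X P (prod_manifold Y Z) (\<lambda>x. (f x, g x))"
proof (rule smo_locally[OF X smo_openin[OF f]])
  note Y' = mfd_charted[OF Y] and Z' = mfd_charted[OF Z]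
  fix x assume x: "x \<in> P"
  obtain U \<phi> where U: "(U, \<phi>) \<in> atlas Y" "f x \<in> U" using charted_cover[OF Y' smo_in[OF f x]] .
  obtain V \<psi> where V: "(V, \<psi>) \<in> atlas Z" "g x \<in> V" using charted_cover[OF Z' smo_in[OF g x]] .
  have o: "openin (mtop Y) U" "openin (mtop Z) V"
    using is_chartD(1)[OF charted_chart[OF Y' U(1)]] is_chartD(1)[OF charted_chart[OF Z' V(1)]] .
  let ?\<xi> = "\<lambda>(x, y). join_coords (mdim Y) (\<phi> x) (\<psi> y)"
  have A: "(U \<times> V, ?\<xi>) \<in> atlas (prod_manifold Y Z)" using U V by (auto simp: prod_manifold_def)
  let ?Q = "{x\<in>P. f x \<in> U} \<inter> {x\<in>P. g x \<in> V}"
  have Q: "openin (mtop X) ?Q" using smo_vimage_open[OF f o(1)] smo_vimage_open[OF g o(2)] by auto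
  have "smo X ?Q (prod_manifold Y Z) (\<lambda>x. (f x, g x))"
  proof (rule smo_chartI[OF X A charted_prod[OF Y' Z'] Q])
    fix j assume j: "j < mdim (prod_manifold Y Z)"
    show "sfun X ?Q (\<lambda>x. ?\<xi> (f x, g x) j)"
    proof (cases "j < mdim Y")
      case True
      show ?thesis
        using sfun_subset[OF smo_sfun[OF f mfd_coord[OF Y U(1) True]] Q] by (simp add: join_coords_def True)
    next
      case False
      then have "j - mdim Y < mdim Z" using j by auto
      then show ?thesis
        using sfun_subset[OF smo_sfun[OF g mfd_coord[OF Z V(1)]] Q] by (simp add: join_coords_def False)
    qed
  qed auto
  then show "\<exists>Q. x \<in> Q \<and> smo X Q (prod_manifold Y Z) (\<lambda>x. (f x, g x))"
    using x U V by (intro exI[of _ ?Q]) auto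
qed

section \<open>Linear coordinates on vector bundles\<close>

abbreviation over :: "('e, 'm) vbundle \<Rightarrow> 'm set \<Rightarrow> 'e set" where
  "over E U \<equiv> {e \<in> vpoints E. proj E e \<in> U}"

abbreviation EM :: "nat \<Rightarrow> (nat \<Rightarrow> real) manifold" where "EM \<equiv> euclidean_manifold"

text \<open>The map \<open>h\<close> is the inverse of \<open>e \<mapsto> (proj E e, \<theta> e)\<close>.\<close>

definition lincoord ::
  "('e, 'm) vbundle \<Rightarrow> 'm set \<Rightarrow> nat \<Rightarrow> ('e \<Rightarrow> nat \<Rightarrow> real) \<Rightarrow> ('m \<Rightarrow> (nat \<Rightarrow> real) \<Rightarrow> 'e) \<Rightarrow> bool" where
  "lincoord E U r \<theta> h \<longleftrightarrow> openin (mtop (base E)) U \<and>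
     (\<forall>j<r. sfun (total_space E) (over E U) (\<lambda>e. \<theta> e j)) \<and>
     smo (prod_manifold (base E) (EM r)) (U \<times> EE r) (total_space E) (\<lambda>z. h (fst z) (snd z)) \<and>
     (\<forall>e\<in>over E U. \<theta> e \<in> EE r \<and> h (proj E e) (\<theta> e) = e) \<and>
     (\<forall>m\<in>U. \<forall>v\<in>EE r. h m v \<in> vpoints E \<and> proj E (h m v) = m \<and> \<theta> (h m v) = v) \<and>
     (\<forall>m\<in>U. \<forall>e\<in>fibre E m. \<forall>e'\<in>fibre E m. \<forall>i. \<theta> (vadd E e e') i = \<theta> e i + \<theta> e' i) \<and>
     (\<forall>m\<in>U. \<forall>e\<in>fibre E m. \<forall>s i. \<theta> (vscale E s e) i = s * \<theta> e i)"

lemma vbD: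
  assumes "vector_bundle E"
  shows "mfd (total_space E)" "mfd (base E)" "charted (total_space E)" "charted (base E)"
    "smo (total_space E) (vpoints E) (base E) (proj E)"
    "\<And>e. e \<in> vpoints E \<Longrightarrow> proj E e \<in> mpoints (base E)"
    "mdim (total_space E) = mdim (base E) + rank E"
    "openin (mtop (base E)) U \<Longrightarrow> openin (mtop (total_space E)) (over E U)"
proof -
  show m: "mfd (total_space E)" "mfd (base E)"
    using assms by (auto simp: vector_bundle_def smooth_manifold_mfd)
  then show c: "charted (total_space E)" "charted (base E)" by (auto intro: mfd_charted)
  have p: "smooth_map (total_space E) (base E) (proj E)" using assms by (auto simp: vector_bundle_def)
  show s: "smo (total_space E) (vpoints E) (base E) (proj E)"
    by (rule smooth_map_smo[OF c p])
  show "\<And>e. e \<in> vpoints E \<Longrightarrow> proj E e \<in> mpoints (base E)" using smo_in[OF s] .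
  show "mdim (total_space E) = mdim (base E) + rank E"
    using assms by (auto simp: vector_bundle_def rank_def)
  show "openin (mtop (base E)) U \<Longrightarrow> openin (mtop (total_space E)) (over E U)"
    using smo_vimage_open[OF s] .
qed

text \<open>A trivialization in split form: fibre coordinates, and separately the inverse as a map
  out of a product with the whole base manifold. This avoids carrying open submanifolds through
  later arguments.\<close>

lemma local_trivialization_lincoord:
  assumes E: "vector_bundle E" and t: "local_trivialization E U \<Phi>"
  shows "lincoord E U (rank E) (\<lambda>e. snd (\<Phi> e)) (\<lambda>m v. inv_into (over E U) \<Phi> (m, v))"
proof -
  note vb = vbD[OF E]
  have U: "openin (mtop (base E)) U" using t by (simp add: local_trivialization_def)
  have oU: "openin (mtop (total_space E)) (over E U)" by (rule vb(8)[OF U])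
  have UB: "U \<subseteq> mpoints (base E)" using U by (rule openin_subset)
  let ?X = "open_submanifold (total_space E) (over E U)"
  let ?Y = "prod_manifold (open_submanifold (base E) U) (EM (rank E))"
  have d: "smooth_map ?X ?Y \<Phi>" "bij_betw \<Phi> (mpoints ?X) (mpoints ?Y)" "smooth_map ?Y ?X (inv_into (mpoints ?X) \<Phi>)"
    using t by (auto simp: local_trivialization_def diffeomorphism_def)
  have mX: "mpoints ?X = over E U" and mY: "mpoints ?Y = U \<times> EE (rank E)"
    using UB by (auto simp: topspace_subtopology)
  have cX: "mfd ?X" and cB: "mfd (open_submanifold (base E) U)"
    using mfd_open_submanifold[OF vb(1) oU] mfd_open_submanifold[OF vb(2) U] .
  have cY: "mfd ?Y" by (rule mfd_prod[OF cB mfd_euclidean])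
  have s1: "smo (total_space E) (over E U) ?Y \<Phi>"
    using smooth_map_smo[OF mfd_charted[OF cX] mfd_charted[OF cY] d(1)]
    unfolding mX smo_open_submanifold_dom[OF vb(3) oU] by blast
  have s2: "smo ?Y (U \<times> EE (rank E)) (total_space E) (inv_into (over E U) \<Phi>)"
    using smooth_map_smo[OF mfd_charted[OF cY] mfd_charted[OF cX] d(3)]
    unfolding mX mY smo_open_submanifold_cod[OF vb(3) oU] by blast
  have bij: "bij_betw \<Phi> (over E U) (U \<times> EE (rank E))" using d(2) mX mY by simp
  have lin: "\<And>m e. m \<in> U \<Longrightarrow> e \<in> fibre E m \<Longrightarrow> fst (\<Phi> e) = m"
    "\<And>m e e'. m \<in> U \<Longrightarrow> e \<in> fibre E m \<Longrightarrow> e' \<in> fibre E m \<Longrightarrow> snd (\<Phi> (vadd E e e')) = (\<lambda>i. snd (\<Phi> e) i + snd (\<Phi> e') i)"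
    "\<And>m e r. m \<in> U \<Longrightarrow> e \<in> fibre E m \<Longrightarrow> snd (\<Phi> (vscale E r e)) = (\<lambda>i. r * snd (\<Phi> e) i)"
    using conjunct2[OF conjunct2[OF t[unfolded local_trivialization_def]]] by simp_all
  have f1: "fst (\<Phi> e) = proj E e" if "e \<in> over E U" for e using lin(1) that by (auto simp: fibre_def)
  have in1: "snd (\<Phi> e) \<in> EE (rank E)" if "e \<in> over E U" for e 
    using bij_betw_apply[OF bij that] by (simp only: mem_Times_iff)
  have A: "inv_into (over E U) \<Phi> (proj E e, snd (\<Phi> e)) = e" if "e \<in> over E U" for e
    using bij_betw_inv_into_left[OF bij that] by (simp only: f1[OF that, symmetric] prod.collapse)
  have B: "inv_into (over E U) \<Phi> (m, v) \<in> over E U" "\<Phi> (inv_into (over E U) \<Phi> (m, v)) = (m, v)"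
    if "m \<in> U" "v \<in> EE (rank E)" for m v
    using bij_betw_inv_into_right[OF bij, of "(m,v)"] bij_betwE[OF bij_betw_inv_into[OF bij]] that by auto
  have C: "smo (prod_manifold (base E) (EM (rank E))) (U \<times> EE (rank E)) (total_space E) (inv_into (over E U) \<Phi>)"
  proof -
    have c: "charted (prod_manifold (base E) (EM (rank E)))" by (rule charted_prod[OF vb(4) charted_euclidean])
    have oE: "openin (mtop (EM (rank E))) (EE (rank E))" by simp
    have 1: "smo (prod_manifold (base E) (EM (rank E))) (U \<times> EE (rank E)) (open_submanifold (base E) U) fst"
      unfolding smo_open_submanifold_cod[OF vb(4) U] using smo_fst[OF vb(4) charted_euclidean U oE] by auto
    have "smo (prod_manifold (base E) (EM (rank E))) (U \<times> EE (rank E)) ?Y (\<lambda>z. (fst z, snd z))"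
      by (rule smo_pair[OF c cB mfd_euclidean 1 smo_snd[OF vb(4) charted_euclidean U oE]])
    from smo_compose[OF this s2] show ?thesis by auto
  qed
  have D: "sfun (total_space E) (over E U) (\<lambda>e. snd (\<Phi> e) j)" if "j < rank E" for j
  proof -
    have "smo ?Y (U \<times> EE (rank E)) (EM (rank E)) snd"
      using smo_snd[OF mfd_charted[OF cB] charted_euclidean, of U "rank E" "EE (rank E)"] UB
      by (auto simp: openin_subtopology_refl)
    moreover have "sfun (EM (rank E)) (EE (rank E)) (\<lambda>v. v j)" by (simp add: sfun_euclidean_iff C_on_coord)
    ultimately have "sfun ?Y (U \<times> EE (rank E)) (\<lambda>z. snd z j)" by (rule smo_sfun') auto
    from smo_sfun'[OF s1 this] show ?thesis using bij_betw_imp_surj_on[OF bij] by simp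
  qed
  have B': "proj E (inv_into (over E U) \<Phi> (m, v)) = m" if "m \<in> U" "v \<in> EE (rank E)" for m v
    using f1[OF B(1)[OF that]] B(2)[OF that] by simp
  show ?thesis unfolding lincoord_def
    using U D A B B' C in1 lin(2,3) by (auto simp: fibre_def)
qed

lemma lincoordD:
  assumes "lincoord E U r \<theta> h"
  shows "openin (mtop (base E)) U"
    "j < r \<Longrightarrow> sfun (total_space E) (over E U) (\<lambda>e. \<theta> e j)"
    "e \<in> over E U \<Longrightarrow> \<theta> e \<in> EE r"
    "e \<in> over E U \<Longrightarrow> h (proj E e) (\<theta> e) = e"
    "m \<in> U \<Longrightarrow> v \<in> EE r \<Longrightarrow> h m v \<in> vpoints E"
    "m \<in> U \<Longrightarrow> v \<in> EE r \<Longrightarrow> proj E (h m v) = m"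
    "m \<in> U \<Longrightarrow> v \<in> EE r \<Longrightarrow> \<theta> (h m v) = v"
    "e \<in> over E U \<Longrightarrow> e' \<in> vpoints E \<Longrightarrow> proj E e' = proj E e \<Longrightarrow> \<theta> (vadd E e e') i = \<theta> e i + \<theta> e' i"
    "e \<in> over E U \<Longrightarrow> \<theta> (vscale E s e) i = s * \<theta> e i"
  using assms by (auto simp: lincoord_def fibre_def)

lemma lincoord_inj:
  assumes "lincoord E U r \<theta> h" "e \<in> over E U" "e' \<in> vpoints E" "proj E e' = proj E e" "\<And>i. i < r \<Longrightarrow> \<theta> e i = \<theta> e' i"
  shows "e = e'"
proof -
  note l = lincoordD[OF assms(1)]
  have "\<theta> e = \<theta> e'" 
    by (rule EE_eqI[OF l(3) l(3) assms(5)]) (use assms(2,3,4) in auto)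
  moreover have "e' \<in> over E U" using assms(2,3,4) by simp
  ultimately show ?thesis using l(4)[OF assms(2)] l(4)[of e'] assms(4) by simp
qed

text \<open>The tool for building smooth maps into a total space: a smooth base map together with
  arbitrary smooth coefficient functions, which \<open>trunc r\<close> puts into
  \<open>EE r\<close>.\<close>

lemma lincoord_smo:
  assumes l: "lincoord E U r \<theta> h" and X: "charted X" and E: "mfd (base E)"
    and b: "smo X P (base E) b" "b ` P \<subseteq> U" and v: "\<And>j. j < r \<Longrightarrow> sfun X P (\<lambda>x. v x j)"
  shows "smo X P (total_space E) (\<lambda>x. h (b x) (trunc r (v x)))"
proof -
  have s: "smo (prod_manifold (base E) (EM r)) (U \<times> EE r) (total_space E) (\<lambda>z. h (fst z) (snd z))"
    using l by (simp add: lincoord_def)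
  have "smo X P (prod_manifold (base E) (EM r)) (\<lambda>x. (b x, trunc r (v x)))"
    by (rule smo_pair[OF X E mfd_euclidean b(1) smo_to_euclidean[OF X smo_openin[OF b(1)] v]])
  from smo_compose[OF this s] show ?thesis using b(2) by (simp add: image_subset_iff)
qed

lemma vs_onD:
  assumes "vector_bundle E" "m \<in> mpoints (base E)"
  shows "vector_space_on (fibre E m) (vadd E) (vscale E) (vzero E m)"
  using assms by (auto simp: vector_bundle_def)

lemma vb_ops:
  assumes E: "vector_bundle E"
  shows "e \<in> vpoints E \<Longrightarrow> e' \<in> vpoints E \<Longrightarrow> proj E e' = proj E e \<Longrightarrow> vadd E e e' \<in> vpoints E \<and> proj E (vadd E e e') = proj E e"
    "e \<in> vpoints E \<Longrightarrow> vscale E r e \<in> vpoints E \<and> proj E (vscale E r e) = proj E e"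
    "m \<in> mpoints (base E) \<Longrightarrow> vzero E m \<in> vpoints E \<and> proj E (vzero E m) = m"
proof -
  show "e \<in> vpoints E \<Longrightarrow> e' \<in> vpoints E \<Longrightarrow> proj E e' = proj E e \<Longrightarrow> vadd E e e' \<in> vpoints E \<and> proj E (vadd E e e') = proj E e"
    using vs_onD[OF E vbD(6)[OF E, of e]] by (auto simp: vector_space_on_def fibre_def)
  show "e \<in> vpoints E \<Longrightarrow> vscale E r e \<in> vpoints E \<and> proj E (vscale E r e) = proj E e"
    using vs_onD[OF E vbD(6)[OF E, of e]] by (auto simp: vector_space_on_def fibre_def)
  show "m \<in> mpoints (base E) \<Longrightarrow> vzero E m \<in> vpoints E \<and> proj E (vzero E m) = m"
    using vs_onD[OF E] by (auto simp: vector_space_on_def fibre_def)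
qed

lemma vb_alg:
  assumes E: "vector_bundle E" and e: "e \<in> vpoints E"
  shows "e' \<in> vpoints E \<Longrightarrow> e'' \<in> vpoints E \<Longrightarrow> proj E e' = proj E e \<Longrightarrow> proj E e'' = proj E e \<Longrightarrow>
      vadd E (vadd E e e') e'' = vadd E e (vadd E e' e'')"
    "e' \<in> vpoints E \<Longrightarrow> proj E e' = proj E e \<Longrightarrow> vadd E e e' = vadd E e' e"
    "vadd E (vzero E (proj E e)) e = e" "vadd E e (vzero E (proj E e)) = e"
    "e' \<in> vpoints E \<Longrightarrow> proj E e' = proj E e \<Longrightarrow> vscale E r (vadd E e e') = vadd E (vscale E r e) (vscale E r e')"
    "vscale E (r + s) e = vadd E (vscale E r e) (vscale E s e)"
    "vscale E r (vscale E s e) = vscale E (r * s) e"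
    "vscale E 1 e = e"
    "vscale E 0 e = vzero E (proj E e)"
    "vadd E e (vscale E (-1) e) = vzero E (proj E e)"
    "vscale E r (vzero E (proj E e)) = vzero E (proj E e)"
    "e' \<in> vpoints E \<Longrightarrow> proj E e' = proj E e \<Longrightarrow> vadd E e e' = e' \<Longrightarrow> e = vzero E (proj E e)"
proof -
  define V where "V = fibre E (proj E e)"
  have vs: "vector_space_on V (vadd E) (vscale E) (vzero E (proj E e))"
    unfolding V_def by (rule vs_onD[OF E vbD(6)[OF E e]])
  have eV: "e \<in> V" using e by (simp add: V_def fibre_def)
  have inV: "e' \<in> V" if "e' \<in> vpoints E" "proj E e' = proj E e" for e' using that by (simp add: V_def fibre_def)
  have ax': "\<forall>x\<in>V. \<forall>y\<in>V. \<forall>w\<in>V. vadd E (vadd E x y) w = vadd E x (vadd E y w)"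
    "\<forall>x\<in>V. \<forall>y\<in>V. vadd E x y = vadd E y x"
    "\<forall>x\<in>V. vadd E (vzero E (proj E e)) x = x" "\<forall>x\<in>V. \<exists>y\<in>V. vadd E x y = vzero E (proj E e)"
    "\<forall>r. \<forall>x\<in>V. \<forall>y\<in>V. vscale E r (vadd E x y) = vadd E (vscale E r x) (vscale E r y)"
    "\<forall>r s. \<forall>x\<in>V. vscale E (r + s) x = vadd E (vscale E r x) (vscale E s x)"
    "\<forall>r s. \<forall>x\<in>V. vscale E r (vscale E s x) = vscale E (r * s) x"
    "\<forall>x\<in>V. vscale E 1 x = x" "vzero E (proj E e) \<in> V" "\<forall>r. \<forall>x\<in>V. vscale E r x \<in> V"
    "\<forall>x\<in>V. \<forall>y\<in>V. vadd E x y \<in> V"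
    by (insert vs[unfolded vector_space_on_def]; elim conjE; assumption)+
  note ax = ax'(1)[rule_format] ax'(2)[rule_format] ax'(3)[rule_format] ax'(4)[rule_format] ax'(5)[rule_format]
    ax'(6)[rule_format] ax'(7)[rule_format] ax'(8)[rule_format] ax'(9) ax'(10)[rule_format] ax'(11)[rule_format]
  \<comment> \<open>Cancellation of \<open>y\<close>. Applied to the sum of
    \<open>vscale E 0 e\<close> with itself it identifies this element with the zero of the
    fibre.\<close>
  have idem: "x = vzero E (proj E e)" if x: "x \<in> V" "y \<in> V" "vadd E x y = y" for x y
  proof -
    obtain z where z: "z \<in> V" "vadd E y z = vzero E (proj E e)" using ax(4)[OF x(2)] by blast
    have "vadd E (vadd E x y) z = vzero E (proj E e)" using x(3) z(2) by simp
    then have "vadd E x (vzero E (proj E e)) = vzero E (proj E e)" using ax(1)[OF x(1,2) z(1)] z(2) by simp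
    then show ?thesis using ax(2)[OF x(1) ax(9)] ax(3)[OF x(1)] by simp
  qed
  show "e' \<in> vpoints E \<Longrightarrow> e'' \<in> vpoints E \<Longrightarrow> proj E e' = proj E e \<Longrightarrow> proj E e'' = proj E e \<Longrightarrow>
      vadd E (vadd E e e') e'' = vadd E e (vadd E e' e'')"
    using ax(1) eV inV by blast
  show "e' \<in> vpoints E \<Longrightarrow> proj E e' = proj E e \<Longrightarrow> vadd E e e' = vadd E e' e" using ax(2) eV inV by blast
  show z: "vadd E (vzero E (proj E e)) e = e" using ax(3) eV by blast
  show "vadd E e (vzero E (proj E e)) = e" using z ax(2)[OF eV ax(9)] by simp
  show "e' \<in> vpoints E \<Longrightarrow> proj E e' = proj E e \<Longrightarrow> vscale E r (vadd E e e') = vadd E (vscale E r e) (vscale E r e')"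
    using ax(5) eV inV by blast
  show "vscale E (r + s) e = vadd E (vscale E r e) (vscale E s e)" using ax(6) eV by blast
  show "vscale E r (vscale E s e) = vscale E (r * s) e" using ax(7) eV by blast
  show o: "vscale E 1 e = e" using ax(8) eV by blast
  have "vadd E (vscale E 0 e) (vscale E 0 e) = vscale E 0 e" using ax(6)[OF eV, of 0 0] by simp
  then show s0: "vscale E 0 e = vzero E (proj E e)" using idem ax(10) eV by blast
  show "vadd E e (vscale E (-1) e) = vzero E (proj E e)" using ax(6)[OF eV, of 1 "-1"] s0 o by simp
  show "vscale E r (vzero E (proj E e)) = vzero E (proj E e)" using ax(7)[OF eV, of r 0] s0 by simp
  show "e' \<in> vpoints E \<Longrightarrow> proj E e' = proj E e \<Longrightarrow> vadd E e e' = e' \<Longrightarrow> e = vzero E (proj E e)"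
    using idem eV inV by blast
qed

lemma lincoord_vzero:
  assumes E: "vector_bundle E" and l: "lincoord E U r \<theta> h" and m: "m \<in> U"
  shows "\<theta> (vzero E m) i = 0"
proof -
  have mB: "m \<in> mpoints (base E)" using openin_subset[OF lincoordD(1)[OF l]] m by blast
  note z = vb_ops(3)[OF E mB]
  show ?thesis using lincoordD(8)[OF l, of "vzero E m" "vzero E m" i] vb_alg(3)[OF E, of "vzero E m"] z m by simp
qed

lemma vb_lincoord:
  assumes E: "vector_bundle E" and m: "m \<in> mpoints (base E)"
  obtains U \<Phi> \<theta> h where "m \<in> U" "local_trivialization E U \<Phi>" "lincoord E U (rank E) \<theta> h" "\<theta> = (\<lambda>e. snd (\<Phi> e))"
proof -
  obtain U \<Phi> where U: "m \<in> U" "local_trivialization E U \<Phi>"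
    using E m unfolding vector_bundle_def by blast
  show ?thesis by (rule that[OF U local_trivialization_lincoord[OF E U(2)] refl])
qed

text \<open>Smoothness of the operations is no part of \<open>vector_bundle\<close>. It holds
  because in linear coordinates the sum becomes the sum of coordinates; scaling and the zero section
  are treated in the same way below.\<close>

lemma smo_vadd:
  assumes E: "vector_bundle E" and X: "charted X"
    and f: "smo X P (total_space E) f" and g: "smo X P (total_space E) g"
    and fg: "\<And>x. x \<in> P \<Longrightarrow> proj E (g x) = proj E (f x)"
  shows "smo X P (total_space E) (\<lambda>x. vadd E (f x) (g x))"
proof (rule smo_locally[OF X smo_openin[OF f]])
  note vb = vbD[OF E]
  fix x assume x: "x \<in> P"
  have "proj E (f x) \<in> mpoints (base E)" by (rule vb(6)[OF smo_in[OF f x]])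
  then obtain U \<Phi> \<theta> h where U: "proj E (f x) \<in> U" "local_trivialization E U \<Phi>" "lincoord E U (rank E) \<theta> h"
    by (rule vb_lincoord[OF E])
  note l = lincoordD[OF U(3)]
  let ?Q = "{x\<in>P. f x \<in> over E U}"
  have Q: "openin (mtop X) ?Q" by (rule smo_vimage_open[OF f vb(8)[OF l(1)]])
  have f': "smo X ?Q (total_space E) f" and g': "smo X ?Q (total_space E) g"
    using smo_subset[OF f Q] smo_subset[OF g Q] by auto
  have gU: "g y \<in> over E U" if "y \<in> ?Q" for y using that fg smo_in[OF g] by auto
  have "smo X ?Q (total_space E) (\<lambda>x. h (proj E (f x)) (trunc (rank E) (\<lambda>j. \<theta> (f x) j + \<theta> (g x) j)))"
  proof (rule lincoord_smo[OF U(3) X vb(2)])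
    show "smo X ?Q (base E) (\<lambda>x. proj E (f x))" by (rule smo_compose[OF f' vb(5)]) auto
    fix j assume j: "j < rank E"
    show "sfun X ?Q (\<lambda>x. \<theta> (f x) j + \<theta> (g x) j)"
      by (intro sfun_add[OF X] smo_sfun'[OF f' l(2)[OF j]] smo_sfun'[OF g' l(2)[OF j]]) (use gU in auto)
  qed auto
  then have "smo X ?Q (total_space E) (\<lambda>x. vadd E (f x) (g x))"
  proof (rule smo_cong[OF X])
    fix y assume y: "y \<in> ?Q"
    then have f: "f y \<in> over E U" and yP: "y \<in> P" by auto
    have v: "vadd E (f y) (g y) \<in> over E U" and p: "proj E (vadd E (f y) (g y)) = proj E (f y)"
      using vb_ops(1)[OF E] f gU[OF y] fg[OF yP] by auto
    have "trunc (rank E) (\<lambda>j. \<theta> (f y) j + \<theta> (g y) j) = \<theta> (vadd E (f y) (g y))"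
      using l(8)[OF f] gU[OF y] fg[OF yP] l(3)[OF v] by (intro EE_eqI[of _ "rank E"]) auto
    then show "h (proj E (f y)) (trunc (rank E) (\<lambda>j. \<theta> (f y) j + \<theta> (g y) j)) = vadd E (f y) (g y)"
      using l(4)[OF v] p by simp
  qed
  then show "\<exists>Q. x \<in> Q \<and> smo X Q (total_space E) (\<lambda>x. vadd E (f x) (g x))"
    using x U(1) smo_in[OF f x] by (intro exI[of _ ?Q]) simp
qed

lemma smo_vscale:
  assumes E: "vector_bundle E" and X: "charted X"
    and f: "smo X P (total_space E) f" and s: "sfun X P s"
  shows "smo X P (total_space E) (\<lambda>x. vscale E (s x) (f x))"
proof (rule smo_locally[OF X smo_openin[OF f]])
  note vb = vbD[OF E]
  fix x assume x: "x \<in> P"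
  have "proj E (f x) \<in> mpoints (base E)" by (rule vb(6)[OF smo_in[OF f x]])
  then obtain U \<Phi> \<theta> h where U: "proj E (f x) \<in> U" "local_trivialization E U \<Phi>" "lincoord E U (rank E) \<theta> h"
    by (rule vb_lincoord[OF E])
  note l = lincoordD[OF U(3)]
  let ?Q = "{x\<in>P. f x \<in> over E U}"
  have Q: "openin (mtop X) ?Q" by (rule smo_vimage_open[OF f vb(8)[OF l(1)]])
  have f': "smo X ?Q (total_space E) f" and s': "sfun X ?Q s"
    using smo_subset[OF f Q] sfun_subset[OF s Q] by auto
  have "smo X ?Q (total_space E) (\<lambda>x. h (proj E (f x)) (trunc (rank E) (\<lambda>j. s x * \<theta> (f x) j)))"
  proof (rule lincoord_smo[OF U(3) X vb(2)])
    show "smo X ?Q (base E) (\<lambda>x. proj E (f x))" by (rule smo_compose[OF f' vb(5)]) auto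
    fix j assume j: "j < rank E"
    show "sfun X ?Q (\<lambda>x. s x * \<theta> (f x) j)"
      by (intro sfun_mult[OF X] s' smo_sfun'[OF f' l(2)[OF j]]) auto
  qed auto
  then have "smo X ?Q (total_space E) (\<lambda>x. vscale E (s x) (f x))"
  proof (rule smo_cong[OF X])
    fix y assume y: "y \<in> ?Q"
    then have f: "f y \<in> over E U" by auto
    have v: "vscale E (s y) (f y) \<in> over E U" and p: "proj E (vscale E (s y) (f y)) = proj E (f y)"
      using vb_ops(2)[OF E] f by auto
    have "trunc (rank E) (\<lambda>j. s y * \<theta> (f y) j) = \<theta> (vscale E (s y) (f y))"
      using l(9)[OF f] l(3)[OF v] by (intro EE_eqI[of _ "rank E"]) auto
    then show "h (proj E (f y)) (trunc (rank E) (\<lambda>j. s y * \<theta> (f y) j)) = vscale E (s y) (f y)"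
      using l(4)[OF v] p by simp
  qed
  then show "\<exists>Q. x \<in> Q \<and> smo X Q (total_space E) (\<lambda>x. vscale E (s x) (f x))"
    using x U(1) smo_in[OF f x] by (intro exI[of _ ?Q]) simp
qed

lemma smo_vzero:
  assumes E: "vector_bundle E"
  shows "smo (base E) (mpoints (base E)) (total_space E) (vzero E)"
proof (rule smo_locally[OF vbD(4)[OF E]])
  note vb = vbD[OF E]
  fix m assume m: "m \<in> mpoints (base E)"
  then obtain U \<Phi> \<theta> h where U: "m \<in> U" "local_trivialization E U \<Phi>" "lincoord E U (rank E) \<theta> h"
    by (rule vb_lincoord[OF E])
  note l = lincoordD[OF U(3)]
  have "smo (base E) U (total_space E) (\<lambda>m. h m (trunc (rank E) (\<lambda>j. 0)))"
    by (rule lincoord_smo[OF U(3) vb(4) vb(2) smo_id[OF l(1)]]) (auto intro: sfun_const l(1))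
  then have "smo (base E) U (total_space E) (vzero E)"
  proof (rule smo_cong[OF vb(4)])
    fix y assume y: "y \<in> U"
    then have "y \<in> mpoints (base E)" using openin_subset[OF l(1)] by blast
    note z = vb_ops(3)[OF E this]
    have "trunc (rank E) (\<lambda>j. 0) = \<theta> (vzero E y)"
      using lincoord_vzero[OF E U(3) y] by (simp add: fun_eq_iff trunc_def)
    then show "h y (trunc (rank E) (\<lambda>j. 0)) = vzero E y" using l(4)[of "vzero E y"] z y by simp
  qed
  then show "\<exists>Q. m \<in> Q \<and> smo (base E) Q (total_space E) (vzero E)" using U(1) by blast
qed auto

text \<open>The way back to trivializations, for bundles given by coordinates. The hypotheses speak
  of coordinates and projection only, because the lemma serves to prove that the quotient bundles
  and the core are vector bundles.\<close>

lemma lincoord_local_trivialization: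
  assumes mt: "mfd (total_space E)" and mb: "mfd (base E)" and l: "lincoord E U (rank E) \<theta> h"
    and p: "smo (total_space E) (vpoints E) (base E) (proj E)"
  shows "local_trivialization E U (\<lambda>e. (proj E e, \<theta> e))"
proof -
  note ll = lincoordD[OF l]
  note cb = mfd_charted[OF mb] and ct = mfd_charted[OF mt]
  have U: "openin (mtop (base E)) U" by (rule ll(1))
  have oU: "openin (mtop (total_space E)) (over E U)" by (rule smo_vimage_open[OF p U])
  have UB: "U \<subseteq> mpoints (base E)" using U by (rule openin_subset)
  let ?\<Phi> = "\<lambda>e. (proj E e, \<theta> e)"
  let ?X = "open_submanifold (total_space E) (over E U)"
  let ?Y = "prod_manifold (open_submanifold (base E) U) (EM (rank E))"
  have mX: "mpoints ?X = over E U" and mY: "mpoints ?Y = U \<times> EE (rank E)"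
    using UB by (auto simp: topspace_subtopology)
  have cX: "mfd ?X" and cB: "mfd (open_submanifold (base E) U)"
    using mfd_open_submanifold[OF mt oU] mfd_open_submanifold[OF mb U] .
  have cY: "mfd ?Y" by (rule mfd_prod[OF cB mfd_euclidean])
  have bij: "bij_betw ?\<Phi> (over E U) (U \<times> EE (rank E))"
    by (rule bij_betw_byWitness[where f'="\<lambda>z. h (fst z) (snd z)"]) (use ll(3,4,5,6,7) in auto)
  have p': "smo (total_space E) (over E U) (base E) (proj E)" by (rule smo_subset[OF p oU]) auto
  have "smo ?X (over E U) ?Y (\<lambda>e. (proj E e, trunc (rank E) (\<theta> e)))"
  proof (rule smo_pair[OF mfd_charted[OF cX] cB mfd_euclidean])
    show "smo ?X (over E U) (open_submanifold (base E) U) (proj E)"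
      unfolding smo_open_submanifold_cod[OF cb U] smo_open_submanifold_dom[OF ct oU] using p' by auto
    show "smo ?X (over E U) (EM (rank E)) (\<lambda>e. trunc (rank E) (\<theta> e))"
      unfolding smo_open_submanifold_dom[OF ct oU] 
      by (intro conjI subset_refl smo_to_euclidean[OF ct oU] ll(2))
  qed
  then have "smo ?X (over E U) ?Y ?\<Phi>"
    by (rule smo_cong[OF mfd_charted[OF cX]]) (use ll(3) in \<open>auto intro: trunc_id\<close>)
  then have s1: "smooth_map ?X ?Y ?\<Phi>" 
    by (intro smo_smooth_map[OF mfd_charted[OF cX] cY]) (simp only: mX)
  have s: "smo (prod_manifold (base E) (EM (rank E))) (U \<times> EE (rank E)) (total_space E) (\<lambda>z. h (fst z) (snd z))"
    using l by (simp add: lincoord_def)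
  have oE: "openin (mtop (EM (rank E))) (EE (rank E))" by simp
  have oU': "openin (mtop (open_submanifold (base E) U)) U" using UB by (simp add: openin_subtopology_refl)
  have 1: "smo ?Y (U \<times> EE (rank E)) (base E) fst"
    using smo_fst[OF mfd_charted[OF cB] charted_euclidean oU' oE] unfolding smo_open_submanifold_cod[OF cb U] by blast
  have "smo ?Y (U \<times> EE (rank E)) (prod_manifold (base E) (EM (rank E))) (\<lambda>z. (fst z, snd z))"
    by (rule smo_pair[OF mfd_charted[OF cY] mb mfd_euclidean 1 smo_snd[OF mfd_charted[OF cB] charted_euclidean oU' oE]])
  from smo_compose[OF this s] have "smo ?Y (U \<times> EE (rank E)) (total_space E) (\<lambda>z. h (fst z) (snd z))" by simp
  then have "smo ?Y (U \<times> EE (rank E)) ?X (\<lambda>z. h (fst z) (snd z))"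
    unfolding smo_open_submanifold_cod[OF ct oU] using ll(5,6) by auto
  then have "smo ?Y (mpoints ?Y) ?X (inv_into (mpoints ?X) ?\<Phi>)" unfolding mX mY
  proof (rule smo_cong[OF mfd_charted[OF cY]])
    fix z assume z: "z \<in> U \<times> EE (rank E)"
    then have H: "h (fst z) (snd z) \<in> over E U" "?\<Phi> (h (fst z) (snd z)) = z" using ll(5,6,7) by auto
    then show "h (fst z) (snd z) = inv_into (over E U) ?\<Phi> z"
      using bij_betw_inv_into_left[OF bij H(1)] unfolding H(2) by simp
  qed
  then have s2: "smooth_map ?Y ?X (inv_into (mpoints ?X) ?\<Phi>)" by (rule smo_smooth_map[OF mfd_charted[OF cY] cX])
  show ?thesis unfolding local_trivialization_def diffeomorphism_def
  proof (intro conjI ballI allI U s1 s2)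
    show "bij_betw ?\<Phi> (mpoints ?X) (mpoints ?Y)" unfolding mX mY by (rule bij)
  qed (use ll(8,9) in \<open>auto simp: fibre_def\<close>)
qed

lemma smo_const: "openin (mtop X) P \<Longrightarrow> y \<in> mpoints Y \<Longrightarrow> smo X P Y (\<lambda>_. y)"
  unfolding smo_def
proof (intro conjI allI impI)
  fix W and g :: "'b \<Rightarrow> real" assume "openin (mtop X) P"
  then show "sfun X {x\<in>P. y \<in> W} (\<lambda>x. g y)" by (cases "y \<in> W") (auto intro: sfun_const)
qed auto

text \<open>Additivity makes the difference quotients at any point equal to those at 0, so the
  derivative is the constant \<open>l\<close>. This will turn additivity of the core coordinates
  into homogeneity for real scalars.\<close>

lemma DERIV_additive_linear:
  fixes f :: "real \<Rightarrow> real"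
  assumes add: "\<And>s t. f (s + t) = f s + f t" and d: "(f has_real_derivative l) (at 0)"
  shows "f t = t * f 1"
proof -
  have f0: "f 0 = 0" using add[of 0 0] by simp
  have "(f has_real_derivative l) (at t)" for t
  proof -
    have "((\<lambda>s. f (s + (- t)) + f t) has_real_derivative l + 0) (at t)"
      by (intro DERIV_add DERIV_const) (use d DERIV_shift[of f l t "- t"] in simp)
    moreover have "(\<lambda>s. f (s + (- t)) + f t) = f" using add[of _ t] by (auto simp: fun_eq_iff simp flip: add)
    ultimately show ?thesis by simp
  qed
  then have "((\<lambda>t. f t - l * t) has_real_derivative 0) (at t)" for t
    by (auto intro!: derivative_eq_intros)
  from DERIV_isconst_all[of "\<lambda>t. f t - l * t"] this have "f t - l * t = f 0 - l * 0" for t by blast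
  then have "f t = l * t" for t using f0 by simp
  then show ?thesis by simp
qed

text \<open>The real line enters as the manifold \<open>EM 1\<close> with coordinate
  \<open>x 0\<close>.\<close>

lemma sfun_line_DERIV:
  assumes "sfun (EM 1) P (\<lambda>x. f (x 0))" "x \<in> P"
  shows "\<exists>l. (f has_real_derivative l) (at (x 0))"
proof -
  have "C_on (Suc 0) 1 P (\<lambda>x. f (x 0))" using assms(1) sfun_euclidean_iff by blast
  then obtain g where "\<forall>x\<in>P. ((\<lambda>t. f ((x(0 := t)) 0)) has_real_derivative g x) (at (x 0))"
    unfolding C_on.simps by auto
  then show ?thesis using assms(2) by auto
qed

lemma sfun_snd_coord:
  assumes "charted X" "openin (mtop X) U"
  shows "sfun (prod_manifold X (EM r)) (U \<times> EE r) (\<lambda>z. snd z i)"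
proof -
  have "sfun (EM r) (EE r) (\<lambda>v. v i)" by (simp add: sfun_euclidean_iff C_on_coord)
  moreover have "snd ` (U \<times> EE r) \<subseteq> EE r" by auto
  ultimately show ?thesis using smo_sfun'[OF smo_snd[OF assms(1) charted_euclidean assms(2), of r "EE r"]] by simp
qed

section \<open>Linear coordinates under change of frame\<close>

text \<open>\<open>u m\<close> expresses the old coordinates through the new ones on the fibre over
  \<open>m\<close>; composed with \<open>h\<close> it inverts the new coordinates.\<close>

lemma lincoord_change:
  assumes l: "lincoord E W r \<theta> h" and E: "vector_bundle E"
    and W': "openin (mtop (base E)) W'" "W' \<subseteq> W"
    and sm: "\<And>i. i < r \<Longrightarrow> sfun (total_space E) (over E W') (\<lambda>e. \<theta>' e i)"
    and in1: "\<And>e. e \<in> over E W' \<Longrightarrow> \<theta>' e \<in> EE r"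
    and lin: "\<And>e e' i. e \<in> over E W' \<Longrightarrow> e' \<in> vpoints E \<Longrightarrow> proj E e' = proj E e \<Longrightarrow> \<theta>' (vadd E e e') i = \<theta>' e i + \<theta>' e' i"
      "\<And>e s i. e \<in> over E W' \<Longrightarrow> \<theta>' (vscale E s e) i = s * \<theta>' e i"
    and u: "\<And>i. i < r \<Longrightarrow> sfun (prod_manifold (base E) (EM r)) (W' \<times> EE r) (\<lambda>z. u (fst z) (snd z) i)"
    and inv1: "\<And>m v. m \<in> W' \<Longrightarrow> v \<in> EE r \<Longrightarrow> \<theta>' (h m (trunc r (u m v))) = v"
    and inv2: "\<And>e i. e \<in> over E W' \<Longrightarrow> i < r \<Longrightarrow> u (proj E e) (\<theta>' e) i = \<theta> e i"
  shows "lincoord E W' r \<theta>' (\<lambda>m v. h m (trunc r (u m v)))"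
proof -
  note vb = vbD[OF E] and ll = lincoordD[OF l]
  have "smo (prod_manifold (base E) (EM r)) (W' \<times> EE r) (total_space E) (\<lambda>z. h (fst z) (trunc r (u (fst z) (snd z))))"
    by (rule lincoord_smo[OF l charted_prod[OF vb(4) charted_euclidean] vb(2) smo_fst[OF vb(4) charted_euclidean W'(1)] _ u])
       (use W'(2) in auto)
  moreover have "h (proj E e) (trunc r (u (proj E e) (\<theta>' e))) = e" if e: "e \<in> over E W'" for e
  proof -
    have eW: "e \<in> over E W" using e W'(2) by auto
    have "trunc r (u (proj E e) (\<theta>' e)) = \<theta> e"
      using inv2[OF e] ll(3)[OF eW] by (intro EE_eqI[of _ r]) auto
    then show ?thesis using ll(4)[OF eW] by simp
  qed
  ultimately show ?thesis unfolding lincoord_def fibre_def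
    using W' sm in1 lin inv1 ll(5,6) by (auto simp: subset_iff)
qed

lemma lincoord_restrict:
  assumes l: "lincoord E W r \<theta> h" and E: "vector_bundle E" and W': "openin (mtop (base E)) W'" "W' \<subseteq> W"
  shows "lincoord E W' r \<theta> (\<lambda>m v. h m (trunc r v))"
proof (rule lincoord_change[OF l E W', where u="\<lambda>m v. v"])
  note vb = vbD[OF E] and ll = lincoordD[OF l]
  have sub: "e \<in> over E W" if "e \<in> over E W'" for e using that W'(2) by auto
  show "sfun (total_space E) (over E W') (\<lambda>e. \<theta> e i)" if "i < r" for i
    by (rule sfun_subset[OF ll(2)[OF that] vb(8)[OF W'(1)]]) (use sub in auto)
  show "sfun (prod_manifold (base E) (EM r)) (W' \<times> EE r) (\<lambda>z. snd z i)" for i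
    by (rule sfun_snd_coord[OF vb(4) W'(1)])
  show "\<theta> (h m (trunc r v)) = v" if "m \<in> W'" "v \<in> EE r" for m v
    using ll(7)[of m v] that W'(2) trunc_id[of v r] by auto
qed (use lincoordD(3,8,9)[OF l] W'(2) in auto)

definition unitv :: "nat \<Rightarrow> nat \<Rightarrow> real" where
  "unitv j = (\<lambda>i. if i = j then 1 else 0)"

lemma unitv_EE: "j < n \<Longrightarrow> unitv j \<in> EE n"
  by (auto simp: unitv_def topspace_Euclidean_space)

text \<open>A functional that is linear on one fibre is determined by its values on the frame
  \<open>h m (unitv j)\<close>. The induction runs over the number of coordinates kept by
  \<open>trunc\<close>.\<close>

lemma lincoord_expand:
  assumes E: "vector_bundle E" and l: "lincoord E W r \<theta> h" and m: "m \<in> W"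
    and add: "\<And>e e'. e \<in> fibre E m \<Longrightarrow> e' \<in> fibre E m \<Longrightarrow> f (vadd E e e') = f e + f e'"
    and scl: "\<And>e s. e \<in> fibre E m \<Longrightarrow> f (vscale E s e) = s * f e"
    and e: "e \<in> fibre E m"
  shows "(f e :: real) = (\<Sum>j<r. \<theta> e j * f (h m (unitv j)))"
proof -
  note ll = lincoordD[OF l]
  have inE: "h m v \<in> fibre E m" if "v \<in> EE r" for v using ll(5,6)[OF m that] by (simp add: fibre_def)
  have mB: "m \<in> mpoints (base E)" using openin_subset[OF ll(1)] m by blast
  have v: "f (h m (trunc n v)) = (\<Sum>j<n. v j * f (h m (unitv j)))" if "n \<le> r" for n v
    using that
  proof (induction n)
    case 0
    have z: "vzero E m \<in> fibre E m" using vb_ops(3)[OF E mB] by (simp add: fibre_def)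
    have t0: "trunc 0 v \<in> EE r" by (auto simp: topspace_Euclidean_space)
    \<comment> \<open>The element with zero coordinates is its own multiple by 0, so homogeneity
      makes \<open>f\<close> vanish on it.\<close>
    have "h m (trunc 0 v) = vscale E 0 (h m (trunc 0 v))"
    proof (rule lincoord_inj[OF l])
      show "\<theta> (h m (trunc 0 v)) i = \<theta> (vscale E 0 (h m (trunc 0 v))) i" for i
        using ll(9)[of "h m (trunc 0 v)" 0 i] ll(5,6,7)[OF m t0] m by simp
    qed (use ll(5,6)[OF m t0] vb_ops(2)[OF E] m in auto)
    then show ?case using scl[OF inE[OF t0], of 0] by (simp del: trunc_ge)
  next
    case (Suc n)
    then have n: "n < r" by simp
    have t: "trunc n v \<in> EE r" "trunc (Suc n) v \<in> EE r" using Suc.prems by (auto simp: topspace_Euclidean_space)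
    note u = unitv_EE[OF n]
    have s: "vscale E (v n) (h m (unitv n)) \<in> vpoints E \<and> proj E (vscale E (v n) (h m (unitv n))) = m"
      using vb_ops(2)[OF E] ll(5,6)[OF m u] by auto
    have "h m (trunc (Suc n) v) = vadd E (h m (trunc n v)) (vscale E (v n) (h m (unitv n)))"
    proof (rule lincoord_inj[OF l])
      show "vadd E (h m (trunc n v)) (vscale E (v n) (h m (unitv n))) \<in> vpoints E"
        "proj E (vadd E (h m (trunc n v)) (vscale E (v n) (h m (unitv n)))) = proj E (h m (trunc (Suc n) v))"
        using vb_ops(1)[OF E] s ll(5,6)[OF m t(1)] ll(6)[OF m t(2)] by auto
      show "\<theta> (h m (trunc (Suc n) v)) i = \<theta> (vadd E (h m (trunc n v)) (vscale E (v n) (h m (unitv n)))) i" for i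
        using ll(8)[of "h m (trunc n v)" "vscale E (v n) (h m (unitv n))" i] ll(9)[of "h m (unitv n)" "v n" i]
          s ll(5,6,7)[OF m t(1)] ll(7)[OF m t(2)] ll(5,6,7)[OF m u] m
        by (auto simp: trunc_def unitv_def less_Suc_eq)
    qed (use ll(5,6)[OF m t(2)] m in auto)
    then have "f (h m (trunc (Suc n) v)) = f (h m (trunc n v)) + v n * f (h m (unitv n))"
      using add[OF inE[OF t(1)]] s scl[OF inE[OF u]] by (simp add: fibre_def)
    then show ?case using Suc by simp
  qed
  have eW: "e \<in> over E W" "proj E e = m" using e m by (auto simp: fibre_def)
  have "f e = f (h m (trunc r (\<theta> e)))" using ll(4)[OF eW(1)] trunc_id[OF ll(3)[OF eW(1)]] eW(2) by simp
  then show ?thesis using v[of r "\<theta> e"] by simp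
qed

primrec lcomb :: "('e, 'm) vbundle \<Rightarrow> 'm \<Rightarrow> (nat \<Rightarrow> real) \<Rightarrow> (nat \<Rightarrow> 'e) \<Rightarrow> nat \<Rightarrow> 'e" where
  "lcomb E m c x 0 = vzero E m"
| "lcomb E m c x (Suc n) = vadd E (lcomb E m c x n) (vscale E (c n) (x n))"

lemma lcomb_in:
  assumes E: "vector_bundle E" and m: "m \<in> mpoints (base E)"
    and x: "\<And>j. j < n \<Longrightarrow> x j \<in> vpoints E \<and> proj E (x j) = m"
  shows "lcomb E m c x n \<in> vpoints E \<and> proj E (lcomb E m c x n) = m"
  using x
proof (induction n)
  case 0 then show ?case using vb_ops(3)[OF E m] by simp
next
  case (Suc n)
  have "vscale E (c n) (x n) \<in> vpoints E \<and> proj E (vscale E (c n) (x n)) = m"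
    using Suc.prems[of n] vb_ops(2)[OF E] by simp
  then show ?case using Suc vb_ops(1)[OF E] by simp
qed

lemma vb_add4:
  assumes E: "vector_bundle E" and x: "x \<in> vpoints E" "x' \<in> vpoints E" "y \<in> vpoints E" "y' \<in> vpoints E"
    and p: "proj E x' = proj E x" "proj E y = proj E x" "proj E y' = proj E x"
  shows "vadd E (vadd E x x') (vadd E y y') = vadd E (vadd E x y) (vadd E x' y')"
proof -
  note c = vb_ops(1)[OF E]
  have 1: "vadd E (vadd E x x') (vadd E y y') = vadd E x (vadd E x' (vadd E y y'))"
    using vb_alg(1)[OF E x(1), of x' "vadd E y y'"] c[of y y'] x p by simp
  have 2: "vadd E x' (vadd E y y') = vadd E (vadd E x' y) y'"
    using vb_alg(1)[OF E x(2), of y y'] x p by simp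
  have 3: "vadd E x' y = vadd E y x'" using vb_alg(2)[OF E x(2), of y] x p by simp
  have 4: "vadd E (vadd E y x') y' = vadd E y (vadd E x' y')"
    using vb_alg(1)[OF E x(3), of x' y'] x p by simp
  have 5: "vadd E x (vadd E y (vadd E x' y')) = vadd E (vadd E x y) (vadd E x' y')"
    using vb_alg(1)[OF E x(1), of y "vadd E x' y'"] c[of x' y'] x p by simp
  show ?thesis unfolding 1 2 3 4 5 ..
qed

lemma lcomb_add:
  assumes E: "vector_bundle E" and m: "m \<in> mpoints (base E)"
    and x: "\<And>j. j < n \<Longrightarrow> x j \<in> vpoints E \<and> proj E (x j) = m"
  shows "lcomb E m (\<lambda>j. c j + c' j) x n = vadd E (lcomb E m c x n) (lcomb E m c' x n)"
  using x
proof (induction n)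
  case 0 then show ?case using vb_ops(3)[OF E m] vb_alg(3)[OF E, of "vzero E m"] by simp
next
  case (Suc n)
  have xn: "x n \<in> vpoints E" "proj E (x n) = m" using Suc.prems[of n] by auto
  note s = vb_ops(2)[OF E xn(1)]
  have i: "lcomb E m c x n \<in> vpoints E \<and> proj E (lcomb E m c x n) = m" for c
    by (rule lcomb_in[OF E m]) (use Suc.prems in auto)
  show ?case using Suc vb_alg(6)[OF E xn(1), of "c n" "c' n"]
      vb_add4[OF E, of "lcomb E m c x n" "lcomb E m c' x n" "vscale E (c n) (x n)" "vscale E (c' n) (x n)"] i[of c] i[of c'] s[of "c n"] s[of "c' n"] xn
    by simp
qed

lemma lcomb_scale:
  assumes E: "vector_bundle E" and m: "m \<in> mpoints (base E)"
    and x: "\<And>j. j < n \<Longrightarrow> x j \<in> vpoints E \<and> proj E (x j) = m"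
  shows "lcomb E m (\<lambda>j. s * c j) x n = vscale E s (lcomb E m c x n)"
  using x
proof (induction n)
  case 0 then show ?case using vb_ops(3)[OF E m] vb_alg(11)[OF E, of "vzero E m"] by simp
next
  case (Suc n)
  have xn: "x n \<in> vpoints E" "proj E (x n) = m" using Suc.prems[of n] by auto
  note sc = vb_ops(2)[OF E xn(1)]
  have i: "lcomb E m c x n \<in> vpoints E \<and> proj E (lcomb E m c x n) = m" for c
    by (rule lcomb_in[OF E m]) (use Suc.prems in auto)
  show ?case using Suc vb_alg(7)[OF E xn(1), of s "c n"]
      vb_alg(5)[OF E, of "lcomb E m c x n" "vscale E (c n) (x n)" s] i[of c] sc[of "c n"] xn
    by simp
qed

lemma lincoord_lcomb:
  assumes E: "vector_bundle E" and l: "lincoord E W r \<theta> h" and m: "m \<in> W"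
    and x: "\<And>j. j < n \<Longrightarrow> x j \<in> vpoints E \<and> proj E (x j) = m"
  shows "\<theta> (lcomb E m c x n) i = (\<Sum>j<n. c j * \<theta> (x j) i)"
  using x
proof (induction n)
  case 0 then show ?case using lincoord_vzero[OF E l m] by simp
next
  case (Suc n)
  have mB: "m \<in> mpoints (base E)" using openin_subset[OF lincoordD(1)[OF l]] m by blast
  have xn: "x n \<in> vpoints E" "proj E (x n) = m" using Suc.prems[of n] by auto
  have i: "lcomb E m c x n \<in> vpoints E \<and> proj E (lcomb E m c x n) = m"
    by (rule lcomb_in[OF E mB]) (use Suc.prems in auto)
  then show ?case using Suc lincoordD(8)[OF l, of "lcomb E m c x n" "vscale E (c n) (x n)" i]
     lincoordD(9)[OF l, of "x n" "c n" i] vb_ops(2)[OF E xn(1), of "c n"] xn m by simp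
qed

lemma smo_lcomb:
  assumes E: "vector_bundle E" and X: "charted X" and b: "smo X P (base E) b"
    and x: "\<And>j. j < n \<Longrightarrow> smo X P (total_space E) (x j)"
    and p: "\<And>j y. j < n \<Longrightarrow> y \<in> P \<Longrightarrow> proj E (x j y) = b y"
    and c: "\<And>j. j < n \<Longrightarrow> sfun X P (c j)"
  shows "smo X P (total_space E) (\<lambda>y. lcomb E (b y) (\<lambda>j. c j y) (\<lambda>j. x j y) n)"
  using x p c
proof (induction n)
  case 0
  show ?case using smo_compose[OF b smo_vzero[OF E]] smo_in[OF b] by auto
next
  case (Suc n)
  have IH: "smo X P (total_space E) (\<lambda>y. lcomb E (b y) (\<lambda>j. c j y) (\<lambda>j. x j y) n)"
    using Suc by simp
  have s: "smo X P (total_space E) (\<lambda>y. vscale E (c n y) (x n y))"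
    using Suc.prems by (intro smo_vscale[OF E X]) auto
  show ?case unfolding lcomb.simps
  proof (rule smo_vadd[OF E X IH s])
    fix y assume y: "y \<in> P"
    have "lcomb E (b y) (\<lambda>j. c j y) (\<lambda>j. x j y) n \<in> vpoints E \<and> proj E (lcomb E (b y) (\<lambda>j. c j y) (\<lambda>j. x j y) n) = b y"
      by (rule lcomb_in[OF E]) (use Suc.prems smo_in[OF b y] smo_in[OF Suc.prems(1)] y in auto)
    then show "proj E (vscale E (c n y) (x n y)) = proj E (lcomb E (b y) (\<lambda>j. c j y) (\<lambda>j. x j y) n)"
      using Suc.prems(2)[of n y] y vb_ops(2)[OF E smo_in[OF Suc.prems(1), of n y]] by simp
  qed
qed

text \<open>Serves to push combinations formed over \<open>A\<close> through
  \<open>pB\<close>.\<close>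

lemma lcomb_morphism:
  assumes E: "vector_bundle E" and m: "m \<in> mpoints (base E)"
    and x: "\<And>j. j < n \<Longrightarrow> x j \<in> vpoints E \<and> proj E (x j) = m"
    and z: "f (vzero E m) = vzero F m'"
    and add: "\<And>e e'. e \<in> fibre E m \<Longrightarrow> e' \<in> fibre E m \<Longrightarrow> f (vadd E e e') = vadd F (f e) (f e')"
    and scl: "\<And>e s. e \<in> fibre E m \<Longrightarrow> f (vscale E s e) = vscale F s (f e)"
  shows "f (lcomb E m c x n) = lcomb F m' c (\<lambda>j. f (x j)) n"
  using x
proof (induction n)
  case 0 then show ?case using z by simp
next
  case (Suc n)
  have "lcomb E m c x n \<in> fibre E m" "x n \<in> fibre E m" "vscale E (c n) (x n) \<in> fibre E m"
    using lcomb_in[OF E m, of n x c] Suc.prems Suc.prems[of n] vb_ops(2)[OF E, of "x n" "c n"] by (auto simp: fibre_def)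
  then show ?case using Suc add scl by simp
qed

section \<open>Double vector bundles\<close>

text \<open>Stated for one order of the two structures and instantiated twice with their roles
  exchanged. The clause with \<open>d1\<close>, \<open>d2\<close>, \<open>e1\<close>,
  \<open>e2\<close> is the interchange law of the two additions; it expresses linearity of one
  addition on the fibre product \<open>square_bundle\<close>.\<close>

lemma structure_maps_linearD:
  assumes s: "structure_maps_linear DA DB A B"
    and t: "total_space DA = total_space DB" "base DA = total_space A" "base DB = total_space B" "base A = base B"
    and vDA: "vector_bundle DA" and vDB: "vector_bundle DB"
  shows "d \<in> vpoints DB \<Longrightarrow> proj A (proj DA d) = proj B (proj DB d)"
    "d \<in> vpoints DB \<Longrightarrow> d' \<in> vpoints DB \<Longrightarrow> proj DB d' = proj DB d \<Longrightarrow> proj DA (vadd DB d d') = vadd A (proj DA d) (proj DA d')"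
    "d \<in> vpoints DB \<Longrightarrow> proj DA (vscale DB r d) = vscale A r (proj DA d)"
    "a \<in> vpoints A \<Longrightarrow> proj DB (vzero DA a) = vzero B (proj A a)"
    "a \<in> vpoints A \<Longrightarrow> a' \<in> vpoints A \<Longrightarrow> proj A a' = proj A a \<Longrightarrow> vzero DA (vadd A a a') = vadd DB (vzero DA a) (vzero DA a')"
    "a \<in> vpoints A \<Longrightarrow> vzero DA (vscale A r a) = vscale DB r (vzero DA a)"
    "d \<in> vpoints DB \<Longrightarrow> proj DB (vscale DA r d) = vscale B r (proj DB d)"
    "d \<in> vpoints DB \<Longrightarrow> d' \<in> vpoints DB \<Longrightarrow> proj DB d' = proj DB d \<Longrightarrow> vscale DA r (vadd DB d d') = vadd DB (vscale DA r d) (vscale DA r d')"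
    "d \<in> vpoints DB \<Longrightarrow> vscale DA r (vscale DB s d) = vscale DB s (vscale DA r d)"
    "d1 \<in> vpoints DB \<Longrightarrow> d2 \<in> vpoints DB \<Longrightarrow> proj DA d1 = proj DA d2 \<Longrightarrow>
      proj DB (vadd DA d1 d2) = vadd B (proj DB d1) (proj DB d2)"
    "d1 \<in> vpoints DB \<Longrightarrow> d2 \<in> vpoints DB \<Longrightarrow> proj DA d1 = proj DA d2 \<Longrightarrow> e1 \<in> vpoints DB \<Longrightarrow> e2 \<in> vpoints DB \<Longrightarrow> proj DA e1 = proj DA e2 \<Longrightarrow>
      proj DB e1 = proj DB d1 \<Longrightarrow> proj DB e2 = proj DB d2 \<Longrightarrow>
      vadd DA (vadd DB d1 e1) (vadd DB d2 e2) = vadd DB (vadd DA d1 d2) (vadd DA e1 e2)"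
    "d1 \<in> vpoints DB \<Longrightarrow> d2 \<in> vpoints DB \<Longrightarrow> proj DA d1 = proj DA d2 \<Longrightarrow>
      vadd DA (vscale DB r d1) (vscale DB r d2) = vscale DB r (vadd DA d1 d2)"
proof -
  note s' = s[unfolded structure_maps_linear_def]
  have pB: "proj DB d \<in> mpoints (base DB)" if "d \<in> vpoints DB" for d using vbD(6)[OF vDB that] .
  note s1 = conjunct1[OF s', unfolded vb_morphism_def]
  show s1a: "proj A (proj DA d) = proj B (proj DB d)" if "d \<in> vpoints DB" for d
    using s1 that by blast
  show "proj DA (vadd DB d d') = vadd A (proj DA d) (proj DA d')" if "d \<in> vpoints DB" "d' \<in> vpoints DB" "proj DB d' = proj DB d" for d d'
    using s1 pB[OF that(1)] that unfolding fibre_def by auto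
  show "proj DA (vscale DB r d) = vscale A r (proj DA d)" if "d \<in> vpoints DB" for r d
    using s1 pB[OF that(1)] that unfolding fibre_def by auto
  note s2 = conjunct1[OF conjunct2[OF s'], unfolded vb_morphism_def]
  \<comment> \<open>That \<open>A\<close> is a vector bundle is not among the hypotheses; that
    \<open>proj A\<close> maps into the base is read off from the zero element over
    \<open>a\<close>, passing through \<open>B\<close>.\<close>
  have pa: "proj A a \<in> mpoints (base A)" if "a \<in> vpoints A" for a
  proof -
    have z: "vzero DA a \<in> vpoints DA" "proj DA (vzero DA a) = a" using vb_ops(3)[OF vDA] that t(2) by auto
    have "smooth_map (base DB) (base A) (proj B)" using s1 by blast
    then have "proj B (proj DB (vzero DA a)) \<in> mpoints (base A)"
      using pB[of "vzero DA a"] z t(1) by (auto simp: smooth_map_def continuous_map_def)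
    then show ?thesis using s1a[of "vzero DA a"] z t(1) by simp
  qed
  show "proj DB (vzero DA a) = vzero B (proj A a)" if "a \<in> vpoints A" for a
    using s2 that by blast
  show "vzero DA (vadd A a a') = vadd DB (vzero DA a) (vzero DA a')" if "a \<in> vpoints A" "a' \<in> vpoints A" "proj A a' = proj A a" for a a'
    using s2 pa[OF that(1)] that unfolding fibre_def by auto
  show "vzero DA (vscale A r a) = vscale DB r (vzero DA a)" if "a \<in> vpoints A" for r a
    using s2 pa[OF that(1)] that unfolding fibre_def by auto
  have s4: "vb_morphism DB DB (vscale DA r) (vscale B r)" for r using s' by blast
  show "proj DB (vscale DA r d) = vscale B r (proj DB d)" if "d \<in> vpoints DB" for r d
    using s4[of r] that unfolding vb_morphism_def by blast
  show "vscale DA r (vadd DB d d') = vadd DB (vscale DA r d) (vscale DA r d')"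
    if "d \<in> vpoints DB" "d' \<in> vpoints DB" "proj DB d' = proj DB d" for r d d'
    using s4[of r] that pB[OF that(1)] unfolding vb_morphism_def fibre_def by auto
  show "vscale DA r (vscale DB s d) = vscale DB s (vscale DA r d)" if "d \<in> vpoints DB" for r s d
    using s4[of r] that pB[OF that(1)] unfolding vb_morphism_def fibre_def by auto
  have s3: "vb_morphism (square_bundle DA DB B) DB (\<lambda>(d1, d2). vadd DA d1 d2) (\<lambda>(b1, b2). vadd B b1 b2)"
    using s' by blast
  have vp: "(d1, d2) \<in> vpoints (square_bundle DA DB B)" if "d1 \<in> vpoints DB" "d2 \<in> vpoints DB" "proj DA d1 = proj DA d2" for d1 d2
    using that t by (auto simp: square_bundle_def fibre_product_def submanifold_def)
  have bp: "(proj DB d1, proj DB d2) \<in> mpoints (base (square_bundle DA DB B))"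
    if "d1 \<in> vpoints DB" "d2 \<in> vpoints DB" "proj DA d1 = proj DA d2" for d1 d2
    using that t pB s1a[OF that(1)] s1a[OF that(2)] by (auto simp: square_bundle_def fibre_product_def submanifold_def)
  have fp: "(d1, d2) \<in> fibre (square_bundle DA DB B) (b1, b2)"
    if "d1 \<in> vpoints DB" "d2 \<in> vpoints DB" "proj DA d1 = proj DA d2" "proj DB d1 = b1" "proj DB d2 = b2" for d1 d2 b1 b2
    using vp[OF that(1-3)] that(4,5) by (simp add: fibre_def square_bundle_def)
  show "proj DB (vadd DA d1 d2) = vadd B (proj DB d1) (proj DB d2)"
    if "d1 \<in> vpoints DB" "d2 \<in> vpoints DB" "proj DA d1 = proj DA d2" for d1 d2
  proof -
    have "\<forall>e\<in>vpoints (square_bundle DA DB B). proj DB ((\<lambda>(d1, d2). vadd DA d1 d2) e) = (\<lambda>(b1, b2). vadd B b1 b2) (proj (square_bundle DA DB B) e)"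
      using s3 unfolding vb_morphism_def by blast
    from bspec[OF this vp[OF that]] show ?thesis by (simp add: square_bundle_def)
  qed
  have lin: "\<forall>m\<in>mpoints (base (square_bundle DA DB B)). \<forall>e\<in>fibre (square_bundle DA DB B) m.
     (\<forall>e'\<in>fibre (square_bundle DA DB B) m. (\<lambda>(d1, d2). vadd DA d1 d2) (vadd (square_bundle DA DB B) e e') =
        vadd DB ((\<lambda>(d1, d2). vadd DA d1 d2) e) ((\<lambda>(d1, d2). vadd DA d1 d2) e')) \<and>
     (\<forall>r. (\<lambda>(d1, d2). vadd DA d1 d2) (vscale (square_bundle DA DB B) r e) = vscale DB r ((\<lambda>(d1, d2). vadd DA d1 d2) e))"
    using s3 unfolding vb_morphism_def by blast
  show "vadd DA (vadd DB d1 e1) (vadd DB d2 e2) = vadd DB (vadd DA d1 d2) (vadd DA e1 e2)"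
    if "d1 \<in> vpoints DB" "d2 \<in> vpoints DB" "proj DA d1 = proj DA d2" "e1 \<in> vpoints DB" "e2 \<in> vpoints DB" "proj DA e1 = proj DA e2"
      "proj DB e1 = proj DB d1" "proj DB e2 = proj DB d2" for d1 d2 e1 e2
    using conjunct1[OF bspec[OF bspec[OF lin bp[OF that(1-3)]] fp[OF that(1-3) refl refl]], THEN bspec, OF fp[OF that(4-8)]]
    by (simp add: square_bundle_def)
  show "vadd DA (vscale DB r d1) (vscale DB r d2) = vscale DB r (vadd DA d1 d2)"
    if "d1 \<in> vpoints DB" "d2 \<in> vpoints DB" "proj DA d1 = proj DA d2" for d1 d2 r
    using conjunct2[OF bspec[OF bspec[OF lin bp[OF that(1-3)]] fp[OF that(1-3) refl refl]], THEN spec, of r]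
    by (simp add: square_bundle_def)
qed

locale dvb =
  fixes DA :: "('d, 'a) vbundle" and DB :: "('d, 'b) vbundle"
    and A :: "('a, 'm) vbundle" and B :: "('b, 'm) vbundle"
  assumes dvb: "double_vector_bundle DA DB A B"
begin

lemma vDA: "vector_bundle DA" and vDB: "vector_bundle DB" and vA: "vector_bundle A" and vB: "vector_bundle B"
  and tot: "total_space DB = total_space DA" and baseDA: "base DA = total_space A"
  and baseDB: "base DB = total_space B" and baseB: "base B = base A"
  and smlA: "structure_maps_linear DA DB A B" and smlB: "structure_maps_linear DB DA B A"
  using dvb by (auto simp: double_vector_bundle_def)

abbreviation "D \<equiv> vpoints DA"
abbreviation "TD \<equiv> total_space DA"
abbreviation "overB X \<equiv> {d \<in> vpoints DA. proj DB d \<in> X}"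
abbreviation "M \<equiv> base A"
abbreviation "nA \<equiv> rank A"
abbreviation "nB \<equiv> rank B"
abbreviation "rB \<equiv> rank DB"
abbreviation "nC \<equiv> rank DB - rank A"
abbreviation "pA \<equiv> proj DA"
abbreviation "pB \<equiv> proj DB"
abbreviation "qA \<equiv> proj A"
abbreviation "qB \<equiv> proj B"
abbreviation "addA \<equiv> vadd DA"
abbreviation "addB \<equiv> vadd DB"
abbreviation "sclA \<equiv> vscale DA"
abbreviation "sclB \<equiv> vscale DB"

lemmas bundle_simps [simp] = tot baseDA baseDB baseB

lemmas sA = structure_maps_linearD[OF smlA tot[symmetric] baseDA baseDB baseB[symmetric] vDA vDB, unfolded tot]
lemmas sB = structure_maps_linearD[OF smlB tot baseDB baseDA baseB vDB vDA]

lemmas opsA = vb_ops[OF vDA, unfolded baseDA] and opsB = vb_ops[OF vDB, unfolded tot baseDB]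
lemmas opsa = vb_ops[OF vA] and opsb = vb_ops[OF vB, unfolded baseB]
lemmas vbDA = vbD[OF vDA, unfolded baseDA] and vbDB = vbD[OF vDB, unfolded tot baseDB]
lemmas vba = vbD[OF vA] and vbb = vbD[OF vB, unfolded baseB]

lemma proj_proj: "d \<in> D \<Longrightarrow> qB (pB d) = qA (pA d)"
  using sA(1) by simp

text \<open>The zero section of \<open>D \<rightarrow> A\<close> is additive with respect to
  \<open>addB\<close>, so the element over the zero of \<open>A\<close> is idempotent for
  \<open>addB\<close>, hence a zero element of the other structure.\<close>

lemma vzero_vzero: "m \<in> mpoints M \<Longrightarrow> vzero DB (vzero B m) = vzero DA (vzero A m)"
proof -
  assume m: "m \<in> mpoints M"
  note a = opsa(3)[OF m] and b = opsb(3)[OF m]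
  let ?z = "vzero DA (vzero A m)"
  have z: "?z \<in> D" "pA ?z = vzero A m" using opsA(3)[of "vzero A m"] a by auto
  have "addB ?z ?z = ?z" using sA(5)[of "vzero A m" "vzero A m"] a vb_alg(3)[OF vA, of "vzero A m"] by simp
  then have "?z = vzero DB (pB ?z)" using vb_alg(12)[OF vDB, of ?z ?z] z by simp
  then show ?thesis using sA(4)[of "vzero A m"] a by simp
qed

text \<open>The component \<open>\<alpha>\<^sub>s \<circ> pA\<close> is a combination of the \<open>\<theta>\<^sub>j\<close> with coefficients on \<open>B\<close>. On the zero element of \<open>D\<close> over
  an \<open>a\<close> with \<open>\<alpha> a\<close> the \<open>s\<close>-th unit vector it is 1 while \<open>\<theta>\<^sub>i = 0\<close> for \<open>i < s\<close>; hence a coefficient with \<open>j \<ge> s\<close> does not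
  vanish at the zero of \<open>B\<close>, and \<open>\<theta>\<^sub>j\<close> can be exchanged for \<open>\<alpha>\<^sub>s \<circ> pA\<close>.\<close>

lemma adapted_step:
  assumes U: "m0 \<in> U" "lincoord A U nA \<alpha> hA" and s: "s < nA"
    and l: "lincoord DB W rB \<theta> h" and W: "vzero B m0 \<in> W" "\<And>b. b \<in> W \<Longrightarrow> qB b \<in> U"
    and \<theta>: "\<And>i d. i < s \<Longrightarrow> d \<in> overB W \<Longrightarrow> \<theta> d i = \<alpha> (pA d) i"
  shows "s < rB \<and> (\<exists>W' \<theta>' h'. W' \<subseteq> W \<and> lincoord DB W' rB \<theta>' h' \<and> vzero B m0 \<in> W' \<and>
     (\<forall>i<Suc s. \<forall>d\<in>overB W'. \<theta>' d i = \<alpha> (pA d) i))"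
proof -
  note la = lincoordD[OF U(2)] and ll = lincoordD[OF l, unfolded tot baseDB]
  have m0: "m0 \<in> mpoints M" using openin_subset[OF la(1)] U(1) by blast
  have WB: "W \<subseteq> vpoints B" using openin_subset[OF ll(1)] .
  \<comment> \<open>\<open>Q j b\<close> is the coefficient of the coordinate number
    \<open>j\<close> in the expansion of \<open>\<alpha> (pA d) s\<close> over
    \<open>b\<close>.\<close>
  define Q where "Q = (\<lambda>j b. \<alpha> (pA (h b (unitv j))) s)"
  have pAU: "pA d \<in> over A U" if "d \<in> overB W" for d
    using that W(2)[of "pB d"] vbDA(6)[of d] proj_proj by auto
  have exp: "\<alpha> (pA d) s = (\<Sum>j<rB. \<theta> d j * Q j (pB d))" if d: "d \<in> overB W" for d
    unfolding Q_def
  proof (rule lincoord_expand[OF vDB l, where f="\<lambda>d. \<alpha> (pA d) s" and m="pB d"])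
    fix e e' assume e: "e \<in> fibre DB (pB d)" "e' \<in> fibre DB (pB d)"
    then have e1: "e \<in> overB W" "e' \<in> overB W" "pB e' = pB e" using d by (auto simp: fibre_def)
    show "\<alpha> (pA (addB e e')) s = \<alpha> (pA e) s + \<alpha> (pA e') s"
      using sA(2)[of e e'] e1 la(8)[OF pAU[OF e1(1)], of "pA e'" s] pAU[OF e1(2)] proj_proj[of e] proj_proj[of e'] by simp
  next
    fix e t assume e: "e \<in> fibre DB (pB d)"
    then have e1: "e \<in> overB W" using d by (auto simp: fibre_def)
    show "\<alpha> (pA (sclB t e)) s = t * \<alpha> (pA e) s"
      using sA(3)[of e t] e1 la(9)[OF pAU[OF e1], of t s] by simp
  qed (use d in \<open>auto simp: fibre_def\<close>)
  have "\<exists>j<rB. s \<le> j \<and> Q j (vzero B m0) \<noteq> 0"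
  proof (rule ccontr)
    assume "\<not> ?thesis"
    then have Q0: "Q j (vzero B m0) = 0" if "j < rB" "s \<le> j" for j using that by blast
    define a where "a = hA m0 (unitv s)"
    have a: "a \<in> vpoints A" "qA a = m0" "\<alpha> a = unitv s"
      unfolding a_def using la(5,6,7)[OF U(1) unitv_EE[OF s]] by auto
    define d where "d = vzero DA a"
    have d: "d \<in> D" "pA d = a" unfolding d_def using opsA(3)[of a] a by auto
    have db: "pB d = vzero B m0" unfolding d_def using sA(4)[of a] a by simp
    have dW: "d \<in> overB W" using d db W(1) by simp
    have "\<theta> d j * Q j (pB d) = 0" if "j < rB" for j
    proof (cases "j < s")
      case True
      then show ?thesis using \<theta>[OF True dW] a(3) d(2) by (simp add: unitv_def)
    next
      case False
      then show ?thesis using Q0[OF that] db by simp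
    qed
    then have "(\<Sum>j<rB. \<theta> d j * Q j (pB d)) = 0" by (intro sum.neutral) blast
    then have "\<alpha> a s = 0" using exp[OF dW] d(2) by simp
    then show False using a(3) by (simp add: unitv_def)
  qed
  then obtain j where j: "j < rB" "s \<le> j" "Q j (vzero B m0) \<noteq> 0" by blast
  have smW: "smo (total_space B) W TD (\<lambda>b. h b (trunc rB (unitv i)))" for i
    using lincoord_smo[OF l, unfolded tot baseDB, OF vbb(3) vbb(1) smo_id[OF ll(1)], of "\<lambda>b. unitv i"]
    by (auto intro: sfun_const ll(1))
  have smQ: "sfun (total_space B) W (Q i)" if i: "i < rB" for i
  proof -
    have 1: "smo (total_space B) W TD (\<lambda>b. h b (unitv i))"
      by (rule smo_cong[OF vbb(3) smW[of i]]) (use unitv_EE[OF i] trunc_id in simp)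
    have "smo (total_space B) W (total_space A) (\<lambda>b. pA (h b (unitv i)))"
      by (rule smo_compose[OF 1 vbDA(5)]) (use ll(5) unitv_EE[OF i] in auto)
    then show ?thesis unfolding Q_def
    proof (rule smo_sfun'[OF _ la(2)[OF s]])
      show "(\<lambda>b. pA (h b (unitv i))) ` W \<subseteq> over A U"
        using pAU ll(5,6) unitv_EE[OF i] by auto
    qed
  qed
  \<comment> \<open>Where the pivot \<open>Q j\<close> does not vanish, the expansion can be solved
    for the coordinate number \<open>j\<close>.\<close>
  define W' where "W' = {b\<in>W. Q j b \<in> - {0}}"
  have W': "openin (mtop (total_space B)) W'" "W' \<subseteq> W" "vzero B m0 \<in> W'"
    unfolding W'_def using sfun_vimage_open[OF vbb(3) smQ[OF j(1)], of "- {0}"] W(1) j(3) by auto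
  \<comment> \<open>Position \<open>s\<close> receives the new coordinate; the old coordinate
    \<open>s\<close> moves to position \<open>j\<close>, whose own coordinate is given up.\<close>
  define \<theta>' where "\<theta>' = (\<lambda>d i. if i = s then \<alpha> (pA d) s else if i = j then \<theta> d s else \<theta> d i)"
  \<comment> \<open>\<open>w\<close> undoes this exchange away from position \<open>j\<close>;
    \<open>u\<close> recovers the entry \<open>j\<close> by solving the expansion for it.\<close>
  define w where "w = (\<lambda>(v::nat \<Rightarrow> real) i. if i = s then v j else v i)"
  define u where "u = (\<lambda>b v i. if i = j then (v s - (\<Sum>l\<in>{..<rB}-{j}. w v l * Q l b)) * inverse (Q j b) else w v i)"
  have srB: "s < rB" using j by simp
  have sub: "e \<in> overB W" if "e \<in> overB W'" for e using that W'(2) by auto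
  have oW': "openin (mtop TD) (overB W')" using vbDB(8)[OF W'(1)] by simp
  have lin: "lincoord DB W' rB \<theta>' (\<lambda>b v. h b (trunc rB (u b v)))"
  proof (rule lincoord_change[OF l vDB, unfolded tot baseDB, OF W'(1,2)])
    fix i assume i: "i < rB"
    have t: "sfun TD (overB W') (\<lambda>d. \<theta> d i)" if "i < rB" for i
      using sfun_subset[OF ll(2)[OF that] oW'] sub by auto
    have "smo TD (overB W') (total_space A) pA"
      by (rule smo_subset[OF vbDA(5) oW']) auto
    then have "sfun TD (overB W') (\<lambda>d. \<alpha> (pA d) s)"
      by (rule smo_sfun'[OF _ la(2)[OF s]]) (use pAU sub in auto)
    then show "sfun TD (overB W') (\<lambda>d. \<theta>' d i)"
      unfolding \<theta>'_def using t[OF i] t[OF srB] by (cases "i = s"; cases "i = j"; simp)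
  next
    fix e assume e: "e \<in> overB W'"
    show "\<theta>' e \<in> EE rB" using ll(3)[OF sub[OF e]] j(1) srB unfolding \<theta>'_def topspace_Euclidean_space by auto
    fix e' i assume e': "e' \<in> D" "pB e' = pB e"
    show "\<theta>' (addB e e') i = \<theta>' e i + \<theta>' e' i"
    proof -
      have ee: "e' \<in> overB W" using e' sub[OF e] by auto
      have "\<alpha> (pA (addB e e')) s = \<alpha> (pA e) s + \<alpha> (pA e') s"
        using sA(2)[of e e'] e e' la(8)[OF pAU[OF sub[OF e]], of "pA e'" s] pAU[OF ee] proj_proj[of e] proj_proj[of e'] by simp
      then show ?thesis unfolding \<theta>'_def using ll(8)[OF sub[OF e] e'] by auto
    qed
  next
    fix e t i assume e: "e \<in> overB W'"
    have "\<alpha> (pA (sclB t e)) s = t * \<alpha> (pA e) s"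
      using sA(3)[of e t] e la(9)[OF pAU[OF sub[OF e]], of t s] by simp
    then show "\<theta>' (sclB t e) i = t * \<theta>' e i" unfolding \<theta>'_def using ll(9)[OF sub[OF e]] by auto
  next
    let ?X = "prod_manifold (total_space B) (EM rB)"
    have cX: "charted ?X" by (rule charted_prod[OF vbb(3) charted_euclidean])
    have oE: "openin (mtop (EM rB)) (EE rB)" by simp
    have q: "sfun ?X (W' \<times> EE rB) (\<lambda>z. Q i (fst z))" if "i < rB" for i
      by (rule smo_sfun'[OF smo_fst[OF vbb(3) charted_euclidean W'(1) oE] smQ[OF that]]) (use W'(2) in auto)
    have c: "sfun ?X (W' \<times> EE rB) (\<lambda>z. snd z i)" for i by (rule sfun_snd_coord[OF vbb(3) W'(1)])
    have cw: "sfun ?X (W' \<times> EE rB) (\<lambda>z. w (snd z) i)" for i unfolding w_def using c by (cases "i = s") auto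
    fix i assume "i < rB"
    show "sfun ?X (W' \<times> EE rB) (\<lambda>z. u (fst z) (snd z) i)"
    proof (cases "i = j")
      case True
      have "sfun ?X (W' \<times> EE rB) (\<lambda>z. (snd z s - (\<Sum>l\<in>{..<rB}-{j}. w (snd z) l * Q l (fst z))) * inverse (Q j (fst z)))"
        by (intro sfun_mult[OF cX] sfun_diff[OF cX] sfun_sum[OF cX] sfun_inverse[OF cX] c cw q)
           (use j(1) sfun_openin[OF c] in \<open>auto simp: W'_def\<close>)
      then show ?thesis unfolding u_def using True by simp
    next
      case False
      then show ?thesis unfolding u_def using cw by simp
    qed
  next
    fix b v assume b: "b \<in> W'" and v: "v \<in> EE rB"
    have bW: "b \<in> W" and Qj: "Q j b \<noteq> 0" using b by (auto simp: W'_def)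
    let ?d = "h b (trunc rB (u b v))"
    note d = ll(5,6,7)[OF bW trunc_EE]
    have dW: "?d \<in> overB W" using d(1,2) bW by auto
    have "\<alpha> (pA ?d) s = (\<Sum>i<rB. u b v i * Q i b)" using exp[OF dW] d(2,3)[of "u b v"] by simp
    also have "\<dots> = u b v j * Q j b + (\<Sum>i\<in>{..<rB}-{j}. u b v i * Q i b)"
      using j(1) by (intro sum.remove) auto
    also have "(\<Sum>i\<in>{..<rB}-{j}. u b v i * Q i b) = (\<Sum>i\<in>{..<rB}-{j}. w v i * Q i b)"
      by (rule sum.cong) (auto simp: u_def)
    also have "u b v j * Q j b + \<dots> = v s" using Qj by (simp add: u_def mult.assoc)
    finally have 1: "\<alpha> (pA ?d) s = v s" .
    show "\<theta>' ?d = v"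
    proof
      fix i show "\<theta>' ?d i = v i"
      proof (cases "i < rB")
        case True
        then show ?thesis unfolding \<theta>'_def d(3) using 1 srB by (auto simp: u_def w_def)
      next
        case False
        then show ?thesis unfolding \<theta>'_def d(3) using EE_ge[OF v] srB j(1) by auto
      qed
    qed
  next
    fix e i assume e: "e \<in> overB W'" and i: "i < rB"
    have Qj: "Q j (pB e) \<noteq> 0" using e by (auto simp: W'_def)
    have w: "w (\<theta>' e) l = \<theta> e l" if "l \<noteq> j" for l using that by (auto simp: w_def \<theta>'_def)
    have "\<alpha> (pA e) s = \<theta> e j * Q j (pB e) + (\<Sum>l\<in>{..<rB}-{j}. \<theta> e l * Q l (pB e))"
      unfolding exp[OF sub[OF e]] using j(1) by (intro sum.remove) auto
    also have "(\<Sum>l\<in>{..<rB}-{j}. \<theta> e l * Q l (pB e)) = (\<Sum>l\<in>{..<rB}-{j}. w (\<theta>' e) l * Q l (pB e))"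
      by (rule sum.cong) (auto simp: w)
    finally have "\<theta>' e s - (\<Sum>l\<in>{..<rB}-{j}. w (\<theta>' e) l * Q l (pB e)) = \<theta> e j * Q j (pB e)"
      by (simp add: \<theta>'_def)
    then show "u (pB e) (\<theta>' e) i = \<theta> e i" unfolding u_def using w Qj by auto
  qed
  have "\<theta>' d i = \<alpha> (pA d) i" if "i < Suc s" "d \<in> overB W'" for i d
    using that \<theta>[OF _ sub[OF that(2)], of i] j(2) by (auto simp: \<theta>'_def)
  then show ?thesis using srB lin W' by blast
qed

text \<open>Iteration of the exchange step. At \<open>s = nA\<close> it also yields
  \<open>nA \<le> rB\<close>, so that \<open>nC\<close> is a genuine difference of ranks.\<close>

lemma adapted_coords:
  assumes U: "m0 \<in> U" "lincoord A U nA \<alpha> hA" and s: "s \<le> nA"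
  shows "s \<le> rB \<and> (\<exists>W \<theta> h. lincoord DB W rB \<theta> h \<and> vzero B m0 \<in> W \<and> (\<forall>b\<in>W. qB b \<in> U) \<and>
     (\<forall>i<s. \<forall>d\<in>overB W. \<theta> d i = \<alpha> (pA d) i))"
  using s
proof (induction s)
  case 0
  note la = lincoordD[OF U(2)]
  have m0: "m0 \<in> mpoints M" using openin_subset[OF la(1)] U(1) by blast
  have z: "vzero B m0 \<in> mpoints (base DB)" using opsb(3)[OF m0] by simp
  obtain W \<Phi> \<theta> h where W: "vzero B m0 \<in> W" "local_trivialization DB W \<Phi>" "lincoord DB W rB \<theta> h"
    using vb_lincoord[OF vDB z] by metis
  have oU: "openin (mtop (total_space B)) (over B U)" using vbb(8)[OF la(1)] .
  have "openin (mtop (base DB)) (W \<inter> over B U)" using oU lincoordD(1)[OF W(3)] by auto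
  from lincoord_restrict[OF W(3) vDB this] have "lincoord DB (W \<inter> over B U) rB \<theta> (\<lambda>m v. h m (trunc rB v))" by simp
  moreover have "vzero B m0 \<in> W \<inter> over B U" using W(1) opsb(3)[OF m0] U(1) by simp
  ultimately show ?case by (intro conjI exI[of _ "W \<inter> over B U"] exI) auto
next
  case (Suc s)
  then obtain W \<theta> h where W: "lincoord DB W rB \<theta> h" "vzero B m0 \<in> W" "\<And>b. b \<in> W \<Longrightarrow> qB b \<in> U"
    "\<And>i d. i < s \<Longrightarrow> d \<in> overB W \<Longrightarrow> \<theta> d i = \<alpha> (pA d) i" by auto
  have st: "s < nA" using Suc.prems by simp
  from adapted_step[where s=s, OF U st W(1) W(2) W(3) W(4)]
  obtain W' \<theta>' h' where "s < rB" "W' \<subseteq> W" "lincoord DB W' rB \<theta>' h'" "vzero B m0 \<in> W'"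
     "\<forall>i<Suc s. \<forall>d\<in>overB W'. \<theta>' d i = \<alpha> (pA d) i" by blast
  then show ?case using W(3) by (intro conjI exI[of _ W'] exI[of _ \<theta>'] exI[of _ h']) auto
qed

end

text \<open>The choices made over one open set \<open>V\<close>. The normalization
  \<open>\<theta>0\<close> is what makes the coordinates from \<open>nA\<close> on additive over
  \<open>A\<close>: otherwise their value at the zero element over \<open>a\<close> would appear as
  an error term.\<close>

locale dvb_local = dvb DA DB A B
  for DA :: "('d, 'a) vbundle" and DB :: "('d, 'b) vbundle"
    and A :: "('a, 'm) vbundle" and B :: "('b, 'm) vbundle" +
  fixes V :: "'m set" and \<alpha> :: "'a \<Rightarrow> nat \<Rightarrow> real" and hA :: "'m \<Rightarrow> (nat \<Rightarrow> real) \<Rightarrow> 'a"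
    and \<beta> :: "'b \<Rightarrow> nat \<Rightarrow> real" and hB :: "'m \<Rightarrow> (nat \<Rightarrow> real) \<Rightarrow> 'b"
    and W :: "'b set" and \<theta> :: "'d \<Rightarrow> nat \<Rightarrow> real" and h :: "'b \<Rightarrow> (nat \<Rightarrow> real) \<Rightarrow> 'd" and \<epsilon> :: "nat \<Rightarrow> real"
  assumes la: "lincoord A V (rank A) \<alpha> hA" and lb: "lincoord B V (rank B) \<beta> hB"
    and lD: "lincoord DB W (rank DB) \<theta> h" and rk: "rank A \<le> rank DB"
    and WV: "\<And>b. b \<in> W \<Longrightarrow> proj B b \<in> V" and zW: "\<And>m. m \<in> V \<Longrightarrow> vzero B m \<in> W"
    and \<theta>\<alpha>: "\<And>i d. i < rank A \<Longrightarrow> d \<in> overB W \<Longrightarrow> \<theta> d i = \<alpha> (proj DA d) i"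
    and \<theta>0: "\<And>i a. a \<in> over A V \<Longrightarrow> rank A \<le> i \<Longrightarrow> \<theta> (vzero DA a) i = 0"
    and \<epsilon>: "\<And>j. j < rank B \<Longrightarrow> 0 < \<epsilon> j"
    and \<epsilon>W: "\<And>m j. m \<in> V \<Longrightarrow> j < rank B \<Longrightarrow> vscale B (\<epsilon> j) (hB m (unitv j)) \<in> W"
begin

lemmas la' = lincoordD[OF la] and lb' = lincoordD[OF lb, unfolded baseB] and lD' = lincoordD[OF lD, unfolded tot baseDB]

abbreviation "DV \<equiv> {d \<in> D. qA (pA d) \<in> V}"

lemma VM: "m \<in> V \<Longrightarrow> m \<in> mpoints M"
  using openin_subset[OF la'(1)] by blast

lemma pAV: "d \<in> overB W \<Longrightarrow> pA d \<in> over A V"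
  using WV[of "pB d"] vbDA(6)[of d] proj_proj by auto

lemma D_eqI:
  assumes "d \<in> D" "d' \<in> D" "pB d' = pB d" "pA d' = pA d" "pB d \<in> W" "\<And>l. l < nC \<Longrightarrow> \<theta> d (nA + l) = \<theta> d' (nA + l)"
  shows "d = d'"
proof (rule lincoord_inj[OF lD])
  fix i assume i: "i < rB"
  show "\<theta> d i = \<theta> d' i"
  proof (cases "i < nA")
    case True
    then show ?thesis using \<theta>\<alpha>[OF True, of d] \<theta>\<alpha>[OF True, of d'] assms by simp
  next
    case False
    then show ?thesis using assms(6)[of "i - nA"] i by simp
  qed
qed (use assms in auto)

section \<open>The bilinear section\<close>

definition bb :: "nat \<Rightarrow> 'm \<Rightarrow> 'b" where "bb j m = vscale B (\<epsilon> j) (hB m (unitv j))"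

text \<open>\<open>\<alpha> a\<close> vanishes from index \<open>nA\<close> on, so
  \<open>el j a\<close> is the lift of \<open>a\<close> and of the scaled frame element whose
  remaining coordinates are 0. This is what makes it linear in \<open>a\<close>.\<close>

definition el :: "nat \<Rightarrow> 'a \<Rightarrow> 'd" where "el j a = h (bb j (qA a)) (\<alpha> a)"

lemma bb:
  assumes "m \<in> V" "j < nB"
  shows "bb j m \<in> vpoints B" "qB (bb j m) = m" "bb j m \<in> W" "\<beta> (bb j m) i = \<epsilon> j * unitv j i"
  using \<epsilon>W[OF assms] opsb(2)[of "hB m (unitv j)" "\<epsilon> j"] lb'(5,6,7)[OF assms(1) unitv_EE[OF assms(2)]]
    lb'(9)[of "hB m (unitv j)" "\<epsilon> j" i] assms(1) by (auto simp: bb_def)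

lemma \<alpha>_EE: "a \<in> over A V \<Longrightarrow> \<alpha> a \<in> EE rB"
  using la'(3)[of a] rk by (auto simp: topspace_Euclidean_space)

lemma el:
  assumes a: "a \<in> over A V" and j: "j < nB"
  shows "el j a \<in> D" "pB (el j a) = bb j (qA a)" "pA (el j a) = a" "nA \<le> i \<Longrightarrow> \<theta> (el j a) i = 0"
proof -
  have m: "qA a \<in> V" using a by simp
  note b = bb[OF m j]
  note d = lD'(5,6,7)[OF b(3) \<alpha>_EE[OF a]]
  show e: "el j a \<in> D" "pB (el j a) = bb j (qA a)" using d by (auto simp: el_def)
  have dW: "el j a \<in> overB W" using e b(3) by simp
  show "pA (el j a) = a"
  proof (rule lincoord_inj[OF la])
    show "pA (el j a) \<in> over A V" by (rule pAV[OF dW])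
    show "qA a = qA (pA (el j a))" using proj_proj[OF e(1)] e(2) b(2) by simp
    fix i assume "i < nA"
    then show "\<alpha> (pA (el j a)) i = \<alpha> a i" using \<theta>\<alpha>[OF _ dW] d(3) by (simp add: el_def)
  qed (use a in auto)
  show "nA \<le> i \<Longrightarrow> \<theta> (el j a) i = 0" using d(3) EE_ge[OF la'(3)[OF a]] by (simp add: el_def)
qed

lemma el_add:
  assumes a: "a \<in> over A V" "a' \<in> vpoints A" "qA a' = qA a" and j: "j < nB"
  shows "el j (vadd A a a') = addB (el j a) (el j a')"
proof -
  have a': "a' \<in> over A V" using a by simp
  have s: "vadd A a a' \<in> over A V" "qA (vadd A a a') = qA a" using opsa(1)[of a a'] a by auto
  note e = el[OF a(1) j] and e' = el[OF a' j] and es = el[OF s(1) j]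
  have eq: "pB (el j a') = pB (el j a)" using e(2) e'(2) a(3) by simp
  note ad = opsB(1)[OF e(1) e'(1) eq]
  have W: "bb j (qA a) \<in> W" using bb(3)[OF _ j] a(1) by simp
  show ?thesis
  proof (rule D_eqI)
    show "pA (addB (el j a) (el j a')) = pA (el j (vadd A a a'))" using sA(2)[OF e(1) e'(1) eq] e(3) e'(3) es(3) by simp
    fix l
    show "\<theta> (el j (vadd A a a')) (nA + l) = \<theta> (addB (el j a) (el j a')) (nA + l)"
      using lD'(8)[of "el j a" "el j a'" "nA + l"] e e' es(4)[of "nA + l"] eq W by simp
  qed (use es ad e(2) s W in auto)
qed

lemma el_scl:
  assumes a: "a \<in> over A V" and j: "j < nB"
  shows "el j (vscale A t a) = sclB t (el j a)"
proof -
  have s: "vscale A t a \<in> over A V" "qA (vscale A t a) = qA a" using opsa(2)[of a t] a by auto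
  note e = el[OF a(1) j] and es = el[OF s(1) j]
  note ad = opsB(2)[OF e(1)]
  have W: "bb j (qA a) \<in> W" using bb(3)[OF _ j] a(1) by simp
  show ?thesis
  proof (rule D_eqI)
    show "pA (sclB t (el j a)) = pA (el j (vscale A t a))" using sA(3)[OF e(1)] e(3) es(3) by simp
    fix l
    show "\<theta> (el j (vscale A t a)) (nA + l) = \<theta> (sclB t (el j a)) (nA + l)"
      using lD'(9)[of "el j a" t "nA + l"] e es(4)[of "nA + l"] W by simp
  qed (use es ad e(2) s W in auto)
qed

text \<open>A bilinear right inverse of \<open>d \<mapsto> (pA d, pB d)\<close>: it sends the frame element \<open>\<epsilon>\<^sub>j b\<^sub>j\<close> of \<open>B\<close>,
  which is so close to the zero section that the coordinates \<open>\<theta>\<close> are available, to \<open>el j a\<close>.\<close>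

definition \<sigma> :: "'a \<Rightarrow> 'b \<Rightarrow> 'd" where
  "\<sigma> a b = lcomb DA a (\<lambda>j. \<beta> b j * inverse (\<epsilon> j)) (\<lambda>j. el j a) nB"

lemma lc_in:
  assumes a: "a \<in> over A V" and n: "n \<le> nB"
  shows "lcomb DA a c (\<lambda>j. el j a) n \<in> D" "pA (lcomb DA a c (\<lambda>j. el j a) n) = a"
    "pB (lcomb DA a c (\<lambda>j. el j a) n) = lcomb B (qA a) c (\<lambda>j. bb j (qA a)) n"
proof -
  have x: "el j a \<in> vpoints DA \<and> pA (el j a) = a" if "j < n" for j using el[OF a, of j] that n by simp
  have aM: "a \<in> mpoints (base DA)" using a by simp
  show "lcomb DA a c (\<lambda>j. el j a) n \<in> D" "pA (lcomb DA a c (\<lambda>j. el j a) n) = a"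
    using lcomb_in[OF vDA aM x] by auto
  have "pB (lcomb DA a c (\<lambda>j. el j a) n) = lcomb B (qA a) c (\<lambda>j. pB (el j a)) n"
    by (rule lcomb_morphism[OF vDA aM x]) (use a sA(4) sB(2,3) in \<open>auto simp: fibre_def\<close>)
  also have "\<dots> = lcomb B (qA a) c (\<lambda>j. bb j (qA a)) n"
    using n
  proof (induction n)
    case (Suc n) then show ?case using el(2)[OF a, of n] by simp
  qed simp
  finally show "pB (lcomb DA a c (\<lambda>j. el j a) n) = lcomb B (qA a) c (\<lambda>j. bb j (qA a)) n" .
qed

lemma sig:
  assumes a: "a \<in> over A V" and b: "b \<in> vpoints B" "qB b = qA a"
  shows "\<sigma> a b \<in> D" "pA (\<sigma> a b) = a" "pB (\<sigma> a b) = b"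
proof -
  show "\<sigma> a b \<in> D" "pA (\<sigma> a b) = a" unfolding \<sigma>_def using lc_in[OF a order_refl] by auto
  let ?b = "lcomb B (qA a) (\<lambda>j. \<beta> b j * inverse (\<epsilon> j)) (\<lambda>j. bb j (qA a)) nB"
  have m: "qA a \<in> V" using a by simp
  have mB: "qA a \<in> mpoints (base B)" using VM[OF m] by simp
  have x: "bb j (qA a) \<in> vpoints B \<and> qB (bb j (qA a)) = qA a" if "j < nB" for j
    using bb[OF m that] by simp
  note bi = lcomb_in[OF vB mB x]
  \<comment> \<open>The factors \<open>inverse (\<epsilon> j)\<close> cancel the scaling of the
    frame, so both sides have the same coordinates.\<close>
  have "?b = b"
  proof (rule lincoord_inj[OF lb])
    fix i assume i: "i < nB"
    have "\<beta> ?b i = (\<Sum>j<nB. \<beta> b j * inverse (\<epsilon> j) * \<beta> (bb j (qA a)) i)"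
      by (rule lincoord_lcomb[OF vB lb m x])
    also have "\<dots> = (\<Sum>j<nB. if j = i then \<beta> b i else 0)"
      by (rule sum.cong) (use bb(4)[OF m] \<epsilon> in \<open>force simp: unitv_def\<close>)+
    also have "\<dots> = \<beta> b i" using i by simp
    finally show "\<beta> ?b i = \<beta> b i" .
  qed (use bi b m in auto)
  then show "pB (\<sigma> a b) = b" unfolding \<sigma>_def using lc_in(3)[OF a order_refl] by simp
qed

lemma sig_add_b:
  assumes a: "a \<in> over A V" and b: "b \<in> vpoints B" "qB b = qA a" "b' \<in> vpoints B" "qB b' = qA a"
  shows "\<sigma> a (vadd B b b') = addA (\<sigma> a b) (\<sigma> a b')"
proof -
  have x: "el j a \<in> vpoints DA \<and> pA (el j a) = a" if "j < nB" for j using el[OF a that] by simp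
  have "(\<lambda>j. \<beta> (vadd B b b') j * inverse (\<epsilon> j)) = (\<lambda>j. \<beta> b j * inverse (\<epsilon> j) + \<beta> b' j * inverse (\<epsilon> j))"
    using lb'(8)[of b b'] a b by (simp add: distrib_right)
  then show ?thesis unfolding \<sigma>_def using lcomb_add[OF vDA _ x] a by simp
qed

lemma sig_scl_b:
  assumes a: "a \<in> over A V" and b: "b \<in> vpoints B" "qB b = qA a"
  shows "\<sigma> a (vscale B t b) = sclA t (\<sigma> a b)"
proof -
  have x: "el j a \<in> vpoints DA \<and> pA (el j a) = a" if "j < nB" for j using el[OF a that] by simp
  have "(\<lambda>j. \<beta> (vscale B t b) j * inverse (\<epsilon> j)) = (\<lambda>j. t * (\<beta> b j * inverse (\<epsilon> j)))"
    using lb'(9)[of b t] a b by (simp add: mult.assoc)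
  then show ?thesis unfolding \<sigma>_def using lcomb_scale[OF vDA _ x] a by simp
qed

text \<open>In the second argument linearity is built into the coefficients. In the first it holds
  for each \<open>el j\<close>, and the interchange law carries it through the combination formed
  over \<open>A\<close>.\<close>

lemma sig_add_a:
  assumes a: "a \<in> over A V" "a' \<in> vpoints A" "qA a' = qA a"
  shows "\<sigma> (vadd A a a') b = addB (\<sigma> a b) (\<sigma> a' b)"
proof -
  have a': "a' \<in> over A V" using a by simp
  have s: "vadd A a a' \<in> over A V" "qA (vadd A a a') = qA a" using opsa(1)[of a a'] a by auto
  have "lcomb DA (vadd A a a') c (\<lambda>j. el j (vadd A a a')) n =
      addB (lcomb DA a c (\<lambda>j. el j a) n) (lcomb DA a' c (\<lambda>j. el j a') n)" if "n \<le> nB" for n c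
    using that
  proof (induction n)
    case 0
    then show ?case using sA(5)[of a a'] a by simp
  next
    case (Suc n)
    then have n: "n < nB" "n \<le> nB" by auto
    note l1 = lc_in[OF a(1) n(2), of c] and l2 = lc_in[OF a' n(2), of c]
    note e1 = el[OF a(1) n(1)] and e2 = el[OF a' n(1)]
    note s1 = opsA(2)[OF e1(1), of "c n"] and s2 = opsA(2)[OF e2(1), of "c n"]
    have eq: "pB (el n a') = pB (el n a)" using e1(2) e2(2) a(3) by simp
    have "sclA (c n) (el n (vadd A a a')) = addB (sclA (c n) (el n a)) (sclA (c n) (el n a'))"
      using el_add[OF a n(1)] sA(8)[OF e1(1) e2(1) eq] by simp
    then show ?case
      using Suc.IH n sA(11)[of "lcomb DA a c (\<lambda>j. el j a) n" "sclA (c n) (el n a)"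
          "lcomb DA a' c (\<lambda>j. el j a') n" "sclA (c n) (el n a')"]
        l1 l2 s1 s2 e1(3) e2(3) a(3) sA(7)[OF e1(1), of "c n"] sA(7)[OF e2(1), of "c n"] eq by simp
  qed
  then show ?thesis unfolding \<sigma>_def by simp
qed

lemma sig_scl_a:
  assumes a: "a \<in> over A V"
  shows "\<sigma> (vscale A t a) b = sclB t (\<sigma> a b)"
proof -
  have s: "vscale A t a \<in> over A V" "qA (vscale A t a) = qA a" using opsa(2)[of a t] a by auto
  have "lcomb DA (vscale A t a) c (\<lambda>j. el j (vscale A t a)) n = sclB t (lcomb DA a c (\<lambda>j. el j a) n)" if "n \<le> nB" for n c
    using that
  proof (induction n)
    case 0
    then show ?case using sA(6)[of a t] a by simp
  next
    case (Suc n)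
    then have n: "n < nB" "n \<le> nB" by auto
    note l1 = lc_in[OF a(1) n(2), of c]
    note e1 = el[OF a(1) n(1)]
    note s1 = opsA(2)[OF e1(1), of "c n"]
    show ?case
      using Suc.IH n sA(12)[of "lcomb DA a c (\<lambda>j. el j a) n" "sclA (c n) (el n a)" t]
        l1 s1 e1(1,3) el_scl[OF a n(1), of t] sA(9)[OF e1(1), of "c n" t] by simp
  qed
  then show ?thesis unfolding \<sigma>_def by simp
qed

text \<open>\<open>\<delta> d\<close> lies over \<open>pA d\<close> and over a zero of
  \<open>B\<close>. It belongs to the core only up to translation by the zero element over
  \<open>pA d\<close>, a translation that the coordinates from \<open>nA\<close> on do not
  see.\<close>

definition \<delta> :: "'d \<Rightarrow> 'd" where
  "\<delta> d = addA d (sclA (-1) (\<sigma> (pA d) (pB d)))"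

lemma DVD:
  assumes "d \<in> DV"
  shows "d \<in> D" "pA d \<in> over A V" "pB d \<in> vpoints B" "qB (pB d) = qA (pA d)"
    "qA (pA d) \<in> V" "qA (pA d) \<in> mpoints M"
  using assms vbDA(6)[of d] vbDB(6)[of d] proj_proj[of d] VM by auto

lemma del:
  assumes d: "d \<in> DV"
  shows "\<delta> d \<in> D" "pA (\<delta> d) = pA d" "pB (\<delta> d) = vzero B (qA (pA d))"
proof -
  note d' = DVD[OF d]
  note s = sig[OF d'(2-4)]
  note n = opsA(2)[OF s(1), of "-1"]
  show "\<delta> d \<in> D" "pA (\<delta> d) = pA d" unfolding \<delta>_def using opsA(1)[OF d'(1), of "sclA (-1) (\<sigma> (pA d) (pB d))"] n s by auto
  show "pB (\<delta> d) = vzero B (qA (pA d))" unfolding \<delta>_def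
    using sB(2)[OF d'(1), of "sclA (-1) (\<sigma> (pA d) (pB d))"] n s sA(7)[OF s(1), of "-1"] vb_alg(10)[OF vB d'(3)] d'(4) by simp
qed

text \<open>Above the zero of \<open>B\<close> the two additions can be compared. Write
  \<open>x\<close> as \<open>addB x' z\<close> with \<open>z\<close> the zero over
  \<open>pA x\<close> and \<open>x'\<close> in the core; the interchange law turns
  \<open>addA x y\<close> into \<open>addB x' y\<close>. The coordinates are linear over
  \<open>B\<close> and vanish on \<open>z\<close>.\<close>

lemma core_add:
  assumes x: "x \<in> D" "y \<in> D" "pA y = pA x" "qA (pA x) \<in> V"
    and b: "pB x = vzero B (qA (pA x))" "pB y = vzero B (qA (pA x))" and i: "nA \<le> i"
  shows "\<theta> (addA x y) i = \<theta> x i + \<theta> y i"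
proof -
  define a where "a = pA x"
  define m where "m = qA a"
  have m: "m \<in> V" "m \<in> mpoints M" using x(4) VM by (auto simp: m_def a_def)
  have a: "a \<in> vpoints A" "a \<in> over A V" "qA a = m" using vbDA(6)[OF x(1)] x(4) by (auto simp: a_def m_def)
  define z where "z = vzero DA a"
  have z: "z \<in> D" "pA z = a" "pB z = vzero B m" using opsA(3)[OF a(1)] sA(4)[OF a(1)] a(3) by (auto simp: z_def)
  have bx: "pB x = vzero B m" "pB y = vzero B m" using b by (auto simp: m_def a_def)
  have W: "vzero B m \<in> W" by (rule zW[OF m(1)])
  define nz where "nz = sclB (-1) z"
  have nz: "nz \<in> D" "pB nz = vzero B m" using opsB(2)[OF z(1), of "-1"] z by (auto simp: nz_def)
  define x' where "x' = addB x nz"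
  have x': "x' \<in> D" "pB x' = vzero B m" using opsB(1)[OF x(1) nz(1)] nz bx by (auto simp: x'_def)
  have px': "pA x' = vzero A m"
    using sA(2)[OF x(1) nz(1)] nz bx sA(3)[OF z(1), of "-1"] z(2) vb_alg(10)[OF vA a(1)] a(3)
    by (simp add: x'_def nz_def a_def[symmetric])
  define zD where "zD = vzero DA (vzero A m)"
  have zB: "zD = vzero DB (vzero B m)" using vzero_vzero[OF m(2)] by (simp add: zD_def)
  have vza: "vzero A m \<in> vpoints A" using opsa(3)[OF m(2)] by simp
  have zD: "zD \<in> D" "pA zD = vzero A m" "pB zD = vzero B m"
    using opsA(3)[OF vza] sA(4)[OF vza] opsa(3)[OF m(2)] by (auto simp: zD_def)
  have xx: "x = addB x' z"
  proof -
    have "addB x' z = addB x (addB nz z)" unfolding x'_def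
      using vb_alg(1)[OF vDB, of x nz z] x(1) nz z bx by simp
    also have "addB nz z = addB z nz" using vb_alg(2)[OF vDB, of nz z] nz z by simp
    also have "\<dots> = vzero DB (pB x)" unfolding nz_def using vb_alg(10)[OF vDB, of z] z bx by simp
    also have "addB x \<dots> = x" using vb_alg(4)[OF vDB, of x] x(1) by simp
    finally show ?thesis ..
  qed
  have yy: "y = addB zD y" using vb_alg(3)[OF vDB, of y] x(2) bx zB by simp
  \<comment> \<open>\<open>zD\<close> is a zero element of both structures, so \<open>y\<close> can
    be split as well, and each of the two inner sums over \<open>A\<close> loses one term.\<close>
  have "addA x y = addA (addB x' z) (addB zD y)" using xx yy by simp
  also have "\<dots> = addB (addA x' zD) (addA z y)"
    by (rule sA(11)) (use x' z zD x px' bx in \<open>auto simp: a_def\<close>)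
  also have "addA x' zD = x'" using vb_alg(4)[OF vDA, of x'] x'(1) px' by (simp add: zD_def)
  also have "addA z y = y" using vb_alg(3)[OF vDA, of y] x by (simp add: z_def a_def)
  finally have "addA x y = addB x' y" .
  moreover have "\<theta> (addB x' y) i = \<theta> x' i + \<theta> y i" using lD'(8)[of x' y i] x' x bx W by simp
  moreover have "\<theta> x' i = \<theta> x i + \<theta> nz i" unfolding x'_def using lD'(8)[of x nz i] nz x bx W by simp
  moreover have "\<theta> nz i = 0" unfolding nz_def using lD'(9)[of z "-1" i] z W \<theta>0[OF a(2) i] by (simp add: z_def)
  ultimately show ?thesis by simp
qed

text \<open>The argument by interchange gives additivity over \<open>A\<close> only. As a function
  of \<open>t\<close> the coordinate of \<open>sclA t x\<close> is additive and smooth, hence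
  linear.\<close>

lemma core_scl:
  assumes x: "x \<in> D" "qA (pA x) \<in> V"
    and b: "pB x = vzero B (qA (pA x))" and i: "nA \<le> i" "i < rB"
  shows "\<theta> (sclA t x) i = t * \<theta> x i"
proof -
  define f where "f = (\<lambda>t. \<theta> (sclA t x) i)"
  have mM: "qA (pA x) \<in> mpoints M" using VM[OF x(2)] .
  have s: "sclA t x \<in> D" "pA (sclA t x) = pA x" "pB (sclA t x) = vzero B (qA (pA x))" for t
    using opsA(2)[OF x(1), of t] sA(7)[OF x(1), of t] b vb_alg(11)[OF vB, of "vzero B (qA (pA x))" t] opsb(3)[OF mM]
    by auto
  have W: "vzero B (qA (pA x)) \<in> W" by (rule zW[OF x(2)])
  have add: "f (u + v) = f u + f v" for u v
    unfolding f_def vb_alg(6)[OF vDA x(1)] by (rule core_add) (use s x(2) i in auto)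
  have "smo (EM 1) (EE 1) TD (\<lambda>y. sclA (y 0) x)"
    by (rule smo_vscale[OF vDA charted_euclidean smo_const[OF _ x(1)]])
       (auto simp: sfun_euclidean_iff C_on_coord)
  then have "sfun (EM 1) (EE 1) (\<lambda>y. \<theta> (sclA (y 0) x) i)"
    by (rule smo_sfun'[OF _ lD'(2)[OF i(2)]]) (use s W in auto)
  then have "sfun (EM 1) (EE 1) (\<lambda>y. f (y 0))" by (simp add: f_def)
  from sfun_line_DERIV[OF this, of "\<lambda>_. 0"] obtain l where "(f has_real_derivative l) (at 0)"
    by (auto simp: topspace_Euclidean_space)
  from DERIV_additive_linear[of f, OF add this, of t] show ?thesis
    using vb_alg(8)[OF vDA x(1)] by (simp add: f_def)
qed

section \<open>Core coordinates and their linearity for both structures\<close>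

definition \<gamma> :: "'d \<Rightarrow> nat \<Rightarrow> real" where
  "\<gamma> d = (\<lambda>l. \<theta> (\<delta> d) (nA + l))"

lemma del_W: "d \<in> DV \<Longrightarrow> \<delta> d \<in> overB W"
  using del[of d] zW[of "qA (pA d)"] by simp

lemma gam_EE: "d \<in> DV \<Longrightarrow> \<gamma> d \<in> EE nC"
  unfolding \<gamma>_def using EE_ge[OF lD'(3)[OF del_W]] rk by (auto simp: topspace_Euclidean_space)

text \<open>\<open>\<sigma>\<close> is additive in its second argument, so \<open>\<delta>\<close>
  is additive over \<open>A\<close>; on its values the coordinates are additive by
  \<open>core_add\<close>.\<close>

lemma gam_addA:
  assumes d: "d \<in> DV" "d' \<in> D" "pA d' = pA d"
  shows "\<gamma> (addA d d') l = \<gamma> d l + \<gamma> d' l"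
proof -
  have dV': "d' \<in> DV" using d by simp
  note d1 = DVD[OF d(1)] and d2 = DVD[OF dV']
  note s1 = sig[OF d1(2-4)] and s2 = sig[OF d2(2-4)]
  note n1 = opsA(2)[OF s1(1), of "-1"] and n2 = opsA(2)[OF s2(1), of "-1"]
  have p: "pA (addA d d') = pA d" "pB (addA d d') = vadd B (pB d) (pB d')"
    using opsA(1)[OF d1(1) d2(1) d(3)] sB(2)[OF d1(1) d2(1) d(3)] by auto
  have "\<sigma> (pA d) (vadd B (pB d) (pB d')) = addA (\<sigma> (pA d) (pB d)) (\<sigma> (pA d) (pB d'))"
    by (rule sig_add_b[OF d1(2-4) d2(3)]) (use d2 d in simp)
  then have "\<delta> (addA d d') = addA (addA d d') (addA (sclA (-1) (\<sigma> (pA d) (pB d))) (sclA (-1) (\<sigma> (pA d) (pB d'))))"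
    unfolding \<delta>_def p using vb_alg(5)[OF vDA s1(1), of "\<sigma> (pA d) (pB d')" "-1"] s1 s2 d(3) by simp
  also have "\<dots> = addA (\<delta> d) (\<delta> d')" unfolding \<delta>_def d(3)
    by (rule vb_add4[OF vDA]) (use d1 d2 n1 n2 s1 s2 d in auto)
  finally have "\<delta> (addA d d') = addA (\<delta> d) (\<delta> d')" .
  then show ?thesis unfolding \<gamma>_def
    using core_add[of "\<delta> d" "\<delta> d'" "nA + l"] del[OF d(1)] del[OF dV'] d d1 by simp
qed

lemma gam_sclA:
  assumes d: "d \<in> DV"
  shows "\<gamma> (sclA t d) l = t * \<gamma> d l"
proof -
  note d1 = DVD[OF d(1)]
  note s1 = sig[OF d1(2-4)]
  note n1 = opsA(2)[OF s1(1), of "-1"]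
  note td = opsA(2)[OF d1(1), of t]
  have p: "pA (sclA t d) = pA d" "pB (sclA t d) = vscale B t (pB d)"
    using td sA(7)[OF d1(1)] by auto
  have "\<delta> (sclA t d) = addA (sclA t d) (sclA t (sclA (-1) (\<sigma> (pA d) (pB d))))"
    unfolding \<delta>_def p sig_scl_b[OF d1(2-4)] using vb_alg(7)[OF vDA s1(1)] by simp
  also have "\<dots> = sclA t (\<delta> d)" unfolding \<delta>_def
    by (rule vb_alg(5)[OF vDA, symmetric]) (use d1 n1 s1 in auto)
  finally have eq: "\<delta> (sclA t d) = sclA t (\<delta> d)" .
  show ?thesis
  proof (cases "nA + l < rB")
    case True
    then show ?thesis unfolding \<gamma>_def eq
      using core_scl[of "\<delta> d" "nA + l" t] del[OF d(1)] d1 by simp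
  next
    \<comment> \<open>Indices past the core rank: both sides are 0 because \<open>\<theta>\<close>
      takes values in \<open>EE rB\<close>.\<close>
    case False
    have "sclA t d \<in> DV" using td d1 by simp
    then show ?thesis unfolding \<gamma>_def using EE_ge[OF lD'(3)[OF del_W], of _ "nA + l"] d False by simp
  qed
qed

text \<open>The subtraction in \<open>\<delta>\<close> is over \<open>A\<close>, and the interchange
  law lets addition over \<open>B\<close> pass through it. For the coordinates themselves linearity
  over \<open>B\<close> is given.\<close>

lemma gam_addB:
  assumes d: "d \<in> DV" "d' \<in> D" "pB d' = pB d"
  shows "\<gamma> (addB d d') l = \<gamma> d l + \<gamma> d' l"
proof -
  have q: "qA (pA d') = qA (pA d)" using proj_proj[of d] proj_proj[of d'] d by simp
  have dV': "d' \<in> DV" using d q by simp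
  note d1 = DVD[OF d(1)] and d2 = DVD[OF dV']
  note s1 = sig[OF d1(2-4)] and s2 = sig[OF d2(2-4)]
  note n1 = opsA(2)[OF s1(1), of "-1"] and n2 = opsA(2)[OF s2(1), of "-1"]
  have p: "pB (addB d d') = pB d" "pA (addB d d') = vadd A (pA d) (pA d')"
    using opsB(1)[OF d1(1) d2(1) d(3)] sA(2)[OF d1(1) d2(1) d(3)] by auto
  have eqB: "pB (\<sigma> (pA d') (pB d')) = pB (\<sigma> (pA d) (pB d))" using s1 s2 d(3) by simp
  have "\<sigma> (vadd A (pA d) (pA d')) (pB d) = addB (\<sigma> (pA d) (pB d)) (\<sigma> (pA d') (pB d'))"
    using sig_add_a[OF d1(2) _ q] d2 d(3) by simp
  then have "\<delta> (addB d d') = addA (addB d d') (addB (sclA (-1) (\<sigma> (pA d) (pB d))) (sclA (-1) (\<sigma> (pA d') (pB d'))))"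
    unfolding \<delta>_def p using sA(8)[OF s1(1) s2(1) eqB, of "-1"] by simp
  also have "\<dots> = addB (\<delta> d) (\<delta> d')" unfolding \<delta>_def
    by (rule sA(11)) (use d1 d2 n1 n2 s1 s2 d sA(7)[OF s1(1), of "-1"] sA(7)[OF s2(1), of "-1"] in auto)
  finally have "\<delta> (addB d d') = addB (\<delta> d) (\<delta> d')" .
  then show ?thesis unfolding \<gamma>_def
    using lD'(8)[OF del_W[OF d(1)], of "\<delta> d'"] del[OF d(1)] del[OF dV'] q by simp
qed

lemma gam_sclB:
  assumes d: "d \<in> DV"
  shows "\<gamma> (sclB t d) l = t * \<gamma> d l"
proof -
  note d1 = DVD[OF d(1)]
  note s1 = sig[OF d1(2-4)]
  note n1 = opsA(2)[OF s1(1), of "-1"]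
  note td = opsB(2)[OF d1(1), of t]
  have p: "pB (sclB t d) = pB d" "pA (sclB t d) = vscale A t (pA d)"
    using td sA(3)[OF d1(1)] by auto
  have "\<delta> (sclB t d) = addA (sclB t d) (sclB t (sclA (-1) (\<sigma> (pA d) (pB d))))"
    unfolding \<delta>_def p sig_scl_a[OF d1(2)] using sA(9)[OF s1(1)] by simp
  also have "\<dots> = sclB t (\<delta> d)" unfolding \<delta>_def
    by (rule sA(12)) (use d1 n1 s1 in auto)
  finally have eq: "\<delta> (sclB t d) = sclB t (\<delta> d)" .
  show ?thesis unfolding \<gamma>_def eq using lD'(9)[OF del_W[OF d]] .
qed

definition cor :: "'m \<Rightarrow> (nat \<Rightarrow> real) \<Rightarrow> (nat \<Rightarrow> real) \<Rightarrow> 'd" where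
  "cor m v w = h (vzero B m) (join_coords nA v w)"

text \<open>\<open>cor m v w\<close> lies over \<open>hA m v\<close> and the zero of
  \<open>B\<close>; adding it over \<open>A\<close> to the section changes the core coordinates and
  leaves both projections alone.\<close>

definition G :: "'m \<Rightarrow> (nat \<Rightarrow> real) \<Rightarrow> (nat \<Rightarrow> real) \<Rightarrow> (nat \<Rightarrow> real) \<Rightarrow> 'd" where
  "G m v u w = addA (\<sigma> (hA m v) (hB m u)) (cor m v w)"

lemma cor:
  assumes m: "m \<in> V" and v: "v \<in> EE nA" and w: "w \<in> EE nC"
  shows "cor m v w \<in> D" "pB (cor m v w) = vzero B m" "pA (cor m v w) = hA m v" "\<theta> (cor m v w) (nA + l) = w l"
proof -
  have j: "join_coords nA v w \<in> EE rB" using join_coords_EE[OF w, of nA v] rk by simp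
  note d = lD'(5,6,7)[OF zW[OF m] j]
  show e: "cor m v w \<in> D" "pB (cor m v w) = vzero B m" using d by (auto simp: cor_def)
  have dW: "cor m v w \<in> overB W" using e zW[OF m] by simp
  note a = la'(5,6,7)[OF m v]
  show "pA (cor m v w) = hA m v"
  proof (rule lincoord_inj[OF la pAV[OF dW]])
    show "qA (hA m v) = qA (pA (cor m v w))" using proj_proj[OF e(1)] e(2) a opsb(3)[OF VM[OF m]] by simp
    fix i assume i: "i < nA"
    show "\<alpha> (pA (cor m v w)) i = \<alpha> (hA m v) i"
      using \<theta>\<alpha>[OF i dW] d(3) a(3) i by (simp add: cor_def join_coords_def)
  qed (rule a(1))
  show "\<theta> (cor m v w) (nA + l) = w l" using d(3) by (simp add: cor_def join_coords_def)
qed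

lemma Gprops:
  assumes m: "m \<in> V" and v: "v \<in> EE nA" and u: "u \<in> EE nB" and w: "w \<in> EE nC"
  shows "G m v u w \<in> D" "pA (G m v u w) = hA m v" "pB (G m v u w) = hB m u" "\<gamma> (G m v u w) = w"
    "G m v u w \<in> DV" "qA (pA (G m v u w)) = m" "\<alpha> (pA (G m v u w)) = v" "\<beta> (pB (G m v u w)) = u"
proof -
  note a = la'(5,6,7)[OF m v] and b = lb'(5,6,7)[OF m u] and c = cor[OF m v w]
  have aV: "hA m v \<in> over A V" using a m by simp
  have q: "qB (hB m u) = qA (hA m v)" using a b by simp
  note s = sig[OF aV b(1) q]
  have mM: "m \<in> mpoints M" by (rule VM[OF m])
  show g: "G m v u w \<in> D" "pA (G m v u w) = hA m v"
    unfolding G_def using opsA(1)[OF s(1) c(1)] s c by auto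
  show gb: "pB (G m v u w) = hB m u"
    unfolding G_def using sB(2)[OF s(1) c(1)] s c vb_alg(4)[OF vB b(1)] b(2) by simp
  show "G m v u w \<in> DV" "qA (pA (G m v u w)) = m" "\<alpha> (pA (G m v u w)) = v" "\<beta> (pB (G m v u w)) = u"
    using g gb a b m by auto
  let ?s = "\<sigma> (hA m v) (hB m u)" and ?c = "cor m v w"
  note n = opsA(2)[OF s(1), of "-1"]
  have "\<delta> (G m v u w) = addA (addA ?s ?c) (sclA (-1) ?s)" unfolding \<delta>_def g gb G_def[symmetric] ..
  also have "addA ?s ?c = addA ?c ?s" using vb_alg(2)[OF vDA s(1) c(1)] s c by simp
  also have "addA (addA ?c ?s) (sclA (-1) ?s) = addA ?c (addA ?s (sclA (-1) ?s))"
    using vb_alg(1)[OF vDA c(1) s(1), of "sclA (-1) ?s"] n s c by simp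
  also have "addA ?s (sclA (-1) ?s) = vzero DA (pA ?c)" using vb_alg(10)[OF vDA s(1)] s c by simp
  also have "addA ?c \<dots> = ?c" by (rule vb_alg(4)[OF vDA c(1)])
  finally show "\<gamma> (G m v u w) = w" unfolding \<gamma>_def using c(4) by auto
qed

text \<open>The summand rebuilt by \<open>cor\<close> is \<open>\<delta> d\<close>, and adding the
  section over \<open>A\<close> undoes the subtraction in \<open>\<delta>\<close>.\<close>

lemma G_inv:
  assumes d: "d \<in> DV"
  shows "G (qA (pA d)) (\<alpha> (pA d)) (\<beta> (pB d)) (\<gamma> d) = d"
proof -
  note d' = DVD[OF d]
  let ?m = "qA (pA d)"
  have bV: "pB d \<in> over B V" using d' by simp
  have a: "hA ?m (\<alpha> (pA d)) = pA d" by (rule la'(4)[OF d'(2)])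
  have b: "hB ?m (\<beta> (pB d)) = pB d" using lb'(4)[OF bV] d'(4) by simp
  note c = cor[OF d'(5) la'(3)[OF d'(2)] gam_EE[OF d]]
  note s = sig[OF d'(2-4)]
  note n = opsA(2)[OF s(1), of "-1"]
  have "cor ?m (\<alpha> (pA d)) (\<gamma> d) = \<delta> d"
  proof (rule D_eqI)
    show "\<theta> (cor ?m (\<alpha> (pA d)) (\<gamma> d)) (nA + l) = \<theta> (\<delta> d) (nA + l)" for l
      using c(4) by (simp add: \<gamma>_def)
  qed (use c del[OF d] a zW[OF d'(5)] in auto)
  then have "G ?m (\<alpha> (pA d)) (\<beta> (pB d)) (\<gamma> d) = addA (\<sigma> (pA d) (pB d)) (addA d (sclA (-1) (\<sigma> (pA d) (pB d))))"
    unfolding G_def a b by (simp add: \<delta>_def)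
  also have "\<dots> = addA (addA (\<sigma> (pA d) (pB d)) d) (sclA (-1) (\<sigma> (pA d) (pB d)))"
    using vb_alg(1)[OF vDA s(1) d'(1), of "sclA (-1) (\<sigma> (pA d) (pB d))"] n s by simp
  also have "addA (\<sigma> (pA d) (pB d)) d = addA d (\<sigma> (pA d) (pB d))" using vb_alg(2)[OF vDA s(1) d'(1)] s by simp
  also have "addA (addA d (\<sigma> (pA d) (pB d))) (sclA (-1) (\<sigma> (pA d) (pB d))) =
      addA d (addA (\<sigma> (pA d) (pB d)) (sclA (-1) (\<sigma> (pA d) (pB d))))"
    using vb_alg(1)[OF vDA d'(1) s(1), of "sclA (-1) (\<sigma> (pA d) (pB d))"] n s by simp
  also have "addA (\<sigma> (pA d) (pB d)) (sclA (-1) (\<sigma> (pA d) (pB d))) = vzero DA (pA d)"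
    using vb_alg(10)[OF vDA s(1)] s by simp
  also have "addA d (vzero DA (pA d)) = d" by (rule vb_alg(4)[OF vDA d'(1)])
  finally show ?thesis .
qed

lemma smo_sig:
  assumes X: "charted X" and a: "smo X P (total_space A) a" and b: "smo X P (total_space B) b"
    and aV: "\<And>x. x \<in> P \<Longrightarrow> a x \<in> over A V" and q: "\<And>x. x \<in> P \<Longrightarrow> qB (b x) = qA (a x)"
  shows "smo X P TD (\<lambda>x. \<sigma> (a x) (b x))"
  unfolding \<sigma>_def
proof (rule smo_lcomb[OF vDA X, where x="\<lambda>j x. el j (a x)" and c="\<lambda>j x. \<beta> (b x) j * inverse (\<epsilon> j)"])
  show "smo X P (base DA) a" using a by simp
  fix j assume j: "j < nB"
  have q': "smo X P M (\<lambda>x. qA (a x))" by (rule smo_compose[OF a vba(5)]) (use aV in auto)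
  have "smo X P (total_space B) (\<lambda>x. hB (qA (a x)) (trunc nB (unitv j)))"
    using lincoord_smo[OF lb X, unfolded baseB, OF vba(2) q', of "\<lambda>_. unitv j"] aV smo_openin[OF a]
    by (auto intro: sfun_const)
  then have "smo X P (total_space B) (\<lambda>x. hB (qA (a x)) (unitv j))"
    by (rule smo_cong[OF X]) (use trunc_id[OF unitv_EE[OF j]] in simp)
  from smo_vscale[OF vB X this sfun_const[OF smo_openin[OF a]], of "\<epsilon> j"]
  have bs: "smo X P (total_space B) (\<lambda>x. bb j (qA (a x)))" by (simp add: bb_def)
  have \<alpha>s: "sfun X P (\<lambda>x. \<alpha> (a x) i)" if "i < rB" for i
  proof (cases "i < nA")
    case True
    show ?thesis by (rule smo_sfun'[OF a la'(2)[OF True]]) (use aV in auto)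
  next
    case False
    have "sfun X P (\<lambda>x. 0)" by (rule sfun_const[OF smo_openin[OF a]])
    then show ?thesis by (rule sfun_cong[OF X]) (use EE_ge[OF la'(3)[OF aV]] False in simp)
  qed
  have "smo X P TD (\<lambda>x. h (bb j (qA (a x))) (trunc rB (\<alpha> (a x))))"
    by (rule lincoord_smo[OF lD X, unfolded tot baseDB, OF vbb(1) bs]) (use bb(3)[OF _ j] aV \<alpha>s in auto)
  then show "smo X P (total_space DA) (\<lambda>x. el j (a x))"
    by (rule smo_cong[OF X]) (use trunc_id[OF \<alpha>_EE[OF aV]] in \<open>simp add: el_def\<close>)
  show "proj DA (el j (a y)) = a y" if "y \<in> P" for y by (rule el(3)[OF aV[OF that] j])
  have "sfun X P (\<lambda>x. \<beta> (b x) j)"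
    by (rule smo_sfun'[OF b lb'(2)[OF j]]) (use aV q smo_in[OF b] in auto)
  then show "sfun X P (\<lambda>x. \<beta> (b x) j * inverse (\<epsilon> j))"
    by (intro sfun_mult[OF X] sfun_const smo_openin[OF a])
qed

lemma open_DV: "openin (mtop TD) DV"
proof -
  have "smo TD D M (\<lambda>d. qA (pA d))" by (rule smo_compose[OF vbDA(5) vba(5)]) (use vbDA(6) in auto)
  from smo_vimage_open[OF this la'(1)] show ?thesis .
qed

lemma sfun_gam:
  assumes l: "l < nC"
  shows "sfun TD DV (\<lambda>d. \<gamma> d l)"
proof -
  have a: "smo TD DV (total_space A) pA" by (rule smo_subset[OF vbDA(5) open_DV]) auto
  have b: "smo TD DV (total_space B) pB" by (rule smo_subset[OF vbDB(5) open_DV]) auto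
  have s: "smo TD DV TD (\<lambda>d. \<sigma> (pA d) (pB d))"
    by (rule smo_sig[OF vbDA(3) a b]) (erule DVD(2), erule DVD(4))
  have n: "smo TD DV TD (\<lambda>d. sclA (-1) (\<sigma> (pA d) (pB d)))"
    by (rule smo_vscale[OF vDA vbDA(3) s sfun_const[OF open_DV]])
  have "smo TD DV TD \<delta>" unfolding \<delta>_def[abs_def]
  proof (rule smo_vadd[OF vDA vbDA(3) smo_id[OF open_DV] n])
    fix d assume d: "d \<in> DV"
    note s = sig[OF DVD(2-4)[OF d]]
    show "proj DA (sclA (-1) (\<sigma> (pA d) (pB d))) = proj DA d" using opsA(2)[OF s(1)] s(2) by simp
  qed
  then show ?thesis unfolding \<gamma>_def
    by (rule smo_sfun'[OF _ lD'(2)]) (use del_W l in auto)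
qed

lemma smo_G:
  assumes X: "charted X" and m: "smo X P M m" "m ` P \<subseteq> V"
    and v: "\<And>j. j < nA \<Longrightarrow> sfun X P (\<lambda>x. v x j)" and u: "\<And>j. j < nB \<Longrightarrow> sfun X P (\<lambda>x. u x j)"
    and w: "\<And>j. j < nC \<Longrightarrow> sfun X P (\<lambda>x. w x j)"
  shows "smo X P TD (\<lambda>x. G (m x) (trunc nA (v x)) (trunc nB (u x)) (trunc nC (w x)))"
proof -
  have mV: "m x \<in> V" if "x \<in> P" for x using m(2) that by auto
  have a: "smo X P (total_space A) (\<lambda>x. hA (m x) (trunc nA (v x)))"
    by (rule lincoord_smo[OF la X vba(2) m v])
  have b: "smo X P (total_space B) (\<lambda>x. hB (m x) (trunc nB (u x)))"
    by (rule lincoord_smo[OF lb X, unfolded baseB, OF vba(2) m u])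
  have s: "smo X P TD (\<lambda>x. \<sigma> (hA (m x) (trunc nA (v x))) (hB (m x) (trunc nB (u x))))"
    by (rule smo_sig[OF X a b]) (use la'(5,6) lb'(6) mV in auto)
  have z: "smo X P (total_space B) (\<lambda>x. vzero B (m x))"
    by (rule smo_compose[OF m(1) smo_vzero[OF vB, unfolded baseB]]) (use mV VM in auto)
  have "smo X P TD (\<lambda>x. h (vzero B (m x)) (trunc rB (join_coords nA (v x) (w x))))"
  proof (rule lincoord_smo[OF lD X, unfolded tot baseDB, OF vbb(1) z])
    fix j assume "j < rB"
    then show "sfun X P (\<lambda>x. join_coords nA (v x) (w x) j)"
      using v[of j] w[of "j - nA"] by (cases "j < nA") (auto simp: join_coords_def)
  qed (use zW mV in auto)
  then have c: "smo X P TD (\<lambda>x. cor (m x) (trunc nA (v x)) (trunc nC (w x)))"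
  proof (rule smo_cong[OF X])
    fix x
    have "trunc rB (join_coords nA (v x) (w x)) = join_coords nA (trunc nA (v x)) (trunc nC (w x))"
      using rk by (auto simp: fun_eq_iff join_coords_def trunc_def)
    then show "h (vzero B (m x)) (trunc rB (join_coords nA (v x) (w x))) = cor (m x) (trunc nA (v x)) (trunc nC (w x))"
      by (simp add: cor_def)
  qed
  show ?thesis unfolding G_def
    by (rule smo_vadd[OF vDA X s c]) (use cor(3) sig(2) la'(5,6) lb'(5,6) mV in auto)
qed

end

section \<open>Charts of \<open>D\<close> adapted to the splitting\<close>

context dvb_local begin

text \<open>The core coordinates stand before those of \<open>A\<close> and \<open>B\<close>, so
  that the core is cut out by the vanishing of the trailing coordinates, as
  \<open>submanifold\<close> demands.\<close>

definition dchart :: "('m \<Rightarrow> nat \<Rightarrow> real) \<Rightarrow> 'd \<Rightarrow> nat \<Rightarrow> real" where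
  "dchart \<phi> d = join_coords (mdim M) (\<phi> (qA (pA d))) (join_coords nC (\<gamma> d) (join_coords nA (\<alpha> (pA d)) (\<beta> (pB d))))"

lemma mdim_D: "mdim TD = mdim M + (nC + (nA + nB))"
  using vbDB(7) vbb(7) rk by simp

lemma sfun_join:
  assumes X: "charted X" and f: "\<And>i. i < m \<Longrightarrow> sfun X P (\<lambda>x. f x i)" and g: "\<And>i. i < n \<Longrightarrow> sfun X P (\<lambda>x. g x i)" and j: "j < m + n"
  shows "sfun X P (\<lambda>x. join_coords m (f x) (g x) j)"
  using f[of j] g[of "j - m"] j by (cases "j < m") (auto simp: join_coords_def)

text \<open>Through \<open>maximal_atlasI\<close> no transition map has to be examined: the
  coordinates are smooth functions on \<open>D\<close>, and \<open>G\<close> supplies the smooth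
  inverse.\<close>

lemma dchart_maximal:
  assumes U: "(U, \<phi>) \<in> atlas M"
  shows "({d \<in> D. qA (pA d) \<in> V \<inter> U}, dchart \<phi>) \<in> maximal_atlas TD"
    "dchart \<phi> ` {d \<in> D. qA (pA d) \<in> V \<inter> U} = {z \<in> EE (mdim TD). trunc (mdim M) z \<in> \<phi> ` (V \<inter> U)}"
proof -
  let ?n = "mdim M"
  let ?P = "{d \<in> D. qA (pA d) \<in> V \<inter> U}"
  let ?Q = "{z \<in> EE (mdim TD). trunc ?n z \<in> \<phi> ` (V \<inter> U)}"
  note ch = is_chartD[OF charted_chart[OF vba(4) U]]
  have oVU: "openin (mtop M) (V \<inter> U)" using la'(1) ch(1) by auto
  have q: "smo TD D M (\<lambda>d. qA (pA d))" by (rule smo_compose[OF vbDA(5) vba(5)]) (use vbDA(6) in auto)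
  have oP: "openin (mtop TD) ?P" using smo_vimage_open[OF q oVU] .
  have PDV: "d \<in> DV" if "d \<in> ?P" for d using that by simp
  have oQ: "openin (Euclidean_space (mdim TD)) ?Q"
    unfolding mdim_D by (rule openin_continuous_map_preimage[OF continuous_map_trunc_EE]) (rule ch(8), use oVU in auto)
  let ?m = "\<lambda>z. inv_into U \<phi> (trunc ?n z)"
  let ?v = "\<lambda>z. shift nC (shift ?n z)"
  let ?h = "\<lambda>z. G (?m z) (trunc nA (?v z)) (trunc nB (shift nA (?v z))) (trunc nC (shift ?n z))"
  have mV: "?m z \<in> V \<inter> U" "\<phi> (?m z) = trunc ?n z" if "z \<in> ?Q" for z
    using that ch(6) by auto
  have sm: "smo (EM (mdim TD)) ?Q M ?m"
  proof (rule smo_compose[OF _ smo_chart_inverse[OF vba(4) atlas_maximal[OF vba(2) U]]])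
    show "smo (EM (mdim TD)) ?Q (EM ?n) (trunc ?n)"
      using smo_to_euclidean[OF charted_euclidean, of "mdim TD" ?Q ?n "\<lambda>x. x"] oQ
      by (auto simp: sfun_euclidean_iff C_on_coord)
  qed auto
  have c: "sfun (EM (mdim TD)) ?Q (\<lambda>z. z j)" for j using oQ by (simp add: sfun_euclidean_iff C_on_coord)
  have h: "smo (EM (mdim TD)) ?Q TD ?h"
    by (rule smo_G[OF charted_euclidean sm]) (use mV(1) c in auto)
  have nQ: "shift nA (?v z) \<in> EE nB" if "z \<in> ?Q" for z
    using that unfolding mdim_D by (intro shift_EE) auto
  have 1: "dchart \<phi> d \<in> ?Q \<and> ?h (dchart \<phi> d) = d" if d: "d \<in> ?P" for d
  proof -
    note d' = DVD[OF PDV[OF d]]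
    have b: "pB d \<in> over B V" using d' by simp
    have e: "\<phi> (qA (pA d)) \<in> EE ?n" "\<alpha> (pA d) \<in> EE nA" "\<beta> (pB d) \<in> EE nB" "\<gamma> d \<in> EE nC"
      using ch(5) d la'(3)[OF d'(2)] lb'(3)[OF b] gam_EE[OF PDV[OF d]] by auto
    have "dchart \<phi> d \<in> EE (mdim TD)" unfolding mdim_D dchart_def by (intro join_coords_EE e)
    moreover have "trunc ?n (dchart \<phi> d) = \<phi> (qA (pA d))" unfolding dchart_def by (rule trunc_join[OF e(1)])
    ultimately show ?thesis
      using d G_inv[OF PDV[OF d]] ch(6) e
      by (simp add: dchart_def shift_join trunc_join trunc_id)
  qed
  have 2: "?h z \<in> ?P \<and> dchart \<phi> (?h z) = z" if z: "z \<in> ?Q" for z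
  proof -
    have zE: "z \<in> EE (?n + (nC + (nA + nB)))" using z unfolding mdim_D by simp
    have "?m z \<in> V" using mV(1)[OF z] by simp
    note g = Gprops[OF this trunc_EE trunc_EE trunc_EE, of "?v z" "shift nA (?v z)" "shift ?n z"]
    have "dchart \<phi> (?h z) = join_coords ?n (trunc ?n z) (join_coords nC (trunc nC (shift ?n z))
        (join_coords nA (trunc nA (?v z)) (trunc nB (shift nA (?v z)))))"
      unfolding dchart_def g(4,6,7,8) using mV(2)[OF z] by simp
    also have "\<dots> = z" unfolding trunc_id[OF nQ[OF z]] by (simp only: join_split)
    finally show ?thesis using g(1,6) mV(1)[OF z] by simp
  qed
  have 3: "sfun TD ?P (\<lambda>d. dchart \<phi> d j)" if j: "j < mdim TD" for j
  proof -
    have 1: "sfun TD ?P (\<lambda>d. \<phi> (qA (pA d)) i)" if "i < ?n" for i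
      by (rule smo_sfun'[OF smo_subset[OF q oP] mfd_coord[OF vba(2) U that]]) auto
    have 2: "sfun TD ?P (\<lambda>d. \<gamma> d i)" if "i < nC" for i
      by (rule sfun_subset[OF sfun_gam[OF that] oP]) auto
    have 3: "sfun TD ?P (\<lambda>d. \<alpha> (pA d) i)" if "i < nA" for i
      by (rule smo_sfun'[OF smo_subset[OF vbDA(5) oP] la'(2)[OF that]]) (use vbDA(6) in auto)
    have 4: "sfun TD ?P (\<lambda>d. \<beta> (pB d) i)" if "i < nB" for i
      by (rule smo_sfun'[OF smo_subset[OF vbDB(5) oP] lb'(2)[OF that]]) (use vbDB(6) proj_proj in auto)
    show ?thesis unfolding dchart_def
      by (rule sfun_join[OF vbDA(3) 1 sfun_join[OF vbDA(3) 2 sfun_join[OF vbDA(3) 3 4]] j[unfolded mdim_D]])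
  qed
  show "(?P, dchart \<phi>) \<in> maximal_atlas TD" "dchart \<phi> ` ?P = ?Q"
    using maximal_atlasI[OF vbDA(1) oP oQ 3 h 1 2] by blast+
qed

end

section \<open>Existence of the local data\<close>

context dvb begin

text \<open>Adapted coordinates are normalized on the zero elements over \<open>A\<close>, and the
  frame of \<open>B\<close> at \<open>m0\<close> is scaled into their domain. The conditions reached
  at \<open>m0\<close> are open and finite in number, so they persist nearby.\<close>

lemma local_exists:
  assumes m0: "m0 \<in> mpoints M"
  shows "\<exists>V hA hB W \<theta> h \<epsilon> U1 \<Phi> U2 \<Psi>. m0 \<in> V \<and>
     local_trivialization A U1 \<Phi> \<and> local_trivialization B U2 \<Psi> \<and> V \<subseteq> U1 \<inter> U2 \<and>
     dvb_local DA DB A B V (\<lambda>a. snd (\<Phi> a)) hA (\<lambda>b. snd (\<Psi> b)) hB W \<theta> h \<epsilon>"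
proof -
  obtain U1 \<Phi> \<alpha> hA where U1: "m0 \<in> U1" "local_trivialization A U1 \<Phi>" "lincoord A U1 nA \<alpha> hA" "\<alpha> = (\<lambda>a. snd (\<Phi> a))"
    by (rule vb_lincoord[OF vA m0])
  obtain U2 \<Psi> \<beta> hB where U2: "m0 \<in> U2" "local_trivialization B U2 \<Psi>" "lincoord B U2 nB \<beta> hB" "\<beta> = (\<lambda>b. snd (\<Psi> b))"
    by (rule vb_lincoord[OF vB]) (use m0 in simp)
  note l1 = lincoordD[OF U1(3)] and l2 = lincoordD[OF U2(3), unfolded baseB]
  obtain W \<theta> h where rk: "nA \<le> rB" and W: "lincoord DB W rB \<theta> h" "vzero B m0 \<in> W" "\<And>b. b \<in> W \<Longrightarrow> qB b \<in> U1"
    and \<theta>: "\<And>i d. i < nA \<Longrightarrow> d \<in> overB W \<Longrightarrow> \<theta> d i = \<alpha> (pA d) i"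
    using adapted_coords[OF U1(1,3) order_refl] by auto
  note lW = lincoordD[OF W(1), unfolded tot baseDB]
  \<comment> \<open>Over \<open>V0\<close> the zero section of \<open>B\<close> stays inside
    \<open>W\<close>.\<close>
  define V0 where "V0 = U1 \<inter> U2 \<inter> {m \<in> mpoints M. vzero B m \<in> W}"
  have V0: "openin (mtop M) V0" "m0 \<in> V0" "V0 \<subseteq> U1" "V0 \<subseteq> U2" "V0 \<subseteq> mpoints M" "\<And>m. m \<in> V0 \<Longrightarrow> vzero B m \<in> W"
    unfolding V0_def using l1(1) l2(1) smo_vimage_open[OF smo_vzero[OF vB, unfolded baseB] lW(1)] U1(1) U2(1) m0 W(2)
    by auto
  define W1 where "W1 = W \<inter> over B V0"
  have W1: "openin (mtop (total_space B)) W1" "W1 \<subseteq> W" "\<And>b. b \<in> W1 \<Longrightarrow> qB b \<in> V0" "\<And>m. m \<in> V0 \<Longrightarrow> vzero B m \<in> W1"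
    unfolding W1_def using lW(1) vbb(8)[OF V0(1)] V0(5,6) opsb(3) by auto
  \<comment> \<open>Subtracting the value at the zero element over \<open>pA d\<close> preserves
    linearity over \<open>B\<close>, since projection and zero section are linear, and makes the
    last coordinates vanish on zero elements.\<close>
  define \<theta>' where "\<theta>' = (\<lambda>d i. if i < nA then \<theta> d i else \<theta> d i - \<theta> (vzero DA (pA d)) i)"
  \<comment> \<open>The inverse change adds this value back. It is computable from the new
    coordinates because the first \<open>nA\<close> of them are unchanged and determine
    \<open>pA d\<close>.\<close>
  define u where "u = (\<lambda>b v i. if i < nA then v i else v i + \<theta> (vzero DA (hA (qB b) (trunc nA v))) i)"
  have zer: "vzero DA a \<in> overB W" "pA (vzero DA a) = a" if "a \<in> vpoints A" "qA a \<in> V0" for a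
    using that opsA(3)[of a] sA(4)[of a] V0(6)[of "qA a"] by auto
  have pAo: "pA d \<in> vpoints A" "qA (pA d) \<in> V0" "pA d \<in> over A U1" if "d \<in> overB W1" for d
    using that vbDA(6)[of d] proj_proj[of d] W1(3)[of "pB d"] V0(3) by auto
  have sub: "d \<in> overB W" if "d \<in> overB W1" for d using that W1(2) by auto
  have oW1: "openin (mtop TD) (overB W1)" using vbDB(8)[OF W1(1)] by simp
  have l3: "lincoord DB W1 rB \<theta>' (\<lambda>b v. h b (trunc rB (u b v)))"
  proof (rule lincoord_change[OF W(1) vDB, unfolded tot baseDB, OF W1(1,2)])
    fix i assume i: "i < rB"
    have 1: "sfun TD (overB W1) (\<lambda>d. \<theta> d i)" by (rule sfun_subset[OF lW(2)[OF i] oW1]) (use sub in auto)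
    have "smo TD (overB W1) TD (\<lambda>d. vzero DA (pA d))"
      by (rule smo_compose[OF smo_subset[OF vbDA(5) oW1] smo_vzero[OF vDA, unfolded baseDA]]) (use pAo in auto)
    then have 2: "sfun TD (overB W1) (\<lambda>d. \<theta> (vzero DA (pA d)) i)"
      by (rule smo_sfun'[OF _ lW(2)[OF i]]) (use zer pAo in auto)
    show "sfun TD (overB W1) (\<lambda>d. \<theta>' d i)"
      unfolding \<theta>'_def using 1 sfun_diff[OF vbDA(3) 1 2] by (cases "i < nA") auto
  next
    fix e assume e: "e \<in> overB W1"
    note z = zer[OF pAo(1,2)[OF e]]
    show "\<theta>' e \<in> EE rB" using lW(3)[OF sub[OF e]] lW(3)[OF z(1)] rk unfolding \<theta>'_def topspace_Euclidean_space by auto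
    show "\<theta>' (sclB t e) i = t * \<theta>' e i" for t i
      unfolding \<theta>'_def using lW(9)[OF sub[OF e]] lW(9)[OF z(1)] sA(3)[of e t] sA(6)[OF pAo(1)[OF e], of t] e
      by (simp add: right_diff_distrib)
    fix e' i assume e': "e' \<in> D" "pB e' = pB e"
    then have e1: "e' \<in> overB W1" using e by simp
    note z' = zer[OF pAo(1,2)[OF e1]]
    have qe: "qA (pA e') = qA (pA e)" using proj_proj[of e] proj_proj[of e'] e e' by simp
    have "pB (vzero DA (pA e')) = pB (vzero DA (pA e))" using sA(4) pAo(1)[OF e] pAo(1)[OF e1] qe by simp
    then show "\<theta>' (addB e e') i = \<theta>' e i + \<theta>' e' i"
      unfolding \<theta>'_def using lW(8)[OF sub[OF e] e', of i] lW(8)[OF z(1), of "vzero DA (pA e')" i] z'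
        sA(2)[of e e'] sA(5)[OF pAo(1)[OF e] pAo(1)[OF e1] qe] e e' by simp
  next
    let ?X = "prod_manifold (total_space B) (EM rB)"
    have cX: "charted ?X" by (rule charted_prod[OF vbb(3) charted_euclidean])
    have oE: "openin (mtop (EM rB)) (EE rB)" by simp
    have c: "sfun ?X (W1 \<times> EE rB) (\<lambda>z. snd z i)" for i by (rule sfun_snd_coord[OF vbb(3) W1(1)])
    have qU1: "qB b \<in> U1" if "b \<in> W1" for b using that W1(3) V0(3) by auto
    have W1B: "W1 \<subseteq> vpoints B" using W1(1) openin_subset by blast
    fix i assume i: "i < rB"
    have "smo ?X (W1 \<times> EE rB) M (\<lambda>z. qB (fst z))"
      by (rule smo_compose[OF smo_fst[OF vbb(3) charted_euclidean W1(1) oE] vbb(5)]) (use W1B in auto)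
    then have "smo ?X (W1 \<times> EE rB) (total_space A) (\<lambda>z. hA (qB (fst z)) (trunc nA (snd z)))"
      by (rule lincoord_smo[OF U1(3) cX vba(2)]) (use W1(3) V0(3) c in auto)
    then have "smo ?X (W1 \<times> EE rB) TD (\<lambda>z. vzero DA (hA (qB (fst z)) (trunc nA (snd z))))"
      by (rule smo_compose[OF _ smo_vzero[OF vDA, unfolded baseDA]]) (use l1(5)[OF qU1 trunc_EE] in auto)
    then have 1: "sfun ?X (W1 \<times> EE rB) (\<lambda>z. \<theta> (vzero DA (hA (qB (fst z)) (trunc nA (snd z)))) i)"
      by (rule smo_sfun'[OF _ lW(2)[OF i]])
        (intro image_subsetI zer(1), use l1(5,6)[OF qU1 trunc_EE] W1(3) in auto)
    show "sfun ?X (W1 \<times> EE rB) (\<lambda>z. u (fst z) (snd z) i)"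
      unfolding u_def using c sfun_add[OF cX c[of i] 1] by (cases "i < nA") auto
  next
    fix b v assume b: "b \<in> W1" and v: "v \<in> EE rB"
    let ?a = "hA (qB b) (trunc nA v)"
    let ?d = "h b (trunc rB (u b v))"
    have bW: "b \<in> W" and qU: "qB b \<in> U1" and qV: "qB b \<in> V0" using b W1 V0(3) by auto
    note a = l1(5,6,7)[OF qU trunc_EE, of v]
    note d = lW(5,6,7)[OF bW trunc_EE, of "u b v"]
    have dW: "?d \<in> overB W" "?d \<in> overB W1" using d bW b by auto
    have "pA ?d = ?a"
    proof (rule lincoord_inj[OF U1(3) pAo(3)[OF dW(2)] a(1)])
      show "qA ?a = qA (pA ?d)" using a d proj_proj[of ?d] by simp
      fix i assume "i < nA"
      then show "\<alpha> (pA ?d) i = \<alpha> ?a i" using \<theta>[OF _ dW(1), of i] d(3) a(3) rk by (simp add: u_def)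
    qed
    then have pd: "pA ?d = ?a" .
    have aV: "?a \<in> vpoints A" "qA ?a \<in> V0" using a qV by auto
    show "\<theta>' ?d = v"
    proof
      fix i
      have t: "\<theta> ?d i = trunc rB (u b v) i" by (simp only: d(3))
      have z: "\<theta> (vzero DA ?a) i = 0" if "\<not> i < rB" using EE_ge[OF lW(3)[OF zer(1)[OF aV]]] that by simp
      show "\<theta>' ?d i = v i"
      proof (cases "i < nA")
        case True
        then show ?thesis unfolding \<theta>'_def using t rk by (simp add: u_def)
      next
        case False
        then show ?thesis unfolding \<theta>'_def pd t using z EE_ge[OF v, of i] by (cases "i < rB") (simp_all add: u_def)
      qed
    qed
  next
    fix e i assume e: "e \<in> overB W1" and i: "i < rB"
    have "hA (qB (pB e)) (trunc nA (\<theta>' e)) = pA e"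
    proof -
      have "trunc nA (\<theta>' e) = \<alpha> (pA e)"
        using \<theta>[OF _ sub[OF e]] l1(3)[OF pAo(3)[OF e]] by (intro EE_eqI[of _ nA]) (auto simp: \<theta>'_def)
      then show ?thesis using l1(4)[OF pAo(3)[OF e]] proj_proj[of e] e by simp
    qed
    then show "u (pB e) (\<theta>' e) i = \<theta> e i" unfolding u_def by (simp add: \<theta>'_def)
  qed
  have \<theta>'0: "\<theta>' (vzero DA a) i = 0" if "a \<in> over A V0" "nA \<le> i" for a i
    using that zer[of a] by (simp add: \<theta>'_def)
  \<comment> \<open>Small multiples of a frame vector approach the zero of its fibre, which lies in
    the open set \<open>W1\<close>.\<close>
  have "\<exists>e>0. vscale B e (hB m0 (unitv j)) \<in> W1" if j: "j < nB" for j
  proof -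
    let ?b = "hB m0 (unitv j)"
    note b = l2(5,6)[OF U2(1) unitv_EE[OF j]]
    have "smo (EM 1) (EE 1) (total_space B) (\<lambda>y. vscale B (y 0) ?b)"
      by (rule smo_vscale[OF vB charted_euclidean smo_const[OF _ b(1)]])
         (auto simp: sfun_euclidean_iff C_on_coord)
    from smo_vimage_open[OF this W1(1)] have o: "openin (Euclidean_space 1) {y \<in> EE 1. vscale B (y 0) ?b \<in> W1}" by simp
    have "vscale B 0 ?b = vzero B m0" using vb_alg(9)[OF vB b(1)] b(2) by simp
    then have "(\<lambda>_. 0) \<in> {y \<in> EE 1. vscale B (y 0) ?b \<in> W1}"
      using W1(4)[OF V0(2)] by (simp add: topspace_Euclidean_space)
    from openin_Euclidean_box[OF o this] obtain e where e: "e > 0"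
      "\<And>y. y \<in> EE 1 \<Longrightarrow> (\<forall>i<1. \<bar>y i - 0\<bar> < e) \<Longrightarrow> y \<in> {y \<in> EE 1. vscale B (y 0) ?b \<in> W1}" by auto
    have "(\<lambda>i. if i = 0 then e / 2 else 0) \<in> {y \<in> EE 1. vscale B (y 0) ?b \<in> W1}"
      by (rule e(2)) (use e(1) in \<open>auto simp: topspace_Euclidean_space\<close>)
    then show ?thesis using e(1) by (intro exI[of _ "e / 2"]) simp
  qed
  then have "\<forall>j. \<exists>e. j < nB \<longrightarrow> e > 0 \<and> vscale B e (hB m0 (unitv j)) \<in> W1" by blast
  then obtain \<epsilon> where \<epsilon>: "\<And>j. j < nB \<Longrightarrow> \<epsilon> j > 0" "\<And>j. j < nB \<Longrightarrow> vscale B (\<epsilon> j) (hB m0 (unitv j)) \<in> W1"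
    by metis
  \<comment> \<open>The factors are fixed at \<open>m0\<close>; \<open>N j\<close> is the open set
    of points where the same factor still works.\<close>
  define N where "N = (\<lambda>j. {m \<in> V0. vscale B (\<epsilon> j) (hB m (trunc nB (unitv j))) \<in> W1})"
  have N: "openin (mtop M) (N j)" for j
  proof -
    have "smo M V0 (total_space B) (\<lambda>m. hB m (trunc nB (unitv j)))"
      using lincoord_smo[OF U2(3), unfolded baseB, OF vba(4) vba(2) smo_id[OF V0(1)], of "\<lambda>_. unitv j"] V0(4)
      by (auto intro: sfun_const V0(1))
    from smo_vscale[OF vB vba(4) this sfun_const[OF V0(1)], of "\<epsilon> j"]
    show ?thesis unfolding N_def by (rule smo_vimage_open[OF _ W1(1)])
  qed
  define V where "V = V0 \<inter> (\<Inter>j\<in>{..<nB}. N j)"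
  have "openin (mtop M) (\<Inter>(insert V0 (N ` {..<nB})))"
    by (rule openin_Inter) (use N V0(1) in auto)
  then have Vo: "openin (mtop M) V" by (simp add: V_def)
  have V: "V \<subseteq> V0" "m0 \<in> V" "\<And>m j. m \<in> V \<Longrightarrow> j < nB \<Longrightarrow> vscale B (\<epsilon> j) (hB m (trunc nB (unitv j))) \<in> W1"
    unfolding V_def N_def using V0(2) \<epsilon>(2) trunc_id[OF unitv_EE] by auto
  define W2 where "W2 = W1 \<inter> over B V"
  have W2: "openin (mtop (total_space B)) W2" "W2 \<subseteq> W1" unfolding W2_def using W1(1) vbb(8)[OF Vo] by auto
  have "dvb_local DA DB A B V \<alpha> (\<lambda>m v. hA m (trunc nA v)) \<beta> (\<lambda>m v. hB m (trunc nB v)) W2 \<theta>'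
     (\<lambda>b v. h b (trunc rB (u b (trunc rB v)))) \<epsilon>"
  proof (unfold_locales)
    show "lincoord A V nA \<alpha> (\<lambda>m v. hA m (trunc nA v))"
      by (rule lincoord_restrict[OF U1(3) vA Vo]) (use V V0 in auto)
    show "lincoord B V nB \<beta> (\<lambda>m v. hB m (trunc nB v))"
      by (rule lincoord_restrict[OF U2(3) vB]) (use V V0 Vo in auto)
    show "lincoord DB W2 rB \<theta>' (\<lambda>b v. h b (trunc rB (u b (trunc rB v))))"
      by (rule lincoord_restrict[OF l3 vDB]) (use W2 in auto)
    show "nA \<le> rB" by (rule rk)
    show "qB b \<in> V" if "b \<in> W2" for b using that by (simp add: W2_def)
    show "vzero B m \<in> W2" if "m \<in> V" for m
      using that W1(4)[of m] V(1) V0(5) opsb(3)[of m] by (auto simp: W2_def)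
    show "\<theta>' d i = \<alpha> (pA d) i" if "i < nA" "d \<in> overB W2" for i d
      using that \<theta>[OF that(1) sub] W2(2) by (auto simp: \<theta>'_def)
    show "\<theta>' (vzero DA a) i = 0" if "a \<in> over A V" "nA \<le> i" for i a
      by (rule \<theta>'0) (use that V(1) in auto)
    show "0 < \<epsilon> j" if "j < nB" for j by (rule \<epsilon>(1)[OF that])
    show "vscale B (\<epsilon> j) (hB m (trunc nB (unitv j))) \<in> W2" if "m \<in> V" "j < nB" for m j
      using V(3)[OF that] opsb(2)[OF l2(5)[of m "trunc nB (unitv j)"], of "\<epsilon> j"] l2(6)[of m "trunc nB (unitv j)"] that(1) V(1) V0(4)
      by (auto simp: W2_def)
  qed
  then show ?thesis unfolding U1(4) U2(4) using V(1,2) V0(3,4) U1(2) U2(2) by blast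
qed

end

section \<open>Manifolds and vector bundles from charts\<close>

text \<open>By construction the topology makes every chart continuous. Continuity of the inverse of
  a chart is tested on the generating sets, where it reduces to continuity of the transition
  maps.\<close>

lemma mfd_of_charts:
  fixes \<A> :: "'a chart set"
  assumes inj: "\<And>P \<xi>. (P, \<xi>) \<in> \<A> \<Longrightarrow> inj_on \<xi> P"
    and im: "\<And>P \<xi>. (P, \<xi>) \<in> \<A> \<Longrightarrow> openin (Euclidean_space n) (\<xi> ` P)"
    and op: "\<And>P \<xi> P' \<xi>'. (P, \<xi>) \<in> \<A> \<Longrightarrow> (P', \<xi>') \<in> \<A> \<Longrightarrow> openin (Euclidean_space n) (\<xi> ` (P \<inter> P'))"
    and tr: "\<And>P \<xi> P' \<xi>' j k. (P, \<xi>) \<in> \<A> \<Longrightarrow> (P', \<xi>') \<in> \<A> \<Longrightarrow> j < n \<Longrightarrow>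
        C_on k n (\<xi> ` (P \<inter> P')) (\<lambda>z. \<xi>' (inv_into P \<xi> z) j)"
  shows "mfd (manifold_of_charts n \<A>)" "mpoints (manifold_of_charts n \<A>) = (\<Union>c\<in>\<A>. fst c)"
proof -
  let ?S = "{{x\<in>U. \<phi> x \<in> W} | U \<phi> W. (U, \<phi>) \<in> \<A> \<and> openin (Euclidean_space n) W}"
  let ?X = "manifold_of_charts n \<A>"
  have X: "mtop ?X = topology_generated_by ?S" "mdim ?X = n" "atlas ?X = \<A>"
    by (auto simp: manifold_of_charts_def)
  have EE: "\<xi> x \<in> EE n" if "(P, \<xi>) \<in> \<A>" "x \<in> P" for P \<xi> x using openin_subset[OF im[OF that(1)]] that(2) by auto
  have gen: "openin (mtop ?X) {x\<in>P. \<xi> x \<in> W}" if "(P, \<xi>) \<in> \<A>" "openin (Euclidean_space n) W" for P \<xi> W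
    unfolding X(1) by (rule topology_generated_by_Basis) (use that in blast)
  have full: "{x\<in>P. \<xi> x \<in> EE n} = P" if "(P, \<xi>) \<in> \<A>" for P \<xi> using EE[OF that] by auto
  have oP: "openin (mtop ?X) P" if "(P, \<xi>) \<in> \<A>" for P \<xi>
    using gen[OF that, of "EE n"] full[OF that] by simp
  have "\<Union>?S = (\<Union>c\<in>\<A>. fst c)"
  proof
    show "\<Union>?S \<subseteq> (\<Union>c\<in>\<A>. fst c)"
    proof
      fix x assume "x \<in> \<Union>?S"
      then obtain U \<phi> where "(U, \<phi>) \<in> \<A>" "x \<in> U" by blast
      then show "x \<in> (\<Union>c\<in>\<A>. fst c)" by (intro UN_I[of "(U, \<phi>)"]) auto
    qed
    show "(\<Union>c\<in>\<A>. fst c) \<subseteq> \<Union>?S"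
    proof
      fix x assume "x \<in> (\<Union>c\<in>\<A>. fst c)"
      then obtain P \<xi> where P: "(P, \<xi>) \<in> \<A>" "x \<in> P" by force
      then have "{x\<in>P. \<xi> x \<in> EE n} \<in> ?S" by blast
      moreover have "x \<in> {x\<in>P. \<xi> x \<in> EE n}" using EE[OF P] P(2) by simp
      ultimately show "x \<in> \<Union>?S" by (rule UnionI)
    qed
  qed
  then show ts: "mpoints ?X = (\<Union>c\<in>\<A>. fst c)" unfolding X(1) by simp
  have ch: "is_chart (mtop ?X) n (P, \<xi>)" if P: "(P, \<xi>) \<in> \<A>" for P \<xi>
  proof (rule is_chartI(1)[OF oP[OF P] im[OF P]])
    have tP: "topspace (subtopology (mtop ?X) P) = P" using openin_subset[OF oP[OF P]] by auto
    show "continuous_map (subtopology (mtop ?X) P) (Euclidean_space n) \<xi>"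
      unfolding continuous_map tP
      using gen[OF P] EE[OF P] oP[OF P] by (auto simp: openin_open_subtopology)
    let ?T = "subtopology (Euclidean_space n) (\<xi> ` P)"
    have tT: "topspace ?T = \<xi> ` P" using openin_subset[OF im[OF P]] by auto
    show "continuous_map ?T (mtop ?X) (inv_into P \<xi>)"
      unfolding X(1)
    proof (rule continuous_on_generated_topo)
      fix Q assume "Q \<in> ?S"
      then obtain P' \<xi>' W where Q: "Q = {x\<in>P'. \<xi>' x \<in> W}" "(P', \<xi>') \<in> \<A>" "openin (Euclidean_space n) W" by blast
      let ?I = "\<xi> ` (P \<inter> P')"
      have I: "openin (Euclidean_space n) ?I" by (rule op[OF P Q(2)])
      have "continuous_map (subtopology (Euclidean_space n) ?I) (Euclidean_space n) (\<lambda>z. trunc n (\<xi>' (inv_into P \<xi> z)))"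
        unfolding continuous_map_trunc using C_on_continuous[OF tr[OF P Q(2)]] by blast
      from open_vimage_subtopology[OF I this Q(3)]
      have "openin (Euclidean_space n) {z \<in> ?I. trunc n (\<xi>' (inv_into P \<xi> z)) \<in> W}" .
      also have "{z \<in> ?I. trunc n (\<xi>' (inv_into P \<xi> z)) \<in> W} = inv_into P \<xi> -` Q \<inter> \<xi> ` P"
        using inv_into_f_f[OF inj[OF P]] EE[OF Q(2)] by (auto simp: Q(1) trunc_id)
      finally show "openin ?T (inv_into P \<xi> -` Q \<inter> topspace ?T)"
        unfolding tT using im[OF P] by (simp add: openin_open_subtopology)
    next
      show "inv_into P \<xi> ` topspace ?T \<subseteq> \<Union>?S"
      proof
        fix x assume "x \<in> inv_into P \<xi> ` topspace ?T"
        then have "x \<in> {x\<in>P. \<xi> x \<in> EE n}" unfolding tT full[OF P] using inv_into_f_f[OF inj[OF P]] by auto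
        then show "x \<in> \<Union>?S" using P openin_topspace[of "Euclidean_space n"] by blast
      qed
    qed
  qed (use inv_into_f_f[OF inj[OF P]] in \<open>auto\<close>)
  then have c: "charted ?X" unfolding charted_def using ts X by auto
  show "mfd ?X" unfolding mfd_def
  proof (intro conjI c ballI, safe)
    fix P' \<xi>' j assume P': "(P', \<xi>') \<in> atlas ?X" and j: "j < mdim ?X"
    show "sfun ?X P' (\<lambda>x. \<xi>' x j)"
    proof (rule sfunI)
      show "openin (mtop ?X) P'" using oP P' X(3) by simp
      fix P \<xi> k assume P: "(P, \<xi>) \<in> atlas ?X"
      show "C_on k (mdim ?X) (\<xi> ` (P' \<inter> P)) (\<lambda>x. \<xi>' (inv_into P \<xi> x) j)"
        using tr[of P \<xi> P' \<xi>' j k] P P' j X by (simp add: Int_commute)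
    qed
  qed
qed

lemma second_countable_Euclidean: "second_countable (Euclidean_space n)"
proof -
  obtain \<B> :: "(nat \<Rightarrow> real) set set" where B: "countable \<B>" "\<And>C. C \<in> \<B> \<Longrightarrow> open C"
      "\<And>S. open S \<Longrightarrow> \<exists>U. U \<subseteq> \<B> \<and> S = \<Union>U" using univ_second_countable by blast
  have "second_countable (euclidean :: (nat \<Rightarrow> real) topology)"
    unfolding second_countable_def
  proof (intro exI[of _ \<B>] conjI allI impI)
    fix U and x :: "nat \<Rightarrow> real" assume "openin euclidean U \<and> x \<in> U"
    then obtain \<U> where "\<U> \<subseteq> \<B>" "U = \<Union>\<U>" "x \<in> U" using B(3)[of U] by auto
    then show "\<exists>V\<in>\<B>. x \<in> V \<and> V \<subseteq> U" by auto
  qed (use B in auto)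
  then show ?thesis unfolding Euclidean_space_def euclidean_product_topology by (rule second_countable_subtopology)
qed

lemma second_countable_cover:
  assumes c: "countable \<C>" and o: "\<And>P. P \<in> \<C> \<Longrightarrow> openin X P" and cov: "\<Union>\<C> = topspace X"
    and sc: "\<And>P. P \<in> \<C> \<Longrightarrow> second_countable (subtopology X P)"
  shows "second_countable X"
proof -
  have "\<forall>P\<in>\<C>. \<exists>\<B>. countable \<B> \<and> (\<forall>V\<in>\<B>. openin (subtopology X P) V) \<and>
      (\<forall>U x. openin (subtopology X P) U \<and> x \<in> U \<longrightarrow> (\<exists>V\<in>\<B>. x \<in> V \<and> V \<subseteq> U))"
    using sc unfolding second_countable_def by blast
  then obtain \<B> where B: "\<And>P. P \<in> \<C> \<Longrightarrow> countable (\<B> P)" "\<And>P V. P \<in> \<C> \<Longrightarrow> V \<in> \<B> P \<Longrightarrow> openin (subtopology X P) V"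
     "\<And>P U x. P \<in> \<C> \<Longrightarrow> openin (subtopology X P) U \<Longrightarrow> x \<in> U \<Longrightarrow> \<exists>V\<in>\<B> P. x \<in> V \<and> V \<subseteq> U" by metis
  show ?thesis unfolding second_countable_def
  proof (intro exI[of _ "\<Union>P\<in>\<C>. \<B> P"] conjI ballI allI impI)
    show "countable (\<Union>P\<in>\<C>. \<B> P)" using c B(1) by auto
    fix V assume "V \<in> (\<Union>P\<in>\<C>. \<B> P)"
    then show "openin X V" using B(2) o openin_open_subtopology by blast
  next
    fix U x assume U: "openin X U \<and> x \<in> U"
    then have "x \<in> \<Union>\<C>" using openin_subset cov by blast
    then obtain P where P: "P \<in> \<C>" "x \<in> P" by blast
    have "openin (subtopology X P) (U \<inter> P)" using U openin_subtopology_Int by blast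
    from B(3)[OF P(1) this, of x] U P show "\<exists>V\<in>\<Union>P\<in>\<C>. \<B> P. x \<in> V \<and> V \<subseteq> U" by blast
  qed
qed

text \<open>Points over different base points are separated in \<open>M\<close>; points over the
  same base point lie in one chart, whose domain is a full preimage. Since \<open>M\<close> is
  Lindelof, countably many such domains cover \<open>X\<close>, and each is second
  countable.\<close>

lemma bundle_smooth_manifold:
  assumes X: "mfd X" and M: "smooth_manifold M" and p: "continuous_map (mtop X) (mtop M) p"
    and cov: "\<And>m. m \<in> mpoints M \<Longrightarrow> \<exists>N \<xi>. m \<in> N \<and> openin (mtop M) N \<and> ({x\<in>mpoints X. p x \<in> N}, \<xi>) \<in> atlas X"
  shows "smooth_manifold X"
proof (rule mfd_smooth_manifold[OF X])
  have MH: "Hausdorff_space (mtop M)" and M2: "second_countable (mtop M)" using M by (auto simp: smooth_manifold_def)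
  have pM: "p x \<in> mpoints M" if "x \<in> mpoints X" for x using p that by (auto simp: continuous_map_def)
  note chX = charted_chart[OF mfd_charted[OF X]]
  show "Hausdorff_space (mtop X)" unfolding Hausdorff_space_def
  proof (intro allI impI, elim conjE)
    fix x y assume xy: "x \<in> mpoints X" "y \<in> mpoints X" "x \<noteq> y"
    show "\<exists>U V. openin (mtop X) U \<and> openin (mtop X) V \<and> x \<in> U \<and> y \<in> V \<and> disjnt U V"
    proof (cases "p x = p y")
      case False
      then obtain U V where UV: "openin (mtop M) U" "openin (mtop M) V" "p x \<in> U" "p y \<in> V" "disjnt U V"
        using MH pM xy unfolding Hausdorff_space_def by meson
      show ?thesis
        by (rule exI[of _ "{z\<in>mpoints X. p z \<in> U}"], rule exI[of _ "{z\<in>mpoints X. p z \<in> V}"])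
           (use UV xy openin_continuous_map_preimage[OF p] in \<open>auto simp: disjnt_iff\<close>)
    next
      case True
      obtain N \<xi> where N: "p x \<in> N" "({z\<in>mpoints X. p z \<in> N}, \<xi>) \<in> atlas X" using cov[OF pM[OF xy(1)]] by blast
      let ?P = "{z\<in>mpoints X. p z \<in> N}"
      note ch = is_chartD[OF chX[OF N(2)]]
      have in2: "x \<in> ?P" "y \<in> ?P" using xy N True by auto
      then have "\<xi> x \<noteq> \<xi> y" "\<xi> x \<in> EE (mdim X)" "\<xi> y \<in> EE (mdim X)" using ch(3,5) xy(3) by (auto dest: inj_onD)
      then obtain U V where UV: "openin (Euclidean_space (mdim X)) U" "openin (Euclidean_space (mdim X)) V" "\<xi> x \<in> U" "\<xi> y \<in> V" "disjnt U V"
        using Hausdorff_Euclidean_space[of "mdim X"] unfolding Hausdorff_space_def by meson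
      show ?thesis
        by (rule exI[of _ "{z\<in>?P. \<xi> z \<in> U}"], rule exI[of _ "{z\<in>?P. \<xi> z \<in> V}"])
           (use UV in2 ch(9)[OF UV(1)] ch(9)[OF UV(2)] in \<open>auto simp: disjnt_iff\<close>)
    qed
  qed
  let ?\<U> = "{N. openin (mtop M) N \<and> (\<exists>\<xi>. ({x\<in>mpoints X. p x \<in> N}, \<xi>) \<in> atlas X)}"
  have "Lindelof_space (mtop M)" by (rule second_countable_imp_Lindelof_space[OF M2])
  moreover have "\<Union>?\<U> = mpoints M"
  proof
    show "\<Union>?\<U> \<subseteq> mpoints M" by (auto dest: openin_subset)
    show "mpoints M \<subseteq> \<Union>?\<U>" using cov by blast
  qed
  ultimately obtain \<V> where V: "countable \<V>" "\<V> \<subseteq> ?\<U>" "\<Union>\<V> = mpoints M"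
    unfolding Lindelof_space_def by (metis (no_types, lifting) mem_Collect_eq)
  let ?P = "\<lambda>N. {x\<in>mpoints X. p x \<in> N}"
  show "second_countable (mtop X)"
  proof (rule second_countable_cover[of "?P ` \<V>"])
    show "countable (?P ` \<V>)" using V(1) by auto
    show "openin (mtop X) P" if P: "P \<in> ?P ` \<V>" for P using P V(2) openin_continuous_map_preimage[OF p] by blast
    show "\<Union>(?P ` \<V>) = mpoints X" using pM V(3) by blast
    fix P assume "P \<in> ?P ` \<V>"
    then obtain \<xi> where "(P, \<xi>) \<in> atlas X" using V(2) by auto
    then have "homeomorphic_map (subtopology (mtop X) P) (subtopology (Euclidean_space (mdim X)) (\<xi> ` P)) \<xi>"
      using chX by (auto simp: is_chart_def)
    then show "second_countable (subtopology (mtop X) P)"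
      using homeomorphic_space_second_countability[OF homeomorphic_map_imp_homeomorphic_space]
        second_countable_subtopology[OF second_countable_Euclidean] by blast
  qed
qed

section \<open>Linear extension to free vector spaces\<close>

definition lext :: "('x \<Rightarrow> nat \<Rightarrow> real) \<Rightarrow> ('x \<Rightarrow>\<^sub>0 real) \<Rightarrow> nat \<Rightarrow> real" where
  "lext \<kappa> p t = (\<Sum>x\<in>Poly_Mapping.keys p. Poly_Mapping.lookup p x * \<kappa> x t)"

lemma lext_superset:
  assumes "finite S" "Poly_Mapping.keys p \<subseteq> S"
  shows "lext \<kappa> p t = (\<Sum>x\<in>S. Poly_Mapping.lookup p x * \<kappa> x t)"
  unfolding lext_def by (rule sum.mono_neutral_left) (use assms in \<open>auto simp: in_keys_iff\<close>)

lemma lext_add: "lext \<kappa> (p + q) t = lext \<kappa> p t + lext \<kappa> q t"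
proof -
  let ?S = "Poly_Mapping.keys p \<union> Poly_Mapping.keys q \<union> Poly_Mapping.keys (p + q)"
  show ?thesis
    using lext_superset[of ?S p \<kappa> t] lext_superset[of ?S q \<kappa> t] lext_superset[of ?S "p + q" \<kappa> t]
    by (simp add: lookup_add sum.distrib distrib_right le_supI1)
qed

lemma lext_scale: "lext \<kappa> (free_scale c p) t = c * lext \<kappa> p t"
proof -
  let ?S = "Poly_Mapping.keys p \<union> Poly_Mapping.keys (free_scale c p)"
  show ?thesis
    using lext_superset[of ?S p \<kappa> t] lext_superset[of ?S "free_scale c p" \<kappa> t]
    by (simp add: lookup_free_scale sum_distrib_left mult.assoc)
qed

lemma lext_diff: "lext \<kappa> (p - q) t = lext \<kappa> p t - lext \<kappa> q t"
  using lext_add[of \<kappa> p "- q" t] lext_scale[of \<kappa> "-1" q t] by simp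

lemma lext_zero [simp]: "lext \<kappa> 0 t = 0" by (simp add: lext_def)

lemma lext_gen [simp]: "lext \<kappa> (gen x) t = \<kappa> x t" by (simp add: lext_def)

lemma lext_sum: "lext \<kappa> (\<Sum>s\<in>J. f s) t = (\<Sum>s\<in>J. lext \<kappa> (f s) t)"
  by (induction J rule: infinite_finite_induct) (auto simp: lext_add)

lemma lext_span:
  assumes "\<And>p. p \<in> R \<Longrightarrow> lext \<kappa> p t = 0" "z \<in> free.span R"
  shows "lext \<kappa> z t = 0"
proof -
  have "free.subspace {z. lext \<kappa> z t = 0}"
    unfolding free.subspace_def by (auto simp: lext_add lext_scale)
  then have "free.span R \<subseteq> {z. lext \<kappa> z t = 0}" by (intro free.span_minimal) (use assms(1) in auto)
  then show ?thesis using assms(2) by auto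
qed

lemma free_expand: "p = (\<Sum>x\<in>Poly_Mapping.keys p. free_scale (Poly_Mapping.lookup p x) (gen x))"
proof (rule poly_mapping_eqI)
  fix y
  have "(\<Sum>x\<in>Poly_Mapping.keys p. Poly_Mapping.lookup p x * Poly_Mapping.lookup (gen x) y) =
     (\<Sum>x\<in>Poly_Mapping.keys p. if x = y then Poly_Mapping.lookup p y else 0)"
    by (rule sum.cong) (auto simp: lookup_single when_def)
  also have "\<dots> = Poly_Mapping.lookup p y" by (auto simp: in_keys_iff)
  finally show "Poly_Mapping.lookup p y =
      Poly_Mapping.lookup (\<Sum>x\<in>Poly_Mapping.keys p. free_scale (Poly_Mapping.lookup p x) (gen x)) y"
    by (simp add: lookup_sum lookup_free_scale)
qed

lemma keys_free_scale: "Poly_Mapping.keys (free_scale c p) \<subseteq> Poly_Mapping.keys p"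
  by (auto simp: in_keys_iff lookup_free_scale)

lemma keys_add_subset: "Poly_Mapping.keys p \<subseteq> G \<Longrightarrow> Poly_Mapping.keys q \<subseteq> G \<Longrightarrow> Poly_Mapping.keys (p + q) \<subseteq> G"
  using keys_add[of p q] by blast

lemma keys_sum_subset: "(\<And>s. s \<in> J \<Longrightarrow> Poly_Mapping.keys (f s) \<subseteq> G) \<Longrightarrow> Poly_Mapping.keys (\<Sum>s\<in>J. f s) \<subseteq> G"
proof (induction J rule: infinite_finite_induct)
  case (insert x F)
  then show ?case using keys_add_subset[of "f x" G "sum f F"] by simp
qed auto

lemma quot_class_eq_iff: "quot_class R m p = quot_class R m' q \<longleftrightarrow> m = m' \<and> p - q \<in> free.span (R m)"
proof -
  have "(\<lambda>z. p + z) ` free.span (R m) = (\<lambda>z. q + z) ` free.span (R m) \<longleftrightarrow> p - q \<in> free.span (R m)"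
  proof
    assume eq: "(\<lambda>z. p + z) ` free.span (R m) = (\<lambda>z. q + z) ` free.span (R m)"
    have "p \<in> (\<lambda>z. p + z) ` free.span (R m)" by (rule image_eqI[of _ _ 0]) (auto simp: free.span_zero)
    then show "p - q \<in> free.span (R m)" unfolding eq by auto
  next
    assume d: "p - q \<in> free.span (R m)"
    have "p + z \<in> (\<lambda>z. q + z) ` free.span (R m)" if "z \<in> free.span (R m)" for z
      by (rule image_eqI[of _ _ "(p - q) + z"]) (use d that in \<open>auto intro: free.span_add\<close>)
    moreover have "q + z \<in> (\<lambda>z. p + z) ` free.span (R m)" if "z \<in> free.span (R m)" for z
      by (rule image_eqI[of _ _ "z - (p - q)"]) (use d that in \<open>auto intro: free.span_diff\<close>)
    ultimately show "(\<lambda>z. p + z) ` free.span (R m) = (\<lambda>z. q + z) ` free.span (R m)" by blast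
  qed
  then show ?thesis by (auto simp: quot_class_def)
qed

lemma fst_quot_class [simp]: "fst (quot_class R m p) = m" by (simp add: quot_class_def)

text \<open>\<open>quot_add\<close> is a union over all pairs of representatives; every pair yields
  the same coset, so one pair computes it.\<close>

lemma quot_add_class: "quot_add R (quot_class R m p) (quot_class R m q) = quot_class R m (p + q)"
proof -
  have "snd (quot_class R m (p' + q')) = snd (quot_class R m (p + q))"
    if pq: "p' \<in> snd (quot_class R m p)" "q' \<in> snd (quot_class R m q)" for p' q'
  proof -
    obtain z w where zw: "z \<in> free.span (R m)" "w \<in> free.span (R m)" "p' = p + z" "q' = q + w"
      using pq by (auto simp: quot_class_def)
    have "p' + q' - (p + q) = z + w" using zw by (simp add: algebra_simps)
    then have "p' + q' - (p + q) \<in> free.span (R m)" using zw by (auto intro: free.span_add)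
    then show ?thesis using quot_class_eq_iff by metis
  qed
  moreover have "p \<in> snd (quot_class R m p)" for p unfolding quot_class_def
    by (auto intro!: image_eqI[of _ _ 0] simp: free.span_zero)
  ultimately have "(\<Union>p'\<in>snd (quot_class R m p). \<Union>q'\<in>snd (quot_class R m q). snd (quot_class R m (p' + q'))) = snd (quot_class R m (p + q))"
    by blast
  then show ?thesis by (simp add: quot_add_def prod_eq_iff)
qed

lemma quot_scale_class: "quot_scale R c (quot_class R m p) = quot_class R m (free_scale c p)"
proof -
  have "snd (quot_class R m (free_scale c p')) = snd (quot_class R m (free_scale c p))"
    if p': "p' \<in> snd (quot_class R m p)" for p'
  proof -
    obtain z where z: "z \<in> free.span (R m)" "p' = p + z" using p' by (auto simp: quot_class_def)
    have "free_scale c p' - free_scale c p = free_scale c z" using z by (simp add: free.scale_right_distrib)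
    then have "free_scale c p' - free_scale c p \<in> free.span (R m)" using z by (auto intro: free.span_scale)
    then show ?thesis using quot_class_eq_iff by metis
  qed
  moreover have "p \<in> snd (quot_class R m p)" unfolding quot_class_def
    by (auto intro!: image_eqI[of _ _ 0] simp: free.span_zero)
  ultimately have "(\<Union>p'\<in>snd (quot_class R m p). snd (quot_class R m (free_scale c p'))) = snd (quot_class R m (free_scale c p))"
    by blast
  then show ?thesis by (simp add: quot_scale_def prod_eq_iff)
qed

text \<open>Once the extension of \<open>\<kappa>\<close> kills the relations it is constant on a
  class, so the image is a singleton. The form is that of \<open>tensor_coords\<close>, which
  becomes an instance.\<close>

definition qcoord :: "nat \<Rightarrow> ('x \<Rightarrow> nat \<Rightarrow> real) \<Rightarrow> 'm \<times> ('x \<Rightarrow>\<^sub>0 real) set \<Rightarrow> nat \<Rightarrow> real" where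
  "qcoord r \<kappa> u = the_elem ((\<lambda>p t. if t < r then lext \<kappa> p t else 0) ` snd u)"

section \<open>Bundles of quotients of free vector spaces\<close>

text \<open>The family is trivialized by triples \<open>(V, \<kappa>, g)\<close>: for \<open>m \<in> V\<close> the linear extension of \<open>\<kappa>\<close> gives
  coordinates on the quotient over \<open>m\<close>, and the classes of \<open>g 0 m, g 1 m, \<dots>\<close> are the corresponding basis.\<close>

locale quot_family =
  fixes M :: "'m manifold" and Gs :: "'m \<Rightarrow> 'x set" and R :: "'m \<Rightarrow> ('x \<Rightarrow>\<^sub>0 real) set" and r :: nat
    and T :: "('m set \<times> ('x \<Rightarrow> nat \<Rightarrow> real) \<times> (nat \<Rightarrow> 'm \<Rightarrow> 'x)) set"
  assumes M: "smooth_manifold M"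
    and T_open: "\<And>V \<kappa> g. (V, \<kappa>, g) \<in> T \<Longrightarrow> openin (mtop M) V"
    and T_cover: "\<And>m. m \<in> mpoints M \<Longrightarrow> \<exists>V \<kappa> g. (V, \<kappa>, g) \<in> T \<and> m \<in> V"
    and T_g: "\<And>V \<kappa> g m s. (V, \<kappa>, g) \<in> T \<Longrightarrow> m \<in> V \<Longrightarrow> s < r \<Longrightarrow> g s m \<in> Gs m"
    and T_unit: "\<And>V \<kappa> g m s t. (V, \<kappa>, g) \<in> T \<Longrightarrow> m \<in> V \<Longrightarrow> s < r \<Longrightarrow> t < r \<Longrightarrow> \<kappa> (g s m) t = (if s = t then 1 else 0)"
    and T_rel: "\<And>V \<kappa> g m p t. (V, \<kappa>, g) \<in> T \<Longrightarrow> m \<in> V \<Longrightarrow> p \<in> R m \<Longrightarrow> t < r \<Longrightarrow> lext \<kappa> p t = 0"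
    and T_span: "\<And>V \<kappa> g m x. (V, \<kappa>, g) \<in> T \<Longrightarrow> m \<in> V \<Longrightarrow> x \<in> Gs m \<Longrightarrow>
        gen x - (\<Sum>s<r. free_scale (\<kappa> x s) (gen (g s m))) \<in> free.span (R m)"
    and T_smooth: "\<And>V \<kappa> g V' \<kappa>' g' s t. (V, \<kappa>, g) \<in> T \<Longrightarrow> (V', \<kappa>', g') \<in> T \<Longrightarrow> s < r \<Longrightarrow> t < r \<Longrightarrow>
        sfun M (V \<inter> V') (\<lambda>m. \<kappa>' (g s m) t)"
begin

abbreviation "Q \<equiv> quot_set (mpoints M) Gs R"
abbreviation "n \<equiv> mdim M"

lemma mM: "mfd M" "charted M" using smooth_manifold_mfd[OF M] mfd_charted by auto

lemma T_sub: "(V, \<kappa>, g) \<in> T \<Longrightarrow> V \<subseteq> mpoints M" using T_open openin_subset by blast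

lemma Q_fst: "u \<in> Q \<Longrightarrow> fst u \<in> mpoints M" by (auto simp: quot_set_def)

lemma Q_rep:
  assumes "u \<in> Q"
  obtains p where "u = quot_class R (fst u) p" "Poly_Mapping.keys p \<subseteq> Gs (fst u)"
  using assms by (auto simp: quot_set_def)

lemma Q_class: "m \<in> mpoints M \<Longrightarrow> Poly_Mapping.keys p \<subseteq> Gs m \<Longrightarrow> quot_class R m p \<in> Q"
  by (auto simp: quot_set_def)

lemma qcoord_class:
  assumes T: "(V, \<kappa>, g) \<in> T" "m \<in> V"
  shows "qcoord r \<kappa> (quot_class R m p) = trunc r (lext \<kappa> p)"
proof -
  have "(\<lambda>t. if t < r then lext \<kappa> (p + z) t else 0) = trunc r (lext \<kappa> p)" if "z \<in> free.span (R m)" for z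
    using lext_span[OF T_rel[OF T] that] by (auto simp: fun_eq_iff lext_add)
  then have "(\<lambda>p t. if t < r then lext \<kappa> p t else 0) ` snd (quot_class R m p) = {trunc r (lext \<kappa> p)}"
    using free.span_zero[of "R m"] by (auto simp: quot_class_def image_image)
  then show ?thesis by (simp add: qcoord_def)
qed

definition comb :: "(nat \<Rightarrow> 'm \<Rightarrow> 'x) \<Rightarrow> 'm \<Rightarrow> (nat \<Rightarrow> real) \<Rightarrow> 'm \<times> ('x \<Rightarrow>\<^sub>0 real) set" where
  "comb g m v = quot_class R m (\<Sum>s<r. free_scale (v s) (gen (g s m)))"

lemma lext_comb:
  assumes T: "(V, \<kappa>, g) \<in> T" "(V', \<kappa>', g') \<in> T" "m \<in> V" "m \<in> V'"
  shows "qcoord r \<kappa>' (comb g m v) = trunc r (\<lambda>t. \<Sum>s<r. v s * \<kappa>' (g s m) t)"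
  unfolding comb_def qcoord_class[OF T(2,4)] by (rule trunc_cong) (simp add: lext_sum lext_scale)

lemma comb:
  assumes T: "(V, \<kappa>, g) \<in> T" "m \<in> V"
  shows "comb g m v \<in> Q" "fst (comb g m v) = m" "qcoord r \<kappa> (comb g m v) = trunc r v"
proof -
  have "Poly_Mapping.keys (free_scale (v s) (gen (g s m))) \<subseteq> Gs m" if "s < r" for s
    using keys_free_scale[of "v s" "gen (g s m)"] T_g[OF T that] by auto
  then show "comb g m v \<in> Q" unfolding comb_def using T_sub[OF T(1)] T(2)
    by (intro Q_class keys_sum_subset) auto
  show "fst (comb g m v) = m" by (simp add: comb_def)
  have "(\<Sum>s<r. v s * \<kappa> (g s m) t) = v t" if "t < r" for t
  proof -
    have "(\<Sum>s<r. v s * \<kappa> (g s m) t) = (\<Sum>s<r. if s = t then v t else 0)"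
      by (rule sum.cong) (use T_unit[OF T _ that] in auto)
    then show ?thesis using that by simp
  qed
  then show "qcoord r \<kappa> (comb g m v) = trunc r v"
    unfolding lext_comb[OF T(1) T(1) T(2) T(2)] by (auto simp: fun_eq_iff trunc_def)
qed

text \<open>\<open>T_span\<close> expresses a generator by the frame modulo relations; summing over
  the finite support of a representative extends this to every class, so \<open>comb\<close> inverts
  the coordinates.\<close>

lemma comb_qcoord:
  assumes T: "(V, \<kappa>, g) \<in> T" and u: "u \<in> Q" "fst u \<in> V"
  shows "comb g (fst u) (qcoord r \<kappa> u) = u"
proof -
  define m where "m = fst u"
  obtain p where p: "u = quot_class R m p" "Poly_Mapping.keys p \<subseteq> Gs m"
    using Q_rep[OF u(1)] unfolding m_def by blast
  have m: "m \<in> V" using u(2) by (simp add: m_def)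
  let ?e = "\<lambda>x. gen x - (\<Sum>s<r. free_scale (\<kappa> x s) (gen (g s m)))"
  have "p - (\<Sum>s<r. free_scale (lext \<kappa> p s) (gen (g s m))) = (\<Sum>x\<in>Poly_Mapping.keys p. free_scale (Poly_Mapping.lookup p x) (?e x))"
  proof -
    have "(\<Sum>s<r. free_scale (lext \<kappa> p s) (gen (g s m))) =
       (\<Sum>s<r. \<Sum>x\<in>Poly_Mapping.keys p. free_scale (Poly_Mapping.lookup p x * \<kappa> x s) (gen (g s m)))"
      by (simp add: lext_def free.scale_sum_left)
    also have "\<dots> = (\<Sum>x\<in>Poly_Mapping.keys p. \<Sum>s<r. free_scale (Poly_Mapping.lookup p x * \<kappa> x s) (gen (g s m)))"
      by (rule sum.swap)
    also have "\<dots> = (\<Sum>x\<in>Poly_Mapping.keys p. free_scale (Poly_Mapping.lookup p x) (\<Sum>s<r. free_scale (\<kappa> x s) (gen (g s m))))"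
      by (simp add: free.scale_sum_right)
    finally show ?thesis
      by (subst free_expand[of p]) (simp add: free.scale_right_diff_distrib sum_subtractf)
  qed
  also have "\<dots> \<in> free.span (R m)"
    by (intro free.span_sum free.span_scale T_span[OF T m]) (use p(2) in auto)
  finally have s: "p - (\<Sum>s<r. free_scale (lext \<kappa> p s) (gen (g s m))) \<in> free.span (R m)" .
  have q: "qcoord r \<kappa> u = trunc r (lext \<kappa> p)" unfolding p(1) by (rule qcoord_class[OF T m])
  have "comb g m (qcoord r \<kappa> u) = quot_class R m (\<Sum>s<r. free_scale (lext \<kappa> p s) (gen (g s m)))"
    unfolding comb_def q by simp
  also have "\<dots> = u" using s unfolding p(1) quot_class_eq_iff
    by (metis free.span_neg minus_diff_eq)
  finally show ?thesis by (simp add: m_def)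
qed

lemma qcoord_EE: "(V, \<kappa>, g) \<in> T \<Longrightarrow> u \<in> Q \<Longrightarrow> fst u \<in> V \<Longrightarrow> qcoord r \<kappa> u \<in> EE r"
  by (erule Q_rep[of u]) (metis qcoord_class trunc_EE)

lemma qcoord_inj:
  assumes "(V, \<kappa>, g) \<in> T" "u \<in> Q" "u' \<in> Q" "fst u \<in> V" "fst u' = fst u" "qcoord r \<kappa> u = qcoord r \<kappa> u'"
  shows "u = u'"
proof -
  have "u = comb g (fst u) (qcoord r \<kappa> u)" by (rule comb_qcoord[OF assms(1,2,4), symmetric])
  also have "\<dots> = comb g (fst u') (qcoord r \<kappa> u')" by (simp only: assms(5,6))
  also have "\<dots> = u'" by (rule comb_qcoord[OF assms(1,3)]) (simp only: assms(4,5))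
  finally show ?thesis .
qed

definition qcharts :: "('m \<times> ('x \<Rightarrow>\<^sub>0 real) set) chart set" where
  "qcharts = {({u \<in> Q. fst u \<in> U \<inter> V}, \<lambda>u. join_coords n (\<phi> (fst u)) (qcoord r \<kappa> u)) | U \<phi> V \<kappa> g.
      (U, \<phi>) \<in> atlas M \<and> (V, \<kappa>, g) \<in> T}"

definition X :: "('m \<times> ('x \<Rightarrow>\<^sub>0 real) set) manifold" where "X = manifold_of_charts (n + r) qcharts"

definition E :: "('m \<times> ('x \<Rightarrow>\<^sub>0 real) set, 'm) vbundle" where "E = quot_bundle M R X"

text \<open>The open set \<open>N\<close> inside the chart domain is left free, so that the same
  description covers overlaps of two charts.\<close>

lemma qchart_props:
  assumes U: "(U, \<phi>) \<in> atlas M" and T: "(V, \<kappa>, g) \<in> T" and N: "openin (mtop M) N" "N \<subseteq> U \<inter> V"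
  defines "\<xi> \<equiv> \<lambda>u. join_coords n (\<phi> (fst u)) (qcoord r \<kappa> u)"
  shows "inj_on \<xi> {u \<in> Q. fst u \<in> U \<inter> V}"
    "\<xi> ` {u \<in> Q. fst u \<in> N} = {z \<in> EE (n + r). trunc n z \<in> \<phi> ` N}"
    "openin (Euclidean_space (n + r)) {z \<in> EE (n + r). trunc n z \<in> \<phi> ` N}"
    "z \<in> {z \<in> EE (n + r). trunc n z \<in> \<phi> ` N} \<Longrightarrow>
      inv_into {u \<in> Q. fst u \<in> U \<inter> V} \<xi> z = comb g (inv_into U \<phi> (trunc n z)) (shift n z)"
proof -
  note ch = is_chartD[OF charted_chart[OF mM(2) U]]
  let ?P = "{u \<in> Q. fst u \<in> U \<inter> V}"
  show inj: "inj_on \<xi> ?P"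
  proof (rule inj_onI)
    fix u v assume uv: "u \<in> ?P" "v \<in> ?P" "\<xi> u = \<xi> v"
    have "\<phi> (fst u) = \<phi> (fst v)" using arg_cong[OF uv(3), of "trunc n"] uv(1,2) ch(5) by (simp add: \<xi>_def trunc_join)
    then have f: "fst u = fst v" using ch(3) uv(1,2) by (auto dest: inj_onD)
    have "qcoord r \<kappa> u = qcoord r \<kappa> v" using arg_cong[OF uv(3), of "shift n"] by (simp add: \<xi>_def shift_join)
    then show "u = v" using qcoord_inj[OF T] uv(1,2) f by auto
  qed
  have c: "comb g (inv_into U \<phi> (trunc n z)) (shift n z) \<in> {u \<in> Q. fst u \<in> N} \<and>
     \<xi> (comb g (inv_into U \<phi> (trunc n z)) (shift n z)) = z"
    if z: "z \<in> {z \<in> EE (n + r). trunc n z \<in> \<phi> ` N}" for z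
  proof -
    obtain m where m: "m \<in> N" "trunc n z = \<phi> m" using z by auto
    then have i: "inv_into U \<phi> (trunc n z) = m" using ch(6) N by auto
    have mV: "m \<in> V" using m N by auto
    have sh: "trunc r (shift n z) = shift n z" using z by (intro trunc_id shift_EE) auto
    show ?thesis unfolding i \<xi>_def using comb[OF T mV, of "shift n z"] m(1) sh m(2)[symmetric] join_split by simp
  qed
  show "\<xi> ` {u \<in> Q. fst u \<in> N} = {z \<in> EE (n + r). trunc n z \<in> \<phi> ` N}"
  proof (intro equalityI subsetI)
    fix z assume "z \<in> \<xi> ` {u \<in> Q. fst u \<in> N}"
    then obtain u where u: "u \<in> Q" "fst u \<in> N" "z = \<xi> u" by auto
    then have uUV: "fst u \<in> U" "fst u \<in> V" using N by auto
    show "z \<in> {z \<in> EE (n + r). trunc n z \<in> \<phi> ` N}"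
      using u uUV join_coords_EE[OF qcoord_EE[OF T u(1) uUV(2)]] trunc_join[OF ch(5)[OF uUV(1)]] by (simp add: \<xi>_def)
  next
    fix z assume "z \<in> {z \<in> EE (n + r). trunc n z \<in> \<phi> ` N}"
    note cz = c[OF this]
    show "z \<in> \<xi> ` {u \<in> Q. fst u \<in> N}"
      by (rule image_eqI[where x="comb g (inv_into U \<phi> (trunc n z)) (shift n z)"]) (use cz in auto)
  qed
  show "openin (Euclidean_space (n + r)) {z \<in> EE (n + r). trunc n z \<in> \<phi> ` N}"
    by (rule openin_continuous_map_preimage[OF continuous_map_trunc_EE]) (rule ch(8), use N in auto)
  assume z: "z \<in> {z \<in> EE (n + r). trunc n z \<in> \<phi> ` N}"
  show "inv_into ?P \<xi> z = comb g (inv_into U \<phi> (trunc n z)) (shift n z)"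
    by (rule inv_into_f_eq[OF inj]) (use c[OF z] N in auto)
qed

text \<open>In the fibre direction a transition map is linear with matrix entries
  \<open>\<kappa>' (g s m) t\<close>, so \<open>T_smooth\<close> is what makes the charts
  compatible.\<close>

lemma X_mfd: "mfd X" "mpoints X = Q" "mdim X = n + r" "atlas X = qcharts"
proof -
  show "mdim X = n + r" "atlas X = qcharts" by (auto simp: X_def manifold_of_charts_def)
  have UN: "\<And>U \<phi> V \<kappa> g. (U, \<phi>) \<in> atlas M \<Longrightarrow> (V, \<kappa>, g) \<in> T \<Longrightarrow> openin (mtop M) (U \<inter> V)"
    using is_chartD(1)[OF charted_chart[OF mM(2)]] T_open by blast
  show "mfd X" unfolding X_def
  proof (rule mfd_of_charts(1))
    fix P \<xi> assume "(P, \<xi>) \<in> qcharts"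
    then obtain U \<phi> V \<kappa> g where c: "P = {u \<in> Q. fst u \<in> U \<inter> V}" "\<xi> = (\<lambda>u. join_coords n (\<phi> (fst u)) (qcoord r \<kappa> u))"
      "(U, \<phi>) \<in> atlas M" "(V, \<kappa>, g) \<in> T" by (auto simp: qcharts_def)
    note q = qchart_props[OF c(3,4) UN[OF c(3,4)] order_refl, folded c(2)]
    show "inj_on \<xi> P" "openin (Euclidean_space (n + r)) (\<xi> ` P)" unfolding c(1) q(2) by (rule q)+
    fix P' \<xi>' assume "(P', \<xi>') \<in> qcharts"
    then obtain U' \<phi>' V' \<kappa>' g' where c': "P' = {u \<in> Q. fst u \<in> U' \<inter> V'}" "\<xi>' = (\<lambda>u. join_coords n (\<phi>' (fst u)) (qcoord r \<kappa>' u))"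
      "(U', \<phi>') \<in> atlas M" "(V', \<kappa>', g') \<in> T" by (auto simp: qcharts_def)
    let ?N = "(U \<inter> V) \<inter> (U' \<inter> V')"
    have N: "openin (mtop M) ?N" using UN[OF c(3,4)] UN[OF c'(3,4)] by auto
    have PP: "P \<inter> P' = {u \<in> Q. fst u \<in> ?N}" by (auto simp: c(1) c'(1))
    have Nsub: "?N \<subseteq> U \<inter> V" by auto
    note qn = qchart_props[OF c(3,4) N Nsub, folded c(2)]
    let ?I = "{z \<in> EE (n + r). trunc n z \<in> \<phi> ` ?N}"
    have im: "\<xi> ` (P \<inter> P') = ?I" unfolding PP by (rule qn(2))
    have I: "openin (Euclidean_space (n + r)) ?I" by (rule qn(3))
    show "openin (Euclidean_space (n + r)) (\<xi> ` (P \<inter> P'))" unfolding im by (rule I)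
    fix j k assume j: "j < n + r"
    note ch = is_chartD[OF charted_chart[OF mM(2) c(3)]]
    let ?m = "\<lambda>z. inv_into U \<phi> (trunc n z)"
    have mN: "?m z \<in> ?N" if "z \<in> ?I" for z using that ch(6) by auto
    have sm: "smo (EM (n + r)) ?I M ?m"
    proof (rule smo_compose[OF _ smo_chart_inverse[OF mM(2) atlas_maximal[OF mM(1) c(3)]]])
      show "smo (EM (n + r)) ?I (EM n) (trunc n)"
        using smo_to_euclidean[OF charted_euclidean, of "n + r" ?I n "\<lambda>x. x"] I
        by (auto simp: sfun_euclidean_iff C_on_coord)
    qed auto
    have zc: "sfun (EM (n + r)) ?I (\<lambda>z. z i)" for i using I by (simp add: sfun_euclidean_iff C_on_coord)
    have "sfun (EM (n + r)) ?I (\<lambda>z. \<xi>' (comb g (?m z) (shift n z)) j)"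
    proof (cases "j < n")
      case True
      have "sfun (EM (n + r)) ?I (\<lambda>z. \<phi>' (?m z) j)"
        by (rule smo_sfun'[OF sm mfd_coord[OF mM(1) c'(3) True]]) (use mN in auto)
      then show ?thesis
        by (rule sfun_cong[OF charted_euclidean]) (use True in \<open>simp add: c'(2) comb_def join_coords_def\<close>)
    next
      case False
      then have jr: "j - n < r" using j by simp
      have s: "sfun (EM (n + r)) ?I (\<lambda>z. \<kappa>' (g s (?m z)) (j - n))" if "s < r" for s
        by (rule smo_sfun'[OF sm T_smooth[OF c(4) c'(4) that jr]]) (use mN in auto)
      have "sfun (EM (n + r)) ?I (\<lambda>z. \<Sum>s<r. z (s + n) * \<kappa>' (g s (?m z)) (j - n))"
        by (intro sfun_sum[OF charted_euclidean] sfun_mult[OF charted_euclidean] zc s) (use I in auto)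
      then show ?thesis
      proof (rule sfun_cong[OF charted_euclidean])
        fix z assume z: "z \<in> ?I"
        have "qcoord r \<kappa>' (comb g (?m z) (shift n z)) = trunc r (\<lambda>t. \<Sum>s<r. shift n z s * \<kappa>' (g s (?m z)) t)"
          by (rule lext_comb[OF c(4) c'(4)]) (use mN[OF z] in auto)
        then show "(\<Sum>s<r. z (s + n) * \<kappa>' (g s (?m z)) (j - n)) = \<xi>' (comb g (?m z) (shift n z)) j"
          using False jr by (simp add: c'(2) join_coords_def)
      qed
    qed
    then have C: "C_on k (n + r) ?I (\<lambda>z. \<xi>' (comb g (?m z) (shift n z)) j)" using sfun_euclidean_iff by blast
    show "C_on k (n + r) (\<xi> ` (P \<inter> P')) (\<lambda>z. \<xi>' (inv_into P \<xi> z) j)"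
      unfolding im by (rule C_on_cong[OF I _ C]) (simp only: c(1) qn(4))
  qed
  have "mpoints X = (\<Union>c\<in>qcharts. fst c)" unfolding X_def
    using \<open>mfd X\<close> unfolding X_def by (simp add: mfd_def charted_def) (simp add: manifold_of_charts_def)
  also have "\<dots> = Q"
  proof (intro equalityI subsetI)
    fix u assume u: "u \<in> Q"
    obtain U \<phi> where U: "(U, \<phi>) \<in> atlas M" "fst u \<in> U" using charted_cover[OF mM(2) Q_fst[OF u]] .
    obtain V \<kappa> g where V: "(V, \<kappa>, g) \<in> T" "fst u \<in> V" using T_cover[OF Q_fst[OF u]] by blast
    have "({u \<in> Q. fst u \<in> U \<inter> V}, \<lambda>u. join_coords n (\<phi> (fst u)) (qcoord r \<kappa> u)) \<in> qcharts"
      unfolding qcharts_def using U(1) V(1) by blast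
    then show "u \<in> (\<Union>c\<in>qcharts. fst c)" using u U(2) V(2) by force
  qed (auto simp: qcharts_def)
  finally show "mpoints X = Q" .
qed

end

section \<open>The vector bundle of a quotient family\<close>

context quot_family begin

lemma E_simps [simp]: "total_space E = X" "base E = M" "proj E = fst" "vadd E = quot_add R" "vscale E = quot_scale R"
  "vzero E = (\<lambda>m. quot_class R m 0)"
  by (auto simp: E_def quot_bundle_def)

lemma X_charted: "charted X" by (rule mfd_charted[OF X_mfd(1)])

lemma chart_in: "(U, \<phi>) \<in> atlas M \<Longrightarrow> (V, \<kappa>, g) \<in> T \<Longrightarrow>
    ({u \<in> Q. fst u \<in> U \<inter> V}, \<lambda>u. join_coords n (\<phi> (fst u)) (qcoord r \<kappa> u)) \<in> atlas X"
  unfolding X_mfd(4) qcharts_def by blast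

lemma smo_proj: "smo X Q M fst"
proof (rule smo_locally[OF X_charted])
  show "openin (mtop X) Q" using openin_topspace[of "mtop X"] X_mfd(2) by simp
  fix u assume u: "u \<in> Q"
  obtain U \<phi> where U: "(U, \<phi>) \<in> atlas M" "fst u \<in> U" using charted_cover[OF mM(2) Q_fst[OF u]] .
  obtain V \<kappa> g where V: "(V, \<kappa>, g) \<in> T" "fst u \<in> V" using T_cover[OF Q_fst[OF u]] by blast
  note c = chart_in[OF U(1) V(1)]
  let ?P = "{u \<in> Q. fst u \<in> U \<inter> V}"
  have "smo X ?P M fst"
  proof (rule smo_chartI[OF X_charted U(1) mM(2)])
    show "openin (mtop X) ?P" by (rule is_chartD(1)[OF charted_chart[OF X_charted c]])
    fix j assume j: "j < n"
    have "sfun X ?P (\<lambda>u. join_coords n (\<phi> (fst u)) (qcoord r \<kappa> u) j)"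
      by (rule mfd_coord[OF X_mfd(1) c]) (use j X_mfd(3) in simp)
    then show "sfun X ?P (\<lambda>u. \<phi> (fst u) j)" using j by (simp add: join_coords_def)
  qed auto
  then show "\<exists>P. u \<in> P \<and> smo X P M fst" using u U V by (intro exI[of _ ?P]) simp
qed

lemma fibre_E: "fibre E m = {u \<in> Q. fst u = m}" by (simp add: fibre_def X_mfd(2))

lemma over_E: "over E V = {u \<in> Q. fst u \<in> V}" by (simp add: X_mfd(2))

lemma lincoord_E:
  assumes T: "(V, \<kappa>, g) \<in> T"
  shows "lincoord E V r (qcoord r \<kappa>) (comb g)"
proof -
  note Vo = T_open[OF T]
  have oV: "openin (mtop X) {u \<in> Q. fst u \<in> V}" by (rule smo_vimage_open[OF smo_proj Vo])
  have 1: "sfun X {u \<in> Q. fst u \<in> V} (\<lambda>u. qcoord r \<kappa> u j)" if j: "j < r" for j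
  proof (rule sfun_locally[OF X_charted oV])
    fix u assume u: "u \<in> {u \<in> Q. fst u \<in> V}"
    obtain U \<phi> where U: "(U, \<phi>) \<in> atlas M" "fst u \<in> U" using charted_cover[OF mM(2) Q_fst] u by blast
    have "sfun X {u \<in> Q. fst u \<in> U \<inter> V} (\<lambda>u. join_coords n (\<phi> (fst u)) (qcoord r \<kappa> u) (n + j))"
      by (rule mfd_coord[OF X_mfd(1) chart_in[OF U(1) T]]) (use j X_mfd(3) in simp)
    then have "sfun X {u \<in> Q. fst u \<in> U \<inter> V} (\<lambda>u. qcoord r \<kappa> u j)" by (simp add: join_coords_def)
    then show "\<exists>P. u \<in> P \<and> sfun X P (\<lambda>u. qcoord r \<kappa> u j)"
      using u U(2) by (intro exI[of _ "{u \<in> Q. fst u \<in> U \<inter> V}"]) simp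
  qed
  let ?Y = "prod_manifold M (EM r)"
  have cY: "charted ?Y" by (rule charted_prod[OF mM(2) charted_euclidean])
  have oE: "openin (mtop (EM r)) (EE r)" by simp
  have 2: "smo ?Y (V \<times> EE r) X (\<lambda>z. comb g (fst z) (snd z))"
  proof (rule smo_locally[OF cY])
    show "openin (mtop ?Y) (V \<times> EE r)" using Vo by (simp add: openin_prod_Times_iff)
    fix z assume z: "z \<in> V \<times> EE r"
    then have "fst z \<in> mpoints M" using T_sub[OF T] by auto
    then obtain U \<phi> where U: "(U, \<phi>) \<in> atlas M" "fst z \<in> U" using charted_cover[OF mM(2)] by metis
    have o: "openin (mtop M) (U \<inter> V)" using is_chartD(1)[OF charted_chart[OF mM(2) U(1)]] Vo by auto
    have "smo ?Y ((U \<inter> V) \<times> EE r) X (\<lambda>z. comb g (fst z) (snd z))"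
    proof (rule smo_chartI[OF cY chart_in[OF U(1) T] X_charted])
      show "openin (mtop ?Y) ((U \<inter> V) \<times> EE r)" using o by (simp add: openin_prod_Times_iff)
      fix j assume j: "j < mdim X"
      show "sfun ?Y ((U \<inter> V) \<times> EE r) (\<lambda>z. join_coords n (\<phi> (fst (comb g (fst z) (snd z)))) (qcoord r \<kappa> (comb g (fst z) (snd z))) j)"
      proof (cases "j < n")
        case True
        have "sfun ?Y ((U \<inter> V) \<times> EE r) (\<lambda>z. \<phi> (fst z) j)"
          by (rule smo_sfun'[OF smo_fst[OF mM(2) charted_euclidean o oE] mfd_coord[OF mM(1) U(1) True]]) auto
        then show ?thesis using True by (simp add: comb_def join_coords_def)
      next
        case False
        then have jr: "j - n < r" using j X_mfd(3) by simp
        have "sfun ?Y ((U \<inter> V) \<times> EE r) (\<lambda>z. snd z (j - n))" by (rule sfun_snd_coord[OF mM(2) o])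
        then show ?thesis
          by (rule sfun_cong[OF cY]) (use False jr comb(3)[OF T] in \<open>auto simp: join_coords_def\<close>)
      qed
    qed (use comb[OF T] in auto)
    then show "\<exists>P. z \<in> P \<and> smo ?Y P X (\<lambda>z. comb g (fst z) (snd z))"
      using z U(2) by (intro exI[of _ "(U \<inter> V) \<times> EE r"]) (auto simp: mem_Times_iff)
  qed
  have 3: "qcoord r \<kappa> (quot_add R e e') i = qcoord r \<kappa> e i + qcoord r \<kappa> e' i"
    if m: "m \<in> V" and e: "e \<in> fibre E m" "e' \<in> fibre E m" for m e e' i
  proof -
    obtain p p' where "e = quot_class R m p" "e' = quot_class R m p'"
      using e Q_rep[of e] Q_rep[of e'] unfolding fibre_E by (metis (mono_tags, lifting) mem_Collect_eq)
    then show ?thesis unfolding quot_add_class by (simp add: quot_add_class qcoord_class[OF T m] lext_add trunc_def)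
  qed
  have 4: "qcoord r \<kappa> (quot_scale R s e) i = s * qcoord r \<kappa> e i"
    if m: "m \<in> V" and e: "e \<in> fibre E m" for m e s i
  proof -
    obtain p where "e = quot_class R m p"
      using e Q_rep[of e] unfolding fibre_E by (metis (mono_tags, lifting) mem_Collect_eq)
    then show ?thesis by (simp add: quot_scale_class qcoord_class[OF T m] lext_scale trunc_def)
  qed
  show ?thesis unfolding lincoord_def over_E E_simps
    using Vo 1 2 3 4 qcoord_EE[OF T] comb_qcoord[OF T] comb[OF T] X_mfd(2) by (auto simp: trunc_id)
qed

lemma fibre_vector_space:
  assumes m: "m \<in> mpoints M"
  shows "vector_space_on (fibre E m) (vadd E) (vscale E) (vzero E m)"
proof -
  let ?K = "{p. Poly_Mapping.keys p \<subseteq> Gs m}"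
  have f: "fibre E m = quot_class R m ` ?K"
    unfolding fibre_E using m by (auto simp: quot_set_def)
  have add: "p + q \<in> ?K" if "p \<in> ?K" "q \<in> ?K" for p q using keys_add_subset that by blast
  have scl: "free_scale s p \<in> ?K" if "p \<in> ?K" for s p using keys_free_scale[of s p] that by blast
  have inv: "\<exists>y\<in>?K. quot_class R m (p + y) = quot_class R m 0" if "p \<in> ?K" for p
    using scl[OF that, of "-1"] by (intro bexI[of _ "free_scale (-1) p"]) auto
  show ?thesis
    unfolding f vector_space_on_def E_simps
    using add scl inv
    by (auto simp: quot_add_class quot_scale_class add_ac
      free.scale_right_distrib free.scale_left_distrib mult.commute)
qed

lemma rank_E: "rank E = r" by (simp add: rank_def X_mfd(3))

lemma vector_bundle_E: "vector_bundle E"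
  unfolding vector_bundle_def
proof (intro conjI ballI)
  show sm: "smooth_manifold (total_space E)" unfolding E_simps
  proof (rule bundle_smooth_manifold[OF X_mfd(1) M])
    have "subtopology (mtop X) Q = mtop X" using subtopology_topspace[of "mtop X"] X_mfd(2) by simp
    then show "continuous_map (mtop X) (mtop M) fst" using smo_continuous[OF smo_proj] by simp
    fix m assume m: "m \<in> mpoints M"
    obtain U \<phi> where U: "(U, \<phi>) \<in> atlas M" "m \<in> U" using charted_cover[OF mM(2) m] .
    obtain V \<kappa> g where V: "(V, \<kappa>, g) \<in> T" "m \<in> V" using T_cover[OF m] by blast
    have "openin (mtop M) (U \<inter> V)" using is_chartD(1)[OF charted_chart[OF mM(2) U(1)]] T_open[OF V(1)] by auto
    then show "\<exists>N \<xi>. m \<in> N \<and> openin (mtop M) N \<and> ({x \<in> mpoints X. fst x \<in> N}, \<xi>) \<in> atlas X"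
      using chart_in[OF U(1) V(1)] U(2) V(2) unfolding X_mfd(2) by blast
  qed
  show "smooth_manifold (base E)" using M by simp
  show "mdim (base E) \<le> mdim (total_space E)" by (simp add: X_mfd(3))
  show "smooth_map (total_space E) (base E) (proj E)"
    using smo_smooth_map[OF X_charted mM(1)] smo_proj X_mfd(2) by simp
  fix m assume m: "m \<in> mpoints (base E)"
  then show "vector_space_on (fibre E m) (vadd E) (vscale E) (vzero E m)" using fibre_vector_space by simp
  have "m \<in> mpoints M" using m by simp
  then obtain V \<kappa> g where V: "(V, \<kappa>, g) \<in> T" "m \<in> V" using T_cover by blast
  have "local_trivialization E V (\<lambda>e. (proj E e, qcoord r \<kappa> e))"
    by (rule lincoord_local_trivialization) (use X_mfd mM smo_proj lincoord_E[OF V(1)] rank_E in auto)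
  then show "\<exists>U \<Phi>. m \<in> U \<and> local_trivialization E U \<Phi>" using V(2) by blast
qed

text \<open>Near each point one triple suffices: base map and fibre coordinates rebuild
  \<open>F\<close> through \<open>comb\<close>.\<close>

lemma smo_into:
  assumes Y: "charted Y" and b: "smo Y P M b" and F: "\<And>y. y \<in> P \<Longrightarrow> F y \<in> Q \<and> fst (F y) = b y"
    and c: "\<And>y. y \<in> P \<Longrightarrow> \<exists>V \<kappa> g N. (V, \<kappa>, g) \<in> T \<and> y \<in> N \<and> openin (mtop Y) N \<and> N \<subseteq> P \<and> b ` N \<subseteq> V \<and>
        (\<forall>t<r. sfun Y N (\<lambda>y. qcoord r \<kappa> (F y) t))"
  shows "smo Y P X F"
proof (rule smo_locally[OF Y smo_openin[OF b]])
  fix y assume y: "y \<in> P"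
  obtain V \<kappa> g N where V: "(V, \<kappa>, g) \<in> T" "y \<in> N" "openin (mtop Y) N" "N \<subseteq> P" "b ` N \<subseteq> V"
        "\<And>t. t < r \<Longrightarrow> sfun Y N (\<lambda>y. qcoord r \<kappa> (F y) t)" using c[OF y] by auto
  have "smo Y N X (\<lambda>y. comb g (b y) (trunc r (qcoord r \<kappa> (F y))))"
    using lincoord_smo[OF lincoord_E[OF V(1)] Y, unfolded E_simps, OF mM(1) smo_subset[OF b V(3,4)] V(5), where v="\<lambda>y. qcoord r \<kappa> (F y)"] V(6)
    by blast
  then have "smo Y N X F"
  proof (rule smo_cong[OF Y])
    fix z assume z: "z \<in> N"
    then have f: "F z \<in> Q" "fst (F z) = b z" "fst (F z) \<in> V" using F[of z] V(4,5) by auto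
    show "comb g (b z) (trunc r (qcoord r \<kappa> (F z))) = F z"
      using comb_qcoord[OF V(1) f(1,3)] trunc_id[OF qcoord_EE[OF V(1) f(1,3)]] f(2) by simp
  qed
  then show "\<exists>N. y \<in> N \<and> smo Y N X F" using V(2) by blast
qed

end

section \<open>Multilinear expansion modulo a span\<close>

text \<open>A generator of a free space does not depend linearly on its label; sums and multiples
  are respected only up to elements of the span. These errors are collected while the coordinates
  are split off one by one.\<close>

lemma lin_mod:
  fixes \<Gamma> :: "(nat \<Rightarrow> real) \<Rightarrow> ('x \<Rightarrow>\<^sub>0 real)"
  assumes add: "\<And>v v'. v \<in> EE n \<Longrightarrow> v' \<in> EE n \<Longrightarrow> \<Gamma> v + \<Gamma> v' - \<Gamma> (\<lambda>i. v i + v' i) \<in> free.span S"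
    and scl: "\<And>v t. v \<in> EE n \<Longrightarrow> free_scale t (\<Gamma> v) - \<Gamma> (\<lambda>i. t * v i) \<in> free.span S"
    and v: "v \<in> EE n"
  shows "\<Gamma> v - (\<Sum>j<n. free_scale (v j) (\<Gamma> (unitv j))) \<in> free.span S"
proof -
  have "\<Gamma> (trunc k v) - (\<Sum>j<k. free_scale (v j) (\<Gamma> (unitv j))) \<in> free.span S" if "k \<le> n" for k
    using that
  proof (induction k)
    case 0
    \<comment> \<open>The scaling condition for the scalar 0 puts \<open>\<Gamma>\<close> of the
      zero vector into the span.\<close>
    have "free_scale 0 (\<Gamma> v) - \<Gamma> (\<lambda>i. 0 * v i) \<in> free.span S" by (rule scl[OF v])
    moreover have "(\<lambda>i. 0 * v i) = trunc 0 v" by (auto simp: fun_eq_iff)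
    ultimately have "- \<Gamma> (trunc 0 v) \<in> free.span S" by (simp del: trunc_ge)
    from free.span_neg[OF this] show ?case by (simp del: trunc_ge)
  next
    case (Suc k)
    then have k: "k < n" by simp
    have t: "trunc k v \<in> EE n" "(\<lambda>i. v k * unitv k i) \<in> EE n" using k by (auto simp: topspace_Euclidean_space unitv_def)
    have eq: "(\<lambda>i. trunc k v i + v k * unitv k i) = trunc (Suc k) v" by (auto simp: fun_eq_iff trunc_def unitv_def less_Suc_eq)
    have 1: "\<Gamma> (trunc k v) + \<Gamma> (\<lambda>i. v k * unitv k i) - \<Gamma> (trunc (Suc k) v) \<in> free.span S"
      using add[OF t] unfolding eq .
    have 2: "free_scale (v k) (\<Gamma> (unitv k)) - \<Gamma> (\<lambda>i. v k * unitv k i) \<in> free.span S"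
      by (rule scl[OF unitv_EE[OF k]])
    have 3: "\<Gamma> (trunc k v) - (\<Sum>j<k. free_scale (v j) (\<Gamma> (unitv j))) \<in> free.span S" using Suc by simp
    have "\<Gamma> (trunc (Suc k) v) - (\<Sum>j<Suc k. free_scale (v j) (\<Gamma> (unitv j))) =
       (\<Gamma> (trunc k v) - (\<Sum>j<k. free_scale (v j) (\<Gamma> (unitv j)))) -
       (\<Gamma> (trunc k v) + \<Gamma> (\<lambda>i. v k * unitv k i) - \<Gamma> (trunc (Suc k) v)) -
       (free_scale (v k) (\<Gamma> (unitv k)) - \<Gamma> (\<lambda>i. v k * unitv k i))" by simp
    also have "\<dots> \<in> free.span S" by (rule free.span_diff[OF free.span_diff[OF 3 1] 2])
    finally show ?case .
  qed
  from this[of n] show ?thesis using trunc_id[OF v] by simp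
qed

text \<open>Reindexing along \<open>(i, j) \<mapsto> i * b + j\<close>, the encoding of pairs in
  \<open>tensor_coords\<close>.\<close>

lemma sum_div_mod: "(\<Sum>k<a * b. f (k div b) (k mod b)) = (\<Sum>i<a. \<Sum>j<b. f i (j::nat))"
proof -
  have "(\<Sum>i<a. \<Sum>j<b. f i j) = (\<Sum>(i, j)\<in>{..<a} \<times> {..<b}. f i j)" by (rule sum.cartesian_product)
  also have "\<dots> = (\<Sum>k<a * b. f (k div b) (k mod b))"
  proof (rule sum.reindex_bij_witness[of _ "\<lambda>k. (k div b, k mod b)" "\<lambda>(i, j). i * b + j"])
    fix x assume x: "x \<in> {..<a} \<times> {..<b}"
    obtain i j where ij: "x = (i, j)" "i < a" "j < b" using x by auto
    have "i * b + j < Suc i * b" using ij by simp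
    also have "\<dots> \<le> a * b" using ij by (intro mult_le_mono1) simp
    finally show "(case x of (i, j) \<Rightarrow> i * b + j) \<in> {..<a * b}" using ij by simp
    show "((case x of (i, j) \<Rightarrow> i * b + j) div b, (case x of (i, j) \<Rightarrow> i * b + j) mod b) = x" using ij by simp
    show "f ((case x of (i, j) \<Rightarrow> i * b + j) div b) ((case x of (i, j) \<Rightarrow> i * b + j) mod b) = (case x of (i, j) \<Rightarrow> f i j)"
      using ij by simp
  next
    fix k assume k: "k \<in> {..<a * b}"
    then have "b > 0" by (cases b) auto
    then show "(k div b, k mod b) \<in> {..<a} \<times> {..<b}" using k by (auto simp: less_mult_imp_div_less)
    show "(case (k div b, k mod b) of (i, j) \<Rightarrow> i * b + j) = k" by simp
  qed
  finally show ?thesis ..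
qed

lemma div_mod_bounds: "k < a * b \<Longrightarrow> k div b < a \<and> k mod b < (b::nat)"
  by (metis less_mult_imp_div_less mod_less_divisor mult_0_right not_gr_zero not_less_zero)

text \<open>Expand in the first variable, then each term in the second; \<open>sum_div_mod\<close>
  merges the two sums.\<close>

lemma bilin_mod:
  fixes \<Gamma> :: "(nat \<Rightarrow> real) \<Rightarrow> (nat \<Rightarrow> real) \<Rightarrow> ('x \<Rightarrow>\<^sub>0 real)"
  assumes add1: "\<And>v v' u. v \<in> EE a \<Longrightarrow> v' \<in> EE a \<Longrightarrow> u \<in> EE b \<Longrightarrow> \<Gamma> v u + \<Gamma> v' u - \<Gamma> (\<lambda>i. v i + v' i) u \<in> free.span S"
    and scl1: "\<And>v u t. v \<in> EE a \<Longrightarrow> u \<in> EE b \<Longrightarrow> free_scale t (\<Gamma> v u) - \<Gamma> (\<lambda>i. t * v i) u \<in> free.span S"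
    and add2: "\<And>v u u'. v \<in> EE a \<Longrightarrow> u \<in> EE b \<Longrightarrow> u' \<in> EE b \<Longrightarrow> \<Gamma> v u + \<Gamma> v u' - \<Gamma> v (\<lambda>i. u i + u' i) \<in> free.span S"
    and scl2: "\<And>v u t. v \<in> EE a \<Longrightarrow> u \<in> EE b \<Longrightarrow> free_scale t (\<Gamma> v u) - \<Gamma> v (\<lambda>i. t * u i) \<in> free.span S"
    and v: "v \<in> EE a" and u: "u \<in> EE b"
  shows "\<Gamma> v u - (\<Sum>k<a * b. free_scale (v (k div b) * u (k mod b)) (\<Gamma> (unitv (k div b)) (unitv (k mod b)))) \<in> free.span S"
proof -
  have 1: "\<Gamma> v u - (\<Sum>i<a. free_scale (v i) (\<Gamma> (unitv i) u)) \<in> free.span S"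
    by (rule lin_mod[where \<Gamma>="\<lambda>v. \<Gamma> v u"]) (use add1 scl1 u v in auto)
  have 2: "\<Gamma> (unitv i) u - (\<Sum>j<b. free_scale (u j) (\<Gamma> (unitv i) (unitv j))) \<in> free.span S" if "i < a" for i
    by (rule lin_mod) (use add2 scl2 u unitv_EE[OF that] in auto)
  have "(\<Sum>k<a * b. free_scale (v (k div b) * u (k mod b)) (\<Gamma> (unitv (k div b)) (unitv (k mod b)))) =
     (\<Sum>i<a. \<Sum>j<b. free_scale (v i * u j) (\<Gamma> (unitv i) (unitv j)))" by (rule sum_div_mod)
  also have "\<dots> = (\<Sum>i<a. free_scale (v i) (\<Sum>j<b. free_scale (u j) (\<Gamma> (unitv i) (unitv j))))"
    by (simp add: free.scale_sum_right)
  finally have "\<Gamma> v u - (\<Sum>k<a * b. free_scale (v (k div b) * u (k mod b)) (\<Gamma> (unitv (k div b)) (unitv (k mod b)))) =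
     (\<Gamma> v u - (\<Sum>i<a. free_scale (v i) (\<Gamma> (unitv i) u))) +
     (\<Sum>i<a. free_scale (v i) (\<Gamma> (unitv i) u - (\<Sum>j<b. free_scale (u j) (\<Gamma> (unitv i) (unitv j)))))"
    by (simp add: free.scale_right_diff_distrib sum_subtractf)
  also have "\<dots> \<in> free.span S"
    by (intro free.span_add 1 free.span_sum free.span_scale 2) auto
  finally show ?thesis .
qed

section \<open>The tensor product bundle\<close>

definition tensor_kappa :: "nat \<Rightarrow> ('a \<Rightarrow> nat \<Rightarrow> real) \<Rightarrow> ('b \<Rightarrow> nat \<Rightarrow> real) \<Rightarrow> 'a \<times> 'b \<Rightarrow> nat \<Rightarrow> real" where
  "tensor_kappa rB \<alpha> \<beta> = (\<lambda>(a, b) k. \<alpha> a (k div rB) * \<beta> b (k mod rB))"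

text \<open>Both trivializations are taken over the same \<open>V\<close>. The frame consists of
  pairs of frame elements, numbered by quotient and remainder to match
  \<open>tensor_kappa\<close>.\<close>

definition tensor_family ::
  "('a, 'm) vbundle \<Rightarrow> ('b, 'm) vbundle \<Rightarrow> ('m set \<times> ('a \<times> 'b \<Rightarrow> nat \<Rightarrow> real) \<times> (nat \<Rightarrow> 'm \<Rightarrow> 'a \<times> 'b)) set" where
  "tensor_family A B = {(V, tensor_kappa (rank B) (\<lambda>a. snd (\<Phi> a)) (\<lambda>b. snd (\<Psi> b)),
      \<lambda>k m. (inv_into (over A V) \<Phi> (m, unitv (k div rank B)), inv_into (over B V) \<Psi> (m, unitv (k mod rank B)))) | V \<Phi> \<Psi>.
     local_trivialization A V \<Phi> \<and> local_trivialization B V \<Psi>}"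

text \<open>Shrinking passes through linear coordinates, which replaces the first component of the
  trivialization by the projection and keeps the fibre coordinates.\<close>

lemma local_trivialization_restrict:
  assumes E: "vector_bundle E" and t: "local_trivialization E U \<Phi>" and U': "openin (mtop (base E)) U'" "U' \<subseteq> U"
  shows "local_trivialization E U' (\<lambda>e. (proj E e, snd (\<Phi> e)))"
  by (rule lincoord_local_trivialization[OF vbD(1,2)[OF E] lincoord_restrict[OF local_trivialization_lincoord[OF E t] E U'] vbD(5)[OF E]])

lemma lincoord_hadd:
  assumes E: "vector_bundle E" and l: "lincoord E U r \<theta> h" and m: "m \<in> U" and v: "v \<in> EE r" "v' \<in> EE r"
  shows "h m (\<lambda>i. v i + v' i) = vadd E (h m v) (h m v')"
proof -
  note ll = lincoordD[OF l]
  have s: "(\<lambda>i. v i + v' i) \<in> EE r" using v by (auto simp: topspace_Euclidean_space)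
  note a = ll(5-7)[OF m v(1)] and b = ll(5-7)[OF m v(2)] and c = ll(5-7)[OF m s]
  show ?thesis
    by (rule lincoord_inj[OF l]) (use a b c m vb_ops(1)[OF E a(1) b(1)] ll(8)[of "h m v" "h m v'"] in auto)
qed

lemma lincoord_hscl:
  assumes E: "vector_bundle E" and l: "lincoord E U r \<theta> h" and m: "m \<in> U" and v: "v \<in> EE r"
  shows "h m (\<lambda>i. t * v i) = vscale E t (h m v)"
proof -
  note ll = lincoordD[OF l]
  have s: "(\<lambda>i. t * v i) \<in> EE r" using v by (auto simp: topspace_Euclidean_space)
  note a = ll(5-7)[OF m v(1)] and c = ll(5-7)[OF m s]
  show ?thesis
    by (rule lincoord_inj[OF l]) (use a c m vb_ops(2)[OF E a(1)] ll(9)[of "h m v"] in auto)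
qed

text \<open>The coordinates kill the relations because products of linear coordinates are bilinear.
  The frame spans by \<open>bilin_mod\<close>, whose error terms are tensor relations.\<close>

lemma tensor_quot_family:
  assumes A: "vector_bundle A" and B: "vector_bundle B" and AB: "base A = base B"
  shows "quot_family (base A) (\<lambda>m. fibre A m \<times> fibre B m) (tensor_relations A B) (rank A * rank B) (tensor_family A B)"
proof
  note vA = vbD[OF A] and vB = vbD[OF B, folded AB]
  let ?M = "base A" and ?rA = "rank A" and ?rB = "rank B"
  show "smooth_manifold ?M" using A by (simp add: vector_bundle_def)
  fix m assume m: "m \<in> mpoints ?M"
  obtain U \<Phi> where U: "m \<in> U" "local_trivialization A U \<Phi>" using A m by (auto simp: vector_bundle_def)
  obtain V \<Psi> where V: "m \<in> V" "local_trivialization B V \<Psi>" using B m AB by (auto simp: vector_bundle_def)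
  have o: "openin (mtop (base A)) (U \<inter> V)" "openin (mtop (base B)) (U \<inter> V)"
    using U(2) V(2) AB by (auto simp: local_trivialization_def)
  have "local_trivialization A (U \<inter> V) (\<lambda>e. (proj A e, snd (\<Phi> e)))" "local_trivialization B (U \<inter> V) (\<lambda>e. (proj B e, snd (\<Psi> e)))"
    using local_trivialization_restrict[OF A U(2) o(1)] local_trivialization_restrict[OF B V(2) o(2)] by auto
  then have "\<exists>\<kappa> g. (U \<inter> V, \<kappa>, g) \<in> tensor_family A B" unfolding tensor_family_def by blast
  then show "\<exists>V \<kappa> g. (V, \<kappa>, g) \<in> tensor_family A B \<and> m \<in> V" using U(1) V(1) by blast
next
  note vA = vbD[OF A] and vB = vbD[OF B, folded AB]
  let ?M = "base A" and ?rA = "rank A" and ?rB = "rank B"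
  fix V and \<kappa> :: "'a \<times> 'c \<Rightarrow> nat \<Rightarrow> real" and g assume T: "(V, \<kappa>, g) \<in> tensor_family A B"
  then obtain \<Phi> \<Psi> where t: "\<kappa> = tensor_kappa ?rB (\<lambda>a. snd (\<Phi> a)) (\<lambda>b. snd (\<Psi> b))"
      "g = (\<lambda>k m. (inv_into (over A V) \<Phi> (m, unitv (k div rank B)), inv_into (over B V) \<Psi> (m, unitv (k mod rank B))))"
      "local_trivialization A V \<Phi>" "local_trivialization B V \<Psi>" unfolding tensor_family_def by blast
  define \<alpha> where "\<alpha> = (\<lambda>a. snd (\<Phi> a))"
  define \<beta> where "\<beta> = (\<lambda>b. snd (\<Psi> b))"
  define hA where "hA = (\<lambda>m v. inv_into (over A V) \<Phi> (m, v))"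
  define hB where "hB = (\<lambda>m v. inv_into (over B V) \<Psi> (m, v))"
  have lA: "lincoord A V ?rA \<alpha> hA" using local_trivialization_lincoord[OF A t(3)] by (simp add: \<alpha>_def hA_def)
  have lB: "lincoord B V ?rB \<beta> hB" using local_trivialization_lincoord[OF B t(4)] by (simp add: \<beta>_def hB_def)
  have \<kappa>: "\<kappa> = tensor_kappa ?rB \<alpha> \<beta>" and g: "g = (\<lambda>k m. (hA m (unitv (k div ?rB)), hB m (unitv (k mod ?rB))))"
    using t by (auto simp: \<alpha>_def \<beta>_def hA_def hB_def)
  note la = lincoordD[OF lA] and lb = lincoordD[OF lB, folded AB]
  show Vo: "openin (mtop ?M) V" by (rule la(1))
  have fa: "hA m v \<in> fibre A m" if "m \<in> V" "v \<in> EE ?rA" for m v using la(5,6)[OF that] by (simp add: fibre_def)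
  have fb: "hB m v \<in> fibre B m" if "m \<in> V" "v \<in> EE ?rB" for m v using lb(5,6)[OF that] by (simp add: fibre_def)
  have oA: "a \<in> over A V" if "m \<in> V" "a \<in> fibre A m" for a m using that by (auto simp: fibre_def)
  have oB: "b \<in> over B V" if "m \<in> V" "b \<in> fibre B m" for b m using that by (auto simp: fibre_def)
  {
    fix m assume m: "m \<in> V"
    fix s assume "s < ?rA * ?rB"
    then have s: "s div ?rB < ?rA" "s mod ?rB < ?rB" using div_mod_bounds by auto
    show "g s m \<in> fibre A m \<times> fibre B m" unfolding g using fa fb m unitv_EE s by simp
    fix u assume u: "u < ?rA * ?rB"
    \<comment> \<open>The product of the two coordinates is 1 exactly if quotient and remainder
      agree, and these determine the index.\<close>
    show "\<kappa> (g s m) u = (if s = u then 1 else 0)"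
      unfolding \<kappa> g tensor_kappa_def using la(7)[OF m unitv_EE[OF s(1)]] lb(7)[OF m unitv_EE[OF s(2)]]
      by (auto simp: unitv_def) (metis div_mod_decomp)+
  next
    fix m p u assume m: "m \<in> V" and p: "p \<in> tensor_relations A B m"
    have aa: "\<alpha> (vadd A a a') i = \<alpha> a i + \<alpha> a' i" if "a \<in> fibre A m" "a' \<in> fibre A m" for a a' i
      using la(8)[OF oA[OF m that(1)], of a' i] that by (simp add: fibre_def)
    have bb: "\<beta> (vadd B a a') i = \<beta> a i + \<beta> a' i" if "a \<in> fibre B m" "a' \<in> fibre B m" for a a' i
      using lb(8)[OF oB[OF m that(1)], of a' i] that by (simp add: fibre_def)
    have as: "\<alpha> (vscale A t a) i = t * \<alpha> a i" if "a \<in> fibre A m" for a t i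
      using la(9)[OF oA[OF m that(1)]] .
    have bs: "\<beta> (vscale B t a) i = t * \<beta> a i" if "a \<in> fibre B m" for a t i
      using lb(9)[OF oB[OF m that(1)]] .
    show "lext \<kappa> p u = 0" using p unfolding tensor_relations_def \<kappa>
      by (auto simp: lext_add lext_diff lext_scale tensor_kappa_def aa bb as bs distrib_left distrib_right mult_ac)
  next
    fix m x assume m: "m \<in> V" and x: "x \<in> fibre A m \<times> fibre B m"
    obtain a b where ab: "x = (a, b)" "a \<in> fibre A m" "b \<in> fibre B m" using x by auto
    define \<Gamma> where "\<Gamma> = (\<lambda>v u. gen (hA m v, hB m u))"
    let ?S = "tensor_relations A B m"
    have "\<Gamma> (\<alpha> a) (\<beta> b) - (\<Sum>k<?rA * ?rB. free_scale (\<alpha> a (k div ?rB) * \<beta> b (k mod ?rB)) (\<Gamma> (unitv (k div ?rB)) (unitv (k mod ?rB)))) \<in> free.span ?S"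
    proof (rule bilin_mod)
      fix v v' u assume v: "v \<in> EE ?rA" and v': "v' \<in> EE ?rA" and u: "u \<in> EE ?rB"
      have "\<Gamma> v u + \<Gamma> v' u - \<Gamma> (\<lambda>i. v i + v' i) u \<in> ?S"
        unfolding \<Gamma>_def lincoord_hadd[OF A lA m v v'] tensor_relations_def using fa[OF m] fb[OF m] u v v' by blast
      then show "\<Gamma> v u + \<Gamma> v' u - \<Gamma> (\<lambda>i. v i + v' i) u \<in> free.span ?S" by (rule free.span_base)
    next
      fix v u t assume v: "v \<in> EE ?rA" and u: "u \<in> EE ?rB"
      have "free_scale t (\<Gamma> v u) - \<Gamma> (\<lambda>i. t * v i) u \<in> ?S"
        unfolding \<Gamma>_def lincoord_hscl[OF A lA m v] tensor_relations_def using fa[OF m] fb[OF m] u v by blast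
      then show "free_scale t (\<Gamma> v u) - \<Gamma> (\<lambda>i. t * v i) u \<in> free.span ?S" by (rule free.span_base)
    next
      fix v u u' assume v: "v \<in> EE ?rA" and u: "u \<in> EE ?rB" and u': "u' \<in> EE ?rB"
      have "\<Gamma> v u + \<Gamma> v u' - \<Gamma> v (\<lambda>i. u i + u' i) \<in> ?S"
        unfolding \<Gamma>_def lincoord_hadd[OF B lB m u u'] tensor_relations_def using fa[OF m] fb[OF m] u v u' by blast
      then show "\<Gamma> v u + \<Gamma> v u' - \<Gamma> v (\<lambda>i. u i + u' i) \<in> free.span ?S" by (rule free.span_base)
    next
      fix v u t assume v: "v \<in> EE ?rA" and u: "u \<in> EE ?rB"
      have "free_scale t (\<Gamma> v u) - \<Gamma> v (\<lambda>i. t * u i) \<in> ?S"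
        unfolding \<Gamma>_def lincoord_hscl[OF B lB m u] tensor_relations_def using fa[OF m] fb[OF m] u v by blast
      then show "free_scale t (\<Gamma> v u) - \<Gamma> v (\<lambda>i. t * u i) \<in> free.span ?S" by (rule free.span_base)
    qed (use la(3)[OF oA[OF m ab(2)]] lb(3)[OF oB[OF m ab(3)]] in auto)
    moreover have "\<Gamma> (\<alpha> a) (\<beta> b) = gen x" unfolding \<Gamma>_def ab(1)
      using la(4)[OF oA[OF m ab(2)]] lb(4)[OF oB[OF m ab(3)]] ab by (simp add: fibre_def)
    ultimately show "gen x - (\<Sum>s<?rA * ?rB. free_scale (\<kappa> x s) (gen (g s m))) \<in> free.span ?S"
      by (simp add: \<Gamma>_def \<kappa> g tensor_kappa_def ab(1))
  next
    fix V' and \<kappa>' :: "'a \<times> 'c \<Rightarrow> nat \<Rightarrow> real" and g' s u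
    assume T': "(V', \<kappa>', g') \<in> tensor_family A B" and su: "s < ?rA * ?rB" "u < ?rA * ?rB"
    then obtain \<Phi>' \<Psi>' where t': "\<kappa>' = tensor_kappa ?rB (\<lambda>a. snd (\<Phi>' a)) (\<lambda>b. snd (\<Psi>' b))"
      "local_trivialization A V' \<Phi>'" "local_trivialization B V' \<Psi>'" unfolding tensor_family_def by blast
    note la2 = lincoordD[OF local_trivialization_lincoord[OF A t'(2)]]
    note lb2 = lincoordD[OF local_trivialization_lincoord[OF B t'(3)], folded AB]
    have N: "openin (mtop ?M) (V \<inter> V')" using Vo la2(1) by auto
    have s: "s div ?rB < ?rA" "s mod ?rB < ?rB" "u div ?rB < ?rA" "u mod ?rB < ?rB" using div_mod_bounds su by auto
    have "smo ?M (V \<inter> V') (total_space A) (\<lambda>m. hA m (trunc ?rA (unitv (s div ?rB))))"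
      by (rule lincoord_smo[OF lA vA(4) vA(2) smo_id[OF N]]) (use N in \<open>auto intro: sfun_const\<close>)
    then have "sfun ?M (V \<inter> V') (\<lambda>m. snd (\<Phi>' (hA m (trunc ?rA (unitv (s div ?rB))))) (u div ?rB))"
      by (rule smo_sfun'[OF _ la2(2)[OF s(3)]]) (use la(5,6)[OF _ trunc_EE] in auto)
    moreover have "smo ?M (V \<inter> V') (total_space B) (\<lambda>m. hB m (trunc ?rB (unitv (s mod ?rB))))"
      by (rule lincoord_smo[OF lB vA(4)]) (use N vB(2) AB smo_id[OF N] in \<open>auto intro: sfun_const\<close>)
    then have "sfun ?M (V \<inter> V') (\<lambda>m. snd (\<Psi>' (hB m (trunc ?rB (unitv (s mod ?rB))))) (u mod ?rB))"
      by (rule smo_sfun'[OF _ lb2(2)[OF s(4)]]) (use lb(5,6)[OF _ trunc_EE] in auto)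
    ultimately show "sfun ?M (V \<inter> V') (\<lambda>m. \<kappa>' (g s m) u)"
      using sfun_mult[OF vA(4)] trunc_id[OF unitv_EE[OF s(1)]] trunc_id[OF unitv_EE[OF s(2)]]
      by (simp add: t'(1) g tensor_kappa_def)
  }
qed

text \<open>The prescribed charts of the tensor product are the charts of this family, so the
  results on quotient families apply to \<open>tensor_bundle\<close> itself.\<close>

lemma tensor_bundle_eq:
  assumes A: "vector_bundle A" and B: "vector_bundle B" and AB: "base A = base B"
  shows "tensor_bundle A B = quot_family.E (base A) (\<lambda>m. fibre A m \<times> fibre B m) (tensor_relations A B) (rank A * rank B) (tensor_family A B)"
proof -
  interpret t: quot_family "base A" "\<lambda>m. fibre A m \<times> fibre B m" "tensor_relations A B" "rank A * rank B" "tensor_family A B"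
    by (rule tensor_quot_family[OF assms])
  have c: "tensor_coords A B \<Phi> \<Psi> = qcoord (rank A * rank B) (tensor_kappa (rank B) (\<lambda>a. snd (\<Phi> a)) (\<lambda>b. snd (\<Psi> b)))" for \<Phi> \<Psi>
  proof -
    have "(\<Sum>(a, b)\<in>Poly_Mapping.keys p. Poly_Mapping.lookup p (a, b)
            * snd (\<Phi> a) (k div rank B) * snd (\<Psi> b) (k mod rank B)) =
        lext (tensor_kappa (rank B) (\<lambda>a. snd (\<Phi> a)) (\<lambda>b. snd (\<Psi> b))) p k" for p k
      unfolding lext_def tensor_kappa_def by (rule sum.cong) (auto simp: mult.assoc)
    then show ?thesis by (intro ext) (simp only: tensor_coords_def qcoord_def)
  qed
  have "tensor_charts A B = t.qcharts"
    unfolding tensor_charts_def t.qcharts_def tensor_set_def c unfolding tensor_family_def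
    by (simp only: mem_Collect_eq prod.inject) blast
  then show ?thesis unfolding tensor_bundle_def t.E_def t.X_def by simp
qed

section \<open>Embedded submanifolds\<close>

lemma submanifold_simps [simp]: "mtop (submanifold X S k) = subtopology (mtop X) S" "mdim (submanifold X S k) = k"
  by (auto simp: submanifold_def)

lemma EE_mono: "k \<le> n \<Longrightarrow> x \<in> EE k \<Longrightarrow> x \<in> EE n"
  by (auto simp: topspace_Euclidean_space)

lemma openin_Euclidean_slice:
  assumes k: "k \<le> n" and W: "openin (Euclidean_space n) W"
  shows "openin (Euclidean_space k) (W \<inter> EE k)"
proof -
  have "continuous_map (Euclidean_space k) (Euclidean_space n) (\<lambda>x. trunc n x)"
    unfolding continuous_map_trunc using continuous_map_coord by blast
  from openin_continuous_map_preimage[OF this W]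
  have "openin (Euclidean_space k) {x \<in> EE k. trunc n x \<in> W}" .
  moreover have "{x \<in> EE k. trunc n x \<in> W} = W \<inter> EE k" using trunc_id[OF EE_mono[OF k]] by auto
  ultimately show ?thesis by simp
qed

text \<open>Since \<open>EE k\<close> is a subset of the ambient Euclidean space, the same
  coordinate map serves on \<open>S\<close>; what has to be compared are the two Euclidean
  topologies.\<close>

lemma slice_chart:
  assumes X: "mfd X" and k: "k \<le> mdim X" and U: "(U, \<phi>) \<in> maximal_atlas X"
    and sl: "\<phi> ` (U \<inter> S) = \<phi> ` U \<inter> EE k"
  shows "is_chart (subtopology (mtop X) S) k (U \<inter> S, \<phi>)"
    "y \<in> \<phi> ` (U \<inter> S) \<Longrightarrow> inv_into (U \<inter> S) \<phi> y = inv_into U \<phi> y"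
proof -
  note ch = is_chartD[OF conjunct1[OF U[unfolded maximal_atlas_iff]]]
  have o: "openin (subtopology (mtop X) S) (U \<inter> S)" using ch(1) openin_subtopology_Int by blast
  have oI: "openin (Euclidean_space k) (\<phi> ` U \<inter> EE k)" by (rule openin_Euclidean_slice[OF k ch(2)])
  have st: "subtopology (subtopology (mtop X) S) (U \<inter> S) = subtopology (mtop X) (U \<inter> S)"
    by (simp add: subtopology_subtopology Int_commute inf_left_commute)
  have sub: "continuous_map (subtopology (mtop X) (U \<inter> S)) (Euclidean_space (mdim X)) \<phi>"
    by (rule continuous_map_from_subtopology_mono[OF ch(4)]) auto
  have "continuous_map (subtopology (mtop X) (U \<inter> S)) (Euclidean_space k) (\<lambda>x. trunc k (\<phi> x))"
    unfolding continuous_map_trunc using continuous_map_compose[OF sub continuous_map_coord] by (simp add: o_def)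
  note trc = this
  have inE: "\<phi> x \<in> EE k" if "x \<in> U \<inter> S" for x using sl that by blast
  have c: "continuous_map (subtopology (subtopology (mtop X) S) (U \<inter> S)) (Euclidean_space k) \<phi>"
    unfolding st by (rule continuous_map_eq[OF trc]) (use inE trunc_id in auto)
  have "continuous_map (subtopology (Euclidean_space (mdim X)) (\<phi> ` U)) (mtop X) (inv_into U \<phi>)"
    using smo_continuous[OF smo_chart_inverse[OF mfd_charted[OF X] U]] by simp
  moreover have "continuous_map (subtopology (Euclidean_space k) (\<phi> ` U \<inter> EE k)) (subtopology (Euclidean_space (mdim X)) (\<phi> ` U)) (\<lambda>x. x)"
  proof -
    have "continuous_map (subtopology (Euclidean_space k) (\<phi> ` U \<inter> EE k)) (Euclidean_space (mdim X)) (\<lambda>x. trunc (mdim X) x)"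
      unfolding continuous_map_trunc using continuous_map_from_subtopology[OF continuous_map_coord] by blast
    then have "continuous_map (subtopology (Euclidean_space k) (\<phi> ` U \<inter> EE k)) (Euclidean_space (mdim X)) (\<lambda>x. x)"
      by (rule continuous_map_eq) (use trunc_id[OF EE_mono[OF k]] in auto)
    then show ?thesis by (auto simp: continuous_map_in_subtopology)
  qed
  ultimately have "continuous_map (subtopology (Euclidean_space k) (\<phi> ` U \<inter> EE k)) (mtop X) (inv_into U \<phi>)"
    using continuous_map_compose[of _ _ "\<lambda>x. x" _ "inv_into U \<phi>"] by (simp add: o_def)
  moreover have inv: "inv_into U \<phi> y \<in> U \<inter> S \<and> \<phi> (inv_into U \<phi> y) = y" if "y \<in> \<phi> ` U \<inter> EE k" for y
    using that ch(6) unfolding sl[symmetric] by auto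
  ultimately have c': "continuous_map (subtopology (Euclidean_space k) (\<phi> ` U \<inter> EE k)) (subtopology (mtop X) S) (inv_into U \<phi>)"
    by (auto simp: continuous_map_in_subtopology)
  have inv1: "\<phi> x \<in> \<phi> ` U \<inter> EE k \<and> inv_into U \<phi> (\<phi> x) = x" if "x \<in> U \<inter> S" for x
    using that inE ch(6) by auto
  note r = is_chartI[OF o oI c c' inv1 inv]
  show "is_chart (subtopology (mtop X) S) k (U \<inter> S, \<phi>)" by (rule r(1))
  show "y \<in> \<phi> ` (U \<inter> S) \<Longrightarrow> inv_into (U \<inter> S) \<phi> y = inv_into U \<phi> y" unfolding sl by (rule r(3))
qed

lemma atlas_submanifold: "atlas (submanifold X S k) = {(U \<inter> S, \<phi>) | U \<phi>. (U, \<phi>) \<in> maximal_atlas X \<and> \<phi> ` (U \<inter> S) = \<phi> ` U \<inter> EE k}"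
  by (simp add: submanifold_def)

text \<open>In a slice chart the restricted function is the ambient one composed with the inclusion
  of \<open>EE k\<close>, written as \<open>trunc ?n\<close> to fit
  \<open>C_on_compose\<close>.\<close>

lemma sfun_submanifold:
  assumes X: "mfd X" and k: "k \<le> mdim X" and g: "sfun X P g"
  shows "sfun (submanifold X S k) (P \<inter> S) g"
proof (rule sfunI)
  show "openin (mtop (submanifold X S k)) (P \<inter> S)" using sfun_openin[OF g] openin_subtopology_Int by auto
  fix U' \<phi> i assume "(U', \<phi>) \<in> atlas (submanifold X S k)"
  then obtain U where U: "U' = U \<inter> S" "(U, \<phi>) \<in> maximal_atlas X" "\<phi> ` (U \<inter> S) = \<phi> ` U \<inter> EE k"
    unfolding atlas_submanifold by blast
  note sc = slice_chart[OF X k U(2,3)]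
  note ch = is_chartD[OF conjunct1[OF U(2)[unfolded maximal_atlas_iff]]]
  let ?n = "mdim X"
  have "sfun (EM ?n) {y \<in> \<phi> ` U. inv_into U \<phi> y \<in> P} (\<lambda>y. g (inv_into U \<phi> y))"
    by (rule smo_sfun[OF smo_chart_inverse[OF mfd_charted[OF X] U(2)] g])
  moreover have "{y \<in> \<phi> ` U. inv_into U \<phi> y \<in> P} = \<phi> ` (P \<inter> U)" using ch(6) by force
  ultimately have G: "openin (Euclidean_space ?n) (\<phi> ` (P \<inter> U))" "C_on i ?n (\<phi> ` (P \<inter> U)) (\<lambda>y. g (inv_into U \<phi> y))"
    by (auto simp: sfun_euclidean_iff)
  have eq: "\<phi> ` (P \<inter> S \<inter> U') = \<phi> ` (P \<inter> U) \<inter> EE k"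
  proof
    show "\<phi> ` (P \<inter> S \<inter> U') \<subseteq> \<phi> ` (P \<inter> U) \<inter> EE k" using U(1,3) by blast
    show "\<phi> ` (P \<inter> U) \<inter> EE k \<subseteq> \<phi> ` (P \<inter> S \<inter> U')"
    proof
      fix y assume y: "y \<in> \<phi> ` (P \<inter> U) \<inter> EE k"
      then obtain x where x: "x \<in> P" "x \<in> U" "y = \<phi> x" by auto
      then have "y \<in> \<phi> ` (U \<inter> S)" using y U(3) by blast
      then obtain x' where "x' \<in> U" "x' \<in> S" "y = \<phi> x'" by auto
      then show "y \<in> \<phi> ` (P \<inter> S \<inter> U')" using x ch(3) U(1) by (metis IntI image_eqI inj_onD)
    qed
  qed
  have I: "openin (Euclidean_space k) (\<phi> ` (P \<inter> S \<inter> U'))" unfolding eq by (rule openin_Euclidean_slice[OF k G(1)])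
  have tr: "trunc ?n y = y" if "y \<in> \<phi> ` (P \<inter> S \<inter> U')" for y
    using that EE_mono[OF k] unfolding eq by (intro trunc_id) auto
  have "C_on i k (\<phi> ` (P \<inter> S \<inter> U')) (\<lambda>y. (\<lambda>y. g (inv_into U \<phi> y)) (trunc ?n y))"
    by (rule C_on_compose[OF I G(1) C_on_coord _ G(2)]) (use tr eq in auto)
  then show "C_on i (mdim (submanifold X S k)) (\<phi> ` (P \<inter> S \<inter> U')) (\<lambda>x. g (inv_into U' \<phi> x))"
    unfolding submanifold_simps
  proof (rule C_on_cong[OF I, rotated])
    fix y assume y: "y \<in> \<phi> ` (P \<inter> S \<inter> U')"
    then have "y \<in> \<phi> ` (U \<inter> S)" using U(1) by blast
    then show "g (inv_into U \<phi> (trunc ?n y)) = g (inv_into U' \<phi> y)" unfolding U(1) tr[OF y] using sc(2) by simp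
  qed
qed

lemma mfd_submanifold:
  assumes X: "mfd X" and k: "k \<le> mdim X" and S: "S \<subseteq> mpoints X"
    and cov: "\<And>x. x \<in> S \<Longrightarrow> \<exists>U \<phi>. x \<in> U \<and> (U, \<phi>) \<in> maximal_atlas X \<and> \<phi> ` (U \<inter> S) = \<phi> ` U \<inter> EE k"
  shows "mfd (submanifold X S k)"
  unfolding mfd_def
proof (intro conjI ballI, safe)
  show "charted (submanifold X S k)"
    unfolding charted_def
  proof (intro conjI ballI)
    fix c assume "c \<in> atlas (submanifold X S k)"
    then show "is_chart (mtop (submanifold X S k)) (mdim (submanifold X S k)) c"
      using slice_chart(1)[OF X k] unfolding atlas_submanifold by auto
  next
    show "(\<Union>c\<in>atlas (submanifold X S k). fst c) = mpoints (submanifold X S k)"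
    proof (intro equalityI subsetI)
      fix x assume "x \<in> (\<Union>c\<in>atlas (submanifold X S k). fst c)"
      then show "x \<in> mpoints (submanifold X S k)" using S unfolding atlas_submanifold by auto
    next
      fix x assume "x \<in> mpoints (submanifold X S k)"
      then have x: "x \<in> S" by simp
      from cov[OF x] obtain U \<phi> where U: "x \<in> U" "(U, \<phi>) \<in> maximal_atlas X" "\<phi> ` (U \<inter> S) = \<phi> ` U \<inter> EE k" by blast
      then have "(U \<inter> S, \<phi>) \<in> atlas (submanifold X S k)" unfolding atlas_submanifold by blast
      then show "x \<in> (\<Union>c\<in>atlas (submanifold X S k). fst c)" using x U(1) by force
    qed
  qed
  fix V \<psi> j assume "(V, \<psi>) \<in> atlas (submanifold X S k)" and j: "j < mdim (submanifold X S k)"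
  then obtain U where U: "V = U \<inter> S" "(U, \<psi>) \<in> maximal_atlas X" unfolding atlas_submanifold by blast
  have "sfun X U (\<lambda>x. \<psi> x j)" using U(2) j k unfolding maximal_atlas_iff by simp
  from sfun_submanifold[OF X k this] show "sfun (submanifold X S k) V (\<lambda>x. \<psi> x j)" unfolding U(1) .
qed

lemma smo_inclusion:
  assumes X: "mfd X" and k: "k \<le> mdim X" and S: "S \<subseteq> mpoints X"
  shows "smo (submanifold X S k) S X (\<lambda>x. x)"
  unfolding smo_def
proof (intro conjI allI impI)
  show "openin (mtop (submanifold X S k)) S" using S by (simp add: openin_subtopology_refl)
  show "(\<lambda>x. x) ` S \<subseteq> mpoints X" using S by auto
  fix W g assume "sfun X W g"
  from sfun_submanifold[OF X k this, of S] show "sfun (submanifold X S k) {x\<in>S. x \<in> W} g"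
    by (simp add: Int_def conj_commute)
qed

text \<open>The coordinates of a slice chart are coordinates of an ambient chart, so for a map with
  values in \<open>S\<close> smoothness into \<open>X\<close> is enough.\<close>

lemma smo_into_submanifold:
  assumes X: "mfd X" and k: "k \<le> mdim X" and Y: "mfd (submanifold X S k)" and Z: "charted Z"
    and F: "smo Z P X F" and S: "F ` P \<subseteq> S"
  shows "smo Z P (submanifold X S k) F"
proof (rule smo_locally[OF Z smo_openin[OF F]])
  fix z assume z: "z \<in> P"
  then have "F z \<in> mpoints (submanifold X S k)" using S smo_in[OF F z] by auto
  then obtain V \<phi> where V: "(V, \<phi>) \<in> atlas (submanifold X S k)" "F z \<in> V" using charted_cover[OF mfd_charted[OF Y]] by metis
  then obtain U where U: "V = U \<inter> S" "(U, \<phi>) \<in> maximal_atlas X" unfolding atlas_submanifold by blast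
  have oU: "openin (mtop X) U" using is_chartD(1)[OF conjunct1[OF U(2)[unfolded maximal_atlas_iff]]] .
  have "smo Z {z\<in>P. F z \<in> U} (submanifold X S k) F"
  proof (rule smo_chartI[OF Z V(1) mfd_charted[OF Y] smo_vimage_open[OF F oU]])
    show "F x \<in> V" if "x \<in> {z\<in>P. F z \<in> U}" for x using that S U(1) by auto
    fix j assume "j < mdim (submanifold X S k)"
    then have "sfun X U (\<lambda>x. \<phi> x j)" using U(2) k unfolding maximal_atlas_iff by simp
    from smo_sfun[OF F this] show "sfun Z {z\<in>P. F z \<in> U} (\<lambda>x. \<phi> (F x) j)" .
  qed
  then show "\<exists>Q. z \<in> Q \<and> smo Z Q (submanifold X S k) F" using z V(2) U(1) by (intro exI[of _ "{z\<in>P. F z \<in> U}"]) auto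
qed

section \<open>Decompositions of a double vector bundle and its core\<close>

abbreviation zr :: "nat \<Rightarrow> real" where "zr \<equiv> \<lambda>_. 0"

lemma zr_EE [simp]: "zr \<in> EE n" by (simp add: topspace_Euclidean_space)

context dvb begin

abbreviation "overM V \<equiv> {d \<in> D. qA (pA d) \<in> V}"

text \<open>A splitting of \<open>D\<close> over \<open>V\<close>: \<open>G m\<close> is inverse to \<open>d \<mapsto> (\<Phi> (pA d), \<Psi> (pB d), \<gamma> d)\<close> on the slice of \<open>m\<close>, and
  the core coordinate \<open>\<gamma>\<close> is linear for both structures.\<close>

definition dtriv :: "'m set \<Rightarrow> ('a \<Rightarrow> 'm \<times> (nat \<Rightarrow> real)) \<Rightarrow> ('b \<Rightarrow> 'm \<times> (nat \<Rightarrow> real)) \<Rightarrow> ('d \<Rightarrow> nat \<Rightarrow> real) \<Rightarrow>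
    ('m \<Rightarrow> (nat \<Rightarrow> real) \<Rightarrow> (nat \<Rightarrow> real) \<Rightarrow> (nat \<Rightarrow> real) \<Rightarrow> 'd) \<Rightarrow> bool" where
  "dtriv V \<Phi> \<Psi> \<gamma> G \<longleftrightarrow> local_trivialization A V \<Phi> \<and> local_trivialization B V \<Psi> \<and> nA \<le> rB \<and>
     (\<forall>l<nC. sfun TD (overM V) (\<lambda>d. \<gamma> d l)) \<and>
     (\<forall>d\<in>overM V. \<gamma> d \<in> EE nC \<and> G (qA (pA d)) (snd (\<Phi> (pA d))) (snd (\<Psi> (pB d))) (\<gamma> d) = d) \<and>
     (\<forall>m\<in>V. \<forall>v\<in>EE nA. \<forall>u\<in>EE nB. \<forall>w\<in>EE nC. G m v u w \<in> D \<and> qA (pA (G m v u w)) = m \<and>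
        snd (\<Phi> (pA (G m v u w))) = v \<and> snd (\<Psi> (pB (G m v u w))) = u \<and> \<gamma> (G m v u w) = w) \<and>
     (\<forall>d\<in>overM V. \<forall>d'\<in>D. \<forall>l. pA d' = pA d \<longrightarrow> \<gamma> (addA d d') l = \<gamma> d l + \<gamma> d' l) \<and>
     (\<forall>d\<in>overM V. \<forall>d'\<in>D. \<forall>l. pB d' = pB d \<longrightarrow> \<gamma> (addB d d') l = \<gamma> d l + \<gamma> d' l) \<and>
     (\<forall>d\<in>overM V. \<forall>t l. \<gamma> (sclA t d) l = t * \<gamma> d l \<and> \<gamma> (sclB t d) l = t * \<gamma> d l) \<and>
     (\<forall>v\<in>EE nA. \<forall>u\<in>EE nB. \<forall>w\<in>EE nC. smo M V TD (\<lambda>m. G m v u w)) \<and>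
     smo (prod_manifold M (EM nC)) (V \<times> EE nC) TD (\<lambda>z. G (fst z) zr zr (snd z)) \<and>
     (\<forall>(U, \<phi>)\<in>atlas M. ({d \<in> D. qA (pA d) \<in> V \<inter> U},
        \<lambda>d. join_coords (mdim M) (\<phi> (qA (pA d))) (join_coords nC (\<gamma> d) (join_coords nA (snd (\<Phi> (pA d))) (snd (\<Psi> (pB d))))))
        \<in> maximal_atlas TD)"

text \<open>The local data keep fibre coordinates of trivializations over larger sets; restricting
  those to \<open>V\<close> gives trivializations with the same fibre coordinates.\<close>

lemma dtriv_exists:
  assumes "m0 \<in> mpoints M"
  shows "\<exists>V \<Phi> \<Psi> \<gamma> G. m0 \<in> V \<and> dtriv V \<Phi> \<Psi> \<gamma> G"
proof -
  obtain V hA hB W \<theta> h \<epsilon> U1 \<Phi> U2 \<Psi> where V: "m0 \<in> V" "local_trivialization A U1 \<Phi>" "local_trivialization B U2 \<Psi>" "V \<subseteq> U1 \<inter> U2"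
    and L: "dvb_local DA DB A B V (\<lambda>a. snd (\<Phi> a)) hA (\<lambda>b. snd (\<Psi> b)) hB W \<theta> h \<epsilon>"
    using local_exists[OF assms] by auto
  interpret L: dvb_local DA DB A B V "\<lambda>a. snd (\<Phi> a)" hA "\<lambda>b. snd (\<Psi> b)" hB W \<theta> h \<epsilon> by (rule L)
  have Vo: "openin (mtop M) V" by (rule L.la'(1))
  have t: "local_trivialization A V (\<lambda>a. (qA a, snd (\<Phi> a)))" "local_trivialization B V (\<lambda>b. (qB b, snd (\<Psi> b)))"
    using local_trivialization_restrict[OF vA V(2)] local_trivialization_restrict[OF vB V(3)] Vo V(4) by auto
  have s1: "smo M V TD (\<lambda>m. L.G m v u w)" if "v \<in> EE nA" "u \<in> EE nB" "w \<in> EE nC" for v u w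
    using L.smo_G[OF vba(4) smo_id[OF Vo], of "\<lambda>_. v" "\<lambda>_. u" "\<lambda>_. w"] that
    by (auto simp: trunc_id intro: sfun_const Vo)
  have s2: "smo (prod_manifold M (EM nC)) (V \<times> EE nC) TD (\<lambda>z. L.G (fst z) zr zr (snd z))"
  proof -
    have cX: "charted (prod_manifold M (EM nC))" by (rule charted_prod[OF vba(4) charted_euclidean])
    have oE: "openin (mtop (EM nC)) (EE nC)" by simp
    have o: "openin (mtop (prod_manifold M (EM nC))) (V \<times> EE nC)" using Vo by (simp add: openin_prod_Times_iff)
    have "smo (prod_manifold M (EM nC)) (V \<times> EE nC) TD (\<lambda>z. L.G (fst z) (trunc nA zr) (trunc nB zr) (trunc nC (snd z)))"
      by (rule L.smo_G[OF cX smo_fst[OF vba(4) charted_euclidean Vo oE]])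
         (use sfun_snd_coord[OF vba(4) Vo] o in \<open>auto intro: sfun_const\<close>)
    then show ?thesis by (rule smo_cong[OF cX]) (auto simp: trunc_id simp del: trunc_ge)
  qed
  have c: "({d \<in> D. qA (pA d) \<in> V \<inter> U},
        \<lambda>d. join_coords (mdim M) (\<phi> (qA (pA d))) (join_coords nC (L.\<gamma> d) (join_coords nA (snd (\<Phi> (pA d))) (snd (\<Psi> (pB d))))))
        \<in> maximal_atlas TD" if "(U, \<phi>) \<in> atlas M" for U \<phi>
    using L.dchart_maximal(1)[OF that] unfolding L.dchart_def[abs_def] .
  have "dtriv V (\<lambda>a. (qA a, snd (\<Phi> a))) (\<lambda>b. (qB b, snd (\<Psi> b))) L.\<gamma> L.G"
    unfolding dtriv_def snd_conv
    by (intro conjI ballI allI impI t L.rk L.sfun_gam L.gam_EE L.G_inv L.gam_addA L.gam_addB L.gam_sclA L.gam_sclB s1 s2)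
       (use L.Gprops c in auto)
  then show ?thesis using V(1) by blast
qed

lemma dtrivD:
  assumes "dtriv V \<Phi> \<Psi> \<gamma> G"
  shows "local_trivialization A V \<Phi>" "local_trivialization B V \<Psi>" "nA \<le> rB"
    "l < nC \<Longrightarrow> sfun TD (overM V) (\<lambda>d. \<gamma> d l)"
    "d \<in> overM V \<Longrightarrow> \<gamma> d \<in> EE nC"
    "d \<in> overM V \<Longrightarrow> G (qA (pA d)) (snd (\<Phi> (pA d))) (snd (\<Psi> (pB d))) (\<gamma> d) = d"
    "m \<in> V \<Longrightarrow> v \<in> EE nA \<Longrightarrow> u \<in> EE nB \<Longrightarrow> w \<in> EE nC \<Longrightarrow> G m v u w \<in> D \<and> qA (pA (G m v u w)) = m \<and>
        snd (\<Phi> (pA (G m v u w))) = v \<and> snd (\<Psi> (pB (G m v u w))) = u \<and> \<gamma> (G m v u w) = w"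
    "d \<in> overM V \<Longrightarrow> d' \<in> D \<Longrightarrow> pA d' = pA d \<Longrightarrow> \<gamma> (addA d d') l = \<gamma> d l + \<gamma> d' l"
    "d \<in> overM V \<Longrightarrow> d' \<in> D \<Longrightarrow> pB d' = pB d \<Longrightarrow> \<gamma> (addB d d') l = \<gamma> d l + \<gamma> d' l"
    "d \<in> overM V \<Longrightarrow> \<gamma> (sclA t d) l = t * \<gamma> d l" "d \<in> overM V \<Longrightarrow> \<gamma> (sclB t d) l = t * \<gamma> d l"
    "v \<in> EE nA \<Longrightarrow> u \<in> EE nB \<Longrightarrow> w \<in> EE nC \<Longrightarrow> smo M V TD (\<lambda>m. G m v u w)"
    "smo (prod_manifold M (EM nC)) (V \<times> EE nC) TD (\<lambda>z. G (fst z) zr zr (snd z))"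
    "(U, \<phi>) \<in> atlas M \<Longrightarrow> ({d \<in> D. qA (pA d) \<in> V \<inter> U},
        \<lambda>d. join_coords (mdim M) (\<phi> (qA (pA d))) (join_coords nC (\<gamma> d) (join_coords nA (snd (\<Phi> (pA d))) (snd (\<Psi> (pB d))))))
        \<in> maximal_atlas TD"
  using assms unfolding dtriv_def by auto

lemma dtriv_lin:
  assumes t: "dtriv V \<Phi> \<Psi> \<gamma> G"
  shows "lincoord A V nA (\<lambda>a. snd (\<Phi> a)) (\<lambda>m v. inv_into (over A V) \<Phi> (m, v))"
    "lincoord B V nB (\<lambda>b. snd (\<Psi> b)) (\<lambda>m v. inv_into (over B V) \<Psi> (m, v))"
    "openin (mtop M) V" "d \<in> overM V \<Longrightarrow> pA d \<in> over A V" "d \<in> overM V \<Longrightarrow> pB d \<in> over B V"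
    "d \<in> overM V \<Longrightarrow> qB (pB d) = qA (pA d)"
proof -
  show l: "lincoord A V nA (\<lambda>a. snd (\<Phi> a)) (\<lambda>m v. inv_into (over A V) \<Phi> (m, v))"
    "lincoord B V nB (\<lambda>b. snd (\<Psi> b)) (\<lambda>m v. inv_into (over B V) \<Psi> (m, v))"
    using local_trivialization_lincoord[OF vA dtrivD(1)[OF t]] local_trivialization_lincoord[OF vB dtrivD(2)[OF t]] .
  show "openin (mtop M) V" by (rule lincoordD(1)[OF l(1)])
  show "d \<in> overM V \<Longrightarrow> pA d \<in> over A V" "d \<in> overM V \<Longrightarrow> pB d \<in> over B V" "d \<in> overM V \<Longrightarrow> qB (pB d) = qA (pA d)"
    using vbDA(6)[of d] vbDB(6)[of d] proj_proj[of d] by auto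
qed

lemma dtriv_eqI:
  assumes t: "dtriv V \<Phi> \<Psi> \<gamma> G" and d: "d \<in> overM V" "d' \<in> D" "qA (pA d') = qA (pA d)"
    and "snd (\<Phi> (pA d)) = snd (\<Phi> (pA d'))" "snd (\<Psi> (pB d)) = snd (\<Psi> (pB d'))" "\<gamma> d = \<gamma> d'"
  shows "d = d'"
proof -
  have "d' \<in> overM V" using d by simp
  have "d = G (qA (pA d)) (snd (\<Phi> (pA d))) (snd (\<Psi> (pB d))) (\<gamma> d)" by (rule dtrivD(6)[OF t d(1), symmetric])
  also have "\<dots> = G (qA (pA d')) (snd (\<Phi> (pA d'))) (snd (\<Psi> (pB d'))) (\<gamma> d')" by (simp only: assms)
  also have "\<dots> = d'" by (rule dtrivD(6)[OF t]) fact
  finally show ?thesis .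
qed

section \<open>The core as a vector bundle\<close>

abbreviation "Cs \<equiv> core_set DA DB A B"
abbreviation "CB \<equiv> core_bundle DA DB A B"
abbreviation "dimC \<equiv> mdim M + (mdim TD + mdim M - (mdim (total_space A) + mdim (total_space B)))"

lemma CB_simps [simp]: "total_space CB = submanifold TD Cs dimC" "base CB = M" "proj CB = (\<lambda>c. qA (pA c))"
   "vadd CB = addA" "vscale CB = sclA" "vzero CB = (\<lambda>m. vzero DA (vzero A m))"
  by (auto simp: core_bundle_def)

lemma Cs_D: "c \<in> Cs \<Longrightarrow> c \<in> D" by (simp add: core_set_def)

lemma Cs_iff: "c \<in> Cs \<longleftrightarrow> c \<in> D \<and> pA c = vzero A (qA (pA c)) \<and> pB c = vzero B (qA (pA c))"
proof
  assume "c \<in> Cs"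
  then obtain m where m: "c \<in> D" "m \<in> mpoints M" "pA c = vzero A m" "pB c = vzero B m" by (auto simp: core_set_def)
  then show "c \<in> D \<and> pA c = vzero A (qA (pA c)) \<and> pB c = vzero B (qA (pA c))" using opsa(3)[OF m(2)] by simp
next
  assume c: "c \<in> D \<and> pA c = vzero A (qA (pA c)) \<and> pB c = vzero B (qA (pA c))"
  then have "qA (pA c) \<in> mpoints M" using vba(6)[of "pA c"] vbDA(6)[of c] by auto
  then show "c \<in> Cs" using c by (auto simp: core_set_def)
qed

text \<open>A vector is zero exactly if its linear coordinates vanish, which turns membership in the
  core into equations between coordinates.\<close>

lemma dtriv_core_iff:
  assumes t: "dtriv V \<Phi> \<Psi> \<gamma> G" and d: "d \<in> overM V"
  shows "d \<in> Cs \<longleftrightarrow> snd (\<Phi> (pA d)) = zr \<and> snd (\<Psi> (pB d)) = zr"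
proof -
  note l = dtriv_lin[OF t]
  have m: "qA (pA d) \<in> mpoints M" "qA (pA d) \<in> V" using d l(3) openin_subset by auto
  have za: "snd (\<Phi> (vzero A (qA (pA d)))) = zr" and zb: "snd (\<Psi> (vzero B (qA (pA d)))) = zr"
    using lincoord_vzero[OF vA l(1) m(2)] lincoord_vzero[OF vB l(2) m(2)] by auto
  have "pA d = vzero A (qA (pA d))" if "snd (\<Phi> (pA d)) = zr"
    by (rule lincoord_inj[OF l(1) l(4)[OF d]]) (use that za opsa(3)[OF m(1)] in auto)
  moreover have "pB d = vzero B (qA (pA d))" if "snd (\<Psi> (pB d)) = zr"
    by (rule lincoord_inj[OF l(2) l(5)[OF d]]) (use that zb opsb(3)[OF m(1)] l(6)[OF d] in auto)
  moreover have "snd (\<Phi> (pA d)) = zr" if e: "pA d = vzero A (qA (pA d))" by (subst e) (rule za)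
  moreover have "snd (\<Psi> (pB d)) = zr" if e: "pB d = vzero B (qA (pA d))" by (subst e) (rule zb)
  moreover have "d \<in> D" using d by simp
  ultimately show ?thesis unfolding Cs_iff[of d] by blast
qed

lemma dimC_le: "dimC \<le> mdim TD"
  using vbDA(7) vba(7) vbDB(7) vbb(7) by simp

lemma dimC_eq: "nA \<le> rB \<Longrightarrow> dimC = mdim M + nC"
  using vbDB(7) vbb(7) vba(7) by simp

text \<open>The coordinates of \<open>A\<close> and \<open>B\<close> occupy the places from
  \<open>dimC\<close> on, and the core is where they vanish; so the chart of \<open>D\<close> is a
  slice chart for the core.\<close>

lemma core_mfd: "mfd (submanifold TD Cs dimC)"
proof (rule mfd_submanifold[OF vbDA(1) dimC_le])
  show "Cs \<subseteq> D" using Cs_D by auto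
  fix c assume c: "c \<in> Cs"
  have m: "qA (pA c) \<in> mpoints M" using vba(6)[of "pA c"] vbDA(6)[OF Cs_D[OF c]] by auto
  obtain V \<Phi> \<Psi> \<gamma> G where V: "qA (pA c) \<in> V" and t: "dtriv V \<Phi> \<Psi> \<gamma> G" using dtriv_exists[OF m] by blast
  obtain U \<phi> where U: "(U, \<phi>) \<in> atlas M" "qA (pA c) \<in> U" using charted_cover[OF vba(4) m] .
  let ?n = "mdim M"
  let ?P = "{d \<in> D. qA (pA d) \<in> V \<inter> U}"
  let ?\<xi> = "\<lambda>d. join_coords ?n (\<phi> (qA (pA d))) (join_coords nC (\<gamma> d) (join_coords nA (snd (\<Phi> (pA d))) (snd (\<Psi> (pB d)))))"
  note mx = dtrivD(14)[OF t U(1)]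
  have K: "dimC = ?n + nC" by (rule dimC_eq[OF dtrivD(3)[OF t]])
  note l = dtriv_lin[OF t]
  have key: "d \<in> Cs \<longleftrightarrow> ?\<xi> d \<in> EE dimC" if d: "d \<in> ?P" for d
  proof -
    have d': "d \<in> overM V" using d by simp
    have g: "\<gamma> d \<in> EE nC" by (rule dtrivD(5)[OF t d'])
    have a: "snd (\<Phi> (pA d)) \<in> EE nA" by (rule lincoordD(3)[OF l(1) l(4)[OF d']])
    show ?thesis unfolding dtriv_core_iff[OF t d'] K
    proof
      assume "snd (\<Phi> (pA d)) = zr \<and> snd (\<Psi> (pB d)) = zr"
      then show "?\<xi> d \<in> EE (?n + nC)" using EE_ge[OF g]
        by (auto simp: topspace_Euclidean_space join_coords_def)
    next
      assume "?\<xi> d \<in> EE (?n + nC)"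
      then have z: "?\<xi> d i = 0" if "?n + nC \<le> i" for i using EE_ge that by blast
      \<comment> \<open>The coordinates of \<open>A\<close> and \<open>B\<close> come after
        \<open>?n\<close> coordinates of \<open>M\<close> and \<open>nC\<close> core coordinates,
        whence the offset.\<close>
      have j: "join_coords nA (snd (\<Phi> (pA d))) (snd (\<Psi> (pB d))) i = 0" for i
        using z[of "?n + (nC + i)"] by (simp add: join_coords_def[of "mdim M"] join_coords_def[of nC])
      have "snd (\<Phi> (pA d)) i = 0" for i
        using j[of i] EE_ge[OF a, of i] by (cases "i < nA") (auto simp: join_coords_def)
      moreover have "snd (\<Psi> (pB d)) i = 0" for i using j[of "nA + i"] by (simp add: join_coords_def)
      ultimately show "snd (\<Phi> (pA d)) = zr \<and> snd (\<Psi> (pB d)) = zr" by auto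
    qed
  qed
  have "?\<xi> ` (?P \<inter> Cs) = ?\<xi> ` ?P \<inter> EE dimC"
  proof (intro equalityI subsetI)
    fix y assume "y \<in> ?\<xi> ` (?P \<inter> Cs)"
    then obtain d where "d \<in> ?P" "d \<in> Cs" "y = ?\<xi> d" by blast
    then show "y \<in> ?\<xi> ` ?P \<inter> EE dimC" using key[of d] by blast
  next
    fix y assume "y \<in> ?\<xi> ` ?P \<inter> EE dimC"
    then obtain d where d: "d \<in> ?P" "y = ?\<xi> d" "y \<in> EE dimC" by blast
    then have "d \<in> ?P \<inter> Cs" using key[OF d(1)] by blast
    then show "y \<in> ?\<xi> ` (?P \<inter> Cs)" unfolding d(2) by (rule imageI)
  qed
  moreover have "c \<in> ?P" using Cs_D[OF c] V U(2) by simp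
  ultimately show "\<exists>U \<phi>. c \<in> U \<and> (U, \<phi>) \<in> maximal_atlas TD \<and> \<phi> ` (U \<inter> Cs) = \<phi> ` U \<inter> EE dimC"
    by (intro exI[of _ ?P] exI[of _ ?\<xi>] conjI mx)
qed

lemma vpoints_CB: "vpoints CB = Cs" using Cs_D by auto

lemma fibre_CB: "m \<in> mpoints M \<Longrightarrow> fibre CB m = {c \<in> D. pA c = vzero A m \<and> pB c = vzero B m}"
proof -
  assume m: "m \<in> mpoints M"
  have "fibre CB m = {c \<in> Cs. qA (pA c) = m}" unfolding fibre_def vpoints_CB by simp
  also have "\<dots> = {c \<in> D. pA c = vzero A m \<and> pB c = vzero B m}"
    using opsa(3)[OF m] by (auto simp: Cs_iff)
  finally show ?thesis .
qed

lemma smo_core_inclusion: "smo (total_space CB) Cs TD (\<lambda>c. c)"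
  unfolding CB_simps by (rule smo_inclusion[OF vbDA(1) dimC_le]) (use Cs_D in auto)

text \<open>The function \<open>\<gamma>\<close> restricts to the core, and \<open>G\<close> with
  zero coordinates for \<open>A\<close> and \<open>B\<close> inverts the restriction.\<close>

lemma core_lincoord:
  assumes t: "dtriv V \<Phi> \<Psi> \<gamma> G"
  shows "lincoord CB V nC \<gamma> (\<lambda>m w. G m zr zr w)"
proof -
  note l = dtriv_lin[OF t] and dt = dtrivD[OF t]
  have ov: "over CB V = overM V \<inter> Cs" unfolding vpoints_CB using Cs_D by auto
  have VM: "m \<in> mpoints M" if "m \<in> V" for m using l(3) openin_subset that by blast
  have Gc: "G m zr zr w \<in> Cs" "qA (pA (G m zr zr w)) = m" "\<gamma> (G m zr zr w) = w" if "m \<in> V" "w \<in> EE nC" for m w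
  proof -
    note g = dt(7)[OF that(1) zr_EE zr_EE that(2)]
    have "G m zr zr w \<in> overM V" using g that by simp
    from dtriv_core_iff[OF t this] show "G m zr zr w \<in> Cs" using g by simp
    show "qA (pA (G m zr zr w)) = m" "\<gamma> (G m zr zr w) = w" using g by auto
  qed
  have fib: "c \<in> overM V \<and> c \<in> D \<and> pA c = vzero A m" if "m \<in> V" "c \<in> fibre CB m" for c m
    using that(2) unfolding fibre_CB[OF VM[OF that(1)]] using opsa(3)[OF VM[OF that(1)]] that(1) by simp
  show ?thesis unfolding lincoord_def ov
  proof (intro conjI ballI allI impI)
    show "openin (mtop (base CB)) V" using l(3) by simp
    show "sfun (total_space CB) (overM V \<inter> Cs) (\<lambda>e. \<gamma> e j)" if "j < nC" for j
      unfolding CB_simps by (rule sfun_submanifold[OF vbDA(1) dimC_le dt(4)[OF that]])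
    show "smo (prod_manifold (base CB) (EM nC)) (V \<times> EE nC) (total_space CB) (\<lambda>z. G (fst z) zr zr (snd z))"
      unfolding CB_simps
      by (rule smo_into_submanifold[OF vbDA(1) dimC_le core_mfd charted_prod[OF vba(4) charted_euclidean] dt(13)]) (use Gc in auto)
    fix e assume e: "e \<in> overM V \<inter> Cs"
    then have e1: "e \<in> overM V" by simp
    show "\<gamma> e \<in> EE nC" by (rule dt(5)[OF e1])
    show "G (proj CB e) zr zr (\<gamma> e) = e" using dt(6)[OF e1] dtriv_core_iff[OF t e1] e by simp
  next
    fix m w assume mw: "m \<in> V" "w \<in> EE nC"
    show "G m zr zr w \<in> vpoints CB" unfolding vpoints_CB using Gc[OF mw] by simp
    show "proj CB (G m zr zr w) = m" "\<gamma> (G m zr zr w) = w" using Gc[OF mw] by auto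
  next
    fix m e e' i assume m: "m \<in> V" and e: "e \<in> fibre CB m" "e' \<in> fibre CB m"
    show "\<gamma> (vadd CB e e') i = \<gamma> e i + \<gamma> e' i"
      using dt(8)[of e e' i] fib[OF m e(1)] fib[OF m e(2)] by auto
  next
    fix m e s i assume m: "m \<in> V" and e: "e \<in> fibre CB m"
    show "\<gamma> (vscale CB s e) i = s * \<gamma> e i" using dt(10)[of e s i] fib[OF m e] by auto
  qed
qed

lemma core_vector_bundle: "vector_bundle CB"
  unfolding vector_bundle_def
proof (intro conjI ballI)
  have "smooth_manifold TD" using vDA by (simp add: vector_bundle_def)
  then have "Hausdorff_space (mtop TD)" "second_countable (mtop TD)" by (auto simp: smooth_manifold_def)
  then show "smooth_manifold (total_space CB)" unfolding CB_simps
    by (intro mfd_smooth_manifold core_mfd) (auto intro: Hausdorff_space_subtopology second_countable_subtopology)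
  show "smooth_manifold (base CB)" using vA by (simp add: vector_bundle_def)
  show "mdim (base CB) \<le> mdim (total_space CB)" by simp
  have c: "charted (total_space CB)" using core_mfd by (simp add: mfd_charted)
  have "smo TD D M (\<lambda>d. qA (pA d))" by (rule smo_compose[OF vbDA(5) vba(5)]) (use vbDA(6) in auto)
  then have p: "smo (total_space CB) (vpoints CB) (base CB) (proj CB)"
    using smo_compose[OF smo_core_inclusion, of D M "\<lambda>d. qA (pA d)"] Cs_D unfolding vpoints_CB by auto
  then show "smooth_map (total_space CB) (base CB) (proj CB)"
    by (intro smo_smooth_map[OF c]) (use vba(2) in auto)
  fix m assume m': "m \<in> mpoints (base CB)"
  then have m: "m \<in> mpoints M" by simp
  show "vector_space_on (fibre CB m) (vadd CB) (vscale CB) (vzero CB m)"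
  proof -
    note za = opsa(3)[OF m]
    have zm: "vzero A m \<in> mpoints (base DA)" using za by simp
    let ?F = "fibre DA (vzero A m)"
    have vs: "vector_space_on ?F addA sclA (vzero DA (vzero A m))" by (rule vs_onD[OF vDA zm])
    let ?C = "{c \<in> D. pA c = vzero A m \<and> pB c = vzero B m}"
    \<comment> \<open>The core fibre is a linear subspace of the fibre of
      \<open>D \<rightarrow> A\<close> over the zero of \<open>A\<close>, so the equational axioms
      are inherited and closure is what remains.\<close>
    have sub: "?C \<subseteq> ?F" by (auto simp: fibre_def)
    have z: "vzero DA (vzero A m) \<in> ?C" using opsA(3)[of "vzero A m"] za sA(4)[of "vzero A m"] by simp
    have zb: "vadd B (vzero B m) (vzero B m) = vzero B m" "vscale B s (vzero B m) = vzero B m" for s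
      using vb_alg(3)[OF vB, of "vzero B m"] vb_alg(11)[OF vB, of "vzero B m"] opsb(3)[OF m] by auto
    have add: "addA x y \<in> ?C" if "x \<in> ?C" "y \<in> ?C" for x y
      using that opsA(1)[of x y] sB(2)[of x y] zb by simp
    have scl: "sclA s x \<in> ?C" if "x \<in> ?C" for x s
      using that opsA(2)[of x s] sA(7)[of x s] zb by simp
    have inv: "\<exists>y\<in>?C. addA x y = vzero DA (vzero A m)" if "x \<in> ?C" for x
      using vb_alg(10)[OF vDA, of x] that scl[OF that, of "-1"] by (intro bexI[of _ "sclA (-1) x"]) auto
    have ax: "\<forall>x\<in>?F. \<forall>y\<in>?F. \<forall>w\<in>?F. addA (addA x y) w = addA x (addA y w)" "\<forall>x\<in>?F. \<forall>y\<in>?F. addA x y = addA y x"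
      "\<forall>x\<in>?F. addA (vzero DA (vzero A m)) x = x" "\<forall>r. \<forall>x\<in>?F. \<forall>y\<in>?F. sclA r (addA x y) = addA (sclA r x) (sclA r y)"
      "\<forall>r s. \<forall>x\<in>?F. sclA (r + s) x = addA (sclA r x) (sclA s x)" "\<forall>r s. \<forall>x\<in>?F. sclA r (sclA s x) = sclA (r * s) x"
      "\<forall>x\<in>?F. sclA 1 x = x"
      by (insert vs[unfolded vector_space_on_def]; elim conjE; assumption)+
    show ?thesis unfolding fibre_CB[OF m] CB_simps vector_space_on_def
      by (intro conjI ballI allI z add scl inv; use ax sub in blast)
  qed
  obtain V \<Phi> \<Psi> \<gamma> G where V: "m \<in> V" and t: "dtriv V \<Phi> \<Psi> \<gamma> G" using dtriv_exists[OF m] by blast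
  have "rank CB = nC" unfolding rank_def CB_simps submanifold_simps dimC_eq[OF dtrivD(3)[OF t]] by simp
  then have "lincoord CB V (rank CB) \<gamma> (\<lambda>m w. G m zr zr w)" using core_lincoord[OF t] by simp
  then have "local_trivialization CB V (\<lambda>e. (proj CB e, \<gamma> e))"
    by (intro lincoord_local_trivialization p) (use core_mfd vba(2) in auto)
  then show "\<exists>U \<Phi>. m \<in> U \<and> local_trivialization CB U \<Phi>" using V by blast
qed

end

section \<open>The bundle of a double vector bundle and its exact sequence\<close>

lemma sum_lessThan_add: "(\<Sum>s<a + b. f s) = (\<Sum>s<a. f s) + (\<Sum>l<b. f (a + l :: nat))"
  by (induction b) (auto simp: add.assoc)

text \<open>The linear map of free vector spaces induced by a map of generators.\<close>

definition fext :: "('x \<Rightarrow> 'y) \<Rightarrow> ('x \<Rightarrow>\<^sub>0 real) \<Rightarrow> ('y \<Rightarrow>\<^sub>0 real)" where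
  "fext f p = (\<Sum>x\<in>Poly_Mapping.keys p. free_scale (Poly_Mapping.lookup p x) (gen (f x)))"

lemma fext_superset:
  assumes "finite S" "Poly_Mapping.keys p \<subseteq> S"
  shows "fext f p = (\<Sum>x\<in>S. free_scale (Poly_Mapping.lookup p x) (gen (f x)))"
  unfolding fext_def by (rule sum.mono_neutral_left) (use assms in \<open>auto simp: in_keys_iff\<close>)

lemma fext_add: "fext f (p + q) = fext f p + fext f q"
proof -
  let ?S = "Poly_Mapping.keys p \<union> Poly_Mapping.keys q \<union> Poly_Mapping.keys (p + q)"
  show ?thesis
    using fext_superset[of ?S p f] fext_superset[of ?S q f] fext_superset[of ?S "p + q" f]
    by (simp add: lookup_add sum.distrib free.scale_left_distrib le_supI1)
qed

lemma fext_scale: "fext f (free_scale c p) = free_scale c (fext f p)"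
proof -
  let ?S = "Poly_Mapping.keys p \<union> Poly_Mapping.keys (free_scale c p)"
  show ?thesis
    using fext_superset[of ?S p f] fext_superset[of ?S "free_scale c p" f]
    by (simp add: lookup_free_scale free.scale_sum_right)
qed

lemma fext_diff: "fext f (p - q) = fext f p - fext f q"
  using fext_add[of f p "- q"] fext_scale[of f "-1" q] by simp

lemma fext_gen [simp]: "fext f (gen x) = gen (f x)"
  by (simp add: fext_def)

lemma fext_zero [simp]: "fext f 0 = 0" by (simp add: fext_def)

lemma fext_span:
  assumes "\<And>p. p \<in> R \<Longrightarrow> fext f p \<in> free.span S" "z \<in> free.span R"
  shows "fext f z \<in> free.span S"
proof -
  have "free.subspace {z. fext f z \<in> free.span S}"
    unfolding free.subspace_def by (auto simp: fext_add fext_scale free.span_zero free.span_add free.span_scale)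
  then have "free.span R \<subseteq> {z. fext f z \<in> free.span S}" by (intro free.span_minimal) (use assms(1) in auto)
  then show ?thesis using assms(2) by auto
qed

lemma keys_fext: "Poly_Mapping.keys p \<subseteq> G \<Longrightarrow> f ` G \<subseteq> H \<Longrightarrow> Poly_Mapping.keys (fext f p) \<subseteq> H"
  unfolding fext_def by (rule keys_sum_subset) (use keys_free_scale in fastforce)

lemma lext_fext: "lext \<kappa> (fext f p) t = lext (\<lambda>x. \<kappa> (f x)) p t"
  unfolding fext_def lext_sum lext_scale lext_gen by (simp add: lext_def)

section \<open>Coordinates and frames on the quotient\<close>

context dvb begin

text \<open>The products come first and in the encoding of the tensor product, so that the
  projection to the tensor product becomes a truncation; the core coordinates follow.\<close>

definition kap :: "('a \<Rightarrow> 'm \<times> (nat \<Rightarrow> real)) \<Rightarrow> ('b \<Rightarrow> 'm \<times> (nat \<Rightarrow> real)) \<Rightarrow> ('d \<Rightarrow> nat \<Rightarrow> real) \<Rightarrow> 'd \<Rightarrow> nat \<Rightarrow> real" where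
  "kap \<Phi> \<Psi> \<gamma> d s = (if s < nA * nB then snd (\<Phi> (pA d)) (s div nB) * snd (\<Psi> (pB d)) (s mod nB) else \<gamma> d (s - nA * nB))"

text \<open>The frame dual to \<open>kap\<close>: lifts of pairs of unit vectors with zero core
  coordinates, then a frame of the core.\<close>

definition frm :: "('m \<Rightarrow> (nat \<Rightarrow> real) \<Rightarrow> (nat \<Rightarrow> real) \<Rightarrow> (nat \<Rightarrow> real) \<Rightarrow> 'd) \<Rightarrow> nat \<Rightarrow> 'm \<Rightarrow> 'd" where
  "frm G s m = (if s < nA * nB then G m (unitv (s div nB)) (unitv (s mod nB)) zr else G m zr zr (unitv (s - nA * nB)))"

definition frakC_family :: "('m set \<times> ('d \<Rightarrow> nat \<Rightarrow> real) \<times> (nat \<Rightarrow> 'm \<Rightarrow> 'd)) set" where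
  "frakC_family = {(V, kap \<Phi> \<Psi> \<gamma>, frm G) | V \<Phi> \<Psi> \<gamma> G. dtriv V \<Phi> \<Psi> \<gamma> G}"

abbreviation "RD \<equiv> dvb_relations DA DB A"

lemma slice_iff: "d \<in> slice DA A m \<longleftrightarrow> d \<in> D \<and> qA (pA d) = m" by (simp add: slice_def)

lemma rel_addA: "d1 \<in> D \<Longrightarrow> d2 \<in> D \<Longrightarrow> pA d2 = pA d1 \<Longrightarrow> qA (pA d1) = m \<Longrightarrow> gen d1 + gen d2 - gen (addA d1 d2) \<in> RD m"
  unfolding dvb_relations_def slice_iff by fastforce

lemma rel_addB: "d1 \<in> D \<Longrightarrow> d2 \<in> D \<Longrightarrow> pB d2 = pB d1 \<Longrightarrow> qA (pA d1) = m \<Longrightarrow> gen d1 + gen d2 - gen (addB d1 d2) \<in> RD m"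
proof -
  assume d: "d1 \<in> D" "d2 \<in> D" "pB d2 = pB d1" "qA (pA d1) = m"
  then have "qA (pA d2) = m" using proj_proj[of d1] proj_proj[of d2] by simp
  then show ?thesis using d unfolding dvb_relations_def slice_iff by fastforce
qed

lemma rel_sclA: "d \<in> D \<Longrightarrow> qA (pA d) = m \<Longrightarrow> free_scale t (gen d) - gen (sclA t d) \<in> RD m"
  unfolding dvb_relations_def slice_iff by blast

lemma rel_sclB: "d \<in> D \<Longrightarrow> qA (pA d) = m \<Longrightarrow> free_scale t (gen d) - gen (sclB t d) \<in> RD m"
  unfolding dvb_relations_def slice_iff by blast

lemma rel_cases:
  assumes "p \<in> RD m"
  obtains d1 d2 where "p = gen d1 + gen d2 - gen (addA d1 d2)" "d1 \<in> D" "d2 \<in> D" "pA d2 = pA d1" "qA (pA d1) = m"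
  | d1 d2 where "p = gen d1 + gen d2 - gen (addB d1 d2)" "d1 \<in> D" "d2 \<in> D" "pB d2 = pB d1" "qA (pA d1) = m"
  | t d where "p = free_scale t (gen d) - gen (sclA t d)" "d \<in> D" "qA (pA d) = m"
  | t d where "p = free_scale t (gen d) - gen (sclB t d)" "d \<in> D" "qA (pA d) = m"
proof -
  consider "\<exists>d1 d2. p = gen d1 + gen d2 - gen (addA d1 d2) \<and> d1 \<in> D \<and> d2 \<in> D \<and> pA d1 = pA d2 \<and> qA (pA d1) = m"
    | "\<exists>d1 d2. p = gen d1 + gen d2 - gen (addB d1 d2) \<and> d1 \<in> D \<and> d2 \<in> D \<and> pB d1 = pB d2 \<and> qA (pA d1) = m"
    | "\<exists>t d. p = free_scale t (gen d) - gen (sclA t d) \<and> d \<in> D \<and> qA (pA d) = m"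
    | "\<exists>t d. p = free_scale t (gen d) - gen (sclB t d) \<and> d \<in> D \<and> qA (pA d) = m"
    using assms unfolding dvb_relations_def slice_iff Un_iff mem_Collect_eq by blast
  then show ?thesis
    by cases (use that in metis)+
qed

text \<open>An operation over \<open>A\<close> fixes the coordinates of \<open>A\<close>, so the
  products are linear in those of \<open>B\<close>, and vice versa. The core coordinates are linear
  for both structures.\<close>

lemma kap_rel:
  assumes t: "dtriv V \<Phi> \<Psi> \<gamma> G" and m: "m \<in> V" and p: "p \<in> RD m"
  shows "lext (kap \<Phi> \<Psi> \<gamma>) p s = 0"
proof -
  note dt = dtrivD[OF t] and l = dtriv_lin[OF t]
  note la = lincoordD[OF l(1)] and lb = lincoordD[OF l(2)]
  from p show ?thesis
  proof (cases rule: rel_cases)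
    case (1 d1 d2)
    then have o: "d1 \<in> overM V" "d2 \<in> overM V" using m by auto
    have "snd (\<Psi> (pB (addA d1 d2))) i = snd (\<Psi> (pB d1)) i + snd (\<Psi> (pB d2)) i" for i
      using sB(2)[OF 1(2,3,4)] lb(8)[OF l(5)[OF o(1)], of "pB d2" i] l(5)[OF o(2)] l(6)[OF o(1)] l(6)[OF o(2)] 1 by simp
    then show ?thesis unfolding 1(1) using dt(8)[OF o(1) 1(3,4)] opsA(1)[OF 1(2,3,4)] 1(4)
      by (simp add: lext_add lext_diff kap_def distrib_left)
  next
    case (2 d1 d2)
    have q: "qA (pA d2) = m" using 2 proj_proj[of d1] proj_proj[of d2] by simp
    then have o: "d1 \<in> overM V" "d2 \<in> overM V" using 2 m by auto
    have "snd (\<Phi> (pA (addB d1 d2))) i = snd (\<Phi> (pA d1)) i + snd (\<Phi> (pA d2)) i" for i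
      using sA(2)[OF 2(2,3,4)] la(8)[OF l(4)[OF o(1)], of "pA d2" i] l(4)[OF o(2)] q 2 by simp
    then show ?thesis unfolding 2(1) using dt(9)[OF o(1) 2(3,4)] opsB(1)[OF 2(2,3,4)] 2(4)
      by (simp add: lext_add lext_diff kap_def distrib_right)
  next
    case (3 c d)
    then have o: "d \<in> overM V" using m by auto
    show ?thesis unfolding 3(1) using dt(10)[OF o] opsA(2)[OF 3(2), of c] sA(7)[OF 3(2), of c] lb(9)[OF l(5)[OF o]]
      by (simp add: lext_scale lext_diff kap_def)
  next
    case (4 c d)
    then have o: "d \<in> overM V" using m by auto
    show ?thesis unfolding 4(1) using dt(11)[OF o] opsB(2)[OF 4(2), of c] sA(3)[OF 4(2), of c] la(9)[OF l(4)[OF o]]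
      by (simp add: lext_scale lext_diff kap_def)
  qed
qed

text \<open>Elements of one slice with equal coordinates are equal, so every operation can be
  computed in coordinates.\<close>

lemma G_ops:
  assumes t: "dtriv V \<Phi> \<Psi> \<gamma> G" and m: "m \<in> V" and v: "v \<in> EE nA" "v' \<in> EE nA" and u: "u \<in> EE nB" "u' \<in> EE nB"
    and w: "w \<in> EE nC" "w' \<in> EE nC"
  shows "addA (G m v u w) (G m v u' w') = G m v (\<lambda>i. u i + u' i) (\<lambda>i. w i + w' i)"
    "addB (G m v u w) (G m v' u w') = G m (\<lambda>i. v i + v' i) u (\<lambda>i. w i + w' i)"
    "sclA c (G m v u w) = G m v (\<lambda>i. c * u i) (\<lambda>i. c * w i)"
    "sclB c (G m v u w) = G m (\<lambda>i. c * v i) u (\<lambda>i. c * w i)"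
    "pA (G m v u' w') = pA (G m v u w)" "pB (G m v' u w') = pB (G m v u w)"
proof -
  note dt = dtrivD[OF t] and l = dtriv_lin[OF t]
  note la = lincoordD[OF l(1)] and lb = lincoordD[OF l(2)]
  have E: "(\<lambda>i. x i + x' i) \<in> EE k" "(\<lambda>i. c * x i) \<in> EE k" if "x \<in> EE k" "x' \<in> EE k" for x x' k
    using that by (auto simp: topspace_Euclidean_space)
  have g: "G m v u w \<in> overM V" "G m v u w \<in> D" "qA (pA (G m v u w)) = m" "snd (\<Phi> (pA (G m v u w))) = v"
      "snd (\<Psi> (pB (G m v u w))) = u" "\<gamma> (G m v u w) = w"
    if "v \<in> EE nA" "u \<in> EE nB" "w \<in> EE nC" for v u w
    using dt(7)[OF m that] m by auto
  show pa: "pA (G m v u' w') = pA (G m v u w)"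
    by (rule lincoord_inj[OF l(1) l(4)]) (use g v u w l(4)[OF g(1)] in auto)
  have pb: "pB (G m v' u w') = pB (G m v u w)" if "v' \<in> EE nA" for v'
    by (rule lincoord_inj[OF l(2) l(5)]) (use g v u w l(5,6)[OF g(1)] that in auto)
  then show "pB (G m v' u w') = pB (G m v u w)" using v(2) by blast
  let ?g = "G m v u w"
  show "addA ?g (G m v u' w') = G m v (\<lambda>i. u i + u' i) (\<lambda>i. w i + w' i)"
  proof -
    note g1 = g[OF v(1) u(1) w(1)] and g2 = g[OF v(1) u(2) w(2)] and g3 = g[OF v(1) E(1)[OF u] E(1)[OF w]]
    have "snd (\<Psi> (pB (addA ?g (G m v u' w')))) = (\<lambda>i. u i + u' i)"
      using sB(2)[OF g1(2) g2(2) pa] lb(8)[OF l(5)[OF g1(1)], of "pB (G m v u' w')"] l(5,6)[OF g2(1)] l(6)[OF g1(1)] g1 g2 by auto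
    then show ?thesis
      by (intro dtriv_eqI[OF t, symmetric] g3(1)) (use opsA(1)[OF g1(2) g2(2) pa] g1 g2 g3 dt(8)[OF g1(1) g2(2) pa] in auto)
  qed
  show "addB ?g (G m v' u w') = G m (\<lambda>i. v i + v' i) u (\<lambda>i. w i + w' i)"
  proof -
    note g1 = g[OF v(1) u(1) w(1)] and g2 = g[OF v(2) u(1) w(2)] and g3 = g[OF E(1)[OF v] u(1) E(1)[OF w]]
    note pb' = pb[OF v(2)]
    have "snd (\<Phi> (pA (addB ?g (G m v' u w')))) = (\<lambda>i. v i + v' i)"
      "qA (pA (addB ?g (G m v' u w'))) = m"
      using sA(2)[OF g1(2) g2(2) pb'] la(8)[OF l(4)[OF g1(1)], of "pA (G m v' u w')"] l(4)[OF g2(1)] l(4)[OF g1(1)] g1 g2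
        opsa(1)[of "pA ?g" "pA (G m v' u w')"] by auto
    then show ?thesis
      by (intro dtriv_eqI[OF t, symmetric] g3(1)) (use opsB(1)[OF g1(2) g2(2) pb'] g1 g2 g3 dt(9)[OF g1(1) g2(2) pb'] in auto)
  qed
  note g1 = g[OF v(1) u(1) w(1)]
  show "sclA c ?g = G m v (\<lambda>i. c * u i) (\<lambda>i. c * w i)"
  proof -
    note g3 = g[OF v(1) E(2)[OF u] E(2)[OF w]]
    have "snd (\<Psi> (pB (sclA c ?g))) = (\<lambda>i. c * u i)"
      using sA(7)[OF g1(2), of c] lb(9)[OF l(5)[OF g1(1)], of c] g1 by auto
    then show ?thesis
      by (intro dtriv_eqI[OF t, symmetric] g3(1)) (use opsA(2)[OF g1(2), of c] g1 g3 dt(10)[OF g1(1)] in auto)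
  qed
  show "sclB c ?g = G m (\<lambda>i. c * v i) u (\<lambda>i. c * w i)"
  proof -
    note g3 = g[OF E(2)[OF v] u(1) E(2)[OF w]]
    have "snd (\<Phi> (pA (sclB c ?g))) = (\<lambda>i. c * v i)" "qA (pA (sclB c ?g)) = m"
      using sA(3)[OF g1(2), of c] la(9)[OF l(4)[OF g1(1)], of c] g1 opsa(2)[of "pA ?g" c] l(4)[OF g1(1)] by auto
    then show ?thesis
      by (intro dtriv_eqI[OF t, symmetric] g3(1)) (use opsB(2)[OF g1(2), of c] g1 g3 dt(11)[OF g1(1)] in auto)
  qed
qed

text \<open>Modulo relations the generator at \<open>(v, u, w)\<close> is the sum of those at
  \<open>(v, u, 0)\<close> and \<open>(v, 0, w)\<close>, by addition over \<open>A\<close>; the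
  latter is the sum of those at \<open>(v, 0, 0)\<close> and \<open>(0, 0, w)\<close>, by addition
  over \<open>B\<close>; and the one at \<open>(v, 0, 0)\<close> vanishes. What remains is bilinear
  in \<open>v\<close>, \<open>u\<close> and linear in \<open>w\<close> modulo relations.\<close>

lemma kap_span:
  assumes t: "dtriv V \<Phi> \<Psi> \<gamma> G" and m: "m \<in> V" and x: "x \<in> slice DA A m"
  shows "gen x - (\<Sum>s<nA * nB + nC. free_scale (kap \<Phi> \<Psi> \<gamma> x s) (gen (frm G s m))) \<in> free.span (RD m)"
proof -
  note dt = dtrivD[OF t] and l = dtriv_lin[OF t]
  have x': "x \<in> overM V" "qA (pA x) = m" using x m by (auto simp: slice_iff)
  define v u w where "v = snd (\<Phi> (pA x))" and "u = snd (\<Psi> (pB x))" and "w = \<gamma> x"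
  have vuw: "v \<in> EE nA" "u \<in> EE nB" "w \<in> EE nC" unfolding v_def u_def w_def
    using lincoordD(3)[OF l(1) l(4)[OF x'(1)]] lincoordD(3)[OF l(2) l(5)[OF x'(1)]] dt(5)[OF x'(1)] .
  have xG: "x = G m v u w" using dt(6)[OF x'(1)] x'(2) by (simp add: v_def u_def w_def)
  let ?S = "free.span (RD m)"
  have gD: "G m v u w \<in> D" "qA (pA (G m v u w)) = m" if "v \<in> EE nA" "u \<in> EE nB" "w \<in> EE nC" for v u w
    using dt(7)[OF m that] by auto
  have addA: "gen (G m v u w) + gen (G m v u' w') - gen (G m v (\<lambda>i. u i + u' i) (\<lambda>i. w i + w' i)) \<in> ?S"
    if "v \<in> EE nA" "u \<in> EE nB" "w \<in> EE nC" "u' \<in> EE nB" "w' \<in> EE nC" for v u w u' w'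
    using free.span_base[OF rel_addA[OF gD(1)[OF that(1,2,3)] gD(1)[OF that(1,4,5)] G_ops(5)[OF t m that(1,1,2,4,3,5)] gD(2)[OF that(1,2,3)]]]
    unfolding G_ops(1)[OF t m that(1,1,2,4,3,5)] .
  have addB: "gen (G m v u w) + gen (G m v' u w') - gen (G m (\<lambda>i. v i + v' i) u (\<lambda>i. w i + w' i)) \<in> ?S"
    if "v \<in> EE nA" "u \<in> EE nB" "w \<in> EE nC" "v' \<in> EE nA" "w' \<in> EE nC" for v u w v' w'
    using free.span_base[OF rel_addB[OF gD(1)[OF that(1,2,3)] gD(1)[OF that(4,2,5)] G_ops(6)[OF t m that(1,4,2,2,3,5)] gD(2)[OF that(1,2,3)]]]
    unfolding G_ops(2)[OF t m that(1,4,2,2,3,5)] .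
  have sclA: "free_scale c (gen (G m v u w)) - gen (G m v (\<lambda>i. c * u i) (\<lambda>i. c * w i)) \<in> ?S"
    if "v \<in> EE nA" "u \<in> EE nB" "w \<in> EE nC" for v u w c
    using free.span_base[OF rel_sclA[OF gD[OF that], of c]] unfolding G_ops(3)[OF t m that(1,1,2,2,3,3)] .
  have sclB: "free_scale c (gen (G m v u w)) - gen (G m (\<lambda>i. c * v i) u (\<lambda>i. c * w i)) \<in> ?S"
    if "v \<in> EE nA" "u \<in> EE nB" "w \<in> EE nC" for v u w c
    using free.span_base[OF rel_sclB[OF gD[OF that], of c]] unfolding G_ops(4)[OF t m that(1,1,2,2,3,3)] .
  have 1: "gen (G m v u zr) + gen (G m v zr w) - gen (G m v u w) \<in> ?S" using addA[of v u zr zr w] vuw by simp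
  have 2: "gen (G m v zr zr) + gen (G m zr zr w) - gen (G m v zr w) \<in> ?S" using addB[of v zr zr zr w] vuw by simp
  \<comment> \<open>\<open>G m v zr zr\<close> is its own multiple by 0 over \<open>A\<close>, so
    its generator is a relation up to sign.\<close>
  have "- gen (G m v zr zr) \<in> ?S" using sclA[of v zr zr 0] vuw by simp
  then have 3: "gen (G m v zr zr) \<in> ?S" using free.span_neg by fastforce
  have 4: "gen (G m v u zr) - (\<Sum>k<nA * nB. free_scale (v (k div nB) * u (k mod nB)) (gen (G m (unitv (k div nB)) (unitv (k mod nB)) zr))) \<in> ?S"
    by (rule bilin_mod[where \<Gamma>="\<lambda>v u. gen (G m v u zr)"])
       (use addA[where w=zr and w'=zr] addB[where w=zr and w'=zr] sclA[where w=zr] sclB[where w=zr] vuw in auto)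
  have 5: "gen (G m zr zr w) - (\<Sum>l<nC. free_scale (w l) (gen (G m zr zr (unitv l)))) \<in> ?S"
    by (rule lin_mod[where \<Gamma>="\<lambda>w. gen (G m zr zr w)"])
       (use addA[where v=zr and u=zr and u'=zr] sclA[where v=zr and u=zr] vuw in auto)
  have e: "(\<Sum>s<nA * nB + nC. free_scale (kap \<Phi> \<Psi> \<gamma> x s) (gen (frm G s m))) =
     (\<Sum>k<nA * nB. free_scale (v (k div nB) * u (k mod nB)) (gen (G m (unitv (k div nB)) (unitv (k mod nB)) zr))) +
     (\<Sum>l<nC. free_scale (w l) (gen (G m zr zr (unitv l))))" (is "_ = ?s1 + ?s2")
    unfolding sum_lessThan_add by (simp add: kap_def frm_def v_def u_def w_def)
  have "gen x - (?s1 + ?s2) = (gen (G m v u zr) - ?s1) + (gen (G m zr zr w) - ?s2) + gen (G m v zr zr) -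
     (gen (G m v zr zr) + gen (G m zr zr w) - gen (G m v zr w)) - (gen (G m v u zr) + gen (G m v zr w) - gen (G m v u w))"
    unfolding xG[symmetric] by simp
  also have "\<dots> \<in> ?S"
    by (rule free.span_diff[OF free.span_diff[OF free.span_add[OF free.span_add[OF 4 5] 3] 2] 1])
  finally show ?thesis unfolding e .
qed

lemma sfun_kap:
  assumes t: "dtriv V \<Phi> \<Psi> \<gamma> G" and s: "s < nA * nB + nC"
  shows "sfun TD (overM V) (\<lambda>d. kap \<Phi> \<Psi> \<gamma> d s)"
proof (cases "s < nA * nB")
  case True
  note l = dtriv_lin[OF t]
  have q: "smo TD D M (\<lambda>d. qA (pA d))" by (rule smo_compose[OF vbDA(5) vba(5)]) (use vbDA(6) in auto)
  have o: "openin (mtop TD) (overM V)" by (rule smo_vimage_open[OF q l(3)])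
  note b = div_mod_bounds[OF True]
  have "sfun TD (overM V) (\<lambda>d. snd (\<Phi> (pA d)) (s div nB))"
    by (rule smo_sfun'[OF smo_subset[OF vbDA(5) o] lincoordD(2)[OF l(1) conjunct1[OF b]]]) (use l(4) in auto)
  moreover have "sfun TD (overM V) (\<lambda>d. snd (\<Psi> (pB d)) (s mod nB))"
    by (rule smo_sfun'[OF smo_subset[OF vbDB(5) o] lincoordD(2)[OF l(2) conjunct2[OF b]]]) (use l(5) in auto)
  ultimately show ?thesis unfolding kap_def using True sfun_mult[OF vbDA(3)] by simp
next
  case False
  then have "s - nA * nB < nC" using s by simp
  from dtrivD(4)[OF t this] show ?thesis unfolding kap_def using False by simp
qed

lemma smo_frm:
  assumes t: "dtriv V \<Phi> \<Psi> \<gamma> G" and s: "s < nA * nB + nC"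
  shows "smo M V TD (frm G s)"
proof (cases "s < nA * nB")
  case True
  note b = div_mod_bounds[OF True]
  show ?thesis using dtrivD(12)[OF t unitv_EE[OF conjunct1[OF b]] unitv_EE[OF conjunct2[OF b]] zr_EE] True
    by (simp add: frm_def[abs_def])
next
  case False
  then have "s - nA * nB < nC" using s by simp
  from dtrivD(12)[OF t zr_EE zr_EE unitv_EE[OF this]] show ?thesis using False by (simp add: frm_def[abs_def])
qed

lemma frm_kap:
  assumes t: "dtriv V \<Phi> \<Psi> \<gamma> G" and m: "m \<in> V" and s: "s < nA * nB + nC"
  shows "frm G s m \<in> slice DA A m" "t' < nA * nB + nC \<Longrightarrow> kap \<Phi> \<Psi> \<gamma> (frm G s m) t' = (if s = t' then 1 else 0)"
proof -
  note dt = dtrivD[OF t]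
  have "frm G s m \<in> slice DA A m \<and> (t' < nA * nB + nC \<longrightarrow> kap \<Phi> \<Psi> \<gamma> (frm G s m) t' = (if s = t' then 1 else 0))"
  proof (cases "s < nA * nB")
    case True
    note b = div_mod_bounds[OF True]
    note g = dt(7)[OF m unitv_EE[OF conjunct1[OF b]] unitv_EE[OF conjunct2[OF b]] zr_EE]
    have "unitv (s div nB) (t' div nB) * unitv (s mod nB) (t' mod nB) = (if s = t' then 1 else 0)"
      by (auto simp: unitv_def) (metis div_mod_decomp)
    then show ?thesis using g True by (auto simp: frm_def kap_def slice_iff)
  next
    case False
    then have "s - nA * nB < nC" using s by simp
    note g = dt(7)[OF m zr_EE zr_EE unitv_EE[OF this]]
    have f: "frm G s m = G m zr zr (unitv (s - nA * nB))" using False by (simp add: frm_def)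
    have "kap \<Phi> \<Psi> \<gamma> (frm G s m) t' = (if s = t' then 1 else 0)"
    proof (cases "t' < nA * nB")
      case True
      then show ?thesis using False g unfolding f kap_def by auto
    next
      case t: False
      have "s - nA * nB = t' - nA * nB \<longleftrightarrow> s = t'" using False t by linarith
      then show ?thesis using t g unfolding f kap_def by (simp add: unitv_def eq_commute)
    qed
    then show ?thesis using g unfolding f slice_iff by simp
  qed
  then show "frm G s m \<in> slice DA A m" "t' < nA * nB + nC \<Longrightarrow> kap \<Phi> \<Psi> \<gamma> (frm G s m) t' = (if s = t' then 1 else 0)" by auto
qed

text \<open>The transition entries are smooth because the frame elements are smooth maps into
  \<open>D\<close> and \<open>kap\<close> consists of smooth functions on \<open>D\<close>.\<close>

lemma frakC_quot_family: "quot_family M (slice DA A) RD (nA * nB + nC) frakC_family"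
proof
  show "smooth_manifold M" using vA by (simp add: vector_bundle_def)
  show "\<exists>V \<kappa> g. (V, \<kappa>, g) \<in> frakC_family \<and> m \<in> V" if "m \<in> mpoints M" for m
    using dtriv_exists[OF that] unfolding frakC_family_def by blast
next
  fix V \<kappa> g assume "(V, \<kappa>, g) \<in> frakC_family"
  then obtain \<Phi> \<Psi> \<gamma> G where t: "dtriv V \<Phi> \<Psi> \<gamma> G" and \<kappa>: "\<kappa> = kap \<Phi> \<Psi> \<gamma>" "g = frm G"
    unfolding frakC_family_def by blast
  show "openin (mtop M) V" by (rule dtriv_lin(3)[OF t])
  show "g s m \<in> slice DA A m" if "m \<in> V" "s < nA * nB + nC" for m s
    unfolding \<kappa> by (rule frm_kap(1)[OF t that])
  show "\<kappa> (g s m) u = (if s = u then 1 else 0)" if "m \<in> V" "s < nA * nB + nC" "u < nA * nB + nC" for m s u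
    unfolding \<kappa> by (rule frm_kap(2)[OF t that])
  show "lext \<kappa> p u = 0" if "m \<in> V" "p \<in> RD m" for m p u unfolding \<kappa> by (rule kap_rel[OF t that])
  show "gen x - (\<Sum>s<nA * nB + nC. free_scale (\<kappa> x s) (gen (g s m))) \<in> free.span (RD m)"
    if "m \<in> V" "x \<in> slice DA A m" for m x unfolding \<kappa> by (rule kap_span[OF t that])
  fix V' \<kappa>' g' s u assume "(V', \<kappa>', g') \<in> frakC_family" and su: "s < nA * nB + nC" "u < nA * nB + nC"
  then obtain \<Phi>' \<Psi>' \<gamma>' G' where t': "dtriv V' \<Phi>' \<Psi>' \<gamma>' G'" and \<kappa>': "\<kappa>' = kap \<Phi>' \<Psi>' \<gamma>'"
    unfolding frakC_family_def by blast
  have o: "openin (mtop M) (V \<inter> V')" using dtriv_lin(3)[OF t] dtriv_lin(3)[OF t'] by auto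
  show "sfun M (V \<inter> V') (\<lambda>m. \<kappa>' (g s m) u)" unfolding \<kappa> \<kappa>'
    by (rule smo_sfun'[OF smo_subset[OF smo_frm[OF t su(1)] o] sfun_kap[OF t' su(2)]])
       (use frm_kap(1)[OF t _ su(1)] in \<open>auto simp: slice_iff\<close>)
qed

section \<open>The projection to the tensor product and exactness\<close>

lemma tensor_family_dtriv:
  assumes t: "dtriv V \<Phi> \<Psi> \<gamma> G"
  shows "\<exists>g. (V, tensor_kappa nB (\<lambda>a. snd (\<Phi> a)) (\<lambda>b. snd (\<Psi> b)), g) \<in> tensor_family A B"
  using dtrivD(1,2)[OF t] unfolding tensor_family_def by blast

text \<open>Defined through a chosen representative; \<open>pmap_class\<close> shows that any
  representative gives the same value.\<close>

definition pmap :: "'m \<times> ('d \<Rightarrow>\<^sub>0 real) set \<Rightarrow> 'm \<times> ('a \<times> 'b \<Rightarrow>\<^sub>0 real) set" where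
  "pmap u = quot_class (tensor_relations A B) (fst u) (fext (\<lambda>d. (pA d, pB d)) (SOME p. u = quot_class RD (fst u) p))"

text \<open>Operations over \<open>A\<close> leave \<open>pA\<close> fixed and act on
  \<open>pB\<close>, those over \<open>B\<close> the other way round, so each kind of relation goes
  to one of the bilinearity relations.\<close>

lemma fext_rel:
  assumes "p \<in> RD m"
  shows "fext (\<lambda>d. (pA d, pB d)) p \<in> free.span (tensor_relations A B m)"
proof -
  have f: "pA d \<in> fibre A m" "pB d \<in> fibre B m" if "d \<in> D" "qA (pA d) = m" for d
    using that vbDA(6)[of d] vbDB(6)[of d] proj_proj[of d] by (auto simp: fibre_def)
  from assms show ?thesis
  proof (cases rule: rel_cases)
    case (1 d1 d2)
    have "fext (\<lambda>d. (pA d, pB d)) p = gen (pA d1, pB d1) + gen (pA d1, pB d2) - gen (pA d1, vadd B (pB d1) (pB d2))"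
      unfolding 1(1) using sB(2)[OF 1(2,3,4)] opsA(1)[OF 1(2,3,4)] 1(4) by (simp add: fext_add fext_diff)
    also have "\<dots> \<in> tensor_relations A B m"
      unfolding tensor_relations_def using f[OF 1(2,5)] f[OF 1(3)] 1(4,5) by auto
    finally show ?thesis by (rule free.span_base)
  next
    case (2 d1 d2)
    have q: "qA (pA d2) = m" using 2 proj_proj[of d1] proj_proj[of d2] by simp
    have "fext (\<lambda>d. (pA d, pB d)) p = gen (pA d1, pB d1) + gen (pA d2, pB d1) - gen (vadd A (pA d1) (pA d2), pB d1)"
      unfolding 2(1) using sA(2)[OF 2(2,3,4)] opsB(1)[OF 2(2,3,4)] 2(4) by (simp add: fext_add fext_diff)
    also have "\<dots> \<in> tensor_relations A B m"
      unfolding tensor_relations_def using f[OF 2(2,5)] f[OF 2(3) q] by auto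
    finally show ?thesis by (rule free.span_base)
  next
    case (3 t d)
    have "fext (\<lambda>d. (pA d, pB d)) p = free_scale t (gen (pA d, pB d)) - gen (pA d, vscale B t (pB d))"
      unfolding 3(1) using sA(7)[OF 3(2)] opsA(2)[OF 3(2)] by (simp add: fext_scale fext_diff)
    also have "\<dots> \<in> tensor_relations A B m"
      unfolding tensor_relations_def using f[OF 3(2,3)] by auto
    finally show ?thesis by (rule free.span_base)
  next
    case (4 t d)
    have "fext (\<lambda>d. (pA d, pB d)) p = free_scale t (gen (pA d, pB d)) - gen (vscale A t (pA d), pB d)"
      unfolding 4(1) using sA(3)[OF 4(2)] opsB(2)[OF 4(2)] by (simp add: fext_scale fext_diff)
    also have "\<dots> \<in> tensor_relations A B m"
      unfolding tensor_relations_def using f[OF 4(2,3)] by auto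
    finally show ?thesis by (rule free.span_base)
  qed
qed

lemma pmap_class: "pmap (quot_class RD m p) = quot_class (tensor_relations A B) m (fext (\<lambda>d. (pA d, pB d)) p)"
proof -
  define p' where "p' = (SOME p'. quot_class RD m p = quot_class RD m p')"
  have "quot_class RD m p = quot_class RD m p'" unfolding p'_def by (rule someI[of _ p]) simp
  then have "p - p' \<in> free.span (RD m)" unfolding quot_class_eq_iff by simp
  from fext_span[OF fext_rel this] have "fext (\<lambda>d. (pA d, pB d)) p - fext (\<lambda>d. (pA d, pB d)) p' \<in> free.span (tensor_relations A B m)"
    by (simp add: fext_diff)
  then have "quot_class (tensor_relations A B) m (fext (\<lambda>d. (pA d, pB d)) p) = quot_class (tensor_relations A B) m (fext (\<lambda>d. (pA d, pB d)) p')"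
    unfolding quot_class_eq_iff by simp
  then show ?thesis unfolding pmap_def by (simp add: p'_def)
qed

lemma exact_sequence:
  "\<exists>X \<pp>. mpoints X = frakC_set DA DB A \<and> smooth_map TD X (frakC_class DA DB A) \<and>
    (\<forall>d\<in>D. \<pp> (frakC_class DA DB A d) = tensor A B (pA d) (pB d)) \<and>
    short_exact_sequence CB (frakC_bundle DA DB A X) (tensor_bundle A B) (frakC_class DA DB A) \<pp>"
proof -
  interpret C: quot_family M "slice DA A" RD "nA * nB + nC" frakC_family by (rule frakC_quot_family)
  interpret T: quot_family M "\<lambda>m. fibre A m \<times> fibre B m" "tensor_relations A B" "nA * nB" "tensor_family A B"
    by (rule tensor_quot_family[OF vA vB baseB[symmetric]])
  let ?r = "nA * nB + nC"
  let ?f = "\<lambda>d. (pA d, pB d)"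
  let ?c = "frakC_class DA DB A"
  have tE: "tensor_bundle A B = T.E" by (rule tensor_bundle_eq[OF vA vB baseB[symmetric]])
  have cE: "frakC_bundle DA DB A C.X = C.E" by (simp add: frakC_bundle_def C.E_def)
  have c: "?c d = quot_class RD (qA (pA d)) (gen d)" for d by (simp add: frakC_class_def)
  have pM: "qA (pA d) \<in> mpoints M" if "d \<in> D" for d using vbDA(6)[OF that] vba(6) by simp
  have cQ: "?c d \<in> C.Q" "fst (?c d) = qA (pA d)" if "d \<in> D" for d
    unfolding c using C.Q_class[OF pM[OF that], of "gen d"] that by (auto simp: slice_iff)
  have ccoord: "qcoord ?r (kap \<Phi> \<Psi> \<gamma>) (?c d) = trunc ?r (kap \<Phi> \<Psi> \<gamma> d)"
    if t: "dtriv V \<Phi> \<Psi> \<gamma> G" and d: "d \<in> overM V" for V \<Phi> \<Psi> \<gamma> G d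
  proof -
    have "(V, kap \<Phi> \<Psi> \<gamma>, frm G) \<in> frakC_family" using t unfolding frakC_family_def by blast
    from C.qcoord_class[OF this, of "qA (pA d)" "gen d"] show ?thesis unfolding c using d
      by (simp add: fun_eq_iff trunc_def)
  qed
  have q: "smo TD D M (\<lambda>d. qA (pA d))" by (rule smo_compose[OF vbDA(5) vba(5)]) (use vbDA(6) in auto)
  \<comment> \<open>Shown on all of \<open>D\<close>; smoothness of the embedding of the core
    follows by restriction.\<close>
  have smc: "smo TD D C.X ?c"
  proof (rule C.smo_into[OF vbDA(3) q])
    show "?c d \<in> C.Q \<and> fst (?c d) = qA (pA d)" if "d \<in> D" for d using cQ[OF that] by simp
    fix d assume d: "d \<in> D"
    obtain V \<Phi> \<Psi> \<gamma> G where V: "qA (pA d) \<in> V" and t: "dtriv V \<Phi> \<Psi> \<gamma> G" using dtriv_exists[OF pM[OF d]] by blast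
    have fam: "(V, kap \<Phi> \<Psi> \<gamma>, frm G) \<in> frakC_family" using t unfolding frakC_family_def by blast
    have "sfun TD (overM V) (\<lambda>d. qcoord ?r (kap \<Phi> \<Psi> \<gamma>) (?c d) s)" if s: "s < ?r" for s
      by (rule sfun_cong[OF vbDA(3) sfun_kap[OF t s]]) (use ccoord[OF t] s in simp)
    then show "\<exists>V \<kappa> g N. (V, \<kappa>, g) \<in> frakC_family \<and> d \<in> N \<and> openin (mtop TD) N \<and> N \<subseteq> D \<and> (\<lambda>d. qA (pA d)) ` N \<subseteq> V \<and>
        (\<forall>t<?r. sfun TD N (\<lambda>y. qcoord ?r \<kappa> (?c y) t))"
      using fam d V smo_vimage_open[OF q dtriv_lin(3)[OF t]]
      by (intro exI[of _ V] exI[of _ "kap \<Phi> \<Psi> \<gamma>"] exI[of _ "frm G"] exI[of _ "overM V"]) auto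
  qed
  have keysf: "Poly_Mapping.keys (fext ?f p) \<subseteq> fibre A m \<times> fibre B m" if "Poly_Mapping.keys p \<subseteq> slice DA A m" for p m
    by (rule keys_fext[OF that]) (use vbDA(6) vbDB(6) proj_proj in \<open>auto simp: slice_iff fibre_def\<close>)
  have pQ: "pmap u \<in> T.Q" "fst (pmap u) = fst u" if u: "u \<in> C.Q" for u
  proof -
    obtain p where p: "u = quot_class RD (fst u) p" "Poly_Mapping.keys p \<subseteq> slice DA A (fst u)" using C.Q_rep[OF u] .
    have "pmap u = quot_class (tensor_relations A B) (fst u) (fext ?f p)" by (subst p(1)) (rule pmap_class)
    then show "pmap u \<in> T.Q" "fst (pmap u) = fst u"
      using T.Q_class[OF C.Q_fst[OF u] keysf[OF p(2)]] by auto
  qed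
  \<comment> \<open>In coordinates over \<open>V\<close> the projection is a truncation; smoothness,
    kernel and surjectivity are all read off from this formula.\<close>
  have pcoord: "qcoord (nA * nB) (tensor_kappa nB (\<lambda>a. snd (\<Phi> a)) (\<lambda>b. snd (\<Psi> b))) (pmap u) = trunc (nA * nB) (qcoord ?r (kap \<Phi> \<Psi> \<gamma>) u)"
    if t: "dtriv V \<Phi> \<Psi> \<gamma> G" and u: "u \<in> C.Q" "fst u \<in> V" for V \<Phi> \<Psi> \<gamma> G u
  proof -
    obtain p where p: "u = quot_class RD (fst u) p" "Poly_Mapping.keys p \<subseteq> slice DA A (fst u)" using C.Q_rep[OF u(1)] .
    have fam: "(V, kap \<Phi> \<Psi> \<gamma>, frm G) \<in> frakC_family" using t unfolding frakC_family_def by blast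
    obtain g where fam': "(V, tensor_kappa nB (\<lambda>a. snd (\<Phi> a)) (\<lambda>b. snd (\<Psi> b)), g) \<in> tensor_family A B"
      using tensor_family_dtriv[OF t] by blast
    have "qcoord ?r (kap \<Phi> \<Psi> \<gamma>) u = trunc ?r (lext (kap \<Phi> \<Psi> \<gamma>) p)" by (subst p(1)) (rule C.qcoord_class[OF fam u(2)])
    moreover have "pmap u = quot_class (tensor_relations A B) (fst u) (fext ?f p)" by (subst p(1)) (rule pmap_class)
    moreover have "lext (tensor_kappa nB (\<lambda>a. snd (\<Phi> a)) (\<lambda>b. snd (\<Psi> b))) (fext ?f p) s = lext (kap \<Phi> \<Psi> \<gamma>) p s" if "s < nA * nB" for s
      unfolding lext_fext using that by (simp add: lext_def tensor_kappa_def kap_def case_prod_beta)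
    ultimately show ?thesis using T.qcoord_class[OF fam' u(2), of "fext ?f p"]
      by (simp add: fun_eq_iff trunc_def)
  qed
  have XQ: "mpoints C.X = C.Q" "mpoints T.X = T.Q" using C.X_mfd T.X_mfd by auto
  have smp: "smo C.X C.Q T.X pmap"
  proof (rule T.smo_into[OF C.X_charted C.smo_proj])
    show "pmap u \<in> T.Q \<and> fst (pmap u) = fst u" if "u \<in> C.Q" for u using pQ[OF that] by simp
    fix u assume u: "u \<in> C.Q"
    obtain V \<Phi> \<Psi> \<gamma> G where V: "fst u \<in> V" and t: "dtriv V \<Phi> \<Psi> \<gamma> G" using dtriv_exists[OF C.Q_fst[OF u]] by blast
    have fam: "(V, kap \<Phi> \<Psi> \<gamma>, frm G) \<in> frakC_family" using t unfolding frakC_family_def by blast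
    obtain g where fam': "(V, tensor_kappa nB (\<lambda>a. snd (\<Phi> a)) (\<lambda>b. snd (\<Psi> b)), g) \<in> tensor_family A B"
      using tensor_family_dtriv[OF t] by blast
    let ?N = "{u \<in> C.Q. fst u \<in> V}"
    have "sfun C.X ?N (\<lambda>u. qcoord (nA * nB) (tensor_kappa nB (\<lambda>a. snd (\<Phi> a)) (\<lambda>b. snd (\<Psi> b))) (pmap u) s)" if s: "s < nA * nB" for s
    proof (rule sfun_cong[OF C.X_charted])
      have "s < ?r" using s by simp
      from lincoordD(2)[OF C.lincoord_E[OF fam] this]
      show "sfun C.X ?N (\<lambda>u. qcoord ?r (kap \<Phi> \<Psi> \<gamma>) u s)" unfolding C.over_E by simp
    qed (use pcoord[OF t] s in simp)
    then show "\<exists>V \<kappa> g N. (V, \<kappa>, g) \<in> tensor_family A B \<and> u \<in> N \<and> openin (mtop C.X) N \<and> N \<subseteq> C.Q \<and> fst ` N \<subseteq> V \<and>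
        (\<forall>t<nA * nB. sfun C.X N (\<lambda>y. qcoord (nA * nB) \<kappa> (pmap y) t))"
      using fam' u V smo_vimage_open[OF C.smo_proj C.T_open[OF fam]]
      by (intro exI[of _ V] exI[of _ "tensor_kappa nB (\<lambda>a. snd (\<Phi> a)) (\<lambda>b. snd (\<Psi> b))"] exI[of _ g] exI[of _ ?N]) auto
  qed
  have idM: "smooth_map M M (\<lambda>m. m)"
    by (rule smo_smooth_map[OF vba(4) vba(2) smo_id]) simp
  have m1: "vb_morphism CB C.E ?c (\<lambda>m. m)"
    unfolding vb_morphism_def
  proof (intro conjI ballI allI)
    have "smo (total_space CB) Cs C.X ?c"
      by (rule smo_compose[OF smo_core_inclusion smc]) (use Cs_D in auto)
    then show "smooth_map (total_space CB) (total_space C.E) ?c"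
      by (intro smo_smooth_map) (use core_mfd C.X_mfd vpoints_CB in \<open>auto intro: mfd_charted\<close>)
    show "smooth_map (base CB) (base C.E) (\<lambda>m. m)" using idM by simp
    show "proj C.E (?c e) = proj CB e" for e by (simp add: c)
    fix m e assume m: "m \<in> mpoints (base CB)" and e: "e \<in> fibre CB m"
    then have m': "m \<in> mpoints M" by simp
    have e': "e \<in> D" "pA e = vzero A m" "qA (pA e) = m" using e opsa(3)[OF m'] unfolding fibre_CB[OF m'] by auto
    show "?c (vscale CB r e) = vscale C.E r (?c e)" for r
      using opsA(2)[OF e'(1), of r] free.span_neg[OF free.span_base[OF rel_sclA[OF e'(1,3), of r]]] e'(3)
      by (simp add: c quot_scale_class quot_class_eq_iff)
    fix e2 assume e2: "e2 \<in> fibre CB m"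
    then have e2': "e2 \<in> D" "pA e2 = pA e" using e'(2) unfolding fibre_CB[OF m'] by auto
    show "?c (vadd CB e e2) = vadd C.E (?c e) (?c e2)"
      using opsA(1)[OF e'(1) e2'] free.span_neg[OF free.span_base[OF rel_addA[OF e'(1) e2' e'(3)]]] e'(3) e2'
      by (simp add: c quot_add_class quot_class_eq_iff)
  qed
  have m2: "vb_morphism C.E T.E pmap (\<lambda>m. m)"
    unfolding vb_morphism_def
  proof (intro conjI ballI allI)
    show "smooth_map (total_space C.E) (total_space T.E) pmap"
      using smp XQ by (intro smo_smooth_map) (use C.X_charted T.X_mfd in auto)
    show "smooth_map (base C.E) (base T.E) (\<lambda>m. m)" using idM by simp
    show "proj T.E (pmap e) = proj C.E e" if "e \<in> vpoints C.E" for e using pQ(2)[of e] that XQ by simp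
    fix m e assume "e \<in> fibre C.E m"
    then obtain p where p: "e = quot_class RD m p" unfolding C.fibre_E by (auto elim: C.Q_rep)
    show "pmap (vscale C.E r e) = vscale T.E r (pmap e)" for r
      unfolding p by (simp add: quot_scale_class pmap_class fext_scale)
    fix e2 assume "e2 \<in> fibre C.E m"
    then obtain p2 where p2: "e2 = quot_class RD m p2" unfolding C.fibre_E by (auto elim: C.Q_rep)
    show "pmap (vadd C.E e e2) = vadd T.E (pmap e) (pmap e2)"
      unfolding p p2 by (simp add: quot_add_class pmap_class fext_add)
  qed
  have inj: "inj_on ?c Cs"
  proof (rule inj_onI)
    fix x y assume xy: "x \<in> Cs" "y \<in> Cs" "?c x = ?c y"
    have D: "x \<in> D" "y \<in> D" using xy Cs_D by auto
    have m: "qA (pA y) = qA (pA x)" using cQ(2)[OF D(1)] cQ(2)[OF D(2)] xy(3) by simp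
    obtain V \<Phi> \<Psi> \<gamma> G where V: "qA (pA x) \<in> V" and t: "dtriv V \<Phi> \<Psi> \<gamma> G" using dtriv_exists[OF pM[OF D(1)]] by blast
    have o: "x \<in> overM V" "y \<in> overM V" using D V m by auto
    have z: "snd (\<Phi> (pA x)) = zr" "snd (\<Psi> (pB x)) = zr" "snd (\<Phi> (pA y)) = zr" "snd (\<Psi> (pB y)) = zr"
      using dtriv_core_iff[OF t o(1)] dtriv_core_iff[OF t o(2)] xy by auto
    \<comment> \<open>From index \<open>nA * nB\<close> on these coordinates are
      \<open>\<gamma>\<close>, so equal classes have equal core coordinates.\<close>
    have k: "trunc ?r (kap \<Phi> \<Psi> \<gamma> x) = trunc ?r (kap \<Phi> \<Psi> \<gamma> y)" using ccoord[OF t o(1)] ccoord[OF t o(2)] xy(3) by simp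
    have "\<gamma> x = \<gamma> y"
    proof (rule EE_eqI[OF dtrivD(5)[OF t o(1)] dtrivD(5)[OF t o(2)]])
      fix i assume "i < nC"
      then show "\<gamma> x i = \<gamma> y i" using fun_cong[OF k, of "nA * nB + i"] by (simp add: kap_def)
    qed
    then show "x = y" by (intro dtriv_eqI[OF t o(1) D(2) m]) (use z in auto)
  qed
  have ker: "?c ` Cs = {x \<in> C.Q. pmap x = vzero T.E (fst x)}"
  proof (intro equalityI subsetI)
    fix x assume "x \<in> ?c ` Cs"
    then obtain d where d: "d \<in> Cs" "x = ?c d" by blast
    define m where "m = qA (pA d)"
    have dD: "d \<in> D" "pA d = vzero A m" "pB d = vzero B m" using d(1) Cs_iff[of d] by (auto simp: m_def)
    have m: "m \<in> mpoints M" unfolding m_def by (rule pM[OF dD(1)])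
    have f: "pA d \<in> fibre A m" "pB d \<in> fibre B m" using opsa(3)[OF m] opsb(3)[OF m] dD(2,3) by (auto simp: fibre_def)
    \<comment> \<open>The tensor of two zero vectors vanishes by the scaling relation with scalar
      0.\<close>
    have "free_scale 0 (gen (pA d, pB d)) - gen (vscale A 0 (pA d), pB d) \<in> tensor_relations A B m"
      unfolding tensor_relations_def by (rule UnI1, rule UnI2, use f in blast)
    moreover have "vscale A 0 (pA d) = pA d" using vb_alg(11)[OF vA, of "vzero A m" 0] opsa(3)[OF m] dD(2) by simp
    ultimately have "free_scale 0 (gen (pA d, pB d)) - gen (pA d, pB d) \<in> free.span (tensor_relations A B m)"
      using free.span_base by simp
    from free.span_neg[OF this] have "gen (pA d, pB d) \<in> free.span (tensor_relations A B m)"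
      by (simp only: free.scale_zero_left minus_diff_eq diff_zero)
    then have "pmap x = vzero T.E m" unfolding d(2) c pmap_class by (simp add: quot_class_eq_iff m_def)
    then show "x \<in> {x \<in> C.Q. pmap x = vzero T.E (fst x)}" using cQ[OF dD(1)] unfolding d(2) m_def by simp
  next
    fix x assume "x \<in> {x \<in> C.Q. pmap x = vzero T.E (fst x)}"
    then have x: "x \<in> C.Q" "pmap x = vzero T.E (fst x)" by auto
    obtain V \<Phi> \<Psi> \<gamma> G where V: "fst x \<in> V" and t: "dtriv V \<Phi> \<Psi> \<gamma> G" using dtriv_exists[OF C.Q_fst[OF x(1)]] by blast
    have fam: "(V, kap \<Phi> \<Psi> \<gamma>, frm G) \<in> frakC_family" using t unfolding frakC_family_def by blast
    obtain g where fam': "(V, tensor_kappa nB (\<lambda>a. snd (\<Phi> a)) (\<lambda>b. snd (\<Psi> b)), g) \<in> tensor_family A B"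
      using tensor_family_dtriv[OF t] by blast
    let ?k = "qcoord ?r (kap \<Phi> \<Psi> \<gamma>) x"
    have "trunc (nA * nB) ?k = trunc (nA * nB) (lext (tensor_kappa nB (\<lambda>a. snd (\<Phi> a)) (\<lambda>b. snd (\<Psi> b))) 0)"
      using pcoord[OF t x(1) V] T.qcoord_class[OF fam' V, of 0] x(2) by simp
    then have k0: "?k s = 0" if "s < nA * nB" for s using that by (auto dest!: fun_cong[of _ _ s])
    \<comment> \<open>The coordinates of \<open>x\<close> beyond the tensor part are the core
      coordinates of the preimage.\<close>
    define w where "w = (\<lambda>l. ?k (nA * nB + l))"
    have w: "w \<in> EE nC" using C.qcoord_EE[OF fam x(1) V] by (auto simp: w_def topspace_Euclidean_space)
    note g = dtrivD(7)[OF t V zr_EE zr_EE w]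
    let ?d = "G (fst x) zr zr w"
    have o: "?d \<in> overM V" using g V by simp
    have dC: "?d \<in> Cs" using dtriv_core_iff[OF t o] g by simp
    have "?c ?d = x"
    proof (rule C.qcoord_inj[OF fam cQ(1)[OF Cs_D[OF dC]] x(1)])
      show "fst (?c ?d) \<in> V" "fst x = fst (?c ?d)" using cQ(2)[OF Cs_D[OF dC]] g V by auto
      show "qcoord ?r (kap \<Phi> \<Psi> \<gamma>) (?c ?d) = ?k"
        unfolding ccoord[OF t o]
        by (rule EE_eqI[OF trunc_EE C.qcoord_EE[OF fam x(1) V]]) (use g k0 in \<open>auto simp: kap_def w_def\<close>)
    qed
    then show "x \<in> ?c ` Cs" using dC by (metis image_eqI)
  qed
  have surj: "pmap ` C.Q = T.Q"
  proof (intro equalityI subsetI)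
    fix y assume "y \<in> pmap ` C.Q" then show "y \<in> T.Q" using pQ by auto
  next
    fix y assume y: "y \<in> T.Q"
    obtain V \<Phi> \<Psi> \<gamma> G where V: "fst y \<in> V" and t: "dtriv V \<Phi> \<Psi> \<gamma> G" using dtriv_exists[OF T.Q_fst[OF y]] by blast
    have fam: "(V, kap \<Phi> \<Psi> \<gamma>, frm G) \<in> frakC_family" using t unfolding frakC_family_def by blast
    obtain g where fam': "(V, tensor_kappa nB (\<lambda>a. snd (\<Phi> a)) (\<lambda>b. snd (\<Psi> b)), g) \<in> tensor_family A B"
      using tensor_family_dtriv[OF t] by blast
    let ?k = "qcoord (nA * nB) (tensor_kappa nB (\<lambda>a. snd (\<Phi> a)) (\<lambda>b. snd (\<Psi> b))) y"
    have k0: "?k s = 0" if "s \<ge> nA * nB" for s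
      using T.qcoord_EE[OF fam' y V] that by (simp add: topspace_Euclidean_space)
    \<comment> \<open>A preimage has the coordinates of \<open>y\<close>, continued by zeros in the
      core part; \<open>k0\<close> supplies the zeros.\<close>
    let ?u = "C.comb (frm G) (fst y) ?k"
    note u = C.comb[OF fam V, of ?k]
    have "pmap ?u = y"
    proof (rule T.qcoord_inj[OF fam' pQ(1)[OF u(1)] y])
      show "fst (pmap ?u) \<in> V" "fst y = fst (pmap ?u)" using pQ(2)[OF u(1)] u(2) V by auto
      have "fst ?u \<in> V" using u(2) V by simp
      from pcoord[OF t u(1) this]
      show "qcoord (nA * nB) (tensor_kappa nB (\<lambda>a. snd (\<Phi> a)) (\<lambda>b. snd (\<Psi> b))) (pmap ?u) = ?k"
        unfolding u(3) by (auto simp: trunc_def k0 intro!: ext)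
    qed
    then show "y \<in> pmap ` C.Q" using u(1) by (metis image_eqI)
  qed
  show ?thesis
  proof (intro exI[of _ C.X] exI[of _ pmap] conjI ballI)
    show "mpoints C.X = frakC_set DA DB A" unfolding XQ frakC_set_def ..
    show "smooth_map TD C.X ?c" by (rule smo_smooth_map[OF vbDA(3) C.X_mfd(1) smc])
    show "pmap (?c d) = tensor A B (pA d) (pB d)" for d
      unfolding c pmap_class by (simp add: tensor_def)
    show "short_exact_sequence CB (frakC_bundle DA DB A C.X) (tensor_bundle A B) ?c pmap"
      unfolding tE cE short_exact_sequence_def
      using core_vector_bundle C.vector_bundle_E T.vector_bundle_E m1 m2 inj ker surj vpoints_CB XQ by simp
  qed
qed

end

theorem theorem3p7:
  fixes DA :: "('d, 'a) vbundle" and DB :: "('d, 'b) vbundle"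
    and A :: "('a, 'm) vbundle" and B :: "('b, 'm) vbundle"
  assumes "double_vector_bundle DA DB A B"
  shows "\<exists>X \<pp>.
    mpoints X = frakC_set DA DB A \<and>
    smooth_map (total_space DA) X (frakC_class DA DB A) \<and>
    (\<forall>d\<in>vpoints DA. \<pp> (frakC_class DA DB A d) = tensor A B (proj DA d) (proj DB d)) \<and>
    short_exact_sequence (core_bundle DA DB A B) (frakC_bundle DA DB A X) (tensor_bundle A B)
      (frakC_class DA DB A) \<pp>"
proof -
  interpret dvb DA DB A B by unfold_locales (rule assms)
  show ?thesis by (rule exact_sequence)
qed

end
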